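(* Let $G$ be a countable group and $n$ a positive integer. (i) If $G$ has Property $P\left(\binom{n}{2}\right)$, then $G$ has Property $Q(n)$; in particular, every countable group has $Q(2)$. (ii) If $G$ has $Q(n)$, then $G$ has $P(n)$. (iii) $G$ has $Q(3)$ if and only if $G$ has $P(3)$. (iv) $G$ has $Q(4)$ if and only if $G$ has $P(6)$. (v) $G$ has $Q(5)$ if and only if $G$ has $P(9)$.
   Context: Countable means finite or countably infinite. A subset $F$ of a group $G$ is irreducibly faithful if there exists an irreducible unitary representation $\pi$ of $G$ (in a Hilbert space) such that $\pi(x) \ne \mathrm{id}$ for all $x \in F$ with $x \ne e$. For $n \ge 0$, $G$ has Property $P(n)$ if every subset of $G$ of size at most $n$ is irreducibly faithful (so every group has $P(0)$). A subset $F$ of $G$ is irreducibly injective if $G$ has an irreducible unitary representation $\pi$ such that the restriction $\pi|_F$ is injective. $G$ has Property $Q(n)$ if every subset of $G$ of size at most $n$ is irreducibly injective. *)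

theory Defs
  imports "HOL-Algebra.Module" "HOL-Algebra.Bij" "HOL-Analysis.Abstract_Metric_Spaces"
begin

section \<open>Complex Hilbert spaces with an explicit carrier\<close>

definition complex_field :: "complex ring" where
  "complex_field = \<lparr>carrier = UNIV, mult = (*), one = 1, zero = 0, add = (+)\<rparr>"

lemma complex_field_simps [simp]:
  "carrier complex_field = UNIV" "mult complex_field = (*)" "one complex_field = 1"
  "zero complex_field = 0" "add complex_field = (+)"
  by (simp_all add: complex_field_def)

lemma field_complex_field: "field complex_field"
proof -
  have "cring complex_field"
  proof (rule cringI)
    show "abelian_group complex_field"
      by (rule abelian_groupI) (auto simp: algebra_simps intro: exI [of _ "- x" for x])
    show "Group.comm_monoid complex_field"
      by (rule comm_monoidI) (auto simp: algebra_simps)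
  qed (auto simp: algebra_simps)
  then show ?thesis
  proof (rule cring.cring_fieldI2)
    show "\<exists>b\<in>carrier complex_field. a \<otimes>\<^bsub>complex_field\<^esub> b = \<one>\<^bsub>complex_field\<^esub>"
      if "a \<noteq> \<zero>\<^bsub>complex_field\<^esub>" for a
      using that by (intro bexI [of _ "inverse a"]) auto
  qed auto
qed

lemma cring_complex_field: "cring complex_field"
  using field_complex_field by (simp add: field_def domain_def)

text \<open>The fields \<open>mult\<close> and \<open>one\<close> inherited from the module record play no role.\<close>

record 'h cinner_space = "(complex, 'h) module" +
  cinner :: "'h \<Rightarrow> 'h \<Rightarrow> complex"

locale complex_inner_product_space = Module.module complex_field H
  for H :: "('h, 'x) cinner_space_scheme" (structure) +
  assumes cinner_add_left:
      "\<lbrakk>x \<in> carrier H; y \<in> carrier H; z \<in> carrier H\<rbrakk> \<Longrightarrow>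
        cinner H (x \<oplus> y) z = cinner H x z + cinner H y z"
    and cinner_smult_left:
      "\<lbrakk>x \<in> carrier H; y \<in> carrier H\<rbrakk> \<Longrightarrow> cinner H (c \<odot> x) y = c * cinner H x y"
    and cinner_commute:
      "\<lbrakk>x \<in> carrier H; y \<in> carrier H\<rbrakk> \<Longrightarrow> cinner H y x = cnj (cinner H x y)"
    and cinner_pos:
      "\<lbrakk>x \<in> carrier H; x \<noteq> \<zero>\<rbrakk> \<Longrightarrow> 0 < Re (cinner H x x)"

definition hnorm :: "('h, 'x) cinner_space_scheme \<Rightarrow> 'h \<Rightarrow> real" where
  "hnorm H x = sqrt (Re (cinner H x x))"

text \<open>The locale \<^locale>\<open>Metric_space\<close> demands symmetry and nonnegativity also outside
  the carrier, hence the case distinction.\<close>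

definition hdist :: "('h, 'x) cinner_space_scheme \<Rightarrow> 'h \<Rightarrow> 'h \<Rightarrow> real" where
  "hdist H x y =
    (if x \<in> carrier H \<and> y \<in> carrier H then hnorm H (x \<ominus>\<^bsub>H\<^esub> y) else 0)"

context complex_inner_product_space
begin

lemma smult_closed' [simp]: "x \<in> carrier H \<Longrightarrow> c \<odot> x \<in> carrier H"
  by (rule smult_closed) auto

lemma smult_minus_one: "x \<in> carrier H \<Longrightarrow> (-1) \<odot> x = \<ominus> x"
proof -
  assume x: "x \<in> carrier H"
  have "(-1) \<odot> x \<oplus> x = ((-1) + 1) \<odot> x"
    using smult_l_distr [of "-1" 1 x] smult_one [OF x] x by simp
  also have "\<dots> = \<zero>" using smult_l_null [OF x] by simp
  finally show ?thesis using x by (simp add: M.minus_equality)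
qed

lemma cinner_add_right:
  "\<lbrakk>x \<in> carrier H; y \<in> carrier H; z \<in> carrier H\<rbrakk> \<Longrightarrow>
    cinner H z (x \<oplus> y) = cinner H z x + cinner H z y"
  by (metis M.add.m_closed cinner_add_left cinner_commute complex_cnj_add)

lemma cinner_smult_right:
  "\<lbrakk>x \<in> carrier H; y \<in> carrier H\<rbrakk> \<Longrightarrow> cinner H y (c \<odot> x) = cnj c * cinner H y x"
  by (metis cinner_commute cinner_smult_left complex_cnj_mult smult_closed')

lemma cinner_zero_left [simp]: "x \<in> carrier H \<Longrightarrow> cinner H \<zero> x = 0"
  using cinner_add_left [of \<zero> \<zero> x] by simp

lemma cinner_zero_right [simp]: "x \<in> carrier H \<Longrightarrow> cinner H x \<zero> = 0"
  using cinner_add_right [of \<zero> \<zero> x] by simp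

lemma cinner_minus_left:
  "\<lbrakk>x \<in> carrier H; y \<in> carrier H\<rbrakk> \<Longrightarrow> cinner H (\<ominus> x) y = - cinner H x y"
  using cinner_smult_left [of x y "-1"] by (simp add: smult_minus_one)

lemma cinner_minus_right:
  "\<lbrakk>x \<in> carrier H; y \<in> carrier H\<rbrakk> \<Longrightarrow> cinner H y (\<ominus> x) = - cinner H y x"
  using cinner_smult_right [of x y "-1"] by (simp add: smult_minus_one)

lemma cinner_self_real: "x \<in> carrier H \<Longrightarrow> cinner H x x = of_real (Re (cinner H x x))"
  using cinner_commute [of x x] by (simp add: complex_eq_iff)

lemma cinner_self_nonneg: "x \<in> carrier H \<Longrightarrow> 0 \<le> Re (cinner H x x)"
  using cinner_pos [of x] by (cases "x = \<zero>") auto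

lemma hnorm_square: "x \<in> carrier H \<Longrightarrow> (hnorm H x)\<^sup>2 = Re (cinner H x x)"
  by (simp add: hnorm_def cinner_self_nonneg)

lemma hnorm_nonneg: "x \<in> carrier H \<Longrightarrow> 0 \<le> hnorm H x"
  by (simp add: hnorm_def cinner_self_nonneg)

lemma Cauchy_Schwarz:
  assumes x: "x \<in> carrier H" and y: "y \<in> carrier H"
  shows "cmod (cinner H x y) \<le> hnorm H x * hnorm H y"
proof (cases "y = \<zero>")
  case True
  then show ?thesis using x by (simp add: hnorm_def)
next
  case False
  define p where "p = Re (cinner H y y)"
  have p: "p > 0" using False y by (simp add: p_def cinner_pos)
  have yy: "cinner H y y = of_real p" using cinner_self_real [OF y] by (simp add: p_def)
  define a where "a = cinner H x y"
  have yx: "cinner H y x = cnj a" using cinner_commute [OF x y] by (simp add: a_def)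
  define c where "c = - (a / of_real p)"
  have cp: "c * of_real p = - a" using p by (simp add: c_def)
  have "cinner H (x \<oplus> c \<odot> y) (x \<oplus> c \<odot> y)
      = cinner H x x + cnj c * a + c * cnj a + c * cnj c * of_real p"
    using x y by (simp add: cinner_add_left cinner_add_right cinner_smult_left
        cinner_smult_right yy yx a_def algebra_simps)
  also have "\<dots> = cinner H x x + c * cnj a"
  proof -
    have "c * cnj c * of_real p = - (cnj c * a)"
      using cp by (metis mult.assoc mult.commute mult_minus_right)
    then show ?thesis by simp
  qed
  also have "c * cnj a = - of_real ((cmod a)\<^sup>2 / p)"
    using p by (simp add: c_def complex_norm_square field_simps flip: of_real_power)
  finally have eq: "cinner H (x \<oplus> c \<odot> y) (x \<oplus> c \<odot> y) = cinner H x x + - of_real ((cmod a)\<^sup>2 / p)" .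
  have "0 \<le> Re (cinner H (x \<oplus> c \<odot> y) (x \<oplus> c \<odot> y))"
    using x y by (intro cinner_self_nonneg) simp
  then have "(cmod a)\<^sup>2 / p \<le> Re (cinner H x x)"
    unfolding eq by (simp del: of_real_divide of_real_power)
  then have "(cmod a)\<^sup>2 \<le> (hnorm H x * hnorm H y)\<^sup>2"
    using p x y by (simp add: power_mult_distrib hnorm_square p_def [symmetric] field_simps)
  then show ?thesis
    unfolding a_def by (rule power2_le_imp_le) (simp add: hnorm_nonneg x y)
qed

lemma hnorm_triangle:
  assumes x: "x \<in> carrier H" and y: "y \<in> carrier H"
  shows "hnorm H (x \<oplus> y) \<le> hnorm H x + hnorm H y"
proof (rule power2_le_imp_le)
  have "Re (cinner H x y) \<le> hnorm H x * hnorm H y"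
    using Cauchy_Schwarz [OF x y] complex_Re_le_cmod order_trans by blast
  moreover have "Re (cinner H y x) = Re (cinner H x y)"
    using cinner_commute [OF x y] by simp
  ultimately show "(hnorm H (x \<oplus> y))\<^sup>2 \<le> (hnorm H x + hnorm H y)\<^sup>2"
    using x y by (simp add: hnorm_square power2_sum cinner_add_left cinner_add_right)
  show "0 \<le> hnorm H x + hnorm H y" by (simp add: hnorm_nonneg x y)
qed

lemma hnorm_minus: "x \<in> carrier H \<Longrightarrow> hnorm H (\<ominus> x) = hnorm H x"
  by (simp add: hnorm_def cinner_minus_left cinner_minus_right)

lemma hnorm_eq_0_iff: "x \<in> carrier H \<Longrightarrow> hnorm H x = 0 \<longleftrightarrow> x = \<zero>"
  using cinner_pos [of x] by (cases "x = \<zero>") (auto simp: hnorm_def)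

lemma Metric_space_hdist: "Metric_space (carrier H) (hdist H)"
proof
  fix x y
  show "0 \<le> hdist H x y"
    by (simp add: hdist_def hnorm_nonneg)
  have "y \<ominus> x = \<ominus> (x \<ominus> y)" if "x \<in> carrier H" "y \<in> carrier H"
    using that by (simp add: M.minus_add M.minus_eq M.add.m_comm)
  then show "hdist H x y = hdist H y x"
    by (auto simp: hdist_def hnorm_minus)
next
  fix x y
  assume "x \<in> carrier H" "y \<in> carrier H"
  then show "hdist H x y = 0 \<longleftrightarrow> x = y"
    by (simp add: hdist_def hnorm_eq_0_iff)
      (metis M.add.inv_closed M.minus_equality M.minus_eq M.minus_minus M.r_neg)
next
  fix x y z
  assume xyz: "x \<in> carrier H" "y \<in> carrier H" "z \<in> carrier H"
  have "x \<ominus> z = (x \<ominus> y) \<oplus> (y \<ominus> z)"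
    using xyz by (simp add: M.minus_eq M.a_assoc M.r_neg1)
  then show "hdist H x z \<le> hdist H x y + hdist H y z"
    using xyz hnorm_triangle [of "x \<ominus> y" "y \<ominus> z"] by (simp add: hdist_def)
qed

end

sublocale complex_inner_product_space \<subseteq> Metric_space "carrier H" "hdist H"
  by (rule Metric_space_hdist)

locale complex_hilbert_space = complex_inner_product_space +
  assumes complete: mcomplete


section \<open>Irreducible unitary representations\<close>

definition unitary_group :: "('h, 'x) cinner_space_scheme \<Rightarrow> ('h \<Rightarrow> 'h) monoid" where
  "unitary_group H = BijGroup (carrier H)
    \<lparr>carrier := {U \<in> Bij (carrier H).
       (\<forall>x\<in>carrier H. \<forall>y\<in>carrier H. U (x \<oplus>\<^bsub>H\<^esub> y) = U x \<oplus>\<^bsub>H\<^esub> U y) \<and>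
       (\<forall>c. \<forall>x\<in>carrier H. U (c \<odot>\<^bsub>H\<^esub> x) = c \<odot>\<^bsub>H\<^esub> U x) \<and>
       (\<forall>x\<in>carrier H. \<forall>y\<in>carrier H. cinner H (U x) (U y) = cinner H x y)}\<rparr>"

locale unitary_representation = G?: group G + H?: complex_hilbert_space H
  for G :: "('a, 'b) monoid_scheme" and H :: "('h, 'x) cinner_space_scheme"
    and \<pi> :: "'a \<Rightarrow> 'h \<Rightarrow> 'h" +
  assumes rep_hom: "\<pi> \<in> hom G (unitary_group H)"

locale irreducible_unitary_representation = unitary_representation G H \<pi>
  for G :: "('a, 'b) monoid_scheme" and H :: "('h, 'x) cinner_space_scheme"
    and \<pi> :: "'a \<Rightarrow> 'h \<Rightarrow> 'h" +
  assumes nonzero: "carrier H \<noteq> {\<zero>\<^bsub>H\<^esub>}"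
    and irreducible: "\<And>W. \<lbrakk>submodule W complex_field H; closedin mtopology W;
      \<And>g. g \<in> carrier G \<Longrightarrow> \<pi> g ` W \<subseteq> W\<rbrakk> \<Longrightarrow> W = {\<zero>\<^bsub>H\<^esub>} \<or> W = carrier H"


section \<open>Irreducibly faithful and irreducibly injective subsets\<close>

text \<open>One cannot quantify existentially over all types \<open>'h\<close> of vectors inside a formula. The
  Hilbert spaces below therefore have carriers (with arbitrary operations) in the type
  \<^typ>\<open>'a \<Rightarrow> complex\<close>, where \<^typ>\<open>'a\<close> is the type of the group elements. This loses nothing:
  every irreducible unitary representation, on a Hilbert space of any type, is
  equivalent to one of these; see the final section.\<close>

definition irreducibly_faithful :: "('a, 'b) monoid_scheme \<Rightarrow> 'a set \<Rightarrow> bool" where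
  "irreducibly_faithful G F \<longleftrightarrow>
    (\<exists>(H :: ('a \<Rightarrow> complex) cinner_space) \<pi>. irreducible_unitary_representation G H \<pi> \<and>
      (\<forall>x\<in>F. x \<noteq> \<one>\<^bsub>G\<^esub> \<longrightarrow> \<pi> x \<noteq> \<one>\<^bsub>unitary_group H\<^esub>))"

definition irreducibly_injective :: "('a, 'b) monoid_scheme \<Rightarrow> 'a set \<Rightarrow> bool" where
  "irreducibly_injective G F \<longleftrightarrow>
    (\<exists>(H :: ('a \<Rightarrow> complex) cinner_space) \<pi>. irreducible_unitary_representation G H \<pi> \<and>
      inj_on \<pi> F)"

definition property_P :: "('a, 'b) monoid_scheme \<Rightarrow> nat \<Rightarrow> bool" where
  "property_P G n \<longleftrightarrow>
    (\<forall>F. F \<subseteq> carrier G \<and> finite F \<and> card F \<le> n \<longrightarrow> irreducibly_faithful G F)"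

definition property_Q :: "('a, 'b) monoid_scheme \<Rightarrow> nat \<Rightarrow> bool" where
  "property_Q G n \<longleftrightarrow>
    (\<forall>F. F \<subseteq> carrier G \<and> finite F \<and> card F \<le> n \<longrightarrow> irreducibly_injective G F)"


section \<open>Adequacy of the choice of carrier type\<close>

definition transport_space ::
    "('h \<Rightarrow> 'k) \<Rightarrow> ('h, 'x) cinner_space_scheme \<Rightarrow> 'k cinner_space" where
  "transport_space T H = (let S = inv_into (carrier H) T in
    \<lparr>carrier = T ` carrier H, mult = (\<lambda>x y. x), one = T \<zero>\<^bsub>H\<^esub>, zero = T \<zero>\<^bsub>H\<^esub>,
     add = (\<lambda>x y. T (S x \<oplus>\<^bsub>H\<^esub> S y)), smult = (\<lambda>c x. T (c \<odot>\<^bsub>H\<^esub> S x)),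
     cinner = (\<lambda>x y. cinner H (S x) (S y))\<rparr>)"

definition transport_rep ::
    "('h \<Rightarrow> 'k) \<Rightarrow> ('h, 'x) cinner_space_scheme \<Rightarrow> ('a \<Rightarrow> 'h \<Rightarrow> 'h) \<Rightarrow> 'a \<Rightarrow> 'k \<Rightarrow> 'k" where
  "transport_rep T H \<pi> g = (\<lambda>x\<in>T ` carrier H. T (\<pi> g (inv_into (carrier H) T x)))"

context irreducible_unitary_representation
begin

lemma rep_closed: "\<lbrakk>g \<in> carrier G; x \<in> carrier H\<rbrakk> \<Longrightarrow> \<pi> g x \<in> carrier H"
  and rep_extensional: "g \<in> carrier G \<Longrightarrow> \<pi> g \<in> extensional (carrier H)"
  and rep_bij: "g \<in> carrier G \<Longrightarrow> bij_betw (\<pi> g) (carrier H) (carrier H)"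
  and rep_add: "\<lbrakk>g \<in> carrier G; x \<in> carrier H; y \<in> carrier H\<rbrakk> \<Longrightarrow>
    \<pi> g (x \<oplus>\<^bsub>H\<^esub> y) = \<pi> g x \<oplus>\<^bsub>H\<^esub> \<pi> g y"
  and rep_smult: "\<lbrakk>g \<in> carrier G; x \<in> carrier H\<rbrakk> \<Longrightarrow> \<pi> g (c \<odot>\<^bsub>H\<^esub> x) = c \<odot>\<^bsub>H\<^esub> \<pi> g x"
  and rep_cinner: "\<lbrakk>g \<in> carrier G; x \<in> carrier H; y \<in> carrier H\<rbrakk> \<Longrightarrow>
    cinner H (\<pi> g x) (\<pi> g y) = cinner H x y"
  using rep_hom
  by (auto simp: hom_def unitary_group_def Bij_def Pi_iff bij_betw_apply)

lemma rep_mult: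
  assumes "g \<in> carrier G" "h \<in> carrier G" "x \<in> carrier H"
  shows "\<pi> (g \<otimes>\<^bsub>G\<^esub> h) x = \<pi> g (\<pi> h x)"
proof -
  have "\<pi> g \<in> Bij (carrier H)" "\<pi> h \<in> Bij (carrier H)"
    using assms rep_hom by (auto simp: hom_def unitary_group_def Pi_iff)
  moreover have "\<pi> (g \<otimes>\<^bsub>G\<^esub> h) = \<pi> g \<otimes>\<^bsub>unitary_group H\<^esub> \<pi> h"
    using assms rep_hom by (simp add: hom_def)
  ultimately show ?thesis
    using assms by (simp add: unitary_group_def BijGroup_def compose_def)
qed

lemma rep_one: "\<pi> \<one>\<^bsub>G\<^esub> = \<one>\<^bsub>unitary_group H\<^esub>"
proof (rule extensionalityI)
  show "\<pi> \<one>\<^bsub>G\<^esub> \<in> extensional (carrier H)" by (simp add: rep_extensional)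
  show "\<one>\<^bsub>unitary_group H\<^esub> \<in> extensional (carrier H)"
    by (simp add: unitary_group_def BijGroup_def)
  fix x assume x: "x \<in> carrier H"
  have "\<pi> \<one>\<^bsub>G\<^esub> (\<pi> \<one>\<^bsub>G\<^esub> x) = \<pi> \<one>\<^bsub>G\<^esub> x"
    using rep_mult [of "\<one>\<^bsub>G\<^esub>" "\<one>\<^bsub>G\<^esub>" x] x by simp
  then have "\<pi> \<one>\<^bsub>G\<^esub> x = x"
    using rep_bij [of "\<one>\<^bsub>G\<^esub>"] x rep_closed [of "\<one>\<^bsub>G\<^esub>" x]
    by (auto simp: bij_betw_def inj_on_def)
  then show "\<pi> \<one>\<^bsub>G\<^esub> x = \<one>\<^bsub>unitary_group H\<^esub> x"
    using x by (simp add: unitary_group_def BijGroup_def)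
qed

lemma transport_irreducible:
  fixes T :: "'h \<Rightarrow> 'k"
  assumes T: "inj_on T (carrier H)"
  shows "irreducible_unitary_representation G (transport_space T H) (transport_rep T H \<pi>)"
proof -
  define S where "S = inv_into (carrier H) T"
  define K where "K = transport_space T H"
  define \<rho> where "\<rho> = transport_rep T H \<pi>"
  have ST [simp]: "x \<in> carrier H \<Longrightarrow> S (T x) = x" for x
    using T by (simp add: S_def)
  have K_carrier: "carrier K = T ` carrier H"
    by (simp add: K_def transport_space_def Let_def)
  have K_simps [simp]:
    "zero K = T \<zero>\<^bsub>H\<^esub>"
    "\<And>x y. x \<in> carrier H \<Longrightarrow> y \<in> carrier H \<Longrightarrow> add K (T x) (T y) = T (x \<oplus>\<^bsub>H\<^esub> y)"
    "\<And>c x. x \<in> carrier H \<Longrightarrow> smult K c (T x) = T (c \<odot>\<^bsub>H\<^esub> x)"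
    "\<And>x y. x \<in> carrier H \<Longrightarrow> y \<in> carrier H \<Longrightarrow> cinner K (T x) (T y) = cinner H x y"
    by (simp_all add: K_def transport_space_def Let_def flip: S_def)
  have T_eq: "x \<in> carrier H \<Longrightarrow> y \<in> carrier H \<Longrightarrow> T x = T y \<longleftrightarrow> x = y" for x y
    using T by (auto simp: inj_on_def)
  have \<rho>_T [simp]: "x \<in> carrier H \<Longrightarrow> \<rho> g (T x) = T (\<pi> g x)" for g x
    by (simp add: \<rho>_def transport_rep_def flip: S_def)
  have K_ab: "abelian_group K"
  proof (rule abelian_groupI)
    fix x assume "x \<in> carrier K"
    then obtain x' where x': "x' \<in> carrier H" "x = T x'" by (auto simp: K_carrier)
    show "\<exists>y\<in>carrier K. y \<oplus>\<^bsub>K\<^esub> x = \<zero>\<^bsub>K\<^esub>"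
      using x' by (intro bexI [of _ "T (\<ominus>\<^bsub>H\<^esub> x')"]) (auto simp: K_carrier M.l_neg)
  qed (auto simp: K_carrier M.a_ac)
  have K_mod: "Module.module complex_field K"
    by (rule moduleI [OF cring_complex_field K_ab])
      (auto simp: K_carrier smult_r_distr smult_l_distr [simplified] smult_assoc1 [simplified]
        smult_one [simplified])
  interpret K: complex_inner_product_space K
    by (intro complex_inner_product_space.intro [OF K_mod] complex_inner_product_space_axioms.intro)
      (auto simp: K_carrier cinner_add_left cinner_smult_left T_eq intro: cinner_pos cinner_commute)
  have K_uminus: "\<ominus>\<^bsub>K\<^esub> (T x) = T (\<ominus>\<^bsub>H\<^esub> x)" if "x \<in> carrier H" for x
    using that by (intro K.M.minus_equality) (auto simp: K_carrier M.l_neg)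
  have K_dist: "hdist K (T x) (T y) = hdist H x y" if "x \<in> carrier H" "y \<in> carrier H" for x y
    using that by (simp add: hdist_def K_carrier hnorm_def M.minus_eq K.M.minus_eq K_uminus)
  have S_K: "x \<in> carrier K \<Longrightarrow> S x \<in> carrier H" and TS: "x \<in> carrier K \<Longrightarrow> T (S x) = x" for x
    by (auto simp: K_carrier)
  have S_dist: "hdist K x y = hdist H (S x) (S y)" if "x \<in> carrier K" "y \<in> carrier K" for x y
    using that K_dist [of "S x" "S y"] by (simp add: S_K TS)
  have K_complete: "K.mcomplete"
    unfolding K.mcomplete_def
  proof (intro allI impI)
    fix \<sigma> assume \<sigma>: "K.MCauchy \<sigma>"
    then have \<sigma>_K: "\<sigma> n \<in> carrier K" for n by (auto simp: K.MCauchy_def)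
    have "MCauchy (S \<circ> \<sigma>)"
      using \<sigma> \<sigma>_K by (auto simp: K.MCauchy_def MCauchy_def S_dist S_K)
    then obtain l where "limitin mtopology (S \<circ> \<sigma>) l sequentially"
      using complete by (auto simp: mcomplete_def)
    then have "limitin K.mtopology \<sigma> (T l) sequentially"
      unfolding limit_metric_sequentially K.limit_metric_sequentially
      using \<sigma>_K by (auto simp: K_carrier S_dist) meson
    then show "\<exists>x. limitin K.mtopology \<sigma> x sequentially" by blast
  qed
  interpret K: complex_hilbert_space K
    by unfold_locales (rule K_complete)
  have \<rho>_Bij: "\<rho> g \<in> Bij (carrier K)" if g: "g \<in> carrier G" for g
  proof -
    have "bij_betw (\<rho> g) (carrier K) (carrier K)"
    proof (rule bij_betw_imageI)
      show "inj_on (\<rho> g) (carrier K)"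
        using rep_bij [OF g] by (auto simp: K_carrier inj_on_def bij_betw_def T_eq rep_closed g)
      have "\<rho> g ` carrier K = T ` \<pi> g ` carrier H"
        by (simp add: K_carrier image_image)
      then show "\<rho> g ` carrier K = carrier K"
        using rep_bij [OF g] by (simp add: bij_betw_def K_carrier)
    qed
    then show ?thesis by (simp add: Bij_def \<rho>_def transport_rep_def K_carrier)
  qed
  have \<rho>_hom: "\<rho> \<in> hom G (unitary_group K)"
  proof (rule homI)
    fix g assume g: "g \<in> carrier G"
    then show "\<rho> g \<in> carrier (unitary_group K)"
      using \<rho>_Bij [OF g]
      by (auto simp: unitary_group_def K_carrier rep_add rep_smult rep_cinner rep_closed)
    fix h assume h: "h \<in> carrier G"
    have "\<rho> (g \<otimes>\<^bsub>G\<^esub> h) x = compose (carrier K) (\<rho> g) (\<rho> h) x" for x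
    proof (cases "x \<in> carrier K")
      case True
      then show ?thesis using g h by (auto simp: K_carrier compose_def rep_mult rep_closed)
    next
      case False
      then show ?thesis by (simp add: compose_def \<rho>_def transport_rep_def K_carrier)
    qed
    then show "\<rho> (g \<otimes>\<^bsub>G\<^esub> h) = \<rho> g \<otimes>\<^bsub>unitary_group K\<^esub> \<rho> h"
      using \<rho>_Bij [OF g] \<rho>_Bij [OF h] by (auto simp: unitary_group_def BijGroup_def)
  qed
  have "irreducible_unitary_representation G K \<rho>"
  proof unfold_locales
    show "\<rho> \<in> hom G (unitary_group K)" by (rule \<rho>_hom)
    obtain v where "v \<in> carrier H" "v \<noteq> \<zero>\<^bsub>H\<^esub>" using nonzero by blast
    then show "carrier K \<noteq> {\<zero>\<^bsub>K\<^esub>}"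
      using T_eq [of v "\<zero>\<^bsub>H\<^esub>"] by (auto simp: K_carrier)
  next
    fix W assume W: "submodule W complex_field K" "closedin K.mtopology W"
      and inv: "\<And>g. g \<in> carrier G \<Longrightarrow> \<rho> g ` W \<subseteq> W"
    note W' = K.submoduleE [OF W(1)]
    define V where "V = {x \<in> carrier H. T x \<in> W}"
    have W_V: "W = T ` V" using W'(1) by (auto simp: V_def K_carrier)
    have zW: "T \<zero>\<^bsub>H\<^esub> \<in> W"
      using subgroup.one_closed [OF submodule.axioms(1) [OF W(1)]] by simp
    have "submodule V complex_field H"
    proof (rule submoduleI)
      show "V \<subseteq> carrier H" "\<zero>\<^bsub>H\<^esub> \<in> V" using zW by (auto simp: V_def)
      show "\<ominus>\<^bsub>H\<^esub> x \<in> V" if "x \<in> V" for x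
        using that W'(3) [of "T x"] by (simp add: V_def K_uminus)
      show "x \<oplus>\<^bsub>H\<^esub> y \<in> V" if "x \<in> V" "y \<in> V" for x y
        using that W'(5) [of "T x" "T y"] by (simp add: V_def)
      show "c \<odot>\<^bsub>H\<^esub> x \<in> V" if "x \<in> V" for c x
        using that W'(4) [of c "T x"] by (simp add: V_def)
    qed
    moreover have "closedin mtopology V"
      unfolding closedin_metric
    proof (intro conjI ballI allI impI)
      show "V \<subseteq> carrier H" by (auto simp: V_def)
      fix x assume "x \<in> carrier H - V"
      then have x: "x \<in> carrier H" "T x \<in> carrier K - W" by (auto simp: V_def K_carrier)
      then obtain r where "r > 0" "disjnt W (K.mball (T x) r)"
        using W(2) unfolding K.closedin_metric by meson
      then have "disjnt V (mball x r)"
        using x(1) unfolding disjnt_iff V_def mball_def K.mball_def by (auto simp: K_carrier K_dist)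
      then show "\<exists>r>0. disjnt V (mball x r)" using \<open>r > 0\<close> by blast
    qed
    moreover have "\<pi> g ` V \<subseteq> V" if "g \<in> carrier G" for g
      using inv [OF that] that by (force simp: V_def rep_closed image_subset_iff)
    ultimately have "V = {\<zero>\<^bsub>H\<^esub>} \<or> V = carrier H" by (rule irreducible)
    then show "W = {\<zero>\<^bsub>K\<^esub>} \<or> W = carrier K" by (auto simp: W_V K_carrier)
  qed
  then show ?thesis by (simp add: K_def \<rho>_def)
qed

lemma orbit_total:
  assumes v: "v \<in> carrier H" "v \<noteq> \<zero>\<^bsub>H\<^esub>"
    and x: "x \<in> carrier H" "\<And>g. g \<in> carrier G \<Longrightarrow> cinner H x (\<pi> g v) = 0"
  shows "x = \<zero>\<^bsub>H\<^esub>"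
proof -
  define W where "W = {x \<in> carrier H. \<forall>g\<in>carrier G. cinner H x (\<pi> g v) = 0}"
  have "submodule W complex_field H"
    by (rule submoduleI)
      (auto simp: W_def cinner_add_left cinner_smult_left cinner_minus_left rep_closed v)
  moreover have "closedin mtopology W"
    unfolding closedin_metric
  proof (intro conjI ballI allI impI)
    show "W \<subseteq> carrier H" by (auto simp: W_def)
    fix x assume "x \<in> carrier H - W"
    then obtain g where x: "x \<in> carrier H" and g: "g \<in> carrier G"
      and neq: "cinner H x (\<pi> g v) \<noteq> 0"
      by (auto simp: W_def)
    let ?w = "\<pi> g v"
    have w: "?w \<in> carrier H" using g v by (simp add: rep_closed)
    define r where "r = cmod (cinner H x ?w) / (hnorm H ?w + 1)"
    have "r > 0" using neq hnorm_nonneg [OF w] by (simp add: r_def)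
    moreover have "disjnt W (mball x r)"
      unfolding disjnt_iff
    proof (intro allI notI, elim conjE)
      fix y assume "y \<in> W" "y \<in> mball x r"
      then have y: "y \<in> carrier H" "cinner H y ?w = 0" and d: "hdist H x y < r"
        using g by (auto simp: W_def)
      have "cmod (cinner H x ?w) = cmod (cinner H (x \<ominus>\<^bsub>H\<^esub> y) ?w)"
        using x y w by (simp add: M.minus_eq cinner_add_left cinner_minus_left)
      also have "\<dots> \<le> hnorm H (x \<ominus>\<^bsub>H\<^esub> y) * hnorm H ?w"
        using x y w by (intro Cauchy_Schwarz) auto
      also have "\<dots> \<le> hnorm H (x \<ominus>\<^bsub>H\<^esub> y) * (hnorm H ?w + 1)"
        using x y by (intro mult_left_mono hnorm_nonneg) auto
      also have "\<dots> < r * (hnorm H ?w + 1)"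
        using d x y hnorm_nonneg [OF w] by (intro mult_strict_right_mono) (auto simp: hdist_def)
      also have "\<dots> = cmod (cinner H x ?w)"
        using hnorm_nonneg [OF w] by (simp add: r_def)
      finally show False by simp
    qed
    ultimately show "\<exists>r>0. disjnt W (mball x r)" by blast
  qed
  moreover have "\<pi> h ` W \<subseteq> W" if h: "h \<in> carrier G" for h
  proof
    fix y assume "y \<in> \<pi> h ` W"
    then obtain x where x: "x \<in> W" and y: "y = \<pi> h x" by blast
    have "cinner H (\<pi> h x) (\<pi> g v) = 0" if g: "g \<in> carrier G" for g
    proof -
      let ?k = "inv\<^bsub>G\<^esub> h \<otimes>\<^bsub>G\<^esub> g"
      have k: "?k \<in> carrier G" "g = h \<otimes>\<^bsub>G\<^esub> ?k"
        using g h by (auto simp flip: G.m_assoc)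
      have "\<pi> g v = \<pi> h (\<pi> ?k v)"
        using k h v rep_mult [of h ?k v] by simp
      then show ?thesis
        using x k(1) h v by (simp add: W_def rep_cinner rep_closed)
    qed
    then show "y \<in> W" using x h by (simp add: y W_def rep_closed)
  qed
  ultimately have "W = {\<zero>\<^bsub>H\<^esub>} \<or> W = carrier H" by (rule irreducible)
  moreover have "v \<notin> W"
  proof
    assume "v \<in> W"
    have "\<pi> \<one>\<^bsub>G\<^esub> v = v"
      using v by (simp add: rep_one unitary_group_def BijGroup_def)
    then show False
      using \<open>v \<in> W\<close> v cinner_pos [of v] by (force simp: W_def)
  qed
  ultimately have "W = {\<zero>\<^bsub>H\<^esub>}" using v by blast
  then show ?thesis using x by (auto simp: W_def)
qed

theorem equivalent_on_functions:
  "\<exists>T :: 'h \<Rightarrow> 'a \<Rightarrow> complex. inj_on T (carrier H) \<and>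
    irreducible_unitary_representation G (transport_space T H) (transport_rep T H \<pi>)"
proof -
  obtain v where v: "v \<in> carrier H" "v \<noteq> \<zero>\<^bsub>H\<^esub>" using nonzero by blast
  define T where "T = (\<lambda>x g. cinner H x (\<pi> g v))"
  have "inj_on T (carrier H)"
  proof (rule inj_onI)
    fix x y assume xy: "x \<in> carrier H" "y \<in> carrier H" and eq: "T x = T y"
    have "cinner H (x \<ominus>\<^bsub>H\<^esub> y) (\<pi> g v) = 0" if "g \<in> carrier G" for g
      using fun_cong [OF eq, of g] xy v that
      by (simp add: T_def M.minus_eq cinner_add_left cinner_minus_left rep_closed)
    then have "x \<ominus>\<^bsub>H\<^esub> y = \<zero>\<^bsub>H\<^esub>"
      using xy by (intro orbit_total [OF v]) auto
    then have "hdist H x y = 0" using xy by (simp add: hdist_def hnorm_eq_0_iff)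
    then show "x = y" using xy by simp
  qed
  then show ?thesis using transport_irreducible by blast
qed

lemma transport_rep_eq_iff:
  assumes T: "inj_on T (carrier H)" and g: "g \<in> carrier G" "h \<in> carrier G"
  shows "transport_rep T H \<pi> g = transport_rep T H \<pi> h \<longleftrightarrow> \<pi> g = \<pi> h"
proof
  assume eq: "transport_rep T H \<pi> g = transport_rep T H \<pi> h"
  show "\<pi> g = \<pi> h"
  proof (rule extensionalityI)
    show "\<pi> g \<in> extensional (carrier H)" "\<pi> h \<in> extensional (carrier H)"
      using g by (simp_all add: rep_extensional)
    fix x assume x: "x \<in> carrier H"
    then show "\<pi> g x = \<pi> h x"
      using fun_cong [OF eq, of "T x"] T g rep_closed
      by (simp add: transport_rep_def inj_on_eq_iff [OF T])
  qed
qed (simp add: transport_rep_def)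

theorem irreducibly_injectiveI:
  assumes F: "F \<subseteq> carrier G" and inj: "inj_on \<pi> F"
  shows "irreducibly_injective G F"
proof -
  obtain T :: "'h \<Rightarrow> 'a \<Rightarrow> complex" where T: "inj_on T (carrier H)"
    and irr: "irreducible_unitary_representation G (transport_space T H) (transport_rep T H \<pi>)"
    using equivalent_on_functions by blast
  have "inj_on (transport_rep T H \<pi>) F"
    using F inj by (auto simp: inj_on_def transport_rep_eq_iff [OF T] subset_iff)
  then show ?thesis using irr unfolding irreducibly_injective_def by blast
qed

theorem irreducibly_faithfulI:
  assumes F: "F \<subseteq> carrier G"
    and nontriv: "\<And>x. \<lbrakk>x \<in> F; x \<noteq> \<one>\<^bsub>G\<^esub>\<rbrakk> \<Longrightarrow> \<pi> x \<noteq> \<one>\<^bsub>unitary_group H\<^esub>"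
  shows "irreducibly_faithful G F"
proof -
  obtain T :: "'h \<Rightarrow> 'a \<Rightarrow> complex" where T: "inj_on T (carrier H)"
    and irr: "irreducible_unitary_representation G (transport_space T H) (transport_rep T H \<pi>)"
    using equivalent_on_functions by blast
  have "transport_rep T H \<pi> x \<noteq> \<one>\<^bsub>unitary_group (transport_space T H)\<^esub>"
    if x: "x \<in> F" "x \<noteq> \<one>\<^bsub>G\<^esub>" for x
  proof -
    have "transport_rep T H \<pi> x \<noteq> transport_rep T H \<pi> \<one>\<^bsub>G\<^esub>"
      using nontriv [OF x] F x(1) by (auto simp: transport_rep_eq_iff [OF T] rep_one subset_iff)
    then show ?thesis
      using irreducible_unitary_representation.rep_one [OF irr] by simp
  qed
  then show ?thesis using irr unfolding irreducibly_faithful_def by blast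
qed

end

end

theory Submission
  imports Defs "HOL-Algebra.Coset" "HOL-Algebra.Multiplicative_Group"
begin

text \<open>Let \<open>p\<^sub>N\<close> be the averaging idempotent of a finite normal subgroup \<open>N\<close>; it is central in the group algebra
  and acts in an irreducible representation as \<open>0\<close> or as the identity. Hence some irreducible representation is
  nontrivial on every member of a finite family of finite normal subgroups if and only if the product of the elements
  \<open>1 - p\<^sub>N\<close> is nonzero: given a nonzero \<open>f\<close> killed by all \<open>p\<^sub>N\<close>, its autocorrelation is
  a state vanishing against them, and a pure state with this property gives the representation by the GNS construction.
  A family with vanishing product is called blocked. Infinite normal subgroups are harmless: the average
  of a finitely supported state over many of their elements is small.

  A blocked family of least cardinality \<open>k\<close> consists, up to a projection, of all minimal normal subgroups of an abelian
  \<open>C\<close> that is a sum of copies of one minimal normal subgroup, that is, of all points of a projective space over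
  a finite field of order \<open>q\<close>. So \<open>P(n)\<close> fails exactly when the points of such a \<open>C\<close>, at most
  \<open>n\<close> in number, form a blocked family, and then \<open>Q(m)\<close> fails if every point contains a nontrivial quotient
  of two among \<open>m\<close> elements of \<open>C\<close>. For at most ten points,
  \<open>C\<close> is a plane over a field of order \<open>q \<le> 9\<close>, with \<open>q + 1\<close> points, or the three-dimensional space over the field
  with two elements. Four points of the affine plane determine all directions for \<open>q \<le> 5\<close>, five points for
  \<open>q \<le> 8\<close>, but no five points determine ten directions for \<open>q = 9\<close>.\<close>

section \<open>Reproducing kernel Hilbert spaces\<close>

text \<open>A countable group has countably many coordinates separating its states, so an extreme
  state can be reached by successive minimisation; a bound on an affine functional \<open>T\<close>
  survives if \<open>T\<close> is minimised first. As the vectors have to be functions on the group,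
  the GNS space is a reproducing kernel space instead of a completed quotient.

  Why a blocked family of least size n is a full set of points: take a maximal normal subgroup Q,
  within the span, that avoids the n given elements. Modulo Q every minimal normal subgroup contains
  the image of one of them, which bounds the number of points by n, while P(n - 1) forces every
  blocked family to have at least n members. The span is abelian because distinct members commute
  and each lies in the join of the others.

  The delicate implication is P(9) to Q(5): five elements have ten quotients, one more than P(9)
  controls. A failure needs ten points, hence a ring of order 9, with each quotient in a point of
  its own. Three of the five elements can be normalised, and the other two are excluded by a finite
  check.\<close>

definition kernel_form :: "('a \<Rightarrow> 'a \<Rightarrow> complex) \<Rightarrow> 'a set \<Rightarrow> ('a \<Rightarrow> complex) \<Rightarrow> complex" where
  "kernel_form k A c = (\<Sum>x\<in>A. \<Sum>y\<in>A. c x * cnj (c y) * k x y)"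

locale pd_kernel =
  fixes X :: "'a set" and k :: "'a \<Rightarrow> 'a \<Rightarrow> complex"
  assumes k_herm: "\<lbrakk>x \<in> X; y \<in> X\<rbrakk> \<Longrightarrow> k y x = cnj (k x y)"
    and k_pos: "\<lbrakk>finite A; A \<subseteq> X\<rbrakk> \<Longrightarrow> 0 \<le> Re (kernel_form k A c)"
begin

text \<open>The supremum of \<open>rgap f\<close> is the square of the norm of \<open>f\<close>; hence \<open>rnorm\<close> is a squared norm.\<close>

definition rgap :: "('a \<Rightarrow> complex) \<Rightarrow> 'a set \<Rightarrow> ('a \<Rightarrow> complex) \<Rightarrow> real" where
  "rgap f A c = 2 * Re (\<Sum>x\<in>A. cnj (c x) * f x) - Re (kernel_form k A c)"

definition finsubs :: "'a set set" where
  "finsubs = {A. finite A \<and> A \<subseteq> X}"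

definition rbounded :: "('a \<Rightarrow> complex) \<Rightarrow> real \<Rightarrow> bool" where
  "rbounded f b \<longleftrightarrow> (\<forall>A\<in>finsubs. \<forall>c. rgap f A c \<le> b)"

text \<open>The kernel space in its dual description: the functions of finite norm. No quotient or
  completion is taken, so the vectors keep the type \<open>'a => complex\<close> demanded by
  \<open>irreducibly_faithful\<close>; vanishing outside \<open>X\<close> makes a function
  determined by its values on \<open>X\<close>.\<close>

definition rspace :: "('a \<Rightarrow> complex) set" where
  "rspace = {f. (\<forall>x. x \<notin> X \<longrightarrow> f x = 0) \<and> (\<exists>b. rbounded f b)}"

definition rnorm :: "('a \<Rightarrow> complex) \<Rightarrow> real" where
  "rnorm f = (SUP p \<in> finsubs \<times> UNIV. rgap f (fst p) (snd p))"

lemma rgap_empty [simp]: "rgap f {} c = 0"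
  by (simp add: rgap_def kernel_form_def)

lemma empty_finsubs [simp]: "{} \<in> finsubs"
  by (simp add: finsubs_def)

lemma rgap_extend:
  assumes "A \<subseteq> B" "finite B"
  shows "rgap f A c = rgap f B (\<lambda>x. if x \<in> A then c x else 0)"
proof -
  have 1: "(\<Sum>x\<in>B. cnj (if x \<in> A then c x else 0) * f x) = (\<Sum>x\<in>A. cnj (c x) * f x)"
    by (rule sum.mono_neutral_cong_right) (use assms in auto)
  have 2: "(\<Sum>y\<in>B. c' * cnj (if y \<in> A then c y else 0) * k x y)
     = (\<Sum>y\<in>A. c' * cnj (c y) * k x y)" for x c'
    by (rule sum.mono_neutral_cong_right) (use assms in auto)
  have 3: "kernel_form k B (\<lambda>x. if x \<in> A then c x else 0) = kernel_form k A c"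
    unfolding kernel_form_def 2
    by (rule sum.mono_neutral_cong_right) (use assms in auto)
  show ?thesis unfolding rgap_def 1 3 ..
qed

text \<open>Jointly in the function and the coefficients, \<open>rgap\<close> is a real quadratic
  form, so it satisfies the parallelogram law before any supremum is taken.\<close>

lemma rgap_parallelogram:
  "rgap (\<lambda>x. f x + g x) B (\<lambda>x. u x + w x) + rgap (\<lambda>x. f x - g x) B (\<lambda>x. u x - w x)
    = 2 * rgap f B u + 2 * rgap g B w"
proof -
  have 1: "(\<Sum>x\<in>B. cnj (u x + w x) * (f x + g x)) + (\<Sum>x\<in>B. cnj (u x - w x) * (f x - g x))
      = 2 * (\<Sum>x\<in>B. cnj (u x) * f x) + 2 * (\<Sum>x\<in>B. cnj (w x) * g x)"
    unfolding sum_distrib_left sum.distrib [symmetric]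
    by (rule sum.cong) (auto simp: algebra_simps)
  have 2: "kernel_form k B (\<lambda>x. u x + w x) + kernel_form k B (\<lambda>x. u x - w x)
      = 2 * kernel_form k B u + 2 * kernel_form k B w"
    unfolding kernel_form_def sum_distrib_left sum.distrib [symmetric]
    by (intro sum.cong refl) (auto simp: algebra_simps)
  show ?thesis
    using arg_cong [OF 1, of Re] arg_cong [OF 2, of Re] by (simp add: rgap_def)
qed

lemma rbounded_zero [simp]: "rbounded (\<lambda>x. 0) 0"
  by (auto simp: rbounded_def rgap_def finsubs_def k_pos)

lemma rnorm_upper: "\<lbrakk>f \<in> rspace; A \<in> finsubs\<rbrakk> \<Longrightarrow> rgap f A c \<le> rnorm f"
proof -
  assume "f \<in> rspace" and A: "A \<in> finsubs"
  then obtain b where "rbounded f b" by (auto simp: rspace_def)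
  then have "bdd_above ((\<lambda>p. rgap f (fst p) (snd p)) ` (finsubs \<times> UNIV))"
    by (auto simp: rbounded_def intro!: bdd_aboveI [of _ b])
  then show ?thesis
    unfolding rnorm_def using A by (intro cSUP_upper2 [where x="(A,c)"]) auto
qed

lemma rnorm_least: "rbounded f b \<Longrightarrow> rnorm f \<le> b"
  unfolding rnorm_def by (rule cSUP_least) (auto simp: rbounded_def intro: empty_finsubs)

lemma rnorm_nonneg: "f \<in> rspace \<Longrightarrow> 0 \<le> rnorm f"
  using rnorm_upper [of f "{}"] by simp

lemma rnorm_zero [simp]: "rnorm (\<lambda>x. 0) = 0"
proof -
  have "(\<lambda>x. 0) \<in> rspace" using rbounded_zero unfolding rspace_def by blast
  then show ?thesis using rnorm_least [OF rbounded_zero] rnorm_nonneg by force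
qed

lemma rgap_sum_bound:
  assumes f: "f \<in> rspace" and g: "g \<in> rspace" and A: "A \<in> finsubs" and B: "B \<in> finsubs"
  shows "rgap (\<lambda>x. f x + g x) A a + rgap (\<lambda>x. f x - g x) B b \<le> 2 * rnorm f + 2 * rnorm g"
proof -
  let ?C = "A \<union> B"
  have C: "?C \<in> finsubs" "finite ?C" using A B by (auto simp: finsubs_def)
  define c where "c = (\<lambda>x. if x \<in> A then a x else 0)"
  define d where "d = (\<lambda>x. if x \<in> B then b x else 0)"
  \<comment> \<open>The coefficients for the sum and for the difference vary independently; written
    as \<open>u + w\<close> and \<open>u - w\<close> they fit
    \<open>rgap_parallelogram\<close>.\<close>
  define u where "u = (\<lambda>x. (c x + d x) / 2)"
  define w where "w = (\<lambda>x. (c x - d x) / 2)"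
  have cd: "c = (\<lambda>x. u x + w x)" "d = (\<lambda>x. u x - w x)"
    by (auto simp: u_def w_def field_simps)
  have "rgap (\<lambda>x. f x + g x) A a + rgap (\<lambda>x. f x - g x) B b
     = rgap (\<lambda>x. f x + g x) ?C c + rgap (\<lambda>x. f x - g x) ?C d"
    using C by (simp add: rgap_extend [of A ?C] rgap_extend [of B ?C] c_def d_def)
  also have "\<dots> = 2 * rgap f ?C u + 2 * rgap g ?C w"
    unfolding cd by (rule rgap_parallelogram)
  also have "\<dots> \<le> 2 * rnorm f + 2 * rnorm g"
    using rnorm_upper [OF f C(1), of u] rnorm_upper [OF g C(1), of w] by linarith
  finally show ?thesis .
qed

lemma rgap_scale: "rgap (\<lambda>x. t * f x) A (\<lambda>x. t * c x) = (cmod t)\<^sup>2 * rgap f A c"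
proof -
  have tt: "cnj t * t = of_real ((cmod t)\<^sup>2)" by (metis complex_norm_square mult.commute)
  have 1: "(\<Sum>x\<in>A. cnj (t * c x) * (t * f x)) = (cnj t * t) * (\<Sum>x\<in>A. cnj (c x) * f x)"
    unfolding sum_distrib_left by (rule sum.cong) auto
  have 2: "kernel_form k A (\<lambda>x. t * c x) = (cnj t * t) * kernel_form k A c"
    unfolding kernel_form_def sum_distrib_left by (intro sum.cong refl) auto
  show ?thesis unfolding rgap_def 1 2 tt by (simp add: algebra_simps del: of_real_power)
qed

lemma
  assumes f: "f \<in> rspace"
  shows rspace_scale: "(\<lambda>x. t * f x) \<in> rspace"
    and rnorm_scale: "rnorm (\<lambda>x. t * f x) = (cmod t)\<^sup>2 * rnorm f"
proof -
  have le: "rbounded (\<lambda>x. t * f x) ((cmod t)\<^sup>2 * rnorm f)" if f: "f \<in> rspace" for t f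
  proof (cases "t = 0")
    case False
    show ?thesis
      unfolding rbounded_def
    proof (intro ballI allI)
      fix A c assume A: "A \<in> finsubs"
      have "rgap (\<lambda>x. t * f x) A c = (cmod t)\<^sup>2 * rgap f A (\<lambda>x. c x / t)"
        using rgap_scale [of t f A "\<lambda>x. c x / t"] False by simp
      then show "rgap (\<lambda>x. t * f x) A c \<le> (cmod t)\<^sup>2 * rnorm f"
        using rnorm_upper [OF f A] by (simp add: mult_left_mono)
    qed
  qed simp
  show in_space: "(\<lambda>x. t * f x) \<in> rspace" for t using le [OF f, of t] f by (auto simp: rspace_def)
  show "rnorm (\<lambda>x. t * f x) = (cmod t)\<^sup>2 * rnorm f"
  proof (cases "t = 0")
    case False
    have "rnorm f \<le> (cmod (1/t))\<^sup>2 * rnorm (\<lambda>x. t * f x)"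
      using rnorm_least [OF le [OF in_space [of t], of "1/t"]] False by simp
    then have "(cmod t)\<^sup>2 * rnorm f \<le> rnorm (\<lambda>x. t * f x)"
      using False by (simp add: norm_divide field_simps)
    then show ?thesis using rnorm_least [OF le [OF f, of t]] by simp
  qed simp
qed

lemma rspace_add: assumes f: "f \<in> rspace" and g: "g \<in> rspace"
  shows "(\<lambda>x. f x + g x) \<in> rspace"
proof -
  have "rbounded (\<lambda>x. f x + g x) (2 * rnorm f + 2 * rnorm g)"
    unfolding rbounded_def using rgap_sum_bound [OF f g _ empty_finsubs] by auto
  then show ?thesis using f g by (auto simp: rspace_def)
qed

lemma rspace_zero: "(\<lambda>x. 0) \<in> rspace"
  using rbounded_zero unfolding rspace_def by blast

lemma rspace_uminus: "f \<in> rspace \<Longrightarrow> (\<lambda>x. - f x) \<in> rspace"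
  using rspace_scale [of f "-1"] by simp

lemma rspace_diff: "\<lbrakk>f \<in> rspace; g \<in> rspace\<rbrakk> \<Longrightarrow> (\<lambda>x. f x - g x) \<in> rspace"
  using rspace_add [of f "\<lambda>x. - g x"] rspace_uminus [of g] by simp

lemma rnorm_uminus: "f \<in> rspace \<Longrightarrow> rnorm (\<lambda>x. - f x) = rnorm f"
  using rnorm_scale [of f "-1"] by simp

text \<open>\<open>rgap_sum_bound\<close> gives one inequality after taking the two suprema
  separately; the same inequality for \<open>f + g\<close> and \<open>f - g\<close> is the reverse
  one.\<close>

lemma rnorm_parallelogram:
  assumes f: "f \<in> rspace" and g: "g \<in> rspace"
  shows "rnorm (\<lambda>x. f x + g x) + rnorm (\<lambda>x. f x - g x) = 2 * rnorm f + 2 * rnorm g"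
proof -
  have le: "rnorm (\<lambda>x. f x + g x) + rnorm (\<lambda>x. f x - g x) \<le> 2 * rnorm f + 2 * rnorm g"
    if f: "f \<in> rspace" and g: "g \<in> rspace" for f g
  proof -
    have "rgap (\<lambda>x. f x - g x) B b \<le> 2 * rnorm f + 2 * rnorm g - rnorm (\<lambda>x. f x + g x)"
      if B: "B \<in> finsubs" for B b
    proof -
      have "rnorm (\<lambda>x. f x + g x) \<le> 2 * rnorm f + 2 * rnorm g - rgap (\<lambda>x. f x - g x) B b"
        by (rule rnorm_least) (use rgap_sum_bound [OF f g _ B] in \<open>force simp: rbounded_def algebra_simps\<close>)
      then show ?thesis by simp
    qed
    then have "rnorm (\<lambda>x. f x - g x) \<le> 2 * rnorm f + 2 * rnorm g - rnorm (\<lambda>x. f x + g x)"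
      by (intro rnorm_least) (simp add: rbounded_def)
    then show ?thesis by simp
  qed
  have "rnorm (\<lambda>x. 2 * f x) + rnorm (\<lambda>x. 2 * g x)
      \<le> 2 * rnorm (\<lambda>x. f x + g x) + 2 * rnorm (\<lambda>x. f x - g x)"
    using le [OF rspace_add [OF f g] rspace_diff [OF f g]] by (simp add: algebra_simps)
  then show ?thesis using le [OF f g] by (simp add: rnorm_scale f g)
qed

text \<open>The real part of the inner product, by polarisation.\<close>

definition rinner :: "('a \<Rightarrow> complex) \<Rightarrow> ('a \<Rightarrow> complex) \<Rightarrow> real" where
  "rinner f g = (rnorm (\<lambda>x. f x + g x) - rnorm (\<lambda>x. f x - g x)) / 4"

lemma rinner_commute: "\<lbrakk>f \<in> rspace; g \<in> rspace\<rbrakk> \<Longrightarrow> rinner g f = rinner f g"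
  using rnorm_uminus [OF rspace_diff, of f g] by (simp add: rinner_def add.commute)

text \<open>The Jordan--von Neumann argument.\<close>

lemma rinner_add_left:
  assumes f: "f \<in> rspace" and f': "f' \<in> rspace" and g: "g \<in> rspace"
  shows "rinner (\<lambda>x. f x + f' x) g = rinner f g + rinner f' g"
proof -
  note cl = rspace_add rspace_diff f f' g
  \<comment> \<open>After cancellation the right side is N(f + h) + N(f' + h) + N(f + f') - N(f) -
    N(f') - N(h), with N for \<open>rnorm\<close>. Subtracting the instances \<open>h = g\<close>
    and \<open>h = - g\<close> leaves exactly additivity.\<close>
  have e: "rnorm (\<lambda>x. (f x + f' x) + h x) =
      rnorm f + rnorm f' - (rnorm h) + rnorm (\<lambda>x. f x + h x) + rnorm (\<lambda>x. f' x + h x)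
        - rnorm (\<lambda>x. f x - f' x) - (rnorm f + rnorm f' - rnorm (\<lambda>x. f x - f' x)) + 
       (rnorm (\<lambda>x. f x + f' x) - rnorm f - rnorm f')"
    if h: "h \<in> rspace" for h
  proof -
    have 1: "rnorm (\<lambda>x. (f x + h x) + f' x) + rnorm (\<lambda>x. (f x + h x) - f' x)
        = 2 * rnorm (\<lambda>x. f x + h x) + 2 * rnorm f'"
      by (rule rnorm_parallelogram) (intro cl h)+
    have 2: "rnorm (\<lambda>x. (f x - f' x) + h x) + rnorm (\<lambda>x. (f x - f' x) - h x)
        = 2 * rnorm (\<lambda>x. f x - f' x) + 2 * rnorm h"
      by (rule rnorm_parallelogram) (intro cl h)+
    have 3: "rnorm (\<lambda>x. f x + (f' x + h x)) + rnorm (\<lambda>x. f x - (f' x + h x))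
        = 2 * rnorm f + 2 * rnorm (\<lambda>x. f' x + h x)"
      by (rule rnorm_parallelogram) (intro cl h)+
    have 4: "rnorm (\<lambda>x. f x + f' x) + rnorm (\<lambda>x. f x - f' x) = 2 * rnorm f + 2 * rnorm f'"
      by (rule rnorm_parallelogram) (intro cl h)+
    show ?thesis using 1 2 3 4 by (simp add: algebra_simps)
  qed
  have "rnorm (\<lambda>x. - g x) = rnorm g" by (rule rnorm_uminus [OF g])
  then show ?thesis
    using e [OF g] e [OF rspace_uminus [OF g]] by (simp add: rinner_def field_simps)
qed

text \<open>The deviation \<open>d\<close> from linearity is additive and vanishes at the integers,
  so its values are those on fractional parts and are bounded. A bounded additive function is zero,
  because \<open>d (n t) = n d t\<close>.\<close>

lemma additive_bounded_linear:
  fixes h :: "real \<Rightarrow> real"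
  assumes add: "\<And>s t. h (s + t) = h s + h t" and bdd: "\<And>t. \<bar>t\<bar> \<le> 1 \<Longrightarrow> \<bar>h t\<bar> \<le> C"
  shows "h t = t * h 1"
proof -
  define d where "d = (\<lambda>t. h t - t * h 1)"
  have d_add: "d (s + t) = d s + d t" for s t by (simp add: d_def add algebra_simps)
  have d0: "d 0 = 0" using d_add [of 0 0] by simp
  have d_nat: "d (of_nat n * t) = of_nat n * d t" for n t
    by (induction n) (simp_all add: d0 d_add distrib_right)
  have d_neg: "d (- t) = - d t" for t using d_add [of t "-t"] d0 by simp
  have d1: "d 1 = 0" by (simp add: d_def)
  have d_int: "d (of_int i) = 0" for i
  proof (cases i rule: int_cases)
    case (nonneg n) then show ?thesis using d_nat [of n 1] d1 by simp
  next
    case (neg n) then show ?thesis using d_nat [of "Suc n" 1] d1 d_neg [of "of_nat (Suc n)"] by simp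
  qed
  have bd: "\<bar>d t\<bar> \<le> C + \<bar>h 1\<bar>" for t
  proof -
    have "d t = d (frac t) + d (of_int \<lfloor>t\<rfloor>)" using d_add [of "frac t" "of_int \<lfloor>t\<rfloor>"] by (simp add: frac_def)
    then have "d t = d (frac t)" by (simp add: d_int)
    moreover have fr: "0 \<le> frac t" "frac t \<le> 1" using frac_lt_1 [of t] by (auto simp: less_imp_le)
    moreover have "\<bar>h (frac t)\<bar> \<le> C" using bdd fr by simp
    moreover have "\<bar>frac t * h 1\<bar> \<le> \<bar>h 1\<bar>" using fr by (simp add: abs_mult mult_left_le_one_le)
    ultimately show ?thesis unfolding d_def by linarith
  qed
  have "d t = 0"
  proof (rule ccontr)
    assume "d t \<noteq> 0"
    then obtain n :: nat where "C + \<bar>h 1\<bar> < of_nat n * \<bar>d t\<bar>" using ex_less_of_nat_mult [of "\<bar>d t\<bar>"] by auto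
    then show False using bd [of "of_nat n * t"] by (simp add: d_nat abs_mult)
  qed
  then show ?thesis by (simp add: d_def)
qed

lemma rinner_real_scale:
  assumes f: "f \<in> rspace" and g: "g \<in> rspace"
  shows "rinner (\<lambda>x. of_real t * f x) g = t * rinner f g"
proof -
  have sf: "(\<lambda>x. of_real t * f x) \<in> rspace" for t by (rule rspace_scale [OF f])
  have "rinner (\<lambda>x. of_real t * f x) g = t * rinner (\<lambda>x. of_real 1 * f x) g"
  proof (rule additive_bounded_linear)
    show "rinner (\<lambda>x. of_real (s + t) * f x) g =
        rinner (\<lambda>x. of_real s * f x) g + rinner (\<lambda>x. of_real t * f x) g" for s t
      using rinner_add_left [OF sf [of s] sf [of t] g] by (simp add: algebra_simps)
    fix t :: real assume t: "\<bar>t\<bar> \<le> 1"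
    have "rnorm (\<lambda>x. of_real t * f x) = t\<^sup>2 * rnorm f" by (simp add: rnorm_scale f)
    moreover have "t\<^sup>2 * rnorm f \<le> rnorm f"
      using t rnorm_nonneg [OF f] by (intro mult_left_le_one_le) (auto simp: abs_square_le_1)
    ultimately have "rnorm (\<lambda>x. of_real t * f x + g x) + rnorm (\<lambda>x. of_real t * f x - g x)
        \<le> 2 * rnorm f + 2 * rnorm g"
      using rnorm_parallelogram [OF sf g, of t] by linarith
    moreover have "0 \<le> rnorm (\<lambda>x. of_real t * f x + g x)" "0 \<le> rnorm (\<lambda>x. of_real t * f x - g x)"
      by (intro rnorm_nonneg rspace_add rspace_diff sf g)+
    ultimately show "\<bar>rinner (\<lambda>x. of_real t * f x) g\<bar> \<le> 2 * rnorm f + 2 * rnorm g"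
      using rnorm_nonneg [OF f] rnorm_nonneg [OF g] unfolding rinner_def by (simp add: abs_le_iff)
  qed
  then show ?thesis by simp
qed

text \<open>The product is conjugate linear in the second argument, so its imaginary part is the
  real part after multiplying \<open>g\<close> by the imaginary unit.\<close>

definition rcinner :: "('a \<Rightarrow> complex) \<Rightarrow> ('a \<Rightarrow> complex) \<Rightarrow> complex" where
  "rcinner f g = Complex (rinner f g) (rinner f (\<lambda>x. \<i> * g x))"

definition rkhs :: "('a \<Rightarrow> complex) cinner_space" where
  "rkhs = \<lparr>carrier = rspace, mult = (\<lambda>f g. f), one = (\<lambda>x. 0), zero = (\<lambda>x. 0),
     add = (\<lambda>f g x. f x + g x), smult = (\<lambda>t f x. t * f x), cinner = rcinner\<rparr>"

lemma rkhs_simps [simp]: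
  "carrier rkhs = rspace" "zero rkhs = (\<lambda>x. 0)" "add rkhs f g = (\<lambda>x. f x + g x)"
  "smult rkhs t f = (\<lambda>x. t * f x)" "cinner rkhs = rcinner"
  by (simp_all add: rkhs_def)

lemma rinner_i:
  assumes f: "f \<in> rspace" and g: "g \<in> rspace"
  shows "rinner (\<lambda>x. \<i> * f x) g = - rinner f (\<lambda>x. \<i> * g x)"
proof -
  have "rnorm (\<lambda>x. \<i> * f x + g x) = rnorm (\<lambda>x. f x - \<i> * g x)"
    using rnorm_scale [OF rspace_diff [OF f rspace_scale [OF g, of \<i>]], of \<i>]
    by (simp add: right_diff_distrib flip: mult.assoc)
  moreover have "rnorm (\<lambda>x. \<i> * f x - g x) = rnorm (\<lambda>x. f x + \<i> * g x)"
    using rnorm_scale [OF rspace_add [OF f rspace_scale [OF g, of \<i>]], of \<i>]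
    by (simp add: distrib_left flip: mult.assoc)
  moreover have "a = c \<Longrightarrow> b = d \<Longrightarrow> (a - b) / 4 = - ((d - c) / 4)" for a b c d :: real
    by (simp add: field_simps)
  ultimately show ?thesis unfolding rinner_def by blast
qed

lemma rinner_self: "f \<in> rspace \<Longrightarrow> rinner f f = rnorm f"
  using rnorm_scale [of f 2] by (simp add: rinner_def)

section \<open>The reproducing property\<close>

definition rker :: "'a \<Rightarrow> 'a \<Rightarrow> complex" where
  "rker x = (\<lambda>y. if y \<in> X then k x y else 0)"

text \<open>Completing the square: adding \<open>t\<close> times the kernel function at
  \<open>x\<close> amounts to shifting one coefficient by \<open>t\<close> and adding a constant.
  The shift is a bijection of the coefficients, so the supremum changes by that constant
  only.\<close>

lemma rgap_rker:
  assumes x: "x \<in> B" and B: "B \<in> finsubs"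
  shows "rgap (\<lambda>y. f y + t * rker x y) B c
    = rgap f B (\<lambda>y. c y - (if y = x then t else 0)) + (2 * Re (cnj t * f x) + (cmod t)\<^sup>2 * Re (k x x))"
proof -
  have fB: "finite B" and BX: "B \<subseteq> X" using B by (auto simp: finsubs_def)
  have tt: "cnj t * t = of_real ((cmod t)\<^sup>2)" by (metis complex_norm_square mult.commute)
  define d where "d = (\<lambda>y. c y - (if y = x then t else 0))"
  have c: "c = (\<lambda>y. d y + (if y = x then t else 0))" by (auto simp: d_def)
  define p where "p = (\<Sum>y\<in>B. t * cnj (d y) * k x y)"
  have p': "(\<Sum>y\<in>B. d y * cnj t * k y x) = cnj p"
    unfolding p_def cnj_sum using BX x by (intro sum.cong refl) (auto simp: k_herm [of x] subset_iff)
  have ell: "(\<Sum>y\<in>B. cnj (c y) * (f y + t * rker x y))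
    = (\<Sum>y\<in>B. cnj (d y) * f y) + cnj t * f x + p + cnj t * t * k x x"
  proof -
    have "(\<Sum>y\<in>B. cnj (c y) * (f y + t * rker x y)) =
      (\<Sum>y\<in>B. cnj (d y) * f y + (if y = x then cnj t * f x else 0) + t * cnj (d y) * k x y
        + (if y = x then cnj t * t * k x x else 0))"
      using BX by (intro sum.cong) (auto simp: c rker_def algebra_simps)
    then show ?thesis using fB x by (simp add: sum.distrib p_def)
  qed
  have q: "kernel_form k B c = kernel_form k B d + p + cnj p + cnj t * t * k x x"
  proof -
    have "kernel_form k B c = (\<Sum>y\<in>B. \<Sum>z\<in>B. (d y * cnj (d z) * k y z
       + (if z = x then d y * cnj t * k y x else 0)) + ((if y = x then t * cnj (d z) * k x z else 0)
       + (if y = x then (if z = x then cnj t * t * k x x else 0) else 0)))"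
      unfolding kernel_form_def c by (intro sum.cong refl) (auto simp: algebra_simps)
    also have "\<dots> = kernel_form k B d + (\<Sum>y\<in>B. d y * cnj t * k y x)
       + ((\<Sum>y\<in>B. if y = x then p else 0) + (\<Sum>y\<in>B. if y = x then cnj t * t * k x x else 0))"
    proof -
      have "(\<Sum>z\<in>B. if y = x then t * cnj (d z) * k x z else 0) = (if y = x then p else 0)" for y
        by (simp add: p_def)
      moreover have "(\<Sum>z\<in>B. if y = x then (if z = x then cnj t * t * k x x else 0) else 0)
        = (if y = x then cnj t * t * k x x else 0)" for y
        using fB x by simp
      ultimately show ?thesis
        using fB x by (simp only: sum.distrib kernel_form_def) simp
    qed
    finally show ?thesis using fB x by (simp add: p')
  qed
  have "Re (cnj t * t * k x x) = (cmod t)\<^sup>2 * Re (k x x)"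
    unfolding tt by (simp del: of_real_power)
  moreover have "u = v \<Longrightarrow> 2 * (a + b + c + u) - (e + c + c + u) = 2 * a - e + (2 * b + v)"
    for a b c e u v :: real by simp
  ultimately show ?thesis
    unfolding rgap_def ell q plus_complex.sel cnj.sel d_def [symmetric] by blast
qed

lemma rnorm_add_rker:
  assumes f: "f \<in> rspace" and x: "x \<in> X"
  shows "(\<lambda>y. f y + t * rker x y) \<in> rspace" (is "?g \<in> _")
    and "rnorm (\<lambda>y. f y + t * rker x y) = rnorm f + (2 * Re (cnj t * f x) + (cmod t)\<^sup>2 * Re (k x x))"
proof -
  define b where "b = 2 * Re (cnj t * f x) + (cmod t)\<^sup>2 * Re (k x x)"
  have ins: "insert x A \<in> finsubs" "finite (insert x A)" if "A \<in> finsubs" for A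
    using that x by (auto simp: finsubs_def)
  have bd: "rbounded ?g (rnorm f + b)"
    unfolding rbounded_def
  proof (intro ballI allI)
    fix A c assume A: "A \<in> finsubs"
    show "rgap ?g A c \<le> rnorm f + b"
      unfolding rgap_extend [OF subset_insertI ins(2) [OF A]] rgap_rker [OF insertI1 ins(1) [OF A]] b_def
      using rnorm_upper [OF f ins(1) [OF A]] by simp
  qed
  then show g: "?g \<in> rspace" using f x by (auto simp: rspace_def rker_def)
  have "rbounded f (rnorm ?g - b)"
    unfolding rbounded_def
  proof (intro ballI allI)
    fix A and c :: "'a \<Rightarrow> complex" assume A: "A \<in> finsubs"
    define c' where "c' = (\<lambda>y. if y \<in> A then c y else 0)"
    define d where "d = (\<lambda>y. c' y + (if y = x then t else 0))"
    have "rgap f A c = rgap f (insert x A) (\<lambda>y. d y - (if y = x then t else 0))"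
      unfolding rgap_extend [OF subset_insertI ins(2) [OF A]] d_def c'_def by simp
    then have "rgap f A c + b = rgap ?g (insert x A) d"
      unfolding rgap_rker [OF insertI1 ins(1) [OF A]] b_def by simp
    then show "rgap f A c \<le> rnorm ?g - b"
      using rnorm_upper [OF g ins(1) [OF A], of d] by simp
  qed
  then show "rnorm ?g = rnorm f + (2 * Re (cnj t * f x) + (cmod t)\<^sup>2 * Re (k x x))"
    using rnorm_least [OF bd] rnorm_least [of f "rnorm ?g - b"] by (simp add: b_def)
qed

lemma rker_in: "x \<in> X \<Longrightarrow> rker x \<in> rspace"
  using rnorm_add_rker(1) [OF rspace_zero, of x 1] by simp

text \<open>Polarising \<open>rnorm_add_rker\<close> between \<open>t\<close> and \<open>- t\<close>
  gives the real part of \<open>cnj t * f x\<close>; \<open>t = 1\<close> and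
  \<open>t = \<i>\<close> yield the real and the imaginary part of the value.\<close>

lemma reproducing:
  assumes f: "f \<in> rspace" and x: "x \<in> X"
  shows "rcinner f (rker x) = f x"
proof -
  have "rinner f (\<lambda>y. t * rker x y) = Re (cnj t * f x)" for t
    using rnorm_add_rker(2) [OF f x, of t] rnorm_add_rker(2) [OF f x, of "-t"]
    by (simp add: rinner_def)
  from this [of 1] this [of \<i>] show ?thesis
    by (simp add: rcinner_def complex_eq_iff)
qed

lemma rnorm_pos:
  assumes f: "f \<in> rspace" and nz: "f \<noteq> (\<lambda>x. 0)"
  shows "0 < rnorm f"
proof -
  obtain x where x: "f x \<noteq> 0" "x \<in> X" using f nz by (auto simp: rspace_def)
  have X: "{x} \<in> finsubs" using x by (simp add: finsubs_def)
  define K where "K = Re (k x x)"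
  have K: "0 \<le> K" using k_pos [of "{x}" "\<lambda>_. 1"] x by (simp add: K_def kernel_form_def)
  \<comment> \<open>Testing at the single point \<open>x\<close> with coefficient
    \<open>r * f x\<close> gives \<open>r * (2 - r * K)\<close> times the squared modulus of
    \<open>f x\<close>. This is positive once \<open>r * K < 2\<close>; the summand 1 keeps
    \<open>r\<close> defined for \<open>K = 0\<close>.\<close>
  define r where "r = 1 / (K + 1)"
  have r: "0 < r" "r * K < 1" using K by (auto simp: r_def field_simps)
  have ff: "f x * cnj (f x) = of_real ((cmod (f x))\<^sup>2)" by (rule complex_norm_square [symmetric])
  have "rgap f {x} (\<lambda>_. of_real r * f x) = (2 * r - r * r * K) * (cmod (f x))\<^sup>2"
  proof -
    have "cnj (of_real r * f x) * f x = of_real (r * (cmod (f x))\<^sup>2)"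
      using ff by (simp add: mult.commute)
    moreover have "of_real r * f x * cnj (of_real r * f x) * k x x = of_real (r * r * (cmod (f x))\<^sup>2) * k x x"
      using ff by (simp add: mult_ac)
    moreover have "rgap f {x} c = 2 * Re (cnj (c x) * f x) - Re (c x * cnj (c x) * k x x)" for c
      by (simp add: rgap_def kernel_form_def)
    ultimately have "rgap f {x} (\<lambda>_. of_real r * f x)
      = 2 * Re (of_real (r * (cmod (f x))\<^sup>2)) - Re (of_real (r * r * (cmod (f x))\<^sup>2) * k x x)"
      by (simp only:)
    also have "\<dots> = 2 * (r * (cmod (f x))\<^sup>2) - r * r * (cmod (f x))\<^sup>2 * K"
      unfolding Re_complex_of_real K_def by (simp del: of_real_mult of_real_power)
    finally show ?thesis by (simp add: algebra_simps)
  qed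
  moreover have "2 * r - r * r * K = r * (2 - r * K)" by (simp add: algebra_simps)
  moreover have "r * (2 - r * K) > 0" using r by (intro mult_pos_pos) auto
  ultimately have "0 < rgap f {x} (\<lambda>_. of_real r * f x)" using x by simp
  then show ?thesis using rnorm_upper [OF f X] by (meson less_le_trans)
qed

section \<open>The kernel space is a Hilbert space\<close>

lemma abelian_group_rkhs: "abelian_group rkhs"
  by (rule abelian_groupI)
    (auto simp: rspace_add rspace_zero algebra_simps intro!: bexI [of _ "\<lambda>x. - f x" for f] rspace_uminus)

lemma module_rkhs: "Module.module complex_field rkhs"
  by (rule moduleI [OF cring_complex_field abelian_group_rkhs])
    (auto simp: rspace_scale algebra_simps)

lemma complex_inner_product_space_rkhs: "complex_inner_product_space rkhs"
proof (intro complex_inner_product_space.intro [OF module_rkhs]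
    complex_inner_product_space_axioms.intro, simp_all)
  fix f g h assume f: "f \<in> rspace" and g: "g \<in> rspace"
  show "rcinner (\<lambda>x. f x + g x) h = rcinner f h + rcinner g h" if h: "h \<in> rspace"
    by (simp add: rcinner_def rinner_add_left f g h rspace_scale complex_eq_iff)
next
  fix f g c assume f: "f \<in> rspace" and g: "g \<in> rspace"
  have ii: "rinner f (\<lambda>x. - g x) = - rinner f g"
    using rinner_real_scale [OF g f, of "-1"] by (simp add: rinner_commute f g rspace_uminus)
  have sc: "rinner (\<lambda>x. c * f x) h = Re c * rinner f h - Im c * rinner f (\<lambda>x. \<i> * h x)"
    if h: "h \<in> rspace" for h
  proof -
    have "(\<lambda>x. c * f x) = (\<lambda>x. of_real (Re c) * f x + of_real (Im c) * (\<i> * f x))"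
      using complex_eq [of c] by (metis distrib_right mult.assoc mult.commute)
    then show ?thesis
      by (simp add: rinner_add_left rspace_scale f h rinner_real_scale rinner_i)
  qed
  show "rcinner (\<lambda>x. c * f x) g = c * rcinner f g"
    by (simp add: rcinner_def sc g rspace_scale complex_eq_iff ii flip: mult.assoc)
  show "rcinner g f = cnj (rcinner f g)"
    by (simp add: rcinner_def complex_eq_iff rinner_commute [OF f g]
        rinner_commute [OF rspace_scale [OF f] g] rinner_i f g)
next
  fix f assume f: "f \<in> rspace" "f \<noteq> (\<lambda>x. 0)"
  then show "0 < Re (rcinner f f)"
    by (simp add: rcinner_def rinner_self rnorm_pos)
qed

sublocale RK: complex_inner_product_space rkhs
  by (rule complex_inner_product_space_rkhs)

lemma rkhs_minus: "f \<in> rspace \<Longrightarrow> \<ominus>\<^bsub>rkhs\<^esub> f = (\<lambda>x. - f x)"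
  by (rule RK.M.minus_equality) (auto simp: rspace_uminus)

lemma hdist_rkhs: "\<lbrakk>f \<in> rspace; g \<in> rspace\<rbrakk> \<Longrightarrow> hdist rkhs f g = sqrt (rnorm (\<lambda>x. f x - g x))"
  by (simp add: hdist_def hnorm_def RK.M.minus_eq rkhs_minus rcinner_def rinner_self rspace_diff
      del: add_uminus_conv_diff add: diff_conv_add_uminus [symmetric])

lemma rspace_pointwise:
  assumes f: "f \<in> rspace" and x: "x \<in> X"
  shows "(cmod (f x))\<^sup>2 \<le> rnorm f * Re (k x x)"
proof -
  have "cmod (rcinner f (rker x)) \<le> hnorm rkhs f * hnorm rkhs (rker x)"
    using RK.Cauchy_Schwarz [of f "rker x"] f x by (simp add: rker_in)
  then have "(cmod (f x))\<^sup>2 \<le> (hnorm rkhs f * hnorm rkhs (rker x))\<^sup>2"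
    by (simp add: reproducing f x power_mono)
  also have "\<dots> = rnorm f * Re (k x x)"
    using RK.hnorm_square [of f] RK.hnorm_square [of "rker x"] f x
    by (simp add: power_mult_distrib rker_in rcinner_def rinner_self)
      (metis complex.sel(1) rcinner_def rinner_self reproducing rker_in rker_def x)
  finally show ?thesis .
qed

text \<open>Evaluations are bounded, so a Cauchy sequence converges pointwise. Each
  \<open>rgap\<close> involves only finitely many values, so bounds on \<open>rnorm\<close> pass to
  the pointwise limit, which is therefore in the space and is also the limit in norm.\<close>

lemma mcomplete_rkhs: "RK.mcomplete"
  unfolding RK.mcomplete_def
proof (intro allI impI)
  fix \<sigma> assume C: "RK.MCauchy \<sigma>"
  then have "range \<sigma> \<subseteq> rspace" unfolding RK.MCauchy_def by simp
  then have \<sigma>: "\<sigma> n \<in> rspace" for n by auto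
  have dist: "rnorm (\<lambda>x. \<sigma> m x - \<sigma> n x) = (hdist rkhs (\<sigma> m) (\<sigma> n))\<^sup>2" for m n
    by (simp add: hdist_rkhs \<sigma> rnorm_nonneg rspace_diff)
  have small: "\<exists>N. \<forall>m\<ge>N. \<forall>n\<ge>N. rnorm (\<lambda>x. \<sigma> m x - \<sigma> n x) \<le> e" if "e > 0" for e
  proof -
    obtain N where N: "\<And>m n. N \<le> m \<Longrightarrow> N \<le> n \<Longrightarrow> hdist rkhs (\<sigma> m) (\<sigma> n) < sqrt e"
      using C \<open>e > 0\<close> unfolding RK.MCauchy_def by (metis real_sqrt_gt_0_iff)
    have "rnorm (\<lambda>x. \<sigma> m x - \<sigma> n x) \<le> e" if "N \<le> m" "N \<le> n" for m n
      using power_mono [OF less_imp_le [OF N [OF that]], of 2] \<open>e > 0\<close> by (simp add: dist)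
    then show ?thesis by blast
  qed
  have conv: "convergent (\<lambda>n. \<sigma> n x)" for x
  proof (cases "x \<in> X")
    case True
    define K where "K = Re (k x x)"
    have K: "0 \<le> K" using k_pos [of "{x}" "\<lambda>_. 1"] True by (simp add: K_def kernel_form_def)
    have "Cauchy (\<lambda>n. \<sigma> n x)"
    proof (rule CauchyI)
      fix e :: real assume e: "0 < e"
      then have "e\<^sup>2 / (K + 1) > 0" using K by simp
      then obtain N where N: "\<And>m n. N \<le> m \<Longrightarrow> N \<le> n \<Longrightarrow> rnorm (\<lambda>x. \<sigma> m x - \<sigma> n x) \<le> e\<^sup>2 / (K + 1)"
        using small by blast
      have "norm (\<sigma> m x - \<sigma> n x) < e" if "N \<le> m" "N \<le> n" for m n
      proof -
        have "(cmod (\<sigma> m x - \<sigma> n x))\<^sup>2 \<le> rnorm (\<lambda>x. \<sigma> m x - \<sigma> n x) * K"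
          using rspace_pointwise [OF rspace_diff [OF \<sigma> \<sigma>] True] by (simp add: K_def)
        also have "\<dots> \<le> e\<^sup>2 / (K + 1) * K" using N [OF that] K by (rule mult_right_mono)
        also have "\<dots> < e\<^sup>2" using e K by (simp add: field_simps)
        finally show ?thesis using e power_less_imp_less_base by fastforce
      qed
      then show "\<exists>M. \<forall>m\<ge>M. \<forall>n\<ge>M. norm (\<sigma> m x - \<sigma> n x) < e" by blast
    qed
    then show ?thesis by (rule Cauchy_convergent)
  next
    case False
    then have "\<sigma> n x = 0" for n using \<sigma> [of n] by (simp add: rspace_def)
    then show ?thesis by (simp add: convergent_const)
  qed
  define l where "l = (\<lambda>x. lim (\<lambda>n. \<sigma> n x))"
  have lim: "(\<lambda>n. \<sigma> n x) \<longlonglongrightarrow> l x" for x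
    using conv [of x] by (simp add: l_def convergent_LIMSEQ_iff)
  have gap: "rbounded (\<lambda>x. \<sigma> m x - l x) e" if "\<And>n. N \<le> n \<Longrightarrow> rnorm (\<lambda>x. \<sigma> m x - \<sigma> n x) \<le> e" for m N e
    unfolding rbounded_def
  proof (intro ballI allI)
    fix A c assume A: "A \<in> finsubs"
    have "(\<lambda>n. rgap (\<lambda>x. \<sigma> m x - \<sigma> n x) A c) \<longlonglongrightarrow> rgap (\<lambda>x. \<sigma> m x - l x) A c"
      unfolding rgap_def by (intro tendsto_intros lim)
    moreover have "rgap (\<lambda>x. \<sigma> m x - \<sigma> n x) A c \<le> e" if "N \<le> n" for n
      using rnorm_upper [OF rspace_diff [OF \<sigma> \<sigma>] A] \<open>\<And>n. N \<le> n \<Longrightarrow> rnorm (\<lambda>x. \<sigma> m x - \<sigma> n x) \<le> e\<close> [OF that]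
      by (meson order_trans)
    ultimately show "rgap (\<lambda>x. \<sigma> m x - l x) A c \<le> e"
      by (intro LIMSEQ_le_const2) auto
  qed
  have l0: "l x = 0" if "x \<notin> X" for x
  proof -
    have "(\<lambda>n. \<sigma> n x) = (\<lambda>n. 0)" using \<sigma> that by (auto simp: rspace_def)
    then show ?thesis by (simp add: l_def)
  qed
  have diff_in: "(\<lambda>x. \<sigma> m x - l x) \<in> rspace" if "rbounded (\<lambda>x. \<sigma> m x - l x) e" for m e
    using that l0 \<sigma> by (auto simp: rspace_def)
  have l: "l \<in> rspace"
  proof -
    obtain N where "\<And>m n. N \<le> m \<Longrightarrow> N \<le> n \<Longrightarrow> rnorm (\<lambda>x. \<sigma> m x - \<sigma> n x) \<le> 1"
      using small [of 1] by auto
    then have "(\<lambda>x. \<sigma> N x - l x) \<in> rspace" using gap [of N N 1] diff_in by blast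
    from rspace_diff [OF \<sigma> [of N] this] show ?thesis by simp
  qed
  have "limitin RK.mtopology \<sigma> l sequentially"
    unfolding RK.limit_metric_sequentially
  proof (intro conjI allI impI)
    show "l \<in> carrier rkhs" using l by simp
    fix e :: real assume e: "0 < e"
    then have "(e/2)\<^sup>2 > 0" by simp
    then obtain N where N: "\<And>m n. N \<le> m \<Longrightarrow> N \<le> n \<Longrightarrow> rnorm (\<lambda>x. \<sigma> m x - \<sigma> n x) \<le> (e/2)\<^sup>2"
      using small by blast
    have "hdist rkhs (\<sigma> m) l < e" if "N \<le> m" for m
    proof -
      have "rnorm (\<lambda>x. \<sigma> m x - l x) \<le> (e/2)\<^sup>2"
        using gap [of N m] N [OF that] by (intro rnorm_least) auto
      then have "sqrt (rnorm (\<lambda>x. \<sigma> m x - l x)) \<le> e/2"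
        using e real_le_lsqrt by (metis half_gt_zero less_imp_le real_sqrt_le_iff real_sqrt_abs abs_of_pos)
      then show ?thesis using e by (simp add: hdist_rkhs \<sigma> l)
    qed
    then show "\<exists>N. \<forall>n\<ge>N. \<sigma> n \<in> carrier rkhs \<and> hdist rkhs (\<sigma> n) l < e"
      using \<sigma> by auto
  qed
  then show "\<exists>x. limitin RK.mtopology \<sigma> x sequentially" by blast
qed

sublocale RK: complex_hilbert_space rkhs
  by unfold_locales (rule mcomplete_rkhs)

end

section \<open>Orthogonal projections and Gram matrices in the kernel space\<close>

context pd_kernel
begin

lemma rnorm_rcinner: "f \<in> rspace \<Longrightarrow> rcinner f f = of_real (rnorm f)"
  using RK.cinner_self_real [of f] by (simp add: rcinner_def rinner_self)

lemma rcinner_diff_left: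
  "\<lbrakk>f \<in> rspace; g \<in> rspace; h \<in> rspace\<rbrakk> \<Longrightarrow> rcinner (\<lambda>x. f x - g x) h = rcinner f h - rcinner g h"
  using RK.cinner_add_left [of f "\<lambda>x. - g x" h] RK.cinner_minus_left [of g h]
  by (simp add: rspace_uminus rkhs_minus)

lemma rcinner_diff_right:
  "\<lbrakk>f \<in> rspace; g \<in> rspace; h \<in> rspace\<rbrakk> \<Longrightarrow> rcinner h (\<lambda>x. f x - g x) = rcinner h f - rcinner h g"
  using RK.cinner_add_right [of f "\<lambda>x. - g x" h] RK.cinner_minus_right [of g h]
  by (simp add: rspace_uminus rkhs_minus)

lemma rnorm_diff_scale:
  assumes f: "f \<in> rspace" and u: "u \<in> rspace"
  shows "rnorm (\<lambda>x. f x - t * u x) = rnorm f - 2 * Re (cnj t * rcinner f u) + (cmod t)\<^sup>2 * rnorm u"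
proof -
  have tu: "(\<lambda>x. t * u x) \<in> rspace" by (rule rspace_scale [OF u])
  have r: "rcinner f (\<lambda>x. t * u x) = cnj t * rcinner f u"
    using RK.cinner_smult_right [of u f t] f u by simp
  have l: "rcinner (\<lambda>x. t * u x) f = cnj (cnj t * rcinner f u)"
    using RK.cinner_commute [of f "\<lambda>x. t * u x"] f tu r by simp
  have "of_real (rnorm (\<lambda>x. f x - t * u x)) = rcinner f f - cnj t * rcinner f u
      - cnj (cnj t * rcinner f u) + rcinner (\<lambda>x. t * u x) (\<lambda>x. t * u x)"
    using f tu by (simp add: rnorm_rcinner [symmetric] rspace_diff rcinner_diff_left
        rcinner_diff_right r l)
  then have "Re (of_real (rnorm (\<lambda>x. f x - t * u x))) = Re (of_real (rnorm f) - cnj t * rcinner f u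
      - cnj (cnj t * rcinner f u) + of_real ((cmod t)\<^sup>2 * rnorm u))"
    by (simp only: rnorm_rcinner f tu rnorm_scale u)
  then show ?thesis
    unfolding minus_complex.sel plus_complex.sel Re_complex_of_real cnj.sel by argo
qed

text \<open>The projection theorem. A sequence minimising the distance to \<open>W\<close> is Cauchy
  by the parallelogram law, because midpoints stay in \<open>W\<close>; at the limit a first
  variation forces orthogonality.\<close>

lemma rkhs_projection:
  assumes W: "submodule W complex_field rkhs" "closedin RK.mtopology W" and v: "v \<in> rspace"
  shows "\<exists>w\<in>W. \<forall>u\<in>W. rcinner (\<lambda>x. v x - w x) u = 0"
proof -
  note WE = RK.submoduleE [OF W(1)]
  have Wr: "u \<in> rspace" if "u \<in> W" for u using WE(1) that by auto
  have Ws: "(\<lambda>x. t * u x) \<in> W" if "u \<in> W" for u t using WE(4) [of t u] that by simp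
  have Wa: "(\<lambda>x. u x + w x) \<in> W" if "u \<in> W" "w \<in> W" for u w using WE(5) [of u w] that by simp
  define d where "d = (INF w\<in>W. rnorm (\<lambda>x. v x - w x))"
  have nn: "0 \<le> rnorm (\<lambda>x. v x - w x)" if "w \<in> W" for w
    using that by (intro rnorm_nonneg rspace_diff v Wr)
  have bdd: "bdd_below ((\<lambda>w. rnorm (\<lambda>x. v x - w x)) ` W)"
    by (rule bdd_belowI [of _ 0]) (use nn in auto)
  have d_le: "d \<le> rnorm (\<lambda>x. v x - w x)" if "w \<in> W" for w
    unfolding d_def by (rule cINF_lower [OF bdd that])
  have "\<exists>w\<in>W. rnorm (\<lambda>x. v x - w x) < d + e" if "e > 0" for e
    using cINF_less_iff [OF WE(2) bdd, of "d + e"] that by (simp add: d_def)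
  then have "\<exists>w. w \<in> W \<and> rnorm (\<lambda>x. v x - w x) < d + 1 / real (Suc n)" for n
    by (metis of_nat_0_less_iff zero_less_Suc zero_less_divide_1_iff)
  then obtain \<sigma> where \<sigma>: "\<And>n. \<sigma> n \<in> W" and \<sigma>d: "\<And>n. rnorm (\<lambda>x. v x - \<sigma> n x) < d + 1 / real (Suc n)"
    by metis
  have dist: "hdist rkhs f g = sqrt (rnorm (\<lambda>x. f x - g x))" if "f \<in> rspace" "g \<in> rspace" for f g
    using that by (rule hdist_rkhs)
  have cl: "rnorm (\<lambda>x. \<sigma> m x - \<sigma> n x) \<le> 2 / real (Suc m) + 2 / real (Suc n)" for m n
  proof -
    have 1: "rnorm (\<lambda>x. (v x - \<sigma> n x) + (v x - \<sigma> m x)) + rnorm (\<lambda>x. (v x - \<sigma> n x) - (v x - \<sigma> m x))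
      = 2 * rnorm (\<lambda>x. v x - \<sigma> n x) + 2 * rnorm (\<lambda>x. v x - \<sigma> m x)"
      by (rule rnorm_parallelogram) (intro rspace_diff v Wr \<sigma>)+
    have halves: "2 * (a - 1/2 * (b + c)) = (a - b) + (a - c)" for a b c :: complex
      by (simp add: complex_eq_iff field_simps)
    define mid where "mid = (\<lambda>x. (1/2) * (\<sigma> n x + \<sigma> m x))"
    have mid: "mid \<in> W" unfolding mid_def by (intro Ws Wa \<sigma>)
    have "rnorm (\<lambda>x. (v x - \<sigma> n x) + (v x - \<sigma> m x)) = rnorm (\<lambda>x. 2 * (v x - mid x))"
      unfolding mid_def halves ..
    also have "\<dots> = 4 * rnorm (\<lambda>x. v x - mid x)"
      using rnorm_scale [OF rspace_diff [OF v Wr [OF mid]], of 2] by simp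
    finally have "rnorm (\<lambda>x. \<sigma> m x - \<sigma> n x)
       \<le> 2 * rnorm (\<lambda>x. v x - \<sigma> n x) + 2 * rnorm (\<lambda>x. v x - \<sigma> m x) - 4 * d"
      using 1 d_le [OF mid] by simp
    then show ?thesis using \<sigma>d [of m] \<sigma>d [of n] by simp
  qed
  have "RK.MCauchy \<sigma>"
    unfolding RK.MCauchy_def
  proof (intro conjI allI impI)
    show "range \<sigma> \<subseteq> carrier rkhs" using \<sigma> Wr by auto
    fix e :: real assume e: "e > 0"
    obtain N where N: "4 / e\<^sup>2 < real N" using reals_Archimedean2 by blast
    have "hdist rkhs (\<sigma> m) (\<sigma> n) < e" if "N \<le> m" "N \<le> n" for m n
    proof -
      have small: "2 / real (Suc i) < e\<^sup>2 / 2" if "N \<le> i" for i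
      proof -
        have "4 / e\<^sup>2 < real (Suc i)" using N that by linarith
        then show ?thesis using e by (simp add: field_simps)
      qed
      have "rnorm (\<lambda>x. \<sigma> m x - \<sigma> n x) < e\<^sup>2"
        using cl [of m n] small [OF that(1)] small [OF that(2)] by simp
      then show ?thesis
        using e by (simp add: dist Wr \<sigma> real_less_lsqrt rnorm_nonneg rspace_diff)
    qed
    then show "\<exists>N. \<forall>n n'. N \<le> n \<longrightarrow> N \<le> n' \<longrightarrow> hdist rkhs (\<sigma> n) (\<sigma> n') < e" by blast
  qed
  then obtain w where w: "limitin RK.mtopology \<sigma> w sequentially"
    using RK.complete unfolding RK.mcomplete_def by blast
  have wW: "w \<in> W"
    by (rule limitin_closedin [OF w W(2)]) (auto simp: \<sigma>)
  have min: "rnorm (\<lambda>x. v x - w x) \<le> d"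
  proof -
    have lim: "(\<lambda>n. hdist rkhs (\<sigma> n) w) \<longlonglongrightarrow> 0"
    proof (rule LIMSEQ_I)
      fix r :: real assume "0 < r"
      then obtain N where "\<And>n. N \<le> n \<Longrightarrow> hdist rkhs (\<sigma> n) w < r"
        using w unfolding RK.limit_metric_sequentially by blast
      then show "\<exists>no. \<forall>n\<ge>no. norm (hdist rkhs (\<sigma> n) w - 0) < r" by auto
    qed
    have "(\<lambda>n. sqrt (d + 1 / real (Suc n)) + hdist rkhs (\<sigma> n) w) \<longlonglongrightarrow> sqrt (d + 0) + 0"
      by (intro tendsto_intros lim LIMSEQ_Suc [OF lim_1_over_n])
    moreover have "hdist rkhs v w \<le> sqrt (d + 1 / real (Suc n)) + hdist rkhs (\<sigma> n) w" for n
    proof -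
      have "hdist rkhs v w \<le> hdist rkhs v (\<sigma> n) + hdist rkhs (\<sigma> n) w"
        using RK.triangle [of v "\<sigma> n" w] v Wr [OF \<sigma>] Wr [OF wW] by simp
      moreover have "hdist rkhs v (\<sigma> n) \<le> sqrt (d + 1 / real (Suc n))"
        using less_imp_le [OF \<sigma>d [of n]] by (simp add: dist v Wr [OF \<sigma>])
      ultimately show ?thesis by linarith
    qed
    ultimately have "hdist rkhs v w \<le> sqrt d"
      by (intro LIMSEQ_le_const) auto
    then show ?thesis by (simp add: dist v Wr [OF wW])
  qed
  have "rcinner (\<lambda>x. v x - w x) u = 0" if u: "u \<in> W" for u
  proof (rule ccontr)
    define f where "f = (\<lambda>x. v x - w x)"
    have f: "f \<in> rspace" unfolding f_def by (intro rspace_diff v Wr wW)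
    define a where "a = rcinner f u"
    assume "rcinner (\<lambda>x. v x - w x) u \<noteq> 0"
    then have a: "a \<noteq> 0" by (simp add: a_def f_def)
    define n where "n = rnorm u"
    have n: "0 \<le> n" unfolding n_def by (intro rnorm_nonneg Wr u)
    \<comment> \<open>Moving \<open>w\<close> by \<open>t\<close> times \<open>u\<close> lowers the
      squared distance by \<open>s * (2 - s * n)\<close> times the squared modulus of
      \<open>a\<close>, which is positive for this \<open>s\<close>, even if
      \<open>n = 0\<close>.\<close>
    define s where "s = 1 / (n + 1)"
    have s: "0 < s" "s * n < 1" using n by (auto simp: s_def field_simps)
    define t where "t = of_real s * a"
    have "(\<lambda>x. w x + t * u x) \<in> W" by (intro Wa Ws wW u)
    from d_le [OF this] have "d \<le> rnorm (\<lambda>x. f x - t * u x)" by (simp add: f_def algebra_simps)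
    also have "\<dots> = rnorm f - 2 * Re (cnj t * a) + (cmod t)\<^sup>2 * n"
      using rnorm_diff_scale [OF f Wr [OF u], of t] by (simp only: a_def n_def)
    also have "cnj t * a = of_real (s * (cmod a)\<^sup>2)"
      using complex_norm_square [of a] by (simp add: t_def mult.commute)
    also have "(cmod t)\<^sup>2 = s * s * (cmod a)\<^sup>2"
      using s by (simp add: t_def norm_mult power_mult_distrib power2_eq_square)
    also have "rnorm f - 2 * Re (of_real (s * (cmod a)\<^sup>2)) + s * s * (cmod a)\<^sup>2 * n
       = rnorm f - s * (cmod a)\<^sup>2 * (2 - s * n)"
      unfolding Re_complex_of_real by (simp add: algebra_simps)
    finally have "s * (cmod a)\<^sup>2 * (2 - s * n) \<le> 0" using min by (simp add: f_def)
    moreover have "s * (cmod a)\<^sup>2 * (2 - s * n) > 0" using s a by (intro mult_pos_pos) auto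
    ultimately show False by simp
  qed
  then show ?thesis using wW by blast
qed

lemma rspace_sum:
  "\<lbrakk>finite A; \<And>a. a \<in> A \<Longrightarrow> F a \<in> rspace\<rbrakk> \<Longrightarrow> (\<lambda>z. \<Sum>a\<in>A. c a * F a z) \<in> rspace"
  by (induction A rule: finite_induct) (auto simp: rspace_zero rspace_add rspace_scale)

lemma rcinner_sum_left:
  "\<lbrakk>finite A; \<And>a. a \<in> A \<Longrightarrow> F a \<in> rspace; g \<in> rspace\<rbrakk> \<Longrightarrow>
    rcinner (\<lambda>z. \<Sum>a\<in>A. c a * F a z) g = (\<Sum>a\<in>A. c a * rcinner (F a) g)"
proof (induction A rule: finite_induct)
  case empty
  then show ?case using RK.cinner_zero_left [of g] by simp
next
  case (insert a A)
  then have "rcinner (\<lambda>z. c a * F a z + (\<Sum>a\<in>A. c a * F a z)) g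
      = c a * rcinner (F a) g + rcinner (\<lambda>z. \<Sum>a\<in>A. c a * F a z) g"
    using RK.cinner_add_left [of "\<lambda>z. c a * F a z" "\<lambda>z. \<Sum>a\<in>A. c a * F a z" g]
      RK.cinner_smult_left [of "F a" g "c a"] by (simp add: rspace_scale rspace_sum)
  then show ?case using insert by simp
qed

lemma rcinner_sum_right:
  assumes A: "finite A" and F: "\<And>a. a \<in> A \<Longrightarrow> F a \<in> rspace" and g: "g \<in> rspace"
  shows "rcinner g (\<lambda>z. \<Sum>a\<in>A. c a * F a z) = (\<Sum>a\<in>A. cnj (c a) * rcinner g (F a))"
proof -
  have "rcinner g (\<lambda>z. \<Sum>a\<in>A. c a * F a z) = cnj (rcinner (\<lambda>z. \<Sum>a\<in>A. c a * F a z) g)"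
    using RK.cinner_commute [of "\<lambda>z. \<Sum>a\<in>A. c a * F a z" g] A F g by (simp add: rspace_sum)
  also have "\<dots> = (\<Sum>a\<in>A. cnj (c a) * cnj (rcinner (F a) g))"
    by (simp add: rcinner_sum_left A F g)
  also have "\<dots> = (\<Sum>a\<in>A. cnj (c a) * rcinner g (F a))"
    using RK.cinner_commute [OF _ _] F g by (intro sum.cong refl) (metis rkhs_simps(1,5))
  finally show ?thesis .
qed

lemma kernel_form_rcinner:
  assumes A: "finite A" and F: "\<And>a. a \<in> A \<Longrightarrow> F a \<in> rspace"
  shows "0 \<le> Re (kernel_form (\<lambda>x y. rcinner (F x) (F y)) A c)"
proof -
  define u where "u = (\<lambda>z. \<Sum>a\<in>A. c a * F a z)"
  have u: "u \<in> rspace" unfolding u_def by (rule rspace_sum [OF A F])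
  have "rcinner u u = (\<Sum>a\<in>A. c a * rcinner (F a) u)"
    unfolding u_def by (rule rcinner_sum_left [OF A F rspace_sum [OF A F]])
  also have "\<dots> = (\<Sum>a\<in>A. c a * (\<Sum>b\<in>A. cnj (c b) * rcinner (F a) (F b)))"
    by (intro sum.cong refl) (simp add: u_def rcinner_sum_right A F)
  also have "\<dots> = kernel_form (\<lambda>x y. rcinner (F x) (F y)) A c"
    by (simp add: kernel_form_def sum_distrib_left mult.assoc)
  finally show ?thesis using RK.cinner_self_nonneg [of u] u by simp
qed

end


section \<open>Positive definite functions on groups\<close>

text \<open>Hermitian symmetry is a separate clause because positivity is only asked of the real
  part of the form. The value 0 outside the carrier makes such functions elements of their own
  kernel space.\<close>

definition pd_function :: "('a, 'b) monoid_scheme \<Rightarrow> ('a \<Rightarrow> complex) \<Rightarrow> bool" where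
  "pd_function G \<psi> \<longleftrightarrow> (\<forall>x. x \<notin> carrier G \<longrightarrow> \<psi> x = 0) \<and>
    (\<forall>x\<in>carrier G. \<psi> (inv\<^bsub>G\<^esub> x) = cnj (\<psi> x)) \<and>
    (\<forall>A c. finite A \<and> A \<subseteq> carrier G \<longrightarrow>
      0 \<le> Re (kernel_form (\<lambda>x y. \<psi> (inv\<^bsub>G\<^esub> x \<otimes>\<^bsub>G\<^esub> y)) A c))"

text \<open>Indecomposability in the cone of positive definite functions rather than extremality
  among states: this is directly applicable to the two coefficient functions that an invariant
  subspace produces.\<close>

definition pure_pd :: "('a, 'b) monoid_scheme \<Rightarrow> ('a \<Rightarrow> complex) \<Rightarrow> bool" where
  "pure_pd G \<psi> \<longleftrightarrow> pd_function G \<psi> \<and> \<psi> \<one>\<^bsub>G\<^esub> = 1 \<and>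
    (\<forall>\<psi>1 \<psi>2. pd_function G \<psi>1 \<and> pd_function G \<psi>2 \<and> (\<forall>x. \<psi> x = \<psi>1 x + \<psi>2 x)
      \<longrightarrow> (\<exists>c. \<forall>x. \<psi>1 x = c * \<psi> x))"

locale group_pd = group G for G :: "('a, 'b) monoid_scheme" (structure) +
  fixes \<psi> :: "'a \<Rightarrow> complex"
  assumes pd: "pd_function G \<psi>"
begin

sublocale pd_kernel "carrier G" "\<lambda>x y. \<psi> (inv x \<otimes> y)"
proof
  fix x y assume xy: "x \<in> carrier G" "y \<in> carrier G"
  then have "inv y \<otimes> x = inv (inv x \<otimes> y)" by (simp add: inv_mult_group)
  then show "\<psi> (inv y \<otimes> x) = cnj (\<psi> (inv x \<otimes> y))"
    using pd xy by (simp add: pd_function_def)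
qed (use pd in \<open>auto simp: pd_function_def\<close>)

lemma rker_one: "rker \<one> = \<psi>"
  using pd by (auto simp: rker_def pd_function_def)

text \<open>Evaluation at \<open>x\<close> is bounded and \<open>\<psi>\<close> is the kernel
  function at the identity. The bound makes the state space compact, and a positive definite
  function vanishes as soon as its value at the identity does.\<close>

lemma psi_bound: "cmod (\<psi> x) \<le> Re (\<psi> \<one>)"
proof (cases "x \<in> carrier G")
  case True
  have one: "0 \<le> Re (\<psi> \<one>)" using k_pos [of "{\<one>}" "\<lambda>_. 1"] by (simp add: kernel_form_def)
  have "rnorm \<psi> = Re (\<psi> \<one>)"
    using reproducing [OF rker_in [OF one_closed] one_closed] rnorm_rcinner [OF rker_in [OF one_closed]]
    by (simp add: rker_one)
  then have "(cmod (\<psi> x))\<^sup>2 \<le> (Re (\<psi> \<one>))\<^sup>2"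
    using rspace_pointwise [OF rker_in [OF one_closed] True] True
    by (simp add: rker_one power2_eq_square)
  then show ?thesis using one by (simp add: abs_le_square_iff [symmetric])
next
  case False
  then show ?thesis
    using pd k_pos [of "{\<one>}" "\<lambda>_. 1"] by (simp add: pd_function_def kernel_form_def)
qed

section \<open>The GNS representation on the kernel space\<close>

definition ltrans :: "'a \<Rightarrow> ('a \<Rightarrow> complex) \<Rightarrow> 'a \<Rightarrow> complex" where
  "ltrans g f = (\<lambda>y. if y \<in> carrier G then f (inv g \<otimes> y) else 0)"

lemma rgap_ltrans:
  assumes g: "g \<in> carrier G" and A: "A \<in> finsubs"
  shows "rgap (ltrans g f) A c = rgap f ((\<otimes>) (inv g) ` A) (\<lambda>y. c (g \<otimes> y))"
proof -
  have AG: "A \<subseteq> carrier G" using A by (simp add: finsubs_def)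
  have inj: "inj_on ((\<otimes>) (inv g)) A"
    using AG g by (auto intro!: inj_onI simp: subset_iff)
  have gg: "g \<otimes> (inv g \<otimes> x) = x" if "x \<in> carrier G" for x
    using g that by (simp flip: m_assoc)
  have kk: "inv (inv g \<otimes> x) \<otimes> (inv g \<otimes> y) = inv x \<otimes> y" if "x \<in> A" "y \<in> A" for x y
  proof -
    have "inv (inv g \<otimes> x) = inv x \<otimes> g" using g that AG by (simp add: inv_mult_group subset_iff)
    then show ?thesis using g that AG gg by (simp add: m_assoc subset_iff)
  qed
  have 1: "(\<Sum>x\<in>A. cnj (c x) * ltrans g f x) = (\<Sum>x\<in>(\<otimes>) (inv g) ` A. cnj (c (g \<otimes> x)) * f x)"
    unfolding sum.reindex [OF inj] using AG
    by (intro sum.cong) (auto simp: ltrans_def gg subset_iff)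
  have 2: "kernel_form (\<lambda>x y. \<psi> (inv x \<otimes> y)) A c
      = kernel_form (\<lambda>x y. \<psi> (inv x \<otimes> y)) ((\<otimes>) (inv g) ` A) (\<lambda>y. c (g \<otimes> y))"
    unfolding kernel_form_def sum.reindex [OF inj] o_def using AG
    by (intro sum.cong refl) (auto simp: gg kk subset_iff)
  show ?thesis unfolding rgap_def 1 2 ..
qed

lemma ltrans_ltrans:
  "\<lbrakk>g \<in> carrier G; h \<in> carrier G\<rbrakk> \<Longrightarrow> ltrans g (ltrans h f) = ltrans (g \<otimes> h) f"
  by (rule ext) (simp add: ltrans_def inv_mult_group m_assoc)

lemma ltrans_one: "f \<in> rspace \<Longrightarrow> ltrans \<one> f = f"
  by (rule ext) (simp add: ltrans_def rspace_def)

lemma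
  assumes g: "g \<in> carrier G" and f: "f \<in> rspace"
  shows ltrans_in: "ltrans g f \<in> rspace" and rnorm_ltrans: "rnorm (ltrans g f) = rnorm f"
proof -
  have bd: "rbounded (ltrans g f) (rnorm f)" if "g \<in> carrier G" "f \<in> rspace" for g f
    unfolding rbounded_def
  proof (intro ballI allI)
    fix A c assume A: "A \<in> finsubs"
    then have "(\<otimes>) (inv g) ` A \<in> finsubs" using that by (auto simp: finsubs_def)
    then show "rgap (ltrans g f) A c \<le> rnorm f"
      unfolding rgap_ltrans [OF that(1) A] by (rule rnorm_upper [OF that(2)])
  qed
  have inn: "ltrans g f \<in> rspace" if "g \<in> carrier G" "f \<in> rspace" for g f
    using bd [OF that] by (auto simp: rspace_def ltrans_def)
  show "ltrans g f \<in> rspace" by (rule inn [OF g f])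
  have "ltrans (inv g) (ltrans g f) = f" using g f by (simp add: ltrans_ltrans ltrans_one)
  then have "rnorm f \<le> rnorm (ltrans g f)"
    using rnorm_least [OF bd [OF inv_closed [OF g] inn [OF g f]]] by simp
  then show "rnorm (ltrans g f) = rnorm f" using rnorm_least [OF bd [OF g f]] by simp
qed

lemma ltrans_add: "ltrans g (\<lambda>x. f x + h x) = (\<lambda>x. ltrans g f x + ltrans g h x)"
  and ltrans_diff: "ltrans g (\<lambda>x. f x - h x) = (\<lambda>x. ltrans g f x - ltrans g h x)"
  and ltrans_scale: "ltrans g (\<lambda>x. t * f x) = (\<lambda>x. t * ltrans g f x)"
  by (auto simp: ltrans_def)

lemma rcinner_ltrans:
  assumes g: "g \<in> carrier G" and f: "f \<in> rspace" and h: "h \<in> rspace"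
  shows "rcinner (ltrans g f) (ltrans g h) = rcinner f h"
proof -
  have "rinner (ltrans g f) (ltrans g h) = rinner f h" if h: "h \<in> rspace" for h
    using rnorm_ltrans [OF g rspace_add [OF f h]] rnorm_ltrans [OF g rspace_diff [OF f h]]
    by (simp add: rinner_def ltrans_add ltrans_diff)
  from this [OF h] this [OF rspace_scale [OF h, of \<i>]] show ?thesis
    by (simp add: rcinner_def ltrans_scale)
qed

lemma rcinner_ltrans_left:
  assumes g: "g \<in> carrier G" and f: "f \<in> rspace" and h: "h \<in> rspace"
  shows "rcinner (ltrans g f) h = rcinner f (ltrans (inv g) h)"
proof -
  have "h = ltrans g (ltrans (inv g) h)" using g h by (simp add: ltrans_ltrans ltrans_one)
  then show ?thesis using rcinner_ltrans [OF g f ltrans_in [OF inv_closed [OF g] h]] by simp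
qed

lemma ltrans_psi: "g \<in> carrier G \<Longrightarrow> ltrans g \<psi> = rker g"
  by (auto simp: ltrans_def rker_def)

text \<open>Left translation leaves the kernel \<open>\<psi> (inv x \<otimes> y)\<close> invariant,
  hence acts unitarily. The cyclic vector is \<open>\<psi>\<close> itself, the kernel function at
  the identity. The restriction provides the extensionality that \<open>Bij\<close> demands.\<close>

definition gns :: "'a \<Rightarrow> ('a \<Rightarrow> complex) \<Rightarrow> 'a \<Rightarrow> complex" where
  "gns g = restrict (ltrans g) rspace"

lemma unitary_representation_gns: "unitary_representation G rkhs gns"
proof -
  have bij: "bij_betw (gns g) rspace rspace" if g: "g \<in> carrier G" for g
  proof (rule bij_betw_byWitness [where f' = "gns (inv g)"])
    show "\<forall>f\<in>rspace. gns (inv g) (gns g f) = f" "\<forall>f\<in>rspace. gns g (gns (inv g) f) = f"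
      using g by (auto simp: gns_def ltrans_in ltrans_ltrans ltrans_one)
  qed (use g in \<open>auto simp: gns_def ltrans_in\<close>)
  have car: "gns g \<in> carrier (unitary_group rkhs)" if g: "g \<in> carrier G" for g
    using bij [OF g] g
    by (simp add: unitary_group_def Bij_def)
      (simp add: gns_def ltrans_add ltrans_scale rcinner_ltrans rspace_add rspace_scale)
  have "gns \<in> hom G (unitary_group rkhs)"
  proof (rule homI)
    fix g h assume gh: "g \<in> carrier G" "h \<in> carrier G"
    have "gns (g \<otimes> h) = compose rspace (gns g) (gns h)"
      using gh by (intro ext) (simp add: gns_def compose_def ltrans_in ltrans_ltrans)
    then show "gns (g \<otimes> h) = gns g \<otimes>\<^bsub>unitary_group rkhs\<^esub> gns h"
      using car [OF gh(1)] car [OF gh(2)] by (simp add: unitary_group_def BijGroup_def)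
  qed (rule car)
  then show ?thesis
    by (intro unitary_representation.intro unitary_representation_axioms.intro
        is_group RK.complex_hilbert_space_axioms)
qed

lemma pd_function_coefficient:
  assumes w: "w \<in> rspace"
  shows "pd_function G (\<lambda>g. if g \<in> carrier G then rcinner w (ltrans g w) else 0)" (is "pd_function G ?\<phi>")
  unfolding pd_function_def
proof (intro conjI allI impI ballI)
  fix x assume x: "x \<in> carrier G"
  have "rcinner w (ltrans (inv x) w) = rcinner (ltrans x w) w"
    using rcinner_ltrans_left [OF x w w] by simp
  also have "\<dots> = cnj (rcinner w (ltrans x w))"
    using RK.cinner_commute [of w "ltrans x w"] x w by (simp add: ltrans_in)
  finally show "?\<phi> (inv x) = cnj (?\<phi> x)" using x by simp
next
  fix A c assume A: "finite A \<and> A \<subseteq> carrier G"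
  have "?\<phi> (inv x \<otimes> y) = rcinner (ltrans x w) (ltrans y w)" if "x \<in> A" "y \<in> A" for x y
  proof -
    have xy: "x \<in> carrier G" "y \<in> carrier G" using A that by auto
    then have "rcinner (ltrans x w) (ltrans y w) = rcinner w (ltrans (inv x) (ltrans y w))"
      using w by (simp add: rcinner_ltrans_left ltrans_in)
    then show ?thesis using xy by (simp add: ltrans_ltrans)
  qed
  then have "kernel_form (\<lambda>x y. ?\<phi> (inv x \<otimes> y)) A c
      = kernel_form (\<lambda>x y. rcinner (ltrans x w) (ltrans y w)) A c"
    unfolding kernel_form_def by (intro sum.cong refl) simp
  moreover have "0 \<le> Re (kernel_form (\<lambda>x y. rcinner (ltrans x w) (ltrans y w)) A c)"
    using A w by (intro kernel_form_rcinner) (auto simp: ltrans_in)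
  ultimately show "0 \<le> Re (kernel_form (\<lambda>x y. ?\<phi> (inv x \<otimes> y)) A c)" by simp
qed simp

text \<open>An invariant \<open>W\<close> splits \<open>\<psi>\<close> orthogonally into
  \<open>w\<close> in \<open>W\<close> and \<open>z\<close>, whose coefficient functions are
  positive definite and add up to \<open>\<psi>\<close>. Purity gives \<open>w = c \<psi>\<close>:
  if \<open>c = 0\<close>, then \<open>W\<close> is orthogonal to the cyclic vector and is zero;
  otherwise it contains that vector and is everything.\<close>

lemma irreducible_gns:
  assumes pure: "pure_pd G \<psi>"
  shows "irreducible_unitary_representation G rkhs gns"
proof (intro irreducible_unitary_representation.intro [OF unitary_representation_gns]
    irreducible_unitary_representation_axioms.intro)
  have psi_in: "\<psi> \<in> rspace" using rker_in [OF one_closed] by (simp add: rker_one)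
  have "\<psi> \<one> = 1" using pure by (simp add: pure_pd_def)
  then show "carrier rkhs \<noteq> {\<zero>\<^bsub>rkhs\<^esub>}" using psi_in by (auto simp: fun_eq_iff dest!: equalityD1)
  fix W assume W: "submodule W complex_field rkhs" "closedin RK.mtopology W"
    and "\<And>g. g \<in> carrier G \<Longrightarrow> gns g ` W \<subseteq> W"
  note WE = RK.submoduleE [OF W(1)]
  have Wr: "u \<in> rspace" if "u \<in> W" for u using WE(1) that by auto
  then have inv: "ltrans g u \<in> W" if "g \<in> carrier G" "u \<in> W" for g u
    using \<open>\<And>g. g \<in> carrier G \<Longrightarrow> gns g ` W \<subseteq> W\<close> [OF that(1)] that by (force simp: gns_def)
  obtain w where w: "w \<in> W" and perp: "\<And>u. u \<in> W \<Longrightarrow> rcinner (\<lambda>x. \<psi> x - w x) u = 0"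
    using rkhs_projection [OF W psi_in] by blast
  define z where "z = (\<lambda>x. \<psi> x - w x)"
  have z: "z \<in> rspace" unfolding z_def by (intro rspace_diff psi_in Wr w)
  have ltr: "ltrans g \<psi> = (\<lambda>x. ltrans g w x + ltrans g z x)" for g
    by (auto simp: ltrans_def z_def)
  have zW: "rcinner z u = 0" "rcinner u z = 0" if "u \<in> W" for u
    using perp [OF that] RK.cinner_commute [of z u] z Wr [OF that] by (auto simp: z_def)
  define \<phi> where "\<phi> = (\<lambda>w g. if g \<in> carrier G then rcinner w (ltrans g w) else 0)"
  \<comment> \<open>The value of \<open>w\<close> at \<open>g\<close> is its inner product with the
    translate of \<open>\<psi>\<close>; the \<open>z\<close> part contributes nothing since
    \<open>W\<close> is invariant. So the coefficient function of \<open>w\<close> is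
    \<open>w\<close> itself.\<close>
  have wpsi: "rcinner w (ltrans g w) = w g" if g: "g \<in> carrier G" for g
  proof -
    have "w g = rcinner w (ltrans g \<psi>)" using reproducing [OF Wr [OF w] g] g by (simp add: ltrans_psi)
    also have "\<dots> = rcinner w (ltrans g w) + rcinner w (ltrans g z)"
      using RK.cinner_add_right [of "ltrans g w" "ltrans g z" w] g z w
      by (simp add: ltr ltrans_in Wr)
    also have "rcinner w (ltrans g z) = rcinner (ltrans (inv g) w) z"
      using rcinner_ltrans_left [of "inv g" w z] g w z by (simp add: Wr)
    finally show ?thesis using zW inv [of "inv g" w] g w by simp
  qed
  have zpsi: "rcinner z (ltrans g z) = z g" if g: "g \<in> carrier G" for g
  proof -
    have "z g = rcinner z (ltrans g \<psi>)" using reproducing [OF z g] g by (simp add: ltrans_psi)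
    also have "\<dots> = rcinner z (ltrans g w) + rcinner z (ltrans g z)"
      using RK.cinner_add_right [of "ltrans g w" "ltrans g z" z] g z w
      by (simp add: ltr ltrans_in Wr)
    finally show ?thesis using zW inv g w by simp
  qed
  have out: "\<psi> x = 0" "w x = 0" "z x = 0" if "x \<notin> carrier G" for x
    using that psi_in Wr [OF w] z by (auto simp: rspace_def)
  have sum: "\<psi> x = w x + z x" for x by (simp add: z_def)
  have "\<psi> x = \<phi> w x + \<phi> z x" for x
  proof (cases "x \<in> carrier G")
    case True
    then show ?thesis using sum [of x] unfolding \<phi>_def by (simp only: wpsi zpsi if_True)
  next
    case False
    then show ?thesis using out(1) [OF False] unfolding \<phi>_def by simp
  qed
  moreover have "pd_function G (\<phi> w)" "pd_function G (\<phi> z)"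
    unfolding \<phi>_def by (intro pd_function_coefficient Wr w z)+
  ultimately obtain c where c: "\<And>x. \<phi> w x = c * \<psi> x"
    using pure unfolding pure_pd_def by blast
  have wc: "w x = c * \<psi> x" for x
    using c [of x] by (cases "x \<in> carrier G") (auto simp: \<phi>_def wpsi out)
  show "W = {\<zero>\<^bsub>rkhs\<^esub>} \<or> W = carrier rkhs"
  proof (cases "c = 0")
    case True
    then have zpsi: "z = \<psi>" by (auto simp: z_def wc)
    have "u = (\<lambda>x. 0)" if u: "u \<in> W" for u
    proof
      fix g show "u g = 0"
      proof (cases "g \<in> carrier G")
        case g: True
        have "u g = rcinner u (ltrans g \<psi>)" using reproducing [OF Wr [OF u] g] g by (simp add: ltrans_psi)
        also have "\<dots> = rcinner (ltrans (inv g) u) \<psi>"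
          using rcinner_ltrans_left [of "inv g" u \<psi>] g u psi_in by (simp add: Wr)
        finally show ?thesis using zW inv [of "inv g" u] g u zpsi by simp
      next
        case False then show ?thesis using Wr [OF u] by (simp add: rspace_def)
      qed
    qed
    moreover have "(\<lambda>x. 0) \<in> W" using WE(4) [OF _ w, of 0] by simp
    ultimately have "W = {\<lambda>x. 0}" by blast
    then show ?thesis by simp
  next
    case False
    have "(\<lambda>x. (1/c) * w x) \<in> W" using WE(4) [OF _ w, of "1/c"] by simp
    moreover have "(\<lambda>x. (1/c) * w x) = \<psi>" using False by (auto simp: wc)
    ultimately have psiW: "\<psi> \<in> W" by simp
    \<comment> \<open>The component of \<open>f\<close> orthogonal to \<open>W\<close> is orthogonal
      to all translates of \<open>\<psi>\<close>, and these inner products are its values.\<close>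
    have "f \<in> W" if f: "f \<in> rspace" for f
    proof -
      obtain u where u: "u \<in> W" "\<And>y. y \<in> W \<Longrightarrow> rcinner (\<lambda>x. f x - u x) y = 0"
        using rkhs_projection [OF W f] by blast
      have d: "(\<lambda>x. f x - u x) \<in> rspace" by (intro rspace_diff f Wr u)
      have "f g - u g = 0" for g
      proof (cases "g \<in> carrier G")
        case True
        then show ?thesis
          using reproducing [OF d True] u(2) [OF inv [OF True psiW]] by (simp add: ltrans_psi)
      next
        case False then show ?thesis using d by (simp add: rspace_def)
      qed
      then have "f = u" by auto
      then show ?thesis using u by simp
    qed
    then show ?thesis using Wr by auto
  qed
qed

lemma gns_coefficient: "g \<in> carrier G \<Longrightarrow> rcinner \<psi> (gns g \<psi>) = \<psi> g"
  using reproducing [OF rker_in [OF one_closed], of g] rker_in [OF one_closed]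
  by (simp add: rker_one gns_def ltrans_psi)

end

section \<open>Compactness of the state space and existence of pure states\<close>

definition pd_states :: "('a, 'b) monoid_scheme \<Rightarrow> ('a \<Rightarrow> complex) set" where
  "pd_states G = {\<psi>. pd_function G \<psi> \<and> \<psi> \<one>\<^bsub>G\<^esub> = 1}"

lemma continuous_on_coordinate: "continuous_on S (\<lambda>\<psi>::'a \<Rightarrow> complex. \<psi> x)"
  by (rule continuous_on_subset [OF continuous_on_product_coordinates]) simp

text \<open>All defining conditions are closed under pointwise convergence, and
  \<open>psi_bound\<close> places the states in a product of closed unit discs, which is compact by
  Tychonoff.\<close>

lemma
  assumes "group G"
  shows compact_pd_states: "compact (pd_states G)" and closed_pd_states: "closed (pd_states G)"
proof -
  interpret group G by fact
  show closed: "closed (pd_states G)"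
    unfolding pd_states_def pd_function_def kernel_form_def Ball_def
    by (intro closed_Collect_conj closed_Collect_all closed_Collect_imp open_Collect_const
        closed_Collect_eq closed_Collect_le continuous_intros continuous_on_coordinate)
  have "compact (\<Pi>\<^sub>E x\<in>(UNIV :: 'a set). cball (0 :: complex) 1)"
    using compactin_PiE [of "\<lambda>_. euclidean" "UNIV :: 'a set" "\<lambda>_. cball (0 :: complex) 1"]
    by (simp add: euclidean_product_topology)
  moreover have "pd_states G \<subseteq> (\<Pi>\<^sub>E x\<in>UNIV. cball 0 1)"
  proof
    fix \<psi> assume \<psi>: "\<psi> \<in> pd_states G"
    then interpret group_pd G \<psi> by unfold_locales (simp add: pd_states_def)
    show "\<psi> \<in> (\<Pi>\<^sub>E x\<in>UNIV. cball 0 1)"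
      using psi_bound \<psi> by (auto simp: pd_states_def)
  qed
  ultimately show "compact (pd_states G)" using closed by (metis compact_Int_closed inf.absorb_iff2)
qed

lemma kernel_form_scale: "kernel_form (\<lambda>x y. t * k x y) A c = t * kernel_form k A c"
  unfolding kernel_form_def sum_distrib_left by (intro sum.cong refl) (simp add: algebra_simps)

lemma pd_function_scale:
  assumes "pd_function G \<psi>" "0 \<le> t"
  shows "pd_function G (\<lambda>x. of_real t * \<psi> x)"
  using assms by (auto simp: pd_function_def kernel_form_scale)

definition argmin_set :: "('x \<Rightarrow> real) \<Rightarrow> 'x set \<Rightarrow> 'x set" where
  "argmin_set F S = {s \<in> S. \<forall>t\<in>S. F s \<le> F t}"

lemma compact_argmin_set:
  fixes F :: "'x::topological_space \<Rightarrow> real"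
  assumes S: "compact S" "S \<noteq> {}" "closed S" and F: "continuous_on UNIV F"
  shows "compact (argmin_set F S)" "argmin_set F S \<noteq> {}" "closed (argmin_set F S)"
proof -
  obtain m where m: "m \<in> S" "\<forall>t\<in>S. F m \<le> F t"
    using continuous_attains_inf [OF S(1,2)] F continuous_on_subset by (metis top_greatest)
  then show "argmin_set F S \<noteq> {}" by (auto simp: argmin_set_def)
  have "argmin_set F S = S \<inter> {s. F s \<le> F m}"
    using m by (auto simp: argmin_set_def intro: order_trans)
  moreover have "closed {s. F s \<le> F m}"
    by (intro closed_Collect_le continuous_on_const F)
  ultimately show "compact (argmin_set F S)" "closed (argmin_set F S)"
    using S by (simp_all add: compact_Int_closed closed_Int)
qed

text \<open>Lexicographic minimisation along a sequence of functionals. For affine functionals each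
  set is a face of the preceding one, so if the functionals separate points, the intersection is a
  single extreme point. Countability of the group provides such a sequence.\<close>

primrec min_seq :: "(nat \<Rightarrow> 'x \<Rightarrow> real) \<Rightarrow> 'x set \<Rightarrow> nat \<Rightarrow> 'x set" where
  "min_seq F S 0 = S"
| "min_seq F S (Suc n) = argmin_set (F n) (min_seq F S n)"

lemma compact_min_seq:
  fixes F :: "nat \<Rightarrow> 'x::topological_space \<Rightarrow> real"
  assumes S: "compact S" "S \<noteq> {}" "closed S" and F: "\<And>n. continuous_on UNIV (F n)"
  shows "compact (min_seq F S n) \<and> min_seq F S n \<noteq> {} \<and> closed (min_seq F S n)"
proof (induction n)
  case (Suc n)
  then show ?case using compact_argmin_set [of "min_seq F S n", OF _ _ _ F] by simp
qed (use S in simp)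

lemma min_seq_mono: "m \<le> n \<Longrightarrow> min_seq F S n \<subseteq> min_seq F S m"
  by (induction n) (auto simp: le_Suc_eq argmin_set_def)

lemma Inter_min_seq:
  fixes F :: "nat \<Rightarrow> 'x::topological_space \<Rightarrow> real"
  assumes S: "compact S" "S \<noteq> {}" "closed S" and F: "\<And>n. continuous_on UNIV (F n)"
  shows "\<exists>s. \<forall>n. s \<in> min_seq F S n"
proof -
  have "S \<inter> (\<Inter>n\<in>UNIV. min_seq F S n) \<noteq> {}"
  proof (rule compact_imp_fip_image [OF S(1)])
    show "closed (min_seq F S n)" for n
      using compact_min_seq [where F = F, OF S F] by blast
    fix I :: "nat set" assume I: "finite I"
    have "min_seq F S (Max (insert 0 I)) \<subseteq> S \<inter> (\<Inter>n\<in>I. min_seq F S n)"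
    proof (intro Int_greatest INT_greatest)
      show "min_seq F S (Max (insert 0 I)) \<subseteq> S"
        using min_seq_mono [of 0 _ F S] by simp
      show "min_seq F S (Max (insert 0 I)) \<subseteq> min_seq F S n" if "n \<in> I" for n
        using I that by (intro min_seq_mono Max_ge) auto
    qed
    then show "S \<inter> (\<Inter>n\<in>I. min_seq F S n) \<noteq> {}"
      using compact_min_seq [where F = F, OF S F, of "Max (insert 0 I)"] by blast
  qed
  then show ?thesis by auto
qed

text \<open>Minimising first a given functional and then the real and imaginary parts of all coordinates
  yields an extreme point of the state space at which the given functional is minimal.\<close>

lemma exists_pure_pd:
  fixes G :: "('a, 'b) monoid_scheme" (structure)
  assumes G: "group G" and cnt: "countable (carrier G)"
    and \<psi>0: "\<psi>0 \<in> pd_states G"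
    and T: "continuous_on UNIV T" "\<And>s \<alpha> \<beta>. T (\<lambda>x. of_real s * \<alpha> x + of_real (1 - s) * \<beta> x) = s * T \<alpha> + (1 - s) * T \<beta>"
  shows "\<exists>\<psi>. pure_pd G \<psi> \<and> T \<psi> \<le> T \<psi>0"
proof -
  interpret group G by fact
  define e where "e = from_nat_into (carrier G)"
  have e: "range e = carrier G"
    unfolding e_def using cnt by (intro range_from_nat_into) auto
  \<comment> \<open>Index 0 is the given functional; indices \<open>Suc (2 * m)\<close> and
    \<open>Suc (Suc (2 * m))\<close> are the real and the imaginary part at
    \<open>e m\<close>.\<close>
  define F where "F = (\<lambda>n \<psi>. case n of 0 \<Rightarrow> T \<psi>
    | Suc m \<Rightarrow> if even m then Re (\<psi> (e (m div 2))) else Im (\<psi> (e (m div 2))))"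
  have F_cont: "continuous_on UNIV (F n)" for n
  proof (cases n)
    case 0
    then show ?thesis using T(1) by (simp add: F_def)
  next
    case (Suc m)
    then show ?thesis
      by (cases "even m") (auto simp: F_def intro!: continuous_intros continuous_on_coordinate)
  qed
  have F_aff: "F n (\<lambda>x. of_real s * \<alpha> x + of_real (1 - s) * \<beta> x) = s * F n \<alpha> + (1 - s) * F n \<beta>" for n s \<alpha> \<beta>
  proof (cases n)
    case 0
    then show ?thesis using T(2) [of s \<alpha> \<beta>] by (simp add: F_def)
  next
    case (Suc m)
    then show ?thesis by (cases "even m") (simp_all add: F_def del: of_real_diff)
  qed
  let ?K = "pd_states G"
  have ne: "?K \<noteq> {}" using \<psi>0 by auto
  obtain \<psi> where \<psi>: "\<And>n. \<psi> \<in> min_seq F ?K n"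
    using Inter_min_seq [where F = F, OF compact_pd_states [OF G] ne closed_pd_states [OF G] F_cont] by blast
  have \<psi>K: "\<psi> \<in> ?K" using \<psi> [of 0] by simp
  have "T \<psi> \<le> T \<psi>0" using \<psi> [of 1] \<psi>0 by (simp add: argmin_set_def F_def)
  \<comment> \<open>If \<open>\<psi>\<close> lies properly between two states, both stay in every
    minimising set, since a proper mean of values that are at least the minimum attains it only if
    both do. So all coordinates of \<open>\<alpha>\<close> agree with those of
    \<open>\<psi>\<close>.\<close>
  have extreme: "\<alpha> = \<psi>"
    if \<alpha>: "\<alpha> \<in> ?K" and \<beta>: "\<beta> \<in> ?K" and s: "0 < s" "s < 1"
      and eq: "\<psi> = (\<lambda>x. of_real s * \<alpha> x + of_real (1 - s) * \<beta> x)" for \<alpha> \<beta> s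
  proof -
    have F\<psi>: "F n \<psi> = s * F n \<alpha> + (1 - s) * F n \<beta>" for n
      using F_aff [of n s \<alpha> \<beta>] eq by simp
    have conv: "a = c \<and> b = c" if "c = s * a + (1 - s) * b" "c \<le> a" "c \<le> b" for a b c
    proof -
      have "s * (a - c) + (1 - s) * (b - c) = 0" using that(1) by (simp add: algebra_simps)
      moreover have "0 \<le> s * (a - c)" "0 \<le> (1 - s) * (b - c)" using that s by auto
      ultimately have "s * (a - c) = 0" "(1 - s) * (b - c) = 0" by linarith+
      then show ?thesis using s by simp
    qed
    have ind: "\<alpha> \<in> min_seq F ?K n \<and> \<beta> \<in> min_seq F ?K n" for n
    proof (induction n)
      case 0 then show ?case using \<alpha> \<beta> by simp
    next
      case (Suc n)
      have min: "\<And>t. t \<in> min_seq F ?K n \<Longrightarrow> F n \<psi> \<le> F n t"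
        using \<psi> [of "Suc n"] by (simp add: argmin_set_def)
      have "F n \<alpha> = F n \<psi> \<and> F n \<beta> = F n \<psi>"
        using conv [OF F\<psi>] min Suc.IH by blast
      then show ?case using Suc.IH min by (simp add: argmin_set_def)
    qed
    have "F n \<alpha> = F n \<psi>" for n
      using ind [of "Suc n"] \<psi> [of n] \<psi> [of "Suc n"] ind [of n] by (auto simp: argmin_set_def intro: antisym)
    note Feq = this
    have "\<alpha> (e m) = \<psi> (e m)" for m
      using Feq [of "Suc (2 * m)"] Feq [of "Suc (Suc (2 * m))"] by (simp add: F_def complex_eq_iff)
    then have "\<alpha> x = \<psi> x" if "x \<in> carrier G" for x using e that by (metis rangeE)
    then show "\<alpha> = \<psi>" using \<alpha> \<psi>K by (intro ext) (metis (mono_tags) mem_Collect_eq pd_function_def pd_states_def)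
  qed
  have "pure_pd G \<psi>"
    unfolding pure_pd_def
  proof (intro conjI allI impI)
    show "pd_function G \<psi>" "\<psi> \<one>\<^bsub>G\<^esub> = 1" using \<psi>K by (auto simp: pd_states_def)
    fix \<psi>1 \<psi>2 assume "pd_function G \<psi>1 \<and> pd_function G \<psi>2 \<and> (\<forall>x. \<psi> x = \<psi>1 x + \<psi>2 x)"
    then have p1: "pd_function G \<psi>1" and p2: "pd_function G \<psi>2" and sum: "\<And>x. \<psi> x = \<psi>1 x + \<psi>2 x"
      by auto
    interpret P1: group_pd G \<psi>1 by unfold_locales (rule p1)
    interpret P2: group_pd G \<psi>2 by unfold_locales (rule p2)
    \<comment> \<open>The weight of the first summand. For \<open>0 < s < 1\<close> both summands
      are rescaled to states and extremality applies; for the two end values one summand vanishes by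
      \<open>psi_bound\<close>.\<close>
    define s where "s = Re (\<psi>1 \<one>)"
    have one: "\<psi>1 \<one> = of_real s" "\<psi>2 \<one> = of_real (1 - s)" "0 \<le> s" "s \<le> 1"
    proof -
      have "\<psi>1 \<one> = cnj (\<psi>1 \<one>)" using p1 inv_one one_closed unfolding pd_function_def by metis
      then show 1: "\<psi>1 \<one> = of_real s" by (simp add: s_def complex_eq_iff)
      show 2: "\<psi>2 \<one> = of_real (1 - s)" using sum [of \<one>] 1 \<psi>K by (simp add: pd_states_def eq_diff_eq add.commute)
      have "0 \<le> Re (\<psi>1 \<one>)" "0 \<le> Re (\<psi>2 \<one>)"
        using P1.psi_bound [of \<one>] P2.psi_bound [of \<one>] by (auto intro: order_trans [OF norm_ge_zero])
      then show "0 \<le> s" "s \<le> 1" using 2 by (auto simp: s_def)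
    qed
    consider "s = 0" | "s = 1" | "0 < s" "s < 1" using one by linarith
    then show "\<exists>c. \<forall>x. \<psi>1 x = c * \<psi> x"
    proof cases
      case 1
      then have "\<psi>1 x = 0" for x using P1.psi_bound [of x] one by simp
      then show ?thesis by (intro exI [of _ 0]) simp
    next
      case 2
      then have "\<psi>2 x = 0" for x using P2.psi_bound [of x] one by simp
      then show ?thesis using sum by (intro exI [of _ 1]) simp
    next
      case 3
      define \<alpha> where "\<alpha> = (\<lambda>x. of_real (1 / s) * \<psi>1 x)"
      define \<beta> where "\<beta> = (\<lambda>x. of_real (1 / (1 - s)) * \<psi>2 x)"
      have "pd_function G \<alpha>" "pd_function G \<beta>"
        unfolding \<alpha>_def \<beta>_def by (intro pd_function_scale p1 p2; use 3 in simp)+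
      moreover have "\<alpha> \<one> = 1"
        unfolding \<alpha>_def one of_real_mult [symmetric] using 3 by simp
      moreover have "\<beta> \<one> = 1"
        unfolding \<beta>_def one of_real_mult [symmetric] using 3 by simp
      ultimately have \<alpha>\<beta>: "\<alpha> \<in> ?K" "\<beta> \<in> ?K" by (auto simp: pd_states_def)
      have "of_real s * \<alpha> x = \<psi>1 x" "of_real (1 - s) * \<beta> x = \<psi>2 x" for x
        unfolding \<alpha>_def \<beta>_def mult.assoc [symmetric] of_real_mult [symmetric] using 3 by simp_all
      then have "\<psi> = (\<lambda>x. of_real s * \<alpha> x + of_real (1 - s) * \<beta> x)"
        by (intro ext) (simp only: sum)
      from extreme [OF \<alpha>\<beta> 3 this] have "\<alpha> x = \<psi> x" for x by simp
      then have "\<psi>1 x = of_real s * \<psi> x" for x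
        using \<open>\<And>x. of_real s * \<alpha> x = \<psi>1 x\<close> [of x] by simp
      then show ?thesis by blast
    qed
  qed
  then show ?thesis using \<open>T \<psi> \<le> T \<psi>0\<close> by blast
qed

section \<open>Blocked families of normal subgroups\<close>

context group
begin

definition normal_closure :: "'a set \<Rightarrow> 'a set" where
  "normal_closure S = \<Inter>{N. N \<lhd> G \<and> S \<subseteq> N}"

lemma normal_closure_least: "\<lbrakk>N \<lhd> G; S \<subseteq> N\<rbrakk> \<Longrightarrow> normal_closure S \<subseteq> N"
  by (auto simp: normal_closure_def)

lemma normal_closure_superset: "S \<subseteq> normal_closure S"
  by (auto simp: normal_closure_def)

lemma assumes "N \<lhd> G"
  shows normal_subset: "N \<subseteq> carrier G" and normal_one: "\<one> \<in> N"
    and normal_inv: "x \<in> N \<Longrightarrow> inv x \<in> N"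
    and normal_mult: "\<lbrakk>x \<in> N; y \<in> N\<rbrakk> \<Longrightarrow> x \<otimes> y \<in> N"
    and normal_conj: "\<lbrakk>g \<in> carrier G; x \<in> N\<rbrakk> \<Longrightarrow> g \<otimes> x \<otimes> inv g \<in> N"
    and normal_conj': "\<lbrakk>g \<in> carrier G; x \<in> N\<rbrakk> \<Longrightarrow> inv g \<otimes> x \<otimes> g \<in> N"
  using normal.axioms(1) [OF assms] normal.inv_op_closed2 [OF assms] normal.inv_op_closed1 [OF assms]
  by (auto simp: subgroup.subset subgroup.one_closed subgroup.m_inv_closed subgroup.m_closed
      dest: subgroup.subset subgroup.m_inv_closed)

lemma normalI':
  assumes "N \<subseteq> carrier G" "\<one> \<in> N" "\<And>x. x \<in> N \<Longrightarrow> inv x \<in> N"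
    "\<And>x y. \<lbrakk>x \<in> N; y \<in> N\<rbrakk> \<Longrightarrow> x \<otimes> y \<in> N"
    "\<And>g x. \<lbrakk>g \<in> carrier G; x \<in> N\<rbrakk> \<Longrightarrow> g \<otimes> x \<otimes> inv g \<in> N"
  shows "N \<lhd> G"
  unfolding normal_inv_iff using assms by (auto intro!: subgroupI)

lemma normal_closure_normal: assumes "S \<subseteq> carrier G" shows "normal_closure S \<lhd> G"
proof -
  have c: "carrier G \<lhd> G" by (rule normalI') auto
  show ?thesis
    by (rule normalI') (use assms c in \<open>auto simp: normal_closure_def intro: normal_one normal_inv
      normal_mult normal_conj\<close>)
qed

section \<open>Averages over normal subgroups in the group algebra\<close>

definition finsupp :: "('a \<Rightarrow> real) \<Rightarrow> bool" where
  "finsupp f \<longleftrightarrow> finite {x. f x \<noteq> 0} \<and> {x. f x \<noteq> 0} \<subseteq> carrier G"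

text \<open>The condition \<open>coset_null N f\<close> says that \<open>p\<^sub>N f = 0\<close> in the group algebra, so a family of finite normal
  subgroups is blocked if and only if the product of the \<open>1 - p\<^sub>N\<close> vanishes.\<close>

definition coset_null :: "'a set \<Rightarrow> ('a \<Rightarrow> real) \<Rightarrow> bool" where
  "coset_null N f \<longleftrightarrow> (\<forall>g\<in>carrier G. (\<Sum>n\<in>N. f (n \<otimes> g)) = 0)"

definition blocked :: "'a set set \<Rightarrow> bool" where
  "blocked \<N> \<longleftrightarrow> (\<forall>f. finsupp f \<and> (\<forall>N\<in>\<N>. coset_null N f) \<longrightarrow> (\<forall>x. f x = 0))"

definition coset_avg :: "'a set \<Rightarrow> ('a \<Rightarrow> real) \<Rightarrow> 'a \<Rightarrow> real" where
  "coset_avg N f g = (if g \<in> carrier G then (\<Sum>n\<in>N. f (n \<otimes> g)) / real (card N) else 0)"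

lemma finsupp_subset: "\<lbrakk>finite A; A \<subseteq> carrier G; \<And>x. x \<notin> A \<Longrightarrow> f x = 0\<rbrakk> \<Longrightarrow> finsupp f"
  unfolding finsupp_def by (auto intro: finite_subset [of _ A])

lemma finsupp_diff: assumes "finsupp f" "finsupp g" shows "finsupp (\<lambda>x. f x - g x)"
  by (rule finsupp_subset [of "{x. f x \<noteq> 0} \<union> {x. g x \<noteq> 0}"]) (use assms in \<open>auto simp: finsupp_def\<close>)

lemma sum_mult_right_normal:
  assumes N: "N \<lhd> G" and m: "m \<in> N"
  shows "(\<Sum>n\<in>N. F (n \<otimes> m)) = (\<Sum>n\<in>N. F n)" and "(\<Sum>n\<in>N. F (m \<otimes> n)) = (\<Sum>n\<in>N. F n)"
proof -
  have mG: "m \<in> carrier G" and NG: "\<And>n. n \<in> N \<Longrightarrow> n \<in> carrier G" using normal_subset [OF N] m by auto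
  show "(\<Sum>n\<in>N. F (n \<otimes> m)) = (\<Sum>n\<in>N. F n)"
    by (rule sum.reindex_bij_witness [where i = "\<lambda>n. n \<otimes> inv m" and j = "\<lambda>n. n \<otimes> m"])
      (use m mG NG N in \<open>auto simp: m_assoc normal_mult normal_inv\<close>)
  show "(\<Sum>n\<in>N. F (m \<otimes> n)) = (\<Sum>n\<in>N. F n)"
    by (rule sum.reindex_bij_witness [where i = "\<lambda>n. inv m \<otimes> n" and j = "\<lambda>n. m \<otimes> n"])
      (use m mG NG N in \<open>auto simp: m_assoc [symmetric] normal_mult normal_inv\<close>)
qed

lemma sum_inv_normal:
  assumes N: "N \<lhd> G" shows "(\<Sum>n\<in>N. F (inv n)) = (\<Sum>n\<in>N. F n)"
  by (rule sum.reindex_bij_witness [where i = "\<lambda>n. inv n" and j = "\<lambda>n. inv n"])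
    (use N normal_subset [OF N] in \<open>auto simp: normal_inv\<close>)

lemma sum_conj_normal:
  assumes N: "N \<lhd> G" and g: "g \<in> carrier G"
  shows "(\<Sum>n\<in>N. F (g \<otimes> n \<otimes> inv g)) = (\<Sum>n\<in>N. F n)"
proof (rule sum.reindex_bij_witness [where i = "\<lambda>n. inv g \<otimes> n \<otimes> g" and j = "\<lambda>n. g \<otimes> n \<otimes> inv g"])
  fix n assume "n \<in> N"
  then have n: "n \<in> carrier G" using normal_subset [OF N] by auto
  show "inv g \<otimes> (g \<otimes> n \<otimes> inv g) \<otimes> g = n" "g \<otimes> (inv g \<otimes> n \<otimes> g) \<otimes> inv g = n"
    using g n by (simp_all add: m_assoc) (simp_all add: m_assoc [symmetric])
qed (use N g in \<open>auto simp: normal_conj normal_conj'\<close>)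

lemma coset_avg_invariant:
  assumes N: "N \<lhd> G" and m: "m \<in> N" and g: "g \<in> carrier G"
  shows "coset_avg N f (m \<otimes> g) = coset_avg N f g"
proof -
  have "(\<Sum>n\<in>N. f (n \<otimes> (m \<otimes> g))) = (\<Sum>n\<in>N. f ((n \<otimes> m) \<otimes> g))"
    using normal_subset [OF N] m g by (intro sum.cong) (auto simp: m_assoc subset_iff)
  then show ?thesis
    using sum_mult_right_normal(1) [OF N m, of "\<lambda>n. f (n \<otimes> g)"] normal_subset [OF N] m g
    by (auto simp: coset_avg_def)
qed

text \<open>The product of the idempotents \<open>p\<close> and \<open>1 - p\<close> is
  zero.\<close>

lemma coset_null_diff_avg:
  assumes N: "N \<lhd> G" "finite N"
  shows "coset_null N (\<lambda>x. f x - coset_avg N f x)"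
  unfolding coset_null_def
proof
  fix g assume g: "g \<in> carrier G"
  have "card N > 0" using N normal_one by (auto simp: card_gt_0_iff)
  moreover have "(\<Sum>n\<in>N. coset_avg N f (n \<otimes> g)) = (\<Sum>n\<in>N. coset_avg N f g)"
    using g by (intro sum.cong) (auto simp: coset_avg_invariant N)
  ultimately show "(\<Sum>n\<in>N. f (n \<otimes> g) - coset_avg N f (n \<otimes> g)) = 0"
    using g by (simp add: sum_subtractf) (simp add: coset_avg_def)
qed

text \<open>Conjugation by \<open>m\<close> permutes \<open>N\<close>, so the sum of
  \<open>f\<close> over \<open>m N g\<close> is the sum over \<open>N m g\<close>: averages over
  normal subgroups commute.\<close>

lemma coset_null_avg:
  assumes N: "N \<lhd> G" and M: "M \<lhd> G" and f: "coset_null N f"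
  shows "coset_null N (coset_avg M f)"
  unfolding coset_null_def
proof
  fix g assume g: "g \<in> carrier G"
  have NG: "n \<in> carrier G" if "n \<in> N" for n using that normal_subset [OF N] by auto
  have MG: "m \<in> carrier G" if "m \<in> M" for m using that normal_subset [OF M] by auto
  have "(\<Sum>n\<in>N. f (m \<otimes> (n \<otimes> g))) = 0" if m: "m \<in> M" for m
  proof -
    have "(\<Sum>n\<in>N. f (m \<otimes> (n \<otimes> g))) = (\<Sum>n\<in>N. f ((m \<otimes> n \<otimes> inv m) \<otimes> (m \<otimes> g)))"
    proof (intro sum.cong refl)
      fix n assume "n \<in> N"
      then have "m \<otimes> (n \<otimes> g) = (m \<otimes> n \<otimes> inv m) \<otimes> (m \<otimes> g)"
        using NG MG [OF m] g by (simp add: m_assoc) (simp add: m_assoc [symmetric])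
      then show "f (m \<otimes> (n \<otimes> g)) = f ((m \<otimes> n \<otimes> inv m) \<otimes> (m \<otimes> g))" by simp
    qed
    also have "\<dots> = (\<Sum>n\<in>N. f (n \<otimes> (m \<otimes> g)))"
      by (rule sum_conj_normal [OF N MG [OF m], of "\<lambda>n. f (n \<otimes> (m \<otimes> g))"])
    finally show ?thesis using f g MG [OF m] by (simp add: coset_null_def)
  qed
  then have "(\<Sum>m\<in>M. \<Sum>n\<in>N. f (m \<otimes> (n \<otimes> g))) = 0" by simp
  moreover have "(\<Sum>n\<in>N. coset_avg M f (n \<otimes> g)) = (\<Sum>n\<in>N. \<Sum>m\<in>M. f (m \<otimes> (n \<otimes> g))) / real (card M)"
    using g NG by (simp add: coset_avg_def sum_divide_distrib)
  ultimately show "(\<Sum>n\<in>N. coset_avg M f (n \<otimes> g)) = 0"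
    by (simp add: sum.swap [of _ M N])
qed

lemma coset_null_linear:
  assumes "coset_null N f" "coset_null N h" shows "coset_null N (\<lambda>x. f x - h x)"
  using assms by (simp add: coset_null_def sum_subtractf)

text \<open>\<open>N\<close> is a union of cosets of \<open>K\<close>: summing the sums over
  \<open>K\<close> along all of \<open>N\<close> counts every term \<open>card K\<close>
  times.\<close>

lemma coset_null_superset:
  assumes K: "K \<lhd> G" "finite K" and N: "N \<lhd> G" and KN: "K \<subseteq> N" and f: "coset_null K f"
  shows "coset_null N f"
  unfolding coset_null_def
proof
  fix g assume g: "g \<in> carrier G"
  have NG: "n \<in> carrier G" if "n \<in> N" for n using that normal_subset [OF N] by auto
  have "real (card K) * (\<Sum>n\<in>N. f (n \<otimes> g)) = (\<Sum>k\<in>K. \<Sum>n\<in>N. f (n \<otimes> g))" by simp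
  also have "\<dots> = (\<Sum>k\<in>K. \<Sum>n\<in>N. f ((k \<otimes> n) \<otimes> g))"
    using KN by (intro sum.cong refl sum_mult_right_normal(2) [OF N, symmetric]) auto
  also have "\<dots> = (\<Sum>n\<in>N. \<Sum>k\<in>K. f (k \<otimes> (n \<otimes> g)))"
    using g NG KN by (subst sum.swap) (intro sum.cong, auto simp: m_assoc subset_iff)
  also have "\<dots> = 0" using f g NG by (simp add: coset_null_def)
  finally show "(\<Sum>n\<in>N. f (n \<otimes> g)) = 0" using K normal_one [OF K(1)] by auto
qed

lemma finsupp_avg: assumes N: "N \<lhd> G" "finite N" and f: "finsupp f" shows "finsupp (coset_avg N f)"
proof (rule finsupp_subset)
  let ?A = "(\<lambda>(n, x). inv n \<otimes> x) ` (N \<times> {x. f x \<noteq> 0})"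
  show "finite ?A" "?A \<subseteq> carrier G"
    using N f normal_subset [OF N(1)] by (auto simp: finsupp_def subset_iff)
  fix g assume "g \<notin> ?A"
  show "coset_avg N f g = 0"
  proof (cases "g \<in> carrier G")
    case True
    have "f (n \<otimes> g) = 0" if n: "n \<in> N" for n
    proof (rule ccontr)
      assume "f (n \<otimes> g) \<noteq> 0"
      moreover have "g = inv n \<otimes> (n \<otimes> g)"
        using n True normal_subset [OF N(1)] by (auto simp flip: m_assoc)
      ultimately show False using \<open>g \<notin> ?A\<close> n by (force simp: image_iff)
    qed
    then show ?thesis by (simp add: coset_avg_def)
  qed (simp add: coset_avg_def)
qed

section \<open>Linear functionals on the group algebra as witnesses\<close>

definition pairing :: "('a \<Rightarrow> complex) \<Rightarrow> ('a \<Rightarrow> real) \<Rightarrow> complex" where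
  "pairing \<tau> f = (\<Sum>x | f x \<noteq> 0. of_real (f x) * \<tau> x)"

lemma pairing_eq: "\<lbrakk>finite B; \<And>x. x \<notin> B \<Longrightarrow> f x = 0\<rbrakk> \<Longrightarrow> pairing \<tau> f = (\<Sum>x\<in>B. of_real (f x) * \<tau> x)"
  unfolding pairing_def by (rule sum.mono_neutral_left) auto

lemma pairing_diff:
  assumes "finsupp f" "finsupp h"
  shows "pairing \<tau> (\<lambda>x. f x - h x) = pairing \<tau> f - pairing \<tau> h"
proof -
  let ?B = "{x. f x \<noteq> 0} \<union> {x. h x \<noteq> 0}"
  have B: "finite ?B" using assms by (simp add: finsupp_def)
  have "pairing \<tau> f = (\<Sum>x\<in>?B. of_real (f x) * \<tau> x)" "pairing \<tau> h = (\<Sum>x\<in>?B. of_real (h x) * \<tau> x)"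
    "pairing \<tau> (\<lambda>x. f x - h x) = (\<Sum>x\<in>?B. of_real (f x - h x) * \<tau> x)"
    by (rule pairing_eq [OF B]; simp)+
  then show ?thesis by (simp only: of_real_diff left_diff_distrib sum_subtractf)
qed

text \<open>Moving the average from \<open>f\<close> to \<open>\<tau>\<close> turns the pairing into
  coset sums of \<open>\<tau>\<close>. The set \<open>B\<close> is closed under left multiplication
  by \<open>N\<close>, so that the substitution stays inside it.\<close>

lemma pairing_avg:
  assumes N: "N \<lhd> G" "finite N" and f: "finsupp f"
    and \<tau>: "\<And>g. g \<in> carrier G \<Longrightarrow> (\<Sum>n\<in>N. \<tau> (n \<otimes> g)) = 0"
  shows "pairing \<tau> (coset_avg N f) = 0"
proof -
  define S where "S = {x. f x \<noteq> 0} \<union> {x. coset_avg N f x \<noteq> 0}"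
  define B where "B = (\<lambda>(n, x). n \<otimes> x) ` (N \<times> S)"
  have NG: "n \<in> carrier G" if "n \<in> N" for n using that normal_subset [OF N(1)] by auto
  have S: "finite S" "S \<subseteq> carrier G"
    using f finsupp_avg [OF N f] by (auto simp: S_def finsupp_def)
  have B: "finite B" "B \<subseteq> carrier G" using S N NG by (auto simp: B_def)
  have "S \<subseteq> B"
  proof
    fix x assume "x \<in> S"
    then have "x = (\<lambda>(n, x). n \<otimes> x) (\<one>, x)" "(\<one>, x) \<in> N \<times> S"
      using S normal_one [OF N(1)] by auto
    then show "x \<in> B" unfolding B_def by blast
  qed
  have nB: "n \<otimes> b \<in> B" if nb: "n \<in> N" "b \<in> B" for n b
  proof -
    obtain m x where mx: "b = m \<otimes> x" "m \<in> N" "x \<in> S" using nb by (auto simp: B_def)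
    then have "n \<otimes> b = (\<lambda>(n, x). n \<otimes> x) (n \<otimes> m, x)" "(n \<otimes> m, x) \<in> N \<times> S"
      using nb S NG by (auto simp: m_assoc normal_mult [OF N(1)])
    then show ?thesis unfolding B_def by blast
  qed
  have "pairing \<tau> (coset_avg N f) = (\<Sum>x\<in>B. of_real (coset_avg N f x) * \<tau> x)"
    using \<open>S \<subseteq> B\<close> B by (intro pairing_eq) (auto simp: S_def)
  also have "\<dots> = (\<Sum>x\<in>B. (\<Sum>n\<in>N. of_real (f (n \<otimes> x)) * \<tau> x)) / of_nat (card N)"
    using B unfolding sum_divide_distrib
    by (intro sum.cong) (auto simp: coset_avg_def sum_distrib_right sum_divide_distrib)
  also have "(\<Sum>x\<in>B. (\<Sum>n\<in>N. of_real (f (n \<otimes> x)) * \<tau> x)) = (\<Sum>n\<in>N. \<Sum>x\<in>B. of_real (f (n \<otimes> x)) * \<tau> x)"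
    by (rule sum.swap)
  also have "\<dots> = (\<Sum>n\<in>N. \<Sum>y\<in>B. of_real (f y) * \<tau> (inv n \<otimes> y))"
  proof (rule sum.cong [OF refl])
    fix n assume n: "n \<in> N"
    show "(\<Sum>x\<in>B. of_real (f (n \<otimes> x)) * \<tau> x) = (\<Sum>y\<in>B. of_real (f y) * \<tau> (inv n \<otimes> y))"
      by (rule sum.reindex_bij_witness [where i = "\<lambda>y. inv n \<otimes> y" and j = "\<lambda>x. n \<otimes> x"])
        (use n B NG nB normal_inv [OF N(1)] in \<open>auto simp: m_assoc [symmetric] subset_iff\<close>)
  qed
  also have "\<dots> = (\<Sum>y\<in>B. of_real (f y) * (\<Sum>n\<in>N. \<tau> (inv n \<otimes> y)))"
    by (subst sum.swap) (simp add: sum_distrib_left)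
  also have "\<dots> = 0"
    using B \<tau> sum_inv_normal [OF N(1), of "\<lambda>n. \<tau> (n \<otimes> y)" for y] by (intro sum.neutral) (auto simp: subset_iff)
  finally show ?thesis by simp
qed

text \<open>Apply the factors \<open>1 - p\<close> one by one to the indicator of the identity. The
  functional kills every average, so its nonzero value \<open>\<tau> \<one>\<close> survives each
  factor, and the resulting product cannot be zero.\<close>

lemma not_blocked_pairing:
  fixes \<tau> :: "'a \<Rightarrow> complex"
  assumes fin: "finite \<N>" and \<N>: "\<And>N. N \<in> \<N> \<Longrightarrow> N \<lhd> G \<and> finite N"
    and \<tau>: "\<And>N g. N \<in> \<N> \<Longrightarrow> g \<in> carrier G \<Longrightarrow> (\<Sum>n\<in>N. \<tau> (n \<otimes> g)) = 0" and \<tau>1: "\<tau> \<one> \<noteq> 0"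
  shows "\<not> blocked \<N>"
proof -
  have "\<exists>f. finsupp f \<and> pairing \<tau> f \<noteq> 0 \<and> (\<forall>N\<in>\<N>. coset_null N f)"
    using fin \<N> \<tau>
  proof (induction \<N> rule: finite_induct)
    case empty
    define f where "f = (\<lambda>x. if x = \<one> then 1 else (0::real))"
    have "finsupp f" by (rule finsupp_subset [of "{\<one>}"]) (auto simp: f_def)
    moreover have "pairing \<tau> f = \<tau> \<one>"
      using pairing_eq [of "{\<one>}" f \<tau>] by (simp add: f_def)
    ultimately show ?case using \<tau>1 by auto
  next
    case (insert N \<N>)
    then obtain f where f: "finsupp f" "pairing \<tau> f \<noteq> 0" "\<And>M. M \<in> \<N> \<Longrightarrow> coset_null M f" by auto
    have N: "N \<lhd> G" "finite N" using insert by auto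
    let ?f = "\<lambda>x. f x - coset_avg N f x"
    have "finsupp ?f" by (intro finsupp_diff f finsupp_avg N)
    moreover have "pairing \<tau> ?f \<noteq> 0"
      using f pairing_avg [OF N f(1)] insert by (simp add: pairing_diff finsupp_avg N)
    moreover have "coset_null M ?f" if M: "M \<in> insert N \<N>" for M
    proof (cases "M = N")
      case True
      then show ?thesis using coset_null_diff_avg [OF N] by simp
    next
      case False
      then have "M \<lhd> G" "coset_null M f" using M insert.prems(1) f(3) by auto
      then show ?thesis by (intro coset_null_linear coset_null_avg N)
    qed
    ultimately show ?case by blast
  qed
  then show ?thesis unfolding blocked_def pairing_def by fastforce
qed

end

section \<open>Normal subgroups acting in an irreducible representation\<close>

context irreducible_unitary_representation
begin

lemma rep_eq_one_iff:
  "g \<in> carrier G \<Longrightarrow> \<pi> g = \<one>\<^bsub>unitary_group H\<^esub> \<longleftrightarrow> (\<forall>v\<in>carrier H. \<pi> g v = v)"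
  using rep_extensional [of g]
  by (auto simp: unitary_group_def BijGroup_def fun_eq_iff extensional_def)

lemma rep_one_apply: "v \<in> carrier H \<Longrightarrow> \<pi> \<one>\<^bsub>G\<^esub> v = v"
  by (simp add: rep_one unitary_group_def BijGroup_def)

lemma rep_inv_apply:
  "\<lbrakk>g \<in> carrier G; v \<in> carrier H\<rbrakk> \<Longrightarrow> \<pi> (inv\<^bsub>G\<^esub> g) (\<pi> g v) = v"
  "\<lbrakk>g \<in> carrier G; v \<in> carrier H\<rbrakk> \<Longrightarrow> \<pi> g (\<pi> (inv\<^bsub>G\<^esub> g) v) = v"
  using rep_mult [of "inv\<^bsub>G\<^esub> g" g v] rep_mult [of g "inv\<^bsub>G\<^esub> g" v] by (simp_all add: rep_one_apply)

definition rep_kernel :: "'a set" where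
  "rep_kernel = {g \<in> carrier G. \<forall>v\<in>carrier H. \<pi> g v = v}"

lemma rep_kernel_normal: "rep_kernel \<lhd> G"
proof (rule G.normalI')
  fix g x assume "g \<in> carrier G" "x \<in> rep_kernel"
  then show "g \<otimes>\<^bsub>G\<^esub> x \<otimes>\<^bsub>G\<^esub> inv\<^bsub>G\<^esub> g \<in> rep_kernel"
    by (simp add: rep_kernel_def rep_mult rep_closed rep_inv_apply)
next
  fix x assume "x \<in> rep_kernel"
  then show "inv\<^bsub>G\<^esub> x \<in> rep_kernel"
    using rep_inv_apply(1) [of x] by (auto simp: rep_kernel_def)
qed (auto simp: rep_kernel_def rep_one_apply rep_mult)

lemma rep_eq_iff_kernel:
  assumes g: "g \<in> carrier G" "h \<in> carrier G"
  shows "\<pi> g = \<pi> h \<longleftrightarrow> g \<otimes>\<^bsub>G\<^esub> inv\<^bsub>G\<^esub> h \<in> rep_kernel"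
proof
  assume "\<pi> g = \<pi> h"
  then show "g \<otimes>\<^bsub>G\<^esub> inv\<^bsub>G\<^esub> h \<in> rep_kernel"
    using g by (simp add: rep_kernel_def rep_mult rep_inv_apply)
next
  assume "g \<otimes>\<^bsub>G\<^esub> inv\<^bsub>G\<^esub> h \<in> rep_kernel"
  then have "\<pi> g v = \<pi> h v" if "v \<in> carrier H" for v
    using g that rep_mult [of g "inv\<^bsub>G\<^esub> h" "\<pi> h v"]
    by (simp add: rep_kernel_def rep_closed rep_inv_apply)
  then show "\<pi> g = \<pi> h" using g by (intro extensionalityI [of _ "carrier H"]) (auto simp: rep_extensional)
qed

lemma kernel_iff: "g \<in> carrier G \<Longrightarrow> \<pi> g = \<one>\<^bsub>unitary_group H\<^esub> \<longleftrightarrow> g \<in> rep_kernel"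
  by (simp add: rep_eq_one_iff rep_kernel_def)

text \<open>The vectors fixed by a normal subgroup form a closed invariant subspace.\<close>

lemma fixed_vectors_trivial:
  assumes N: "N \<lhd> G" and nt: "\<not> N \<subseteq> rep_kernel"
    and v: "v \<in> carrier H" "\<And>n. n \<in> N \<Longrightarrow> \<pi> n v = v"
  shows "v = \<zero>\<^bsub>H\<^esub>"
proof -
  define W where "W = {v \<in> carrier H. \<forall>n\<in>N. \<pi> n v = v}"
  have NG: "n \<in> carrier G" if "n \<in> N" for n using that G.normal_subset [OF N] by auto
  have zero: "\<pi> g \<zero>\<^bsub>H\<^esub> = \<zero>\<^bsub>H\<^esub>" if "g \<in> carrier G" for g
    using rep_smult [of g "\<zero>\<^bsub>H\<^esub>" 0] that by (simp add: rep_closed smult_l_null [simplified])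
  have minus: "\<pi> g (\<ominus>\<^bsub>H\<^esub> x) = \<ominus>\<^bsub>H\<^esub> \<pi> g x" if "g \<in> carrier G" "x \<in> carrier H" for g x
    using rep_smult [of g x "-1"] that by (simp add: smult_minus_one rep_closed)
  have "submodule W complex_field H"
    by (rule submoduleI) (auto simp: W_def NG zero minus rep_add rep_smult)
  moreover have "closedin mtopology W"
    unfolding closedin_metric
  proof (intro conjI ballI allI impI)
    show "W \<subseteq> carrier H" by (auto simp: W_def)
    fix x assume "x \<in> carrier H - W"
    then obtain n where x: "x \<in> carrier H" and n: "n \<in> N" and neq: "\<pi> n x \<noteq> x" by (auto simp: W_def)
    have nx: "\<pi> n x \<in> carrier H" using NG [OF n] x by (rule rep_closed)
    \<comment> \<open>Half the displacement of \<open>x\<close> under \<open>n\<close>. Since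
      \<open>n\<close> acts isometrically, a vector fixed by \<open>n\<close> at distance less than
      \<open>r\<close> would bring \<open>x\<close> and its image closer together than they
      are.\<close>
    define r where "r = hdist H (\<pi> n x) x / 2"
    have "r > 0" using neq nx x by (simp add: r_def)
    moreover have "disjnt W (mball x r)"
      unfolding disjnt_iff
    proof (intro allI notI, elim conjE)
      fix y assume "y \<in> W" "y \<in> mball x r"
      then have y: "y \<in> carrier H" "\<pi> n y = y" and d: "hdist H x y < r" using n by (auto simp: W_def)
      have "hdist H (\<pi> n x) (\<pi> n y) = hdist H x y"
      proof -
        have "\<pi> n x \<ominus>\<^bsub>H\<^esub> \<pi> n y = \<pi> n (x \<ominus>\<^bsub>H\<^esub> y)"
          using NG [OF n] x y(1) by (simp add: M.minus_eq rep_add minus)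
        then show ?thesis using NG [OF n] x y(1) by (simp add: hdist_def rep_closed hnorm_def rep_cinner)
      qed
      then have "hdist H (\<pi> n x) x < 2 * r"
        using triangle [of "\<pi> n x" y x] nx x y d commute [of x y] by simp
      then show False by (simp add: r_def)
    qed
    ultimately show "\<exists>r>0. disjnt W (mball x r)" by blast
  qed
  moreover have "\<pi> g ` W \<subseteq> W" if g: "g \<in> carrier G" for g
  proof
    fix y assume "y \<in> \<pi> g ` W"
    then obtain x where x: "x \<in> carrier H" "\<And>n. n \<in> N \<Longrightarrow> \<pi> n x = x" and y: "y = \<pi> g x" by (auto simp: W_def)
    have "\<pi> n (\<pi> g x) = \<pi> g x" if n: "n \<in> N" for n
    proof -
      have "n \<otimes>\<^bsub>G\<^esub> g = g \<otimes>\<^bsub>G\<^esub> (inv\<^bsub>G\<^esub> g \<otimes>\<^bsub>G\<^esub> n \<otimes>\<^bsub>G\<^esub> g)"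
        using g NG [OF n] by (simp flip: G.m_assoc)
      then have "\<pi> n (\<pi> g x) = \<pi> (g \<otimes>\<^bsub>G\<^esub> (inv\<^bsub>G\<^esub> g \<otimes>\<^bsub>G\<^esub> n \<otimes>\<^bsub>G\<^esub> g)) x"
        using g NG [OF n] x by (metis rep_mult)
      also have "\<dots> = \<pi> g (\<pi> (inv\<^bsub>G\<^esub> g \<otimes>\<^bsub>G\<^esub> n \<otimes>\<^bsub>G\<^esub> g) x)"
        using g NG [OF n] x(1) by (intro rep_mult) auto
      finally show ?thesis using x G.normal_conj' [OF N g n] by simp
    qed
    then show "y \<in> W" using g x y by (simp add: W_def rep_closed)
  qed
  ultimately have "W = {\<zero>\<^bsub>H\<^esub>} \<or> W = carrier H" by (rule irreducible)
  moreover have "W \<noteq> carrier H" using nt NG by (auto simp: W_def rep_kernel_def)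
  ultimately show ?thesis using v by (auto simp: W_def)
qed

lemma finsum_rep:
  "\<lbrakk>finite A; g \<in> carrier G; \<And>a. a \<in> A \<Longrightarrow> F a \<in> carrier H\<rbrakk> \<Longrightarrow>
    \<pi> g (finsum H F A) = finsum H (\<lambda>a. \<pi> g (F a)) A"
proof (induction A rule: finite_induct)
  case empty
  then show ?case using rep_smult [of g "\<zero>\<^bsub>H\<^esub>" 0] by (simp add: rep_closed smult_l_null [simplified])
next
  case (insert a A)
  then show ?case by (simp add: M.finsum_insert Pi_iff rep_closed rep_add)
qed

lemma cinner_finsum:
  "\<lbrakk>finite A; v \<in> carrier H; \<And>a. a \<in> A \<Longrightarrow> F a \<in> carrier H\<rbrakk> \<Longrightarrow>
    cinner H (finsum H F A) v = (\<Sum>a\<in>A. cinner H (F a) v)"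
  by (induction A rule: finite_induct) (simp_all add: M.finsum_insert Pi_iff cinner_add_left)

text \<open>The sum of the vectors \<open>\<pi> n u\<close> over \<open>N\<close> is fixed by
  \<open>N\<close>, hence zero by \<open>fixed_vectors_trivial\<close>.\<close>

lemma coefficient_coset_sum:
  assumes N: "N \<lhd> G" "finite N" and nt: "\<not> N \<subseteq> rep_kernel"
    and u: "u \<in> carrier H" and v: "v \<in> carrier H"
  shows "(\<Sum>n\<in>N. cinner H (\<pi> n u) v) = 0"
proof -
  have NG: "n \<in> carrier G" if "n \<in> N" for n using that G.normal_subset [OF N(1)] by auto
  define w where "w = finsum H (\<lambda>n. \<pi> n u) N"
  have w: "w \<in> carrier H" unfolding w_def using NG u by (intro M.finsum_closed) (auto simp: rep_closed)
  have "\<pi> m w = w" if m: "m \<in> N" for m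
  proof -
    have "\<pi> m w = finsum H (\<lambda>n. \<pi> m (\<pi> n u)) N"
      unfolding w_def using N NG u m by (intro finsum_rep) (auto simp: rep_closed)
    also have "\<dots> = finsum H (\<lambda>n. \<pi> (m \<otimes>\<^bsub>G\<^esub> n) u) N"
      using NG u m by (intro M.finsum_cong') (auto simp: rep_mult rep_closed)
    also have "\<dots> = finsum H (\<lambda>n. \<pi> n u) ((\<lambda>n. m \<otimes>\<^bsub>G\<^esub> n) ` N)"
      using NG u m by (intro M.finsum_reindex [symmetric])
        (auto simp: rep_closed inj_on_def)
    also have "(\<lambda>n. m \<otimes>\<^bsub>G\<^esub> n) ` N = N"
    proof (rule card_subset_eq [OF N(2)])
      show "(\<lambda>n. m \<otimes>\<^bsub>G\<^esub> n) ` N \<subseteq> N" using m G.normal_mult [OF N(1)] by auto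
      show "card ((\<lambda>n. m \<otimes>\<^bsub>G\<^esub> n) ` N) = card N"
        using NG m by (intro card_image) (auto simp: inj_on_def)
    qed
    finally show ?thesis by (simp add: w_def)
  qed
  then have "w = \<zero>\<^bsub>H\<^esub>" by (intro fixed_vectors_trivial [OF N(1) nt w])
  then have "cinner H w v = 0" using v by simp
  then show ?thesis
    unfolding w_def using N NG u v by (simp add: cinner_finsum rep_closed)
qed

text \<open>A diagonal matrix coefficient is a functional whose coset sums over every member vanish
  and whose value at the identity is the positive number \<open>cinner H v v\<close>.\<close>

lemma not_blocked_if_nontrivial:
  assumes fin: "finite \<N>" and \<N>: "\<And>N. N \<in> \<N> \<Longrightarrow> N \<lhd> G \<and> finite N \<and> \<not> N \<subseteq> rep_kernel"
  shows "\<not> G.blocked \<N>"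
proof -
  obtain v where v: "v \<in> carrier H" "v \<noteq> \<zero>\<^bsub>H\<^esub>" using nonzero by blast
  show ?thesis
  proof (rule G.not_blocked_pairing [OF fin, where \<tau> = "\<lambda>g. cinner H (\<pi> g v) v"])
    show "N \<lhd> G \<and> finite N" if "N \<in> \<N>" for N using \<N> that by blast
    show "cinner H (\<pi> \<one>\<^bsub>G\<^esub> v) v \<noteq> 0" using v cinner_pos [OF v] by (auto simp: rep_one_apply)
    fix N g assume N: "N \<in> \<N>" and g: "g \<in> carrier G"
    have "(\<Sum>n\<in>N. cinner H (\<pi> n (\<pi> g v)) v) = 0"
      using \<N> [OF N] g v by (intro coefficient_coset_sum) (auto simp: rep_closed)
    moreover have "(\<Sum>n\<in>N. cinner H (\<pi> n (\<pi> g v)) v) = (\<Sum>n\<in>N. cinner H (\<pi> (n \<otimes>\<^bsub>G\<^esub> g) v) v)"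
      using g v G.normal_subset [of N] \<N> [OF N] by (intro sum.cong) (auto simp: rep_mult)
    ultimately show "(\<Sum>n\<in>N. cinner H (\<pi> (n \<otimes>\<^bsub>G\<^esub> g) v) v) = 0" by simp
  qed
qed

end

section \<open>From an unblocked family to an irreducible representation\<close>

context group
begin

text \<open>The coefficient of \<open>f\<close> in the left regular representation, that is, the
  inner product of \<open>f\<close> with its translate by \<open>g\<close>; hence a positive
  definite function, of finite support.\<close>

definition autocorr :: "('a \<Rightarrow> real) \<Rightarrow> 'a \<Rightarrow> complex" where
  "autocorr f g = (if g \<in> carrier G then of_real (\<Sum>h | f h \<noteq> 0. f h * f (inv g \<otimes> h)) else 0)"

lemma autocorr_eq:
  assumes f: "finsupp f" and x: "x \<in> carrier G" and y: "y \<in> carrier G"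
    and B: "finite B" "B \<subseteq> carrier G" "(\<lambda>h. x \<otimes> h) ` {h. f h \<noteq> 0} \<subseteq> B"
  shows "autocorr f (inv x \<otimes> y) = of_real (\<Sum>h\<in>B. f (inv x \<otimes> h) * f (inv y \<otimes> h))"
proof -
  let ?S = "{h. f h \<noteq> 0}"
  have S: "finite ?S" "?S \<subseteq> carrier G" using f by (auto simp: finsupp_def)
  have "(\<Sum>h\<in>B. f (inv x \<otimes> h) * f (inv y \<otimes> h))
      = (\<Sum>h\<in>(\<lambda>h. x \<otimes> h) ` ?S. f (inv x \<otimes> h) * f (inv y \<otimes> h))"
  proof (rule sum.mono_neutral_right [OF B(1,3)], intro ballI)
    fix h assume h: "h \<in> B - (\<lambda>h. x \<otimes> h) ` ?S"
    have "f (inv x \<otimes> h) = 0"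
    proof (rule ccontr)
      assume "f (inv x \<otimes> h) \<noteq> 0"
      moreover have "h = x \<otimes> (inv x \<otimes> h)" using h B x by (auto simp flip: m_assoc)
      ultimately show False using h by blast
    qed
    then show "f (inv x \<otimes> h) * f (inv y \<otimes> h) = 0" by simp
  qed
  also have "\<dots> = (\<Sum>h\<in>?S. f (inv x \<otimes> (x \<otimes> h)) * f (inv y \<otimes> (x \<otimes> h)))"
    using S x by (subst sum.reindex) (auto simp: inj_on_def subset_iff)
  also have "\<dots> = (\<Sum>h\<in>?S. f h * f (inv (inv x \<otimes> y) \<otimes> h))"
  proof (intro sum.cong refl)
    fix h assume "h \<in> ?S"
    then have h: "h \<in> carrier G" using S by auto
    have "inv x \<otimes> (x \<otimes> h) = h" using h x by (simp flip: m_assoc)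
    moreover have "inv y \<otimes> (x \<otimes> h) = inv (inv x \<otimes> y) \<otimes> h"
      using h x y by (simp add: inv_mult_group m_assoc)
    ultimately show "f (inv x \<otimes> (x \<otimes> h)) * f (inv y \<otimes> (x \<otimes> h)) = f h * f (inv (inv x \<otimes> y) \<otimes> h)"
      by simp
  qed
  finally show ?thesis using x y by (simp add: autocorr_def)
qed

lemma pd_function_autocorr:
  assumes f: "finsupp f"
  shows "pd_function G (autocorr f)"
  unfolding pd_function_def
proof (intro conjI allI impI ballI)
  let ?S = "{h. f h \<noteq> 0}"
  have S: "finite ?S" "?S \<subseteq> carrier G" using f by (auto simp: finsupp_def)
  show "autocorr f x = 0" if "x \<notin> carrier G" for x using that by (simp add: autocorr_def)
  show "autocorr f (inv x) = cnj (autocorr f x)" if x: "x \<in> carrier G" for x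
  proof -
    let ?B = "(\<lambda>h. x \<otimes> h) ` ?S \<union> (\<lambda>h. \<one> \<otimes> h) ` ?S"
    have B: "finite ?B" "?B \<subseteq> carrier G" using S x by auto
    have "autocorr f (inv x \<otimes> \<one>) = autocorr f (inv \<one> \<otimes> x)"
      using autocorr_eq [OF f x one_closed B] autocorr_eq [OF f one_closed x B] by (simp add: mult.commute)
    moreover have "cnj (autocorr f x) = autocorr f x" by (simp add: autocorr_def)
    ultimately show ?thesis using x by simp
  qed
  fix A and c :: "'a \<Rightarrow> complex" assume A: "finite A \<and> A \<subseteq> carrier G"
  define B where "B = (\<Union>x\<in>A. (\<lambda>h. x \<otimes> h) ` ?S)"
  have B: "finite B" "B \<subseteq> carrier G" using S A by (auto simp: B_def)
  have "kernel_form (\<lambda>x y. autocorr f (inv x \<otimes> y)) A c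
     = (\<Sum>x\<in>A. \<Sum>y\<in>A. \<Sum>h\<in>B. (c x * of_real (f (inv x \<otimes> h))) * cnj (c y * of_real (f (inv y \<otimes> h))))"
    unfolding kernel_form_def
  proof (intro sum.cong refl)
    fix x y assume xy: "x \<in> A" "y \<in> A"
    then have "autocorr f (inv x \<otimes> y) = of_real (\<Sum>h\<in>B. f (inv x \<otimes> h) * f (inv y \<otimes> h))"
      using A by (intro autocorr_eq [OF f _ _ B]) (auto simp: B_def)
    then show "c x * cnj (c y) * autocorr f (inv x \<otimes> y)
      = (\<Sum>h\<in>B. (c x * of_real (f (inv x \<otimes> h))) * cnj (c y * of_real (f (inv y \<otimes> h))))"
      by (simp add: sum_distrib_left mult_ac)
  qed
  also have "\<dots> = (\<Sum>h\<in>B. (\<Sum>x\<in>A. c x * of_real (f (inv x \<otimes> h))) * cnj (\<Sum>y\<in>A. c y * of_real (f (inv y \<otimes> h))))"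
    unfolding sum.swap [where A = A and B = B] by (simp only: cnj_sum sum_product)
  also have "\<dots> = of_real (\<Sum>h\<in>B. (cmod (\<Sum>x\<in>A. c x * of_real (f (inv x \<otimes> h))))\<^sup>2)"
    by (simp only: complex_norm_square [symmetric] of_real_sum)
  finally show "0 \<le> Re (kernel_form (\<lambda>x y. autocorr f (inv x \<otimes> y)) A c)"
    by (simp only: Re_complex_of_real) (simp add: sum_nonneg)
qed

text \<open>Summed over \<open>N\<close>, the autocorrelation pairs \<open>f\<close> with the sum of
  its translates by \<open>N\<close>, which is zero by \<open>coset_null\<close>.\<close>

lemma autocorr_normal_sum:
  assumes f: "finsupp f" and N: "N \<lhd> G" "finite N" "coset_null N f" and g: "g \<in> N"
  shows "(\<Sum>h\<in>N. autocorr f (inv g \<otimes> h)) = 0"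
proof -
  have NG: "n \<in> carrier G" if "n \<in> N" for n using that normal_subset [OF N(1)] by auto
  have "(\<Sum>h\<in>N. autocorr f (inv g \<otimes> h)) = (\<Sum>h\<in>N. autocorr f h)"
    by (rule sum_mult_right_normal(2) [OF N(1) normal_inv [OF N(1) g]])
  also have "\<dots> = of_real (\<Sum>n\<in>N. \<Sum>h | f h \<noteq> 0. f h * f (inv n \<otimes> h))"
    unfolding of_real_sum by (intro sum.cong) (auto simp: autocorr_def NG)
  also have "(\<Sum>n\<in>N. \<Sum>h | f h \<noteq> 0. f h * f (inv n \<otimes> h))
      = (\<Sum>h | f h \<noteq> 0. f h * (\<Sum>n\<in>N. f (inv n \<otimes> h)))"
    by (subst sum.swap) (simp add: sum_distrib_left)
  also have "\<dots> = 0"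
  proof (intro sum.neutral ballI)
    fix h assume "h \<in> {h. f h \<noteq> 0}"
    then have "h \<in> carrier G" using f by (auto simp: finsupp_def)
    then show "f h * (\<Sum>n\<in>N. f (inv n \<otimes> h)) = 0"
      using N(3) sum_inv_normal [OF N(1), of "\<lambda>n. f (n \<otimes> h)"] by (simp add: coset_null_def)
  qed
  finally show ?thesis by simp
qed

lemma finite_autocorr_support:
  assumes f: "finsupp f" shows "finite {g. autocorr f g \<noteq> 0}"
proof (rule finite_subset)
  let ?S = "{h. f h \<noteq> 0}"
  show "finite ((\<lambda>(h, k). h \<otimes> inv k) ` (?S \<times> ?S))" using f by (simp add: finsupp_def)
  show "{g. autocorr f g \<noteq> 0} \<subseteq> (\<lambda>(h, k). h \<otimes> inv k) ` (?S \<times> ?S)"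
  proof
    fix g assume "g \<in> {g. autocorr f g \<noteq> 0}"
    then have g: "g \<in> carrier G" and "(\<Sum>h\<in>?S. f h * f (inv g \<otimes> h)) \<noteq> 0"
      by (auto simp: autocorr_def simp del: of_real_sum of_real_mult split: if_splits)
    then obtain h where h: "h \<in> ?S" "f (inv g \<otimes> h) \<noteq> 0"
      by (metis (no_types, lifting) mult_eq_0_iff sum.neutral)
    have "h \<in> carrier G" using f h by (auto simp: finsupp_def)
    then have "g = h \<otimes> inv (inv g \<otimes> h)" using g by (simp add: inv_mult_group m_assoc [symmetric])
    then show "g \<in> (\<lambda>(h, k). h \<otimes> inv k) ` (?S \<times> ?S)" using h by (force simp: image_iff)
  qed
qed

text \<open>One affine functional \<open>T\<close> treats all elements at once. It is a sum of
  nonnegative terms, and the term of \<open>x\<close> is 1 whenever \<open>x\<close> acts trivially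
  in the representation of the state. So \<open>T < 1\<close> at a pure state excludes every
  nontrivial \<open>x\<close> of \<open>F\<close> from the kernel, and \<open>T < 1\<close> only has
  to be checked at the autocorrelation state.\<close>

theorem irreducibly_faithful_if_not_blocked:
  assumes cnt: "countable (carrier G)" and F: "finite F" "F \<subseteq> carrier G"
    and nb: "\<not> blocked {normal_closure {x} | x. x \<in> F \<and> x \<noteq> \<one> \<and> finite (normal_closure {x})}"
  shows "irreducibly_faithful G F"
proof -
  define F' where "F' = F - {\<one>}"
  have F': "finite F'" "F' \<subseteq> carrier G" using F by (auto simp: F'_def)
  define nc where "nc = (\<lambda>x. normal_closure {x})"
  have ncN: "nc x \<lhd> G" "x \<in> nc x" if "x \<in> F'" for x
    using F' that normal_closure_normal [of "{x}"] normal_closure_superset [of "{x}"] by (auto simp: nc_def)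
  obtain f where f: "finsupp f" "\<exists>x. f x \<noteq> 0"
    and null: "\<And>x. x \<in> F' \<Longrightarrow> finite (nc x) \<Longrightarrow> coset_null (nc x) f"
    using nb unfolding blocked_def nc_def F'_def by blast
  define s where "s = (\<Sum>h | f h \<noteq> 0. f h * f h)"
  have s: "s > 0"
    unfolding s_def using f by (intro sum_pos) (auto simp: finsupp_def not_square_less_zero less_le)
  define \<psi>0 where "\<psi>0 = (\<lambda>g. of_real (1/s) * autocorr f g)"
  have "autocorr f \<one> = of_real s"
    using f by (simp add: autocorr_def s_def finsupp_def subset_iff cong: sum.cong_simp)
  then have \<psi>01: "\<psi>0 \<one> = 1" using s by (simp add: \<psi>0_def)
  have \<psi>0pd: "pd_function G \<psi>0"
    unfolding \<psi>0_def using s by (intro pd_function_scale pd_function_autocorr f) simp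
  have bound: "cmod (\<psi>0 g) \<le> 1" for g
    using group_pd.psi_bound [of G \<psi>0 g] \<psi>0pd \<psi>01 by (simp add: group_pd_def group_pd_axioms_def is_group)
  define E where "E = {g. \<psi>0 g \<noteq> 0}"
  have E: "finite E" using finite_autocorr_support [OF f(1)] s by (simp add: E_def \<psi>0_def)
  \<comment> \<open>With \<open>M\<close> sampled elements the term of an infinite closure is at
    most \<open>card E / M\<close>, which is below \<open>1 / (card F' + 1)\<close>. There are
    \<open>card F'\<close> terms, so their sum stays below 1.\<close>
  define M where "M = (card E + 1) * (card F' + 1)"
  have "\<exists>A. finite A \<and> A \<noteq> {} \<and> A \<subseteq> nc x \<and> (finite (nc x) \<longrightarrow> A = nc x) \<and>
     (infinite (nc x) \<longrightarrow> card A = M)" if x: "x \<in> F'" for x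
  proof (cases "finite (nc x)")
    case True
    then show ?thesis using ncN [OF x] by blast
  next
    case False
    then obtain A where "A \<subseteq> nc x" "finite A" "card A = M" using infinite_arbitrarily_large by blast
    moreover have "M \<noteq> 0" by (simp add: M_def)
    ultimately show ?thesis using False by (intro exI [of _ A]) auto
  qed
  then obtain A where A: "\<And>x. x \<in> F' \<Longrightarrow> finite (A x) \<and> A x \<noteq> {} \<and> A x \<subseteq> nc x \<and>
      (finite (nc x) \<longrightarrow> A x = nc x) \<and> (infinite (nc x) \<longrightarrow> card (A x) = M)"
    by metis
  (* L x is the squared norm of the average of the translates of the cyclic vector over A x, which is 1 when nc x acts
     trivially. *)
  define L where "L = (\<lambda>x \<psi>. (\<Sum>g\<in>A x. \<Sum>h\<in>A x. Re (\<psi> (inv g \<otimes> h))) / (real (card (A x)))\<^sup>2)"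
  define T where "T = (\<lambda>\<psi>. \<Sum>x\<in>F'. L x \<psi>)"
  have L0: "L x \<psi>0 \<le> 1 / (real (card F') + 1)" if x: "x \<in> F'" for x
  proof (cases "finite (nc x)")
    case True
    then have Ax: "A x = nc x" using A [OF x] by blast
    have "(\<Sum>h\<in>A x. \<psi>0 (inv g \<otimes> h)) = 0" if "g \<in> A x" for g
      using autocorr_normal_sum [OF f(1) ncN(1) [OF x] True null [OF x True], of g] that
      unfolding Ax \<psi>0_def sum_distrib_left [symmetric] by simp
    then have "(\<Sum>h\<in>A x. Re (\<psi>0 (inv g \<otimes> h))) = 0" if "g \<in> A x" for g
      unfolding Re_sum [symmetric] using that by simp
    then show ?thesis by (simp add: L_def)
  next
    case False
    then have card: "card (A x) = M" using A [OF x] by blast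
    have AG: "A x \<subseteq> carrier G" using A [OF x] normal_subset [OF ncN(1) [OF x]] by blast
    have fin: "finite (A x)" using A [OF x] by blast
    \<comment> \<open>For fixed \<open>g\<close> at most \<open>card E\<close> elements
      \<open>h\<close> bring the quotient into the support \<open>E\<close>, and each contributes at
      most 1 by \<open>bound\<close>.\<close>
    have "(\<Sum>h\<in>A x. Re (\<psi>0 (inv g \<otimes> h))) \<le> real (card E)" if g: "g \<in> A x" for g
    proof -
      have inj: "inj_on (\<lambda>h. inv g \<otimes> h) (A x)" using AG g by (auto simp: inj_on_def subset_iff)
      have "(\<Sum>h\<in>A x. Re (\<psi>0 (inv g \<otimes> h))) \<le> (\<Sum>h\<in>A x. if inv g \<otimes> h \<in> E then 1 else 0)"
        using bound complex_Re_le_cmod order_trans by (intro sum_mono) (fastforce simp: E_def)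
      also have "\<dots> = real (card (A x \<inter> {h. inv g \<otimes> h \<in> E}))" using fin by (simp add: sum.If_cases)
      also have "\<dots> \<le> real (card E)"
        unfolding of_nat_le_iff
        by (rule card_inj_on_le [where f = "\<lambda>h. inv g \<otimes> h"]) (use E inj in \<open>auto intro: inj_on_subset\<close>)
      finally show ?thesis .
    qed
    then have "(\<Sum>g\<in>A x. \<Sum>h\<in>A x. Re (\<psi>0 (inv g \<otimes> h))) \<le> (\<Sum>g\<in>A x. real (card E))"
      by (intro sum_mono)
    also have "\<dots> = real M * real (card E)" by (simp add: card)
    finally have "L x \<psi>0 \<le> real M * real (card E) / (real M)\<^sup>2"
      unfolding L_def card by (rule divide_right_mono) simp
    also have "\<dots> \<le> 1 / (real (card F') + 1)"
    proof -
      have "M \<noteq> 0" by (simp add: M_def)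
      then have "real M * real (card E) / (real M)\<^sup>2 = real (card E) / real M"
        by (simp add: power2_eq_square)
      also have "\<dots> = real (card E) / ((real (card E) + 1) * (real (card F') + 1))"
        by (simp add: M_def algebra_simps)
      also have "\<dots> \<le> 1 / (real (card F') + 1)" by (simp add: divide_simps mult_right_mono)
      finally show ?thesis .
    qed
    finally show ?thesis .
  qed
  have "T \<psi>0 \<le> (\<Sum>x\<in>F'. 1 / (real (card F') + 1))" unfolding T_def by (intro sum_mono L0)
  also have "\<dots> < 1" by simp
  finally have T0: "T \<psi>0 < 1" .
  have contT: "continuous_on UNIV T"
    unfolding T_def L_def divide_inverse by (intro continuous_intros continuous_on_coordinate)
  have affT: "T (\<lambda>x. of_real t * \<alpha> x + of_real (1 - t) * \<beta> x) = t * T \<alpha> + (1 - t) * T \<beta>" for t \<alpha> \<beta>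
    by (simp add: T_def L_def sum.distrib sum_distrib_left add_divide_distrib del: of_real_diff)
  obtain \<psi> where pure: "pure_pd G \<psi>" and T\<psi>: "T \<psi> < 1"
    using exists_pure_pd [OF is_group cnt _ contT affT, of \<psi>0] \<psi>0pd \<psi>01 T0 by (force simp: pd_states_def)
  interpret P: group_pd G \<psi> by unfold_locales (use pure in \<open>simp add: pure_pd_def\<close>)
  interpret I: irreducible_unitary_representation G P.rkhs P.gns by (rule P.irreducible_gns [OF pure])
  have \<psi>1: "\<psi> \<one> = 1" using pure by (simp add: pure_pd_def)
  have \<psi>in: "\<psi> \<in> carrier P.rkhs" using P.rker_in [OF one_closed] by (simp add: P.rker_one)
  have Lpos: "0 \<le> L x \<psi>" if x: "x \<in> F'" for x
  proof -
    have "A x \<subseteq> carrier G" "finite (A x)" using A [OF x] normal_subset [OF ncN(1) [OF x]] by auto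
    then have "0 \<le> Re (kernel_form (\<lambda>x y. \<psi> (inv x \<otimes> y)) (A x) (\<lambda>_. 1))" by (intro P.k_pos)
    then show ?thesis by (simp add: L_def kernel_form_def)
  qed
  have "P.gns x \<noteq> \<one>\<^bsub>unitary_group P.rkhs\<^esub>" if x: "x \<in> F'" for x
  proof
    assume "P.gns x = \<one>\<^bsub>unitary_group P.rkhs\<^esub>"
    then have "x \<in> I.rep_kernel" using F' x by (simp add: I.kernel_iff subset_iff)
    then have ker: "nc x \<subseteq> I.rep_kernel"
      unfolding nc_def by (intro normal_closure_least I.rep_kernel_normal) auto
    have one: "\<psi> g = 1" if "g \<in> nc x" for g
    proof -
      have g: "g \<in> carrier G" "P.gns g \<psi> = \<psi>" using ker that \<psi>in by (auto simp: I.rep_kernel_def)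
      then show ?thesis
        using P.gns_coefficient [of g] P.gns_coefficient [of \<one>] I.rep_one_apply [OF \<psi>in] \<psi>1 by simp
    qed
    have "\<psi> (inv g \<otimes> h) = 1" if "g \<in> A x" "h \<in> A x" for g h
      using A [OF x] that by (intro one normal_mult [OF ncN(1) [OF x]] normal_inv [OF ncN(1) [OF x]]) blast+
    then have "L x \<psi> = 1" using A [OF x] by (simp add: L_def power2_eq_square)
    moreover have "L x \<psi> \<le> T \<psi>"
      unfolding T_def using x F' Lpos by (intro member_le_sum) auto
    ultimately show False using T\<psi> by simp
  qed
  then have "\<forall>x\<in>F. x \<noteq> \<one> \<longrightarrow> P.gns x \<noteq> \<one>\<^bsub>unitary_group P.rkhs\<^esub>" by (simp add: F'_def)
  then show ?thesis
    unfolding irreducibly_faithful_def using I.irreducible_unitary_representation_axioms by blast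
qed

section \<open>Operations on blocked families\<close>

lemma mult_inv_cancel:
  "\<lbrakk>x \<in> carrier G; y \<in> carrier G\<rbrakk> \<Longrightarrow> inv x \<otimes> (x \<otimes> y) = y"
  "\<lbrakk>x \<in> carrier G; y \<in> carrier G\<rbrakk> \<Longrightarrow> x \<otimes> (inv x \<otimes> y) = y"
  by (simp_all flip: m_assoc)

lemmas word_simps = m_assoc inv_mult_group mult_inv_cancel

text \<open>A function killed by the average over \<open>K\<close> is killed by the average over
  every larger normal subgroup, so shrinking the members can only kill fewer functions.\<close>

lemma blocked_refine:
  assumes bl: "blocked \<N>"
    and ref: "\<And>N. N \<in> \<N> \<Longrightarrow> N \<lhd> G \<and> (\<exists>K\<in>\<K>. K \<lhd> G \<and> finite K \<and> K \<subseteq> N)"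
  shows "blocked \<K>"
  unfolding blocked_def
proof (intro allI impI)
  fix f x assume f: "finsupp f \<and> (\<forall>K\<in>\<K>. coset_null K f)"
  have "coset_null N f" if "N \<in> \<N>" for N
    using ref [OF that] f coset_null_superset by blast
  then show "f x = 0" using bl f by (auto simp: blocked_def)
qed

text \<open>Translate a witness on the right so that it is nonzero at the identity, then cut it off
  outside \<open>M\<close>. A coset of a member lies inside or outside \<open>M\<close> as a whole,
  so its sum is still zero.\<close>

lemma not_blocked_local:
  assumes nb: "\<not> blocked \<N>" and M: "M \<lhd> G" and NM: "\<And>N. N \<in> \<N> \<Longrightarrow> N \<subseteq> M"
  obtains f where "finsupp f" "f \<one> \<noteq> 0" "\<And>x. x \<notin> M \<Longrightarrow> f x = 0" "\<And>N. N \<in> \<N> \<Longrightarrow> coset_null N f"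
proof -
  obtain f h where f: "finsupp f" "f h \<noteq> 0" and null: "\<And>N. N \<in> \<N> \<Longrightarrow> coset_null N f"
    using nb by (auto simp: blocked_def)
  have h: "h \<in> carrier G" using f by (auto simp: finsupp_def)
  have MG: "x \<in> carrier G" if "x \<in> M" for x using that normal_subset [OF M] by auto
  define f' where "f' = (\<lambda>x. if x \<in> M then f (x \<otimes> h) else 0)"
  have "finsupp f'"
  proof (rule finsupp_subset)
    let ?A = "(\<lambda>y. y \<otimes> inv h) ` {y. f y \<noteq> 0}"
    show "finite ?A" "?A \<subseteq> carrier G" using f h by (auto simp: finsupp_def)
    show "f' x = 0" if "x \<notin> ?A" for x
    proof (rule ccontr)
      assume "f' x \<noteq> 0"
      then have x: "x \<in> M" "f (x \<otimes> h) \<noteq> 0" by (auto simp: f'_def split: if_splits)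
      have "x = (x \<otimes> h) \<otimes> inv h" using MG [OF x(1)] h by (simp add: m_assoc)
      then show False using that x by blast
    qed
  qed
  moreover have "f' \<one> \<noteq> 0" using f h normal_one [OF M] by (simp add: f'_def)
  moreover have "f' x = 0" if "x \<notin> M" for x using that by (simp add: f'_def)
  moreover have "coset_null N f'" if N: "N \<in> \<N>" for N
    unfolding coset_null_def
  proof
    fix g assume g: "g \<in> carrier G"
    have NM': "n \<in> M" if "n \<in> N" for n using NM [OF N] that by blast
    show "(\<Sum>n\<in>N. f' (n \<otimes> g)) = 0"
    proof (cases "g \<in> M")
      case True
      have "(\<Sum>n\<in>N. f' (n \<otimes> g)) = (\<Sum>n\<in>N. f (n \<otimes> (g \<otimes> h)))"
        using True NM' MG g h normal_mult [OF M] by (intro sum.cong) (auto simp: f'_def m_assoc)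
      then show ?thesis using null [OF N] g h by (simp add: coset_null_def)
    next
      case False
      have "n \<otimes> g \<notin> M" if n: "n \<in> N" for n
      proof
        assume "n \<otimes> g \<in> M"
        then have "inv n \<otimes> (n \<otimes> g) \<in> M" using NM' [OF n] M by (auto simp: normal_mult normal_inv)
        then show False using False MG NM' [OF n] g by (simp flip: m_assoc)
      qed
      then show ?thesis by (simp add: f'_def)
    qed
  qed
  ultimately show ?thesis by (rule that)
qed

text \<open>Convolve local witnesses living on \<open>M1\<close> and \<open>M2\<close>. As these
  subgroups meet trivially, the value at the identity is the product of the two values there; each
  factor carries its own vanishing sums into the convolution.\<close>

lemma not_blocked_union:
  assumes nb: "\<not> blocked \<N>1" "\<not> blocked \<N>2"
    and M: "M1 \<lhd> G" "finite M1" "M2 \<lhd> G" "M1 \<inter> M2 = {\<one>}"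
    and N1: "\<And>N. N \<in> \<N>1 \<Longrightarrow> N \<subseteq> M1" and N2: "\<And>N. N \<in> \<N>2 \<Longrightarrow> N \<lhd> G \<and> N \<subseteq> M2"
  shows "\<not> blocked (\<N>1 \<union> \<N>2)"
proof -
  obtain f1 where f1: "finsupp f1" "f1 \<one> \<noteq> 0" "\<And>x. x \<notin> M1 \<Longrightarrow> f1 x = 0" "\<And>N. N \<in> \<N>1 \<Longrightarrow> coset_null N f1"
    using not_blocked_local [OF nb(1) M(1) N1] by blast
  obtain f2 where f2: "finsupp f2" "f2 \<one> \<noteq> 0" "\<And>x. x \<notin> M2 \<Longrightarrow> f2 x = 0" "\<And>N. N \<in> \<N>2 \<Longrightarrow> coset_null N f2"
    using not_blocked_local [OF nb(2) M(3)] N2 by blast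
  have MG: "x \<in> carrier G" if "x \<in> M1" for x using that normal_subset [OF M(1)] by auto
  define f where "f = (\<lambda>g. if g \<in> carrier G then \<Sum>h\<in>M1. f1 h * f2 (inv h \<otimes> g) else 0)"
  have "finsupp f"
  proof (rule finsupp_subset)
    let ?A = "(\<lambda>(h, y). h \<otimes> y) ` (M1 \<times> {y. f2 y \<noteq> 0})"
    show "finite ?A" "?A \<subseteq> carrier G" using f2 M MG by (auto simp: finsupp_def)
    show "f g = 0" if "g \<notin> ?A" for g
    proof (cases "g \<in> carrier G")
      case True
      have "f2 (inv h \<otimes> g) = 0" if h: "h \<in> M1" for h
      proof (rule ccontr)
        assume "f2 (inv h \<otimes> g) \<noteq> 0"
        moreover have "g = h \<otimes> (inv h \<otimes> g)" using MG [OF h] True by (simp flip: m_assoc)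
        ultimately show False using \<open>g \<notin> ?A\<close> h by (force simp: image_iff)
      qed
      then show ?thesis by (simp add: f_def)
    qed (simp add: f_def)
  qed
  moreover have "f \<one> \<noteq> 0"
  proof -
    have "f2 (inv h \<otimes> \<one>) = 0" if h: "h \<in> M1 - {\<one>}" for h
    proof (rule f2(3))
      have "inv h \<in> M1" "inv h \<noteq> \<one>" using h MG normal_inv [OF M(1)] by (auto simp: inv_eq_1_iff)
      then have "inv h \<notin> M2" using M(4) by blast
      then show "inv h \<otimes> \<one> \<notin> M2" using h MG by simp
    qed
    then have "f \<one> = (\<Sum>h\<in>{\<one>}. f1 h * f2 (inv h \<otimes> \<one>))"
      unfolding f_def if_P [OF one_closed] using M normal_one [OF M(1)]
      by (intro sum.mono_neutral_right) auto
    then show ?thesis using f1 f2 by simp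
  qed
  moreover have "coset_null N f" if N: "N \<in> \<N>1" for N
    unfolding coset_null_def
  proof
    fix g assume g: "g \<in> carrier G"
    have NM: "n \<in> M1" if "n \<in> N" for n using N1 [OF N] that by blast
    have "(\<Sum>n\<in>N. f (n \<otimes> g)) = (\<Sum>n\<in>N. \<Sum>h\<in>M1. f1 (n \<otimes> h) * f2 (inv h \<otimes> g))"
    proof (intro sum.cong refl)
      fix n assume n: "n \<in> N"
      have nG: "n \<in> carrier G" using MG NM n by blast
      have "f (n \<otimes> g) = (\<Sum>h\<in>M1. f1 (n \<otimes> h) * f2 (inv (n \<otimes> h) \<otimes> (n \<otimes> g)))"
        unfolding f_def using sum_mult_right_normal(2) [OF M(1) NM [OF n], of "\<lambda>h. f1 h * f2 (inv h \<otimes> (n \<otimes> g))"] g nG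
        by simp
      also have "\<dots> = (\<Sum>h\<in>M1. f1 (n \<otimes> h) * f2 (inv h \<otimes> g))"
      proof (intro sum.cong refl)
        fix h assume "h \<in> M1"
        then have "inv (n \<otimes> h) \<otimes> (n \<otimes> g) = inv h \<otimes> (inv n \<otimes> n \<otimes> g)"
          using MG nG g by (simp add: word_simps)
        then show "f1 (n \<otimes> h) * f2 (inv (n \<otimes> h) \<otimes> (n \<otimes> g)) = f1 (n \<otimes> h) * f2 (inv h \<otimes> g)"
          using nG g by simp
      qed
      finally show "f (n \<otimes> g) = (\<Sum>h\<in>M1. f1 (n \<otimes> h) * f2 (inv h \<otimes> g))" .
    qed
    also have "\<dots> = (\<Sum>h\<in>M1. (\<Sum>n\<in>N. f1 (n \<otimes> h)) * f2 (inv h \<otimes> g))"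
      by (subst sum.swap) (simp add: sum_distrib_right)
    also have "\<dots> = 0" using f1(4) [OF N] MG by (simp add: coset_null_def)
    finally show "(\<Sum>n\<in>N. f (n \<otimes> g)) = 0" .
  qed
  moreover have "coset_null N f" if N: "N \<in> \<N>2" for N
    unfolding coset_null_def
  proof
    fix g assume g: "g \<in> carrier G"
    have Nn: "N \<lhd> G" using N2 [OF N] by blast
    have NG: "n \<in> carrier G" if "n \<in> N" for n using normal_subset [OF Nn] that by blast
    have "(\<Sum>n\<in>N. f2 (inv h \<otimes> (n \<otimes> g))) = 0" if h: "h \<in> M1" for h
    proof -
      have hG: "h \<in> carrier G" using MG [OF h] .
      have "(\<Sum>n\<in>N. f2 (inv h \<otimes> (n \<otimes> g))) = (\<Sum>n\<in>N. f2 ((inv h \<otimes> n \<otimes> inv (inv h)) \<otimes> (inv h \<otimes> g)))"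
      proof (intro sum.cong refl)
        fix n assume "n \<in> N"
        then have "inv h \<otimes> (n \<otimes> g) = (inv h \<otimes> n \<otimes> inv (inv h)) \<otimes> (inv h \<otimes> g)"
          using NG hG g by (simp add: word_simps)
        then show "f2 (inv h \<otimes> (n \<otimes> g)) = f2 ((inv h \<otimes> n \<otimes> inv (inv h)) \<otimes> (inv h \<otimes> g))" by simp
      qed
      also have "\<dots> = (\<Sum>n\<in>N. f2 (n \<otimes> (inv h \<otimes> g)))"
        by (rule sum_conj_normal [OF Nn inv_closed [OF hG], of "\<lambda>n. f2 (n \<otimes> (inv h \<otimes> g))"])
      finally show ?thesis using f2(4) [OF N] hG g by (simp add: coset_null_def)
    qed
    then have "(\<Sum>h\<in>M1. f1 h * (\<Sum>n\<in>N. f2 (inv h \<otimes> (n \<otimes> g)))) = 0" by simp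
    moreover have "(\<Sum>n\<in>N. f (n \<otimes> g)) = (\<Sum>n\<in>N. \<Sum>h\<in>M1. f1 h * f2 (inv h \<otimes> (n \<otimes> g)))"
      using g NG by (simp add: f_def)
    ultimately show "(\<Sum>n\<in>N. f (n \<otimes> g)) = 0"
      by (simp add: sum.swap [of _ M1 N] sum_distrib_left)
  qed
  ultimately show ?thesis unfolding blocked_def by blast
qed

text \<open>Let \<open>f\<close> be a witness for the smaller family supported in \<open>M\<close>.
  All members, including \<open>N\<close>, kill \<open>f\<close> minus its average over
  \<open>N\<close>, so \<open>f\<close> equals that average. Then \<open>f\<close> is constant and
  nonzero on \<open>N\<close>, but vanishes outside \<open>M\<close>.\<close>

lemma blocked_insert_subset:
  assumes nb: "\<not> blocked \<N>" and bl: "blocked (insert N \<N>)" and N: "N \<lhd> G" "finite N" and M: "M \<lhd> G"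
    and NM: "\<And>K. K \<in> \<N> \<Longrightarrow> K \<lhd> G \<and> K \<subseteq> M"
  shows "N \<subseteq> M"
proof
  obtain f where f: "finsupp f" "f \<one> \<noteq> 0" "\<And>x. x \<notin> M \<Longrightarrow> f x = 0" "\<And>K. K \<in> \<N> \<Longrightarrow> coset_null K f"
    using not_blocked_local [OF nb M] NM by blast
  let ?f = "\<lambda>x. f x - coset_avg N f x"
  have "coset_null K ?f" if K: "K \<in> insert N \<N>" for K
  proof (cases "K = N")
    case True
    then show ?thesis using coset_null_diff_avg [OF N] by simp
  next
    case False
    then show ?thesis using K NM f by (intro coset_null_linear coset_null_avg N) auto
  qed
  moreover have "finsupp ?f" by (intro finsupp_diff finsupp_avg f N)
  ultimately have eq: "f x = coset_avg N f x" for x using bl unfolding blocked_def by (metis eq_iff_diff_eq_0)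
  fix n assume n: "n \<in> N"
  then have "f (n \<otimes> \<one>) = f \<one>" using eq coset_avg_invariant [OF N(1) n one_closed, of f] by simp
  then show "n \<in> M" using f(2,3) n normal_subset [OF N(1)] by (metis r_one subsetD)
qed

text \<open>Averaging over \<open>Q\<close> passes to the quotient by \<open>Q\<close>, into which
  \<open>C\<close> embeds. A witness on \<open>C\<close> stays nonzero at the identity, and each
  \<open>N\<close> contains some \<open>K\<close> modulo \<open>Q\<close>, so its sums vanish as
  well.\<close>

lemma not_blocked_quotient:
  assumes nb: "\<not> blocked \<K>" and Q: "Q \<lhd> G" "finite Q" and C: "C \<lhd> G" and QC: "C \<inter> Q = {\<one>}"
    and K: "\<And>K. K \<in> \<K> \<Longrightarrow> K \<lhd> G \<and> finite K \<and> K \<subseteq> C"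
    and N: "\<And>N. N \<in> \<N> \<Longrightarrow> N \<lhd> G \<and> (\<exists>K\<in>\<K>. K \<subseteq> N <#> Q)"
  shows "\<not> blocked \<N>"
proof -
  obtain f where f: "finsupp f" "f \<one> \<noteq> 0" "\<And>x. x \<notin> C \<Longrightarrow> f x = 0" "\<And>K. K \<in> \<K> \<Longrightarrow> coset_null K f"
    using not_blocked_local [OF nb C] K by blast
  let ?f = "coset_avg Q f"
  have "finsupp ?f" by (rule finsupp_avg [OF Q f(1)])
  moreover have "?f \<one> \<noteq> 0"
  proof -
    have "(\<Sum>q\<in>Q. f (q \<otimes> \<one>)) = (\<Sum>q\<in>{\<one>}. f (q \<otimes> \<one>))"
      using Q normal_one [OF Q(1)] QC f(3) normal_subset [OF Q(1)]
      by (intro sum.mono_neutral_right) (auto simp: subset_iff)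
    moreover have "card Q \<noteq> 0" using Q normal_one [OF Q(1)] by auto
    ultimately show ?thesis using f(2) by (simp add: coset_avg_def)
  qed
  moreover have "coset_null N ?f" if NN: "N \<in> \<N>" for N
    unfolding coset_null_def
  proof
    fix g assume g: "g \<in> carrier G"
    obtain K where Nn: "N \<lhd> G" and KK: "K \<in> \<K>" and KN: "K \<subseteq> N <#> Q" using N [OF NN] by blast
    have Kn: "K \<lhd> G" "finite K" using K [OF KK] by auto
    have G': "\<And>x. x \<in> N \<Longrightarrow> x \<in> carrier G" "\<And>x. x \<in> K \<Longrightarrow> x \<in> carrier G" "\<And>x. x \<in> Q \<Longrightarrow> x \<in> carrier G"
      using normal_subset Nn Kn(1) Q(1) by blast+
    \<comment> \<open>Modulo \<open>Q\<close>, left multiplication by \<open>k\<close> is left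
      multiplication by some \<open>n0\<close> in \<open>N\<close>, and \<open>?f\<close> does not
      see \<open>Q\<close>. So the sum over \<open>N\<close> may be averaged over \<open>K\<close>,
      where it vanishes.\<close>
    have "(\<Sum>n\<in>N. ?f (k \<otimes> (n \<otimes> g))) = (\<Sum>n\<in>N. ?f (n \<otimes> g))" if k: "k \<in> K" for k
    proof -
      obtain n0 q0 where k': "n0 \<in> N" "q0 \<in> Q" "k = n0 \<otimes> q0" using KN k by (auto simp: set_mult_def)
      have "?f (k \<otimes> (n \<otimes> g)) = ?f ((n0 \<otimes> n) \<otimes> g)" if n: "n \<in> N" for n
      proof -
        have "k \<otimes> (n \<otimes> g) = (n0 \<otimes> q0 \<otimes> inv n0) \<otimes> ((n0 \<otimes> n) \<otimes> g)"
          using k' G' n g by (simp add: word_simps)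
        moreover have "n0 \<otimes> q0 \<otimes> inv n0 \<in> Q" using k' G' by (intro normal_conj [OF Q(1)]) auto
        ultimately show ?thesis using k' G' n g by (simp add: coset_avg_invariant [OF Q(1)])
      qed
      then have "(\<Sum>n\<in>N. ?f (k \<otimes> (n \<otimes> g))) = (\<Sum>n\<in>N. ?f ((n0 \<otimes> n) \<otimes> g))" by (rule sum.cong [OF refl])
      then show ?thesis using sum_mult_right_normal(2) [OF Nn k'(1), of "\<lambda>n. ?f (n \<otimes> g)"] by simp
    qed
    then have "real (card K) * (\<Sum>n\<in>N. ?f (n \<otimes> g)) = (\<Sum>k\<in>K. \<Sum>n\<in>N. ?f (k \<otimes> (n \<otimes> g)))" by simp
    also have "\<dots> = (\<Sum>n\<in>N. \<Sum>k\<in>K. ?f (k \<otimes> (n \<otimes> g)))" by (rule sum.swap)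
    also have "\<dots> = 0"
      using coset_null_avg [OF Kn(1) Q(1) f(4) [OF KK]] G' g by (simp add: coset_null_def)
    finally show "(\<Sum>n\<in>N. ?f (n \<otimes> g)) = 0" using Kn normal_one [OF Kn(1)] by auto
  qed
  ultimately show ?thesis unfolding blocked_def by blast
qed

lemma not_blocked_empty: "\<not> blocked {}"
proof -
  define f where "f = (\<lambda>x. if x = \<one> then 1 else (0::real))"
  have "finsupp f" by (rule finsupp_subset [of "{\<one>}"]) (auto simp: f_def)
  moreover have "f \<one> \<noteq> 0" by (simp add: f_def)
  ultimately show ?thesis unfolding blocked_def by blast
qed

lemma not_blocked_singleton:
  assumes N: "N \<lhd> G" "finite N" "N \<noteq> {\<one>}"
  shows "\<not> blocked {N}"
proof
  assume "blocked {N}"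
  then have "N \<subseteq> {\<one>}"
    using blocked_insert_subset [OF not_blocked_empty _ N(1,2) one_is_normal] by auto
  then show False using N normal_one [OF N(1)] by auto
qed


section \<open>Minimal finite normal subgroups\<close>

definition min_normal :: "'a set \<Rightarrow> bool" where
  "min_normal N \<longleftrightarrow> N \<lhd> G \<and> finite N \<and> N \<noteq> {\<one>} \<and> (\<forall>K. K \<lhd> G \<and> K \<subseteq> N \<longrightarrow> K = {\<one>} \<or> K = N)"

lemma min_normalD:
  assumes "min_normal N"
  shows "N \<lhd> G" "finite N" "N \<noteq> {\<one>}" "\<And>K. \<lbrakk>K \<lhd> G; K \<subseteq> N\<rbrakk> \<Longrightarrow> K = {\<one>} \<or> K = N"
  using assms by (auto simp: min_normal_def)

lemma exists_min_normal:
  assumes "N \<lhd> G" "finite N" "N \<noteq> {\<one>}"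
  shows "\<exists>K. min_normal K \<and> K \<subseteq> N"
  using assms(2,1,3)
proof (induction N rule: finite_psubset_induct)
  case (psubset N)
  show ?case
  proof (cases "min_normal N")
    case False
    then obtain K where "K \<lhd> G" "K \<subseteq> N" "K \<noteq> {\<one>}" "K \<noteq> N"
      using psubset by (auto simp: min_normal_def)
    then show ?thesis using psubset.IH [of K] by blast
  qed auto
qed

lemma normal_Int: "\<lbrakk>N \<lhd> G; M \<lhd> G\<rbrakk> \<Longrightarrow> N \<inter> M \<lhd> G"
  by (rule normalI') (use normal_subset in \<open>auto simp: normal_one normal_inv normal_mult normal_conj\<close>)

lemma min_normal_Int:
  assumes "min_normal N" "M \<lhd> G" "\<not> N \<subseteq> M"
  shows "N \<inter> M = {\<one>}"
  using min_normalD(4) [OF assms(1) normal_Int [OF min_normalD(1) [OF assms(1)] assms(2)]] assms(3)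
  by blast

lemma min_normal_distinct: "\<lbrakk>min_normal N; min_normal M; N \<noteq> M\<rbrakk> \<Longrightarrow> N \<inter> M = {\<one>}"
proof -
  assume N: "min_normal N" and M: "min_normal M" and neq: "N \<noteq> M"
  have "\<not> N \<subseteq> M"
    using min_normalD(4) [OF M min_normalD(1) [OF N]] min_normalD(3) [OF N] neq by blast
  then show ?thesis by (rule min_normal_Int [OF N min_normalD(1) [OF M]])
qed

lemma min_normal_nontrivial:
  assumes "min_normal N" obtains x where "x \<in> N" "x \<noteq> \<one>"
  using min_normalD(3) [OF assms] normal_one [OF min_normalD(1) [OF assms]] by blast

lemma normal_commute:
  assumes N: "N \<lhd> G" and M: "M \<lhd> G" and NM: "N \<inter> M = {\<one>}" and n: "n \<in> N" and m: "m \<in> M"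
  shows "n \<otimes> m = m \<otimes> n"
proof -
  have G: "n \<in> carrier G" "m \<in> carrier G" using assms normal_subset by blast+
  have "n \<otimes> m \<otimes> inv n \<otimes> inv m \<in> M"
    using M G m by (intro normal_mult [OF M] normal_conj normal_inv [OF M])
  moreover have "n \<otimes> (m \<otimes> inv n \<otimes> inv m) \<in> N"
    using N G n by (intro normal_mult [OF N] normal_conj [OF N] normal_inv [OF N]) auto
  then have "n \<otimes> m \<otimes> inv n \<otimes> inv m \<in> N" using G by (simp add: m_assoc)
  ultimately have "n \<otimes> m \<otimes> inv n \<otimes> inv m = \<one>" using NM by blast
  then have "n \<otimes> m \<otimes> inv n = m" using G by (metis inv_equality inv_inv inv_closed m_closed)
  then show ?thesis using G by (metis inv_closed inv_solve_right m_closed)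
qed

section \<open>Products, joins and complements of normal subgroups\<close>

lemma normal_set_mult:
  assumes N: "N \<lhd> G" and M: "M \<lhd> G"
  shows "N <#> M \<lhd> G" "N \<subseteq> N <#> M" "M \<subseteq> N <#> M"
proof -
  have G: "\<And>x. x \<in> N \<Longrightarrow> x \<in> carrier G" "\<And>x. x \<in> M \<Longrightarrow> x \<in> carrier G"
    using assms normal_subset by blast+
  have memI: "x \<in> N <#> M" if "n \<in> N" "m \<in> M" "x = n \<otimes> m" for x n m
    using that by (auto simp: set_mult_def)
  have memE: "\<exists>n\<in>N. \<exists>m\<in>M. x = n \<otimes> m" if "x \<in> N <#> M" for x
    using that by (auto simp: set_mult_def)
  show "N <#> M \<lhd> G"
  proof (rule normalI')
    show "N <#> M \<subseteq> carrier G" using G by (auto simp: set_mult_def)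
    show "\<one> \<in> N <#> M" by (rule memI [of \<one> \<one>]) (use N M in \<open>auto simp: normal_one\<close>)
  next
    fix x assume "x \<in> N <#> M"
    then obtain n m where x: "n \<in> N" "m \<in> M" "x = n \<otimes> m" using memE by blast
    show "inv x \<in> N <#> M"
    proof (rule memI)
      show "inv m \<otimes> inv n \<otimes> m \<in> N" using x G N by (intro normal_conj' [OF N] normal_inv [OF N]) auto
      show "inv m \<in> M" using x M by (simp add: normal_inv)
      show "inv x = inv m \<otimes> inv n \<otimes> m \<otimes> inv m" using x G by (simp add: inv_mult_group m_assoc)
    qed
    fix y assume "y \<in> N <#> M"
    then obtain n' m' where y: "n' \<in> N" "m' \<in> M" "y = n' \<otimes> m'" using memE by blast
    show "x \<otimes> y \<in> N <#> M"
    proof (rule memI)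
      show "n \<otimes> (m \<otimes> n' \<otimes> inv m) \<in> N" using x y G by (intro normal_mult [OF N] normal_conj [OF N]) auto
      show "m \<otimes> m' \<in> M" using x y by (intro normal_mult [OF M])
      show "x \<otimes> y = n \<otimes> (m \<otimes> n' \<otimes> inv m) \<otimes> (m \<otimes> m')"
        using x y G by (simp add: word_simps)
    qed
  next
    fix g x assume g: "g \<in> carrier G" and "x \<in> N <#> M"
    then obtain n m where x: "n \<in> N" "m \<in> M" "x = n \<otimes> m" using memE by blast
    show "g \<otimes> x \<otimes> inv g \<in> N <#> M"
    proof (rule memI)
      show "g \<otimes> n \<otimes> inv g \<in> N" "g \<otimes> m \<otimes> inv g \<in> M" using g x N M by (auto simp: normal_conj)
      show "g \<otimes> x \<otimes> inv g = (g \<otimes> n \<otimes> inv g) \<otimes> (g \<otimes> m \<otimes> inv g)"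
        using g x G by (simp add: word_simps)
    qed
  qed
  show "N \<subseteq> N <#> M" using memI [OF _ normal_one [OF M]] G by fastforce
  show "M \<subseteq> N <#> M" using memI [OF normal_one [OF N]] G by fastforce
qed

lemma finite_set_mult: "\<lbrakk>finite N; finite M\<rbrakk> \<Longrightarrow> finite (N <#> M)"
  by (auto simp: set_mult_def)

lemma set_mult_least: "\<lbrakk>N \<subseteq> L; M \<subseteq> L; L \<lhd> G\<rbrakk> \<Longrightarrow> N <#> M \<subseteq> L"
  by (auto simp: set_mult_def normal_mult subset_iff)

definition join :: "'a set set \<Rightarrow> 'a set" where
  "join \<S> = normal_closure (\<Union>\<S>)"

lemma join_normal: "(\<And>N. N \<in> \<S> \<Longrightarrow> N \<lhd> G) \<Longrightarrow> join \<S> \<lhd> G"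
  unfolding join_def by (intro normal_closure_normal) (blast dest: normal_subset)

lemma join_upper: "N \<in> \<S> \<Longrightarrow> N \<subseteq> join \<S>"
  unfolding join_def using normal_closure_superset by blast

lemma join_least: "\<lbrakk>L \<lhd> G; \<And>N. N \<in> \<S> \<Longrightarrow> N \<subseteq> L\<rbrakk> \<Longrightarrow> join \<S> \<subseteq> L"
  unfolding join_def by (intro normal_closure_least) auto

lemma join_empty: "join {} = {\<one>}"
  using join_least [of "{\<one>}" "{}"] join_normal [of "{}"] normal_one one_is_normal by blast

lemma join_insert_subset:
  assumes "\<And>N. N \<in> insert A \<S> \<Longrightarrow> N \<lhd> G"
  shows "join (insert A \<S>) \<subseteq> A <#> join \<S>"
proof (rule join_least)
  have n: "A \<lhd> G" "join \<S> \<lhd> G" using assms by (auto intro: join_normal)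
  then show "A <#> join \<S> \<lhd> G" by (rule normal_set_mult)
  show "N \<subseteq> A <#> join \<S>" if "N \<in> insert A \<S>" for N
    using that normal_set_mult [OF n] join_upper [of N \<S>] by blast
qed

lemma finite_join:
  assumes "finite \<S>" "\<And>N. N \<in> \<S> \<Longrightarrow> N \<lhd> G \<and> finite N"
  shows "finite (join \<S>)"
  using assms
proof (induction \<S> rule: finite_induct)
  case empty
  then show ?case by (simp add: join_empty)
next
  case (insert A \<S>)
  then have "finite (A <#> join \<S>)" by (auto intro: finite_set_mult)
  moreover have "join (insert A \<S>) \<subseteq> A <#> join \<S>" using insert by (intro join_insert_subset) auto
  ultimately show ?case by (rule finite_subset [rotated])
qed

text \<open>Semisimplicity of a join of minimal normal subgroups: take \<open>C\<close> of largest
  order among the normal subgroups of \<open>M\<close> meeting \<open>Q\<close> trivially. A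
  generator outside \<open>C <#> Q\<close> meets it trivially and could be multiplied onto
  \<open>C\<close>.\<close>

lemma complement_exists:
  assumes \<S>: "\<And>N. N \<in> \<S> \<Longrightarrow> min_normal N" and M: "M = join \<S>" "finite M" and Q: "Q \<lhd> G"
  shows "\<exists>C. C \<lhd> G \<and> C \<subseteq> M \<and> C \<inter> Q = {\<one>} \<and> M \<subseteq> C <#> Q"
proof -
  define P where "P = (\<lambda>C. C \<lhd> G \<and> C \<subseteq> M \<and> C \<inter> Q = {\<one>})"
  have Mn: "M \<lhd> G" unfolding M by (intro join_normal min_normalD(1) \<S>)
  have "P {\<one>}" using one_is_normal normal_one Mn Q by (auto simp: P_def)
  moreover have "\<forall>C. P C \<longrightarrow> card C < Suc (card M)"
    using M by (auto simp: P_def less_Suc_eq_le intro: card_mono)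
  ultimately have "\<exists>C. P C \<and> (\<forall>C'. P C' \<longrightarrow> card C' \<le> card C)"
    by (rule ex_has_greatest_nat)
  then obtain C where C: "P C" and max: "\<And>C'. P C' \<Longrightarrow> card C' \<le> card C"
    by blast
  have Cn: "C \<lhd> G" "C \<subseteq> M" "C \<inter> Q = {\<one>}" using C by (auto simp: P_def)
  note CQ = normal_set_mult [OF Cn(1) Q]
  have "N \<subseteq> C <#> Q" if N: "N \<in> \<S>" for N
  proof (rule ccontr)
    assume "\<not> N \<subseteq> C <#> Q"
    then have NCQ: "N \<inter> (C <#> Q) = {\<one>}" using min_normal_Int [OF \<S> [OF N] CQ(1)] by blast
    have Nn: "N \<lhd> G" by (rule min_normalD(1) [OF \<S> [OF N]])
    note NC = normal_set_mult [OF Nn Cn(1)]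
    have G: "\<And>x. x \<in> N \<Longrightarrow> x \<in> carrier G" "\<And>x. x \<in> C \<Longrightarrow> x \<in> carrier G" "\<And>x. x \<in> Q \<Longrightarrow> x \<in> carrier G"
      using normal_subset Nn Cn(1) Q by blast+
    have "N <#> C \<subseteq> M" using Cn join_upper [OF N] Mn M by (intro set_mult_least) auto
    moreover have "x = \<one>" if x: "x \<in> N <#> C" "x \<in> Q" for x
    proof -
      obtain n c where nc: "n \<in> N" "c \<in> C" "x = n \<otimes> c" using x by (auto simp: set_mult_def)
      have "n = x \<otimes> inv c" using nc G by (simp add: m_assoc)
      also have "\<dots> \<in> C <#> Q" using x nc CQ by (blast intro: normal_mult normal_inv)
      finally have "n = \<one>" using NCQ nc by blast
      then show ?thesis using nc G x Cn(3) by auto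
    qed
    ultimately have "P (N <#> C)" using NC normal_one Q by (auto simp: P_def)
    then have "card (N <#> C) \<le> card C" by (rule max)
    moreover have "finite (N <#> C)" using \<open>N <#> C \<subseteq> M\<close> M(2) by (rule finite_subset)
    ultimately have "C = N <#> C" using NC(3) by (intro card_seteq) auto
    then show False using NC CQ \<open>\<not> N \<subseteq> C <#> Q\<close> by blast
  qed
  then have "M \<subseteq> C <#> Q" unfolding M using CQ(1) by (intro join_least)
  then show ?thesis using Cn by blast
qed

definition centralizer :: "'a set \<Rightarrow> 'a set" where
  "centralizer S = {g \<in> carrier G. \<forall>x\<in>S. g \<otimes> x = x \<otimes> g}"

lemma centralizer_normal:
  assumes N: "N \<lhd> G" shows "centralizer N \<lhd> G"
proof (rule normalI')
  have NG: "x \<in> carrier G" if "x \<in> N" for x using that normal_subset [OF N] by auto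
  show "centralizer N \<subseteq> carrier G" "\<one> \<in> centralizer N" using NG by (auto simp: centralizer_def)
  show "inv x \<in> centralizer N" if "x \<in> centralizer N" for x
  proof -
    have x: "x \<in> carrier G" "\<And>n. n \<in> N \<Longrightarrow> x \<otimes> n = n \<otimes> x" using that by (auto simp: centralizer_def)
    have "inv x \<otimes> n = n \<otimes> inv x" if n: "n \<in> N" for n
    proof -
      have "inv x \<otimes> n = inv x \<otimes> (n \<otimes> x) \<otimes> inv x" using x(1) NG [OF n] by (simp add: m_assoc)
      also have "\<dots> = inv x \<otimes> (x \<otimes> n) \<otimes> inv x" using x(2) [OF n] by simp
      also have "\<dots> = n \<otimes> inv x" using x(1) NG [OF n] by (simp add: m_assoc [symmetric])
      finally show ?thesis .
    qed
    then show ?thesis using x(1) by (simp add: centralizer_def)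
  qed
  show "x \<otimes> y \<in> centralizer N" if "x \<in> centralizer N" "y \<in> centralizer N" for x y
  proof -
    have xy: "x \<in> carrier G" "y \<in> carrier G" "\<And>n. n \<in> N \<Longrightarrow> x \<otimes> n = n \<otimes> x"
      "\<And>n. n \<in> N \<Longrightarrow> y \<otimes> n = n \<otimes> y" using that by (auto simp: centralizer_def)
    have "x \<otimes> y \<otimes> n = n \<otimes> (x \<otimes> y)" if n: "n \<in> N" for n
    proof -
      have "x \<otimes> y \<otimes> n = x \<otimes> n \<otimes> y" using xy(1,2) xy(4) [OF n] NG [OF n] by (simp add: m_assoc)
      also have "\<dots> = n \<otimes> (x \<otimes> y)" using xy(1,2) xy(3) [OF n] NG [OF n] by (simp add: m_assoc)
      finally show ?thesis .
    qed
    then show ?thesis using xy by (simp add: centralizer_def)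
  qed
  fix g x assume g: "g \<in> carrier G" and x: "x \<in> centralizer N"
  have xG: "x \<in> carrier G" using x by (simp add: centralizer_def)
  have "g \<otimes> x \<otimes> inv g \<otimes> n = n \<otimes> (g \<otimes> x \<otimes> inv g)" if n: "n \<in> N" for n
  proof -
    define k where "k = inv g \<otimes> n \<otimes> g"
    have k: "k \<in> N" "k \<in> carrier G" using g n N NG by (auto simp: k_def normal_conj')
    have nk: "n = g \<otimes> k \<otimes> inv g" using g NG [OF n] unfolding k_def by (simp add: word_simps)
    have "x \<otimes> k = k \<otimes> x" using x k by (simp add: centralizer_def)
    then have "g \<otimes> (x \<otimes> k) \<otimes> inv g = g \<otimes> (k \<otimes> x) \<otimes> inv g" by simp
    then show ?thesis
      unfolding nk using g xG k by (simp add: word_simps)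
  qed
  then show "g \<otimes> x \<otimes> inv g \<in> centralizer N" using g xG by (simp add: centralizer_def)
qed

subsection \<open>Equivariant homomorphisms\<close>

text \<open>Homomorphisms for the conjugation action of the whole group. They are extensional, so
  that those between finite subgroups form a finite set whose cardinality counts maps on
  \<open>K\<close>.\<close>

definition ghom :: "'a set \<Rightarrow> 'a set \<Rightarrow> ('a \<Rightarrow> 'a) set" where
  "ghom K L = {f \<in> K \<rightarrow>\<^sub>E L. (\<forall>x\<in>K. \<forall>y\<in>K. f (x \<otimes> y) = f x \<otimes> f y) \<and>
    (\<forall>g\<in>carrier G. \<forall>x\<in>K. f (g \<otimes> x \<otimes> inv g) = g \<otimes> f x \<otimes> inv g)}"

definition giso :: "'a set \<Rightarrow> 'a set \<Rightarrow> bool" where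
  "giso K L \<longleftrightarrow> (\<exists>f\<in>ghom K L. bij_betw f K L)"

lemma ghomD:
  assumes "f \<in> ghom K L"
  shows ghom_closed: "x \<in> K \<Longrightarrow> f x \<in> L" and ghom_ext: "f \<in> extensional K"
    and ghom_mult: "\<lbrakk>x \<in> K; y \<in> K\<rbrakk> \<Longrightarrow> f (x \<otimes> y) = f x \<otimes> f y"
    and ghom_conj: "\<lbrakk>g \<in> carrier G; x \<in> K\<rbrakk> \<Longrightarrow> f (g \<otimes> x \<otimes> inv g) = g \<otimes> f x \<otimes> inv g"
  using assms by (auto simp: ghom_def PiE_def)

lemma ghomI:
  assumes "\<And>x. x \<in> K \<Longrightarrow> f x \<in> L" "\<And>x y. \<lbrakk>x \<in> K; y \<in> K\<rbrakk> \<Longrightarrow> f (x \<otimes> y) = f x \<otimes> f y"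
    "\<And>g x. \<lbrakk>g \<in> carrier G; x \<in> K\<rbrakk> \<Longrightarrow> f (g \<otimes> x \<otimes> inv g) = g \<otimes> f x \<otimes> inv g" and K: "K \<lhd> G"
  shows "restrict f K \<in> ghom K L"
  using assms(1-3) normal_mult [OF K] normal_conj [OF K] by (auto simp: ghom_def)

lemma ghom_one:
  assumes f: "f \<in> ghom K L" and K: "K \<lhd> G" and L: "L \<lhd> G"
  shows "f \<one> = \<one>"
proof -
  have 1: "\<one> \<in> K" using normal_one [OF K] .
  have "f \<one> \<in> carrier G" using ghom_closed [OF f 1] normal_subset [OF L] by auto
  moreover have "f \<one> \<otimes> f \<one> = f \<one>" using ghom_mult [OF f 1 1] by simp
  ultimately show ?thesis by (metis l_cancel_one)
qed

lemma ghom_inv: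
  assumes f: "f \<in> ghom K L" and K: "K \<lhd> G" and L: "L \<lhd> G" and x: "x \<in> K"
  shows "f (inv x) = inv (f x)"
proof (rule inv_equality [symmetric])
  have xG: "x \<in> carrier G" and ix: "inv x \<in> K"
    using x normal_subset [OF K] normal_inv [OF K x] by auto
  show "f (inv x) \<otimes> f x = \<one>"
    using ghom_mult [OF f ix x] ghom_one [OF f K L] xG by simp
  show "f x \<in> carrier G" "f (inv x) \<in> carrier G"
    using ghom_closed [OF f] x ix normal_subset [OF L] by auto
qed

lemma ghom_kernel_normal:
  assumes f: "f \<in> ghom K L" and K: "K \<lhd> G" and L: "L \<lhd> G" and N: "N \<lhd> G"
  shows "{x \<in> K. f x \<in> N} \<lhd> G"
proof (rule normalI')
  show "{x \<in> K. f x \<in> N} \<subseteq> carrier G" using normal_subset [OF K] by auto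
  show "\<one> \<in> {x \<in> K. f x \<in> N}" using ghom_one [OF f K L] normal_one K N by auto
qed (use ghom_inv [OF f K L] ghom_mult [OF f] ghom_conj [OF f] K N in
    \<open>auto simp: normal_inv normal_mult normal_conj\<close>)

lemma ghom_image_normal:
  assumes f: "f \<in> ghom K L" and K: "K \<lhd> G" and L: "L \<lhd> G"
  shows "f ` K \<lhd> G"
proof (rule normalI')
  show "f ` K \<subseteq> carrier G" using normal_subset [OF L] ghom_closed [OF f] by auto
  show "\<one> \<in> f ` K" using ghom_one [OF f K L] normal_one [OF K] by force
next
  fix x assume "x \<in> f ` K"
  then obtain a where a: "a \<in> K" "x = f a" by blast
  show "inv x \<in> f ` K" using a ghom_inv [OF f K L a(1)] normal_inv [OF K a(1)] by force
  show "g \<otimes> x \<otimes> inv g \<in> f ` K" if "g \<in> carrier G" for g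
    using a ghom_conj [OF f that a(1)] normal_conj [OF K that a(1)] by force
  fix y assume "y \<in> f ` K"
  then obtain b where b: "b \<in> K" "y = f b" by blast
  show "x \<otimes> y \<in> f ` K" using a b ghom_mult [OF f a(1) b(1)] normal_mult [OF K a(1) b(1)] by force
qed

lemma ghom_inj_on:
  assumes f: "f \<in> ghom K L" and K: "K \<lhd> G" and L: "L \<lhd> G"
    and ker: "\<And>x. \<lbrakk>x \<in> K; f x = \<one>\<rbrakk> \<Longrightarrow> x = \<one>"
  shows "inj_on f K"
proof (rule inj_onI)
  fix x y assume xy: "x \<in> K" "y \<in> K" "f x = f y"
  have G: "x \<in> carrier G" "y \<in> carrier G" "f y \<in> carrier G"
    using xy normal_subset [OF K] normal_subset [OF L] ghom_closed [OF f] by auto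
  have iy: "inv y \<in> K" by (rule normal_inv [OF K xy(2)])
  have "f (x \<otimes> inv y) = \<one>"
    using xy G ghom_mult [OF f xy(1) iy] ghom_inv [OF f K L xy(2)] by simp
  then have "x \<otimes> inv y = \<one>" by (rule ker [OF normal_mult [OF K xy(1) iy]])
  then show "x = y" using G by (metis inv_closed inv_equality inv_inv)
qed

lemma ghom_min_normal_cases:
  assumes K: "min_normal K" and L: "L \<lhd> G" and f: "f \<in> ghom K L"
  shows "(\<forall>x\<in>K. f x = \<one>) \<or> inj_on f K"
proof -
  note Kn = min_normalD(1) [OF K]
  have "{x \<in> K. f x \<in> {\<one>}} \<lhd> G" by (rule ghom_kernel_normal [OF f Kn L one_is_normal])
  then have "{x \<in> K. f x \<in> {\<one>}} = {\<one>} \<or> {x \<in> K. f x \<in> {\<one>}} = K" by (intro min_normalD(4) [OF K]) auto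
  then show ?thesis using ghom_inj_on [OF f Kn L] by blast
qed

text \<open>Schur's lemma: kernel and image are normal in the whole group.\<close>

lemma ghom_min_normal_bij:
  assumes K: "min_normal K" and L: "min_normal L" and f: "f \<in> ghom K L" and x: "x \<in> K" "f x \<noteq> \<one>"
  shows "bij_betw f K L"
proof -
  note Kn = min_normalD(1) [OF K] and Ln = min_normalD(1) [OF L]
  have inj: "inj_on f K" using ghom_min_normal_cases [OF K Ln f] x by blast
  have "f ` K \<subseteq> L" using ghom_closed [OF f] by auto
  then have "f ` K = {\<one>} \<or> f ` K = L" by (intro min_normalD(4) [OF L] ghom_image_normal [OF f Kn Ln])
  then have "f ` K = L" using x by blast
  then show ?thesis using inj by (simp add: bij_betw_def)
qed

lemma min_normal_image:
  assumes K: "min_normal K" and L: "L \<lhd> G" and f: "f \<in> ghom K L" and inj: "inj_on f K"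
  shows "min_normal (f ` K)"
  unfolding min_normal_def
proof (intro conjI allI impI)
  note Kn = min_normalD [OF K]
  show "f ` K \<lhd> G" by (rule ghom_image_normal [OF f Kn(1) L])
  show "finite (f ` K)" using Kn(2) by simp
  obtain x where x: "x \<in> K" "x \<noteq> \<one>" by (rule min_normal_nontrivial [OF K])
  have "f x \<noteq> f \<one>" using inj x normal_one [OF Kn(1)] by (auto simp: inj_on_def)
  then show "f ` K \<noteq> {\<one>}" using x ghom_one [OF f Kn(1) L] by auto
  fix N assume N: "N \<lhd> G \<and> N \<subseteq> f ` K"
  have "{x \<in> K. f x \<in> N} \<lhd> G" using N by (intro ghom_kernel_normal [OF f Kn(1) L]) auto
  then have "{x \<in> K. f x \<in> N} = {\<one>} \<or> {x \<in> K. f x \<in> N} = K" by (intro Kn(4)) auto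
  moreover have "N = f ` {x \<in> K. f x \<in> N}" using N by auto
  ultimately show "N = {\<one>} \<or> N = f ` K" using ghom_one [OF f Kn(1) L] by auto
qed

lemma ghom_compose:
  assumes "K \<lhd> G" "f \<in> ghom K L" "h \<in> ghom L M"
  shows "restrict (\<lambda>x. h (f x)) K \<in> ghom K M"
  using assms by (intro ghomI) (auto simp: ghomD)

lemma ghom_inv_into:
  assumes K: "K \<lhd> G" and L: "L \<lhd> G" and f: "f \<in> ghom K L" "bij_betw f K L"
  shows "restrict (inv_into K f) L \<in> ghom L K"
proof (rule ghomI [OF _ _ _ L])
  have s: "f (inv_into K f x) = x" "inv_into K f x \<in> K" if "x \<in> L" for x
    using f(2) that by (auto simp: bij_betw_def f_inv_into_f inv_into_into)
  have u: "inv_into K f (f x) = x" if "x \<in> K" for x using f(2) that by (auto simp: bij_betw_def)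
  show "inv_into K f x \<in> K" if "x \<in> L" for x using s that by blast
  show "inv_into K f (x \<otimes> y) = inv_into K f x \<otimes> inv_into K f y" if "x \<in> L" "y \<in> L" for x y
    using u [of "inv_into K f x \<otimes> inv_into K f y"] s that ghom_mult [OF f(1)] normal_mult [OF K] by simp
  show "inv_into K f (g \<otimes> x \<otimes> inv g) = g \<otimes> inv_into K f x \<otimes> inv g" if "g \<in> carrier G" "x \<in> L" for g x
    using u [of "g \<otimes> inv_into K f x \<otimes> inv g"] s that ghom_conj [OF f(1)] normal_conj [OF K] by simp
qed

lemma giso_refl: "K \<lhd> G \<Longrightarrow> giso K K"
  unfolding giso_def using ghomI [of K "\<lambda>x. x" K]
  by (intro bexI [of _ "restrict (\<lambda>x. x) K"]) (auto simp: bij_betw_def inj_on_def)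

lemma giso_sym: assumes "K \<lhd> G" "L \<lhd> G" "giso K L" shows "giso L K"
proof -
  obtain f where f: "f \<in> ghom K L" "bij_betw f K L" using assms by (auto simp: giso_def)
  have "bij_betw (restrict (inv_into K f) L) L K"
    using bij_betw_inv_into [OF f(2)] by (simp cong: bij_betw_cong)
  then show ?thesis using ghom_inv_into [OF assms(1,2) f] unfolding giso_def by blast
qed

lemma giso_trans: assumes "K \<lhd> G" "giso K L" "giso L M" shows "giso K M"
proof -
  obtain f h where f: "f \<in> ghom K L" "bij_betw f K L" and h: "h \<in> ghom L M" "bij_betw h L M"
    using assms by (auto simp: giso_def)
  have "bij_betw (restrict (\<lambda>x. h (f x)) K) K M"
    using bij_betw_trans [OF f(2) h(2)] by (simp add: o_def cong: bij_betw_cong)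
  then show ?thesis using ghom_compose [OF assms(1) f(1) h(1)] unfolding giso_def by blast
qed

lemma finite_ghom: "\<lbrakk>finite K; finite L\<rbrakk> \<Longrightarrow> finite (ghom K L)"
  by (rule finite_subset [of _ "K \<rightarrow>\<^sub>E L"]) (auto simp: ghom_def intro: finite_PiE)

lemma card_ghom_le:
  assumes n: "K \<lhd> G" "K' \<lhd> G" "L \<lhd> G" "L' \<lhd> G" and fin: "finite K'" "finite L'"
    and k: "giso K' K" and l: "giso L L'"
  shows "card (ghom K L) \<le> card (ghom K' L')"
proof -
  obtain f h where f: "f \<in> ghom K' K" "bij_betw f K' K" and h: "h \<in> ghom L L'" "bij_betw h L L'"
    using k l by (auto simp: giso_def)
  define \<Theta> where "\<Theta> = (\<lambda>\<theta>. restrict (\<lambda>x. h (\<theta> (f x))) K')"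
  have "\<Theta> \<theta> \<in> ghom K' L'" if "\<theta> \<in> ghom K L" for \<theta>
    unfolding \<Theta>_def using f(1) h(1) that n(2) by (intro ghomI) (auto simp: ghomD)
  moreover have "inj_on \<Theta> (ghom K L)"
  proof (rule inj_onI)
    fix \<theta> \<theta>' assume t: "\<theta> \<in> ghom K L" "\<theta>' \<in> ghom K L" and eq: "\<Theta> \<theta> = \<Theta> \<theta>'"
    show "\<theta> = \<theta>'"
    proof (rule extensionalityI [of _ K])
      fix x assume "x \<in> K"
      then obtain y where y: "y \<in> K'" "f y = x" using f(2) by (auto simp: bij_betw_def)
      have "h (\<theta> x) = h (\<theta>' x)" using fun_cong [OF eq, of y] y by (simp add: \<Theta>_def)
      then show "\<theta> x = \<theta>' x"
        using h(2) ghom_closed [OF t(1)] ghom_closed [OF t(2)] \<open>x \<in> K\<close> by (auto simp: bij_betw_def inj_on_def)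
    qed (use t in \<open>auto simp: ghom_ext\<close>)
  qed
  ultimately show ?thesis using fin by (intro card_inj_on_le [of \<Theta>]) (auto intro: finite_ghom)
qed


subsection \<open>Internal direct products\<close>

definition lpart :: "'a set \<Rightarrow> 'a set \<Rightarrow> 'a \<Rightarrow> 'a" where
  "lpart A B x = (THE a. a \<in> A \<and> (\<exists>b\<in>B. x = a \<otimes> b))"

definition rpart :: "'a set \<Rightarrow> 'a set \<Rightarrow> 'a \<Rightarrow> 'a" where
  "rpart A B x = inv (lpart A B x) \<otimes> x"

definition gprod :: "'a set \<Rightarrow> 'a set \<Rightarrow> bool" where
  "gprod A B \<longleftrightarrow> A \<lhd> G \<and> B \<lhd> G \<and> A \<inter> B = {\<one>}"

lemma gprodD:
  assumes "gprod A B"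
  shows "A \<lhd> G" "B \<lhd> G" "A \<inter> B = {\<one>}" "\<And>x. x \<in> A \<Longrightarrow> x \<in> carrier G" "\<And>x. x \<in> B \<Longrightarrow> x \<in> carrier G"
    "\<And>x y. \<lbrakk>x \<in> A; y \<in> B\<rbrakk> \<Longrightarrow> y \<otimes> x = x \<otimes> y"
  using assms normal_subset normal_commute [of A B] unfolding gprod_def by (blast, blast, blast, blast, blast, metis)

lemma lpart_eq:
  assumes P: "gprod A B" and a: "a \<in> A" and b: "b \<in> B"
  shows "lpart A B (a \<otimes> b) = a" "rpart A B (a \<otimes> b) = b"
proof -
  note P = gprodD [OF P]
  show l: "lpart A B (a \<otimes> b) = a"
    unfolding lpart_def
  proof (rule the_equality)
    fix a' assume "a' \<in> A \<and> (\<exists>b'\<in>B. a \<otimes> b = a' \<otimes> b')"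
    then obtain b' where a': "a' \<in> A" and b': "b' \<in> B" and eq: "a \<otimes> b = a' \<otimes> b'" by blast
    have "inv a' \<otimes> (a \<otimes> b) \<otimes> inv b = inv a' \<otimes> (a' \<otimes> b') \<otimes> inv b" using eq by simp
    then have "inv a' \<otimes> a = b' \<otimes> inv b" using P(4,5) a a' b b' by (simp add: word_simps)
    moreover have "inv a' \<otimes> a \<in> A" using a a' P(1) by (simp add: normal_mult normal_inv)
    moreover have "b' \<otimes> inv b \<in> B" using b b' P(2) by (simp add: normal_mult normal_inv)
    ultimately have "inv a' \<otimes> a = \<one>" using P(3) by auto
    then show "a' = a" using P(4) a a' by (metis inv_closed inv_equality inv_inv)
  qed (use a b in auto)
  show "rpart A B (a \<otimes> b) = b" unfolding rpart_def l using P(4,5) a b by (simp add: word_simps)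
qed

lemma gprodE:
  assumes "gprod A B" "x \<in> A <#> B"
  obtains a b where "a \<in> A" "b \<in> B" "x = a \<otimes> b" "lpart A B x = a" "rpart A B x = b"
  using assms lpart_eq unfolding set_mult_def by blast

lemma lpart_mult:
  assumes P: "gprod A B" and x: "x \<in> A <#> B" and y: "y \<in> A <#> B"
  shows "lpart A B (x \<otimes> y) = lpart A B x \<otimes> lpart A B y"
    and "rpart A B (x \<otimes> y) = rpart A B x \<otimes> rpart A B y"
proof -
  note Pd = gprodD [OF P]
  obtain a b where a: "a \<in> A" "b \<in> B" "x = a \<otimes> b" "lpart A B x = a" "rpart A B x = b" by (rule gprodE [OF P x])
  obtain a' b' where a': "a' \<in> A" "b' \<in> B" "y = a' \<otimes> b'" "lpart A B y = a'" "rpart A B y = b'" by (rule gprodE [OF P y])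
  have "x \<otimes> y = a \<otimes> (b \<otimes> a') \<otimes> b'" using a a' Pd(4,5) by (simp add: m_assoc)
  also have "\<dots> = (a \<otimes> a') \<otimes> (b \<otimes> b')" using a a' Pd(4,5) Pd(6) [OF a'(1) a(2)] by (simp add: m_assoc)
  finally have e: "x \<otimes> y = (a \<otimes> a') \<otimes> (b \<otimes> b')" .
  show "lpart A B (x \<otimes> y) = lpart A B x \<otimes> lpart A B y" "rpart A B (x \<otimes> y) = rpart A B x \<otimes> rpart A B y"
    unfolding e a(4,5) a'(4,5) using a a' Pd(1,2) by (auto intro!: lpart_eq P normal_mult)
qed

lemma lpart_conj:
  assumes P: "gprod A B" and x: "x \<in> A <#> B" and g: "g \<in> carrier G"
  shows "lpart A B (g \<otimes> x \<otimes> inv g) = g \<otimes> lpart A B x \<otimes> inv g"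
    and "rpart A B (g \<otimes> x \<otimes> inv g) = g \<otimes> rpart A B x \<otimes> inv g"
proof -
  note Pd = gprodD [OF P]
  obtain a b where a: "a \<in> A" "b \<in> B" "x = a \<otimes> b" "lpart A B x = a" "rpart A B x = b" by (rule gprodE [OF P x])
  have e: "g \<otimes> x \<otimes> inv g = (g \<otimes> a \<otimes> inv g) \<otimes> (g \<otimes> b \<otimes> inv g)"
    using a Pd(4,5) g by (simp add: word_simps)
  show "lpart A B (g \<otimes> x \<otimes> inv g) = g \<otimes> lpart A B x \<otimes> inv g"
    "rpart A B (g \<otimes> x \<otimes> inv g) = g \<otimes> rpart A B x \<otimes> inv g"
    unfolding e a(4,5) using a Pd(1,2) g by (auto intro!: lpart_eq P normal_conj)
qed

lemma lpart_closed:
  assumes P: "gprod A B" and x: "x \<in> A <#> B"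
  shows "lpart A B x \<in> A" "rpart A B x \<in> B" "x = lpart A B x \<otimes> rpart A B x"
  by (rule gprodE [OF P x], simp)+

lemma part_ghom:
  assumes P: "gprod A B" and K: "K \<lhd> G" "K \<subseteq> A <#> B"
  shows "restrict (lpart A B) K \<in> ghom K A" "restrict (rpart A B) K \<in> ghom K B"
proof -
  have AB: "x \<in> A <#> B" if "x \<in> K" for x using that K(2) by blast
  show "restrict (lpart A B) K \<in> ghom K A"
    by (intro ghomI K(1) lpart_closed(1) [OF P] lpart_mult(1) [OF P] lpart_conj(1) [OF P] AB)
  show "restrict (rpart A B) K \<in> ghom K B"
    by (intro ghomI K(1) lpart_closed(2) [OF P] lpart_mult(2) [OF P] lpart_conj(2) [OF P] AB)
qed

text \<open>If \<open>K\<close> does not lie in the join of the remaining members, that join and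
  \<open>B\<close> form a direct product, and the projection of \<open>K\<close> to \<open>B\<close>
  is nontrivial, hence an isomorphism.\<close>

lemma giso_of_join:
  assumes "finite \<S>" "\<And>N. N \<in> \<S> \<Longrightarrow> min_normal N" and K: "min_normal K" "K \<subseteq> join \<S>"
  shows "\<exists>B\<in>\<S>. giso K B"
  using assms(1,2) K(2)
proof (induction \<S> rule: finite_induct)
  case empty
  then show ?case using min_normal_nontrivial [OF K(1)] by (auto simp: join_empty)
next
  case (insert B \<S>)
  have B: "min_normal B" and n: "\<And>N. N \<in> insert B \<S> \<Longrightarrow> N \<lhd> G" using insert.prems min_normalD(1) by auto
  have J: "join \<S> \<lhd> G" using n by (intro join_normal) auto
  show ?case
  proof (cases "K \<subseteq> join \<S>")
    case True
    then show ?thesis using insert by auto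
  next
    case False
    then have KJ: "K \<inter> join \<S> = {\<one>}" by (rule min_normal_Int [OF K(1) J])
    have "\<not> B \<subseteq> join \<S>"
      using False insert.prems(2) join_least [OF J, of "insert B \<S>"] join_upper by blast
    then have P: "gprod B (join \<S>)"
      unfolding gprod_def using min_normal_Int [OF B J] min_normalD(1) [OF B] J by blast
    have sub: "K \<subseteq> B <#> join \<S>" using insert.prems(2) join_insert_subset [of B \<S>] n by blast
    note f = part_ghom(1) [OF P min_normalD(1) [OF K(1)] sub]
    obtain x where x: "x \<in> K" "x \<noteq> \<one>" by (rule min_normal_nontrivial [OF K(1)])
    have "lpart B (join \<S>) x \<noteq> \<one>"
    proof
      assume 1: "lpart B (join \<S>) x = \<one>"
      obtain a b where "b \<in> join \<S>" "x = a \<otimes> b" "lpart B (join \<S>) x = a"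
        using gprodE [OF P] sub x by blast
      then have "x \<in> join \<S>" using 1 gprodD(5) [OF P] by auto
      then show False using KJ x by blast
    qed
    then have "bij_betw (restrict (lpart B (join \<S>)) K) K B"
      using x by (intro ghom_min_normal_bij [OF K(1) B f, of x]) auto
    then show ?thesis using f unfolding giso_def by blast
  qed
qed

section \<open>Counting the minimal normal subgroups of a direct product\<close>

definition graph :: "'a set \<Rightarrow> ('a \<Rightarrow> 'a) \<Rightarrow> 'a set" where
  "graph K \<theta> = (\<lambda>x. x \<otimes> \<theta> x) ` K"

lemma min_normal_graph:
  assumes P: "gprod A V" and K: "min_normal K" "K \<subseteq> A" and t: "\<theta> \<in> ghom K V"
  shows "min_normal (graph K \<theta>)" "graph K \<theta> \<subseteq> A <#> V" "graph K \<theta> \<inter> V = {\<one>}"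
    "\<And>x. x \<in> graph K \<theta> \<Longrightarrow> lpart A V x \<in> K \<and> rpart A V x = \<theta> (lpart A V x)"
proof -
  note Pd = gprodD [OF P]
  note Kn = min_normalD(1) [OF K(1)]
  have KG: "x \<in> carrier G" if "x \<in> K" for x using that K(2) Pd(4) by blast
  have tV: "\<theta> x \<in> V" "\<theta> x \<in> carrier G" if "x \<in> K" for x using that ghom_closed [OF t] Pd(5) by blast+
  let ?f = "restrict (\<lambda>x. x \<otimes> \<theta> x) K"
  have im: "?f ` K = graph K \<theta>" by (simp add: graph_def)
  show sub: "graph K \<theta> \<subseteq> A <#> V" using K tV by (auto simp: graph_def set_mult_def)
  have AV: "A <#> V \<lhd> G" by (rule normal_set_mult [OF Pd(1,2)])
  have f: "?f \<in> ghom K (A <#> V)"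
  proof (rule ghomI [OF _ _ _ Kn])
    show "x \<otimes> \<theta> x \<in> A <#> V" if "x \<in> K" for x using that K tV by (auto simp: set_mult_def)
    show "x \<otimes> y \<otimes> \<theta> (x \<otimes> y) = x \<otimes> \<theta> x \<otimes> (y \<otimes> \<theta> y)" if xy: "x \<in> K" "y \<in> K" for x y
    proof -
      have "x \<otimes> \<theta> x \<otimes> (y \<otimes> \<theta> y) = x \<otimes> (\<theta> x \<otimes> y) \<otimes> \<theta> y" using xy KG tV by (simp add: m_assoc)
      also have "\<theta> x \<otimes> y = y \<otimes> \<theta> x" using Pd(6) [of y "\<theta> x"] xy K tV by blast
      finally show ?thesis using xy KG tV by (simp add: ghom_mult [OF t] m_assoc)
    qed
    show "g \<otimes> x \<otimes> inv g \<otimes> \<theta> (g \<otimes> x \<otimes> inv g) = g \<otimes> (x \<otimes> \<theta> x) \<otimes> inv g" if "g \<in> carrier G" "x \<in> K" for g x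
      unfolding ghom_conj [OF t that] using that KG tV by (simp add: word_simps)
  qed
  have parts: "lpart A V (x \<otimes> \<theta> x) = x \<and> rpart A V (x \<otimes> \<theta> x) = \<theta> x" if "x \<in> K" for x
    using lpart_eq [OF P] that K tV by blast
  then show "\<And>x. x \<in> graph K \<theta> \<Longrightarrow> lpart A V x \<in> K \<and> rpart A V x = \<theta> (lpart A V x)"
    by (auto simp: graph_def)
  have inj: "inj_on ?f K" using parts by (auto simp: inj_on_def) metis
  show mn: "min_normal (graph K \<theta>)" unfolding im [symmetric] by (rule min_normal_image [OF K(1) AV f inj])
  have "x = \<one>" if x: "x \<in> graph K \<theta>" "x \<in> V" for x
  proof -
    obtain k where k: "k \<in> K" "x = k \<otimes> \<theta> k" using x by (auto simp: graph_def)
    have "lpart A V x = \<one>" using lpart_eq(1) [OF P normal_one [OF Pd(1)] x(2)] Pd(5) [OF x(2)] by simp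
    then have "k = \<one>" using parts k by simp
    then show ?thesis using k ghom_one [OF t Kn Pd(2)] by simp
  qed
  then show "graph K \<theta> \<inter> V = {\<one>}" using normal_one min_normalD(1) [OF mn] Pd(2) by blast
qed

lemma graph_inject:
  assumes P: "gprod A V" and K: "K \<subseteq> A" "\<theta> \<in> ghom K V" and K': "K' \<subseteq> A" "\<theta>' \<in> ghom K' V"
    and eq: "graph K \<theta> = graph K' \<theta>'"
  shows "K = K' \<and> \<theta> = \<theta>'"
proof -
  have sub: "x \<in> K' \<and> \<theta>' x = \<theta> x"
    if K: "K \<subseteq> A" "\<theta> \<in> ghom K V" and K': "K' \<subseteq> A" "\<theta>' \<in> ghom K' V"
      and eq: "graph K \<theta> = graph K' \<theta>'" and x: "x \<in> K" for K K' \<theta> \<theta>' x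
  proof -
    have "x \<otimes> \<theta> x \<in> graph K' \<theta>'" using x eq by (auto simp: graph_def)
    then obtain y where y: "y \<in> K'" "x \<otimes> \<theta> x = y \<otimes> \<theta>' y" by (auto simp: graph_def)
    have "lpart A V (x \<otimes> \<theta> x) = x" "rpart A V (x \<otimes> \<theta> x) = \<theta> x"
      using lpart_eq [OF P] x K ghom_closed [OF K(2)] by blast+
    moreover have "lpart A V (y \<otimes> \<theta>' y) = y" "rpart A V (y \<otimes> \<theta>' y) = \<theta>' y"
      using lpart_eq [OF P] y K' ghom_closed [OF K'(2)] by blast+
    ultimately show ?thesis using y by simp
  qed
  have "K = K'" using sub [OF K K' eq] sub [OF K' K eq [symmetric]] by blast
  moreover have "\<theta> = \<theta>'"
    using sub [OF K' K eq [symmetric]] ghom_ext [OF K(2)] ghom_ext [OF K'(2)] \<open>K = K'\<close>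
    by (intro extensionalityI [of _ K]) auto
  ultimately show ?thesis ..
qed

definition min_normals :: "'a set \<Rightarrow> 'a set set" where
  "min_normals A = {K. min_normal K \<and> K \<subseteq> A}"

lemma finite_min_normals: "finite A \<Longrightarrow> finite (min_normals A)"
  by (rule finite_subset [of _ "Pow A"]) (auto simp: min_normals_def)

text \<open>A minimal normal subgroup other than \<open>V\<close> meets \<open>V\<close> trivially,
  so it projects injectively to \<open>A\<close> and is the graph of a homomorphism from its
  projection to \<open>V\<close>.\<close>

lemma min_normals_prod:
  assumes P: "gprod A V" and V: "min_normal V"
  shows "min_normals (A <#> V) = insert V ((\<lambda>(K, \<theta>). graph K \<theta>) ` (SIGMA K:min_normals A. ghom K V))"
    (is "_ = ?R")
proof
  note Pd = gprodD [OF P]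
  show "?R \<subseteq> min_normals (A <#> V)"
  proof
    fix L assume "L \<in> ?R"
    then consider "L = V" | K \<theta> where "min_normal K" "K \<subseteq> A" "\<theta> \<in> ghom K V" "L = graph K \<theta>"
      by (auto simp: min_normals_def)
    then show "L \<in> min_normals (A <#> V)"
    proof cases
      case 1
      then show ?thesis using V normal_set_mult(3) [OF Pd(1,2)] by (simp add: min_normals_def)
    next
      case 2
      then show ?thesis
        using min_normal_graph(1,2) [OF P 2(1-3)] by (simp add: min_normals_def)
    qed
  qed
  show "min_normals (A <#> V) \<subseteq> ?R"
  proof
    fix K assume "K \<in> min_normals (A <#> V)"
    then have K: "min_normal K" "K \<subseteq> A <#> V" by (auto simp: min_normals_def)
    show "K \<in> ?R"
    proof (cases "K = V")
      case False
      then have KV: "K \<inter> V = {\<one>}" by (rule min_normal_distinct [OF K(1) V])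
      note Kn = min_normalD(1) [OF K(1)]
      define l where "l = restrict (lpart A V) K"
      have l: "l \<in> ghom K A" unfolding l_def by (rule part_ghom(1) [OF P Kn K(2)])
      have inj: "inj_on l K"
      proof (rule ghom_inj_on [OF l Kn Pd(1)])
        fix x assume x: "x \<in> K" "l x = \<one>"
        have "x = l x \<otimes> rpart A V x" "rpart A V x \<in> V"
          using lpart_closed [OF P, of x] K x by (auto simp: l_def)
        then have "x \<in> V" using x Pd(5) by simp
        then show "x = \<one>" using KV x by blast
      qed
      let ?K' = "l ` K"
      have K': "min_normal ?K'" by (rule min_normal_image [OF K(1) Pd(1) l inj])
      have K'A: "?K' \<subseteq> A" using ghom_closed [OF l] by auto
      have bij: "bij_betw l K ?K'" using inj by (simp add: bij_betw_def)
      have l': "l \<in> ghom K ?K'" using l by (auto simp: ghom_def)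
      define \<theta> where "\<theta> = restrict (\<lambda>x. restrict (rpart A V) K (restrict (inv_into K l) ?K' x)) ?K'"
      have t: "\<theta> \<in> ghom ?K' V"
        unfolding \<theta>_def
        by (rule ghom_compose [OF min_normalD(1) [OF K'] ghom_inv_into [OF Kn min_normalD(1) [OF K'] l' bij]
              part_ghom(2) [OF P Kn K(2)]])
      have "\<theta> (l x) = rpart A V x" if "x \<in> K" for x
        using that inj by (simp add: \<theta>_def)
      then have "l x \<otimes> \<theta> (l x) = x" if "x \<in> K" for x
        using lpart_closed(3) [OF P, of x] K(2) that by (auto simp: l_def)
      then have gr: "graph ?K' \<theta> = K" by (force simp: graph_def image_image)
      have "(?K', \<theta>) \<in> (SIGMA K:min_normals A. ghom K V)" using K' K'A t by (simp add: min_normals_def)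
      then have "K \<in> (\<lambda>(K, \<theta>). graph K \<theta>) ` (SIGMA K:min_normals A. ghom K V)"
        by (rule rev_image_eqI) (simp add: gr)
      then show ?thesis by (rule insertI2)
    qed auto
  qed
qed

text \<open>The recursion for the points of a projective space over a ring of
  \<open>q = card (ghom X X)\<close> elements: one more dimension turns \<open>p\<close> points into
  \<open>1 + p q\<close>, that is, 1, 1 + q, 1 + q + q^2 and so on.\<close>

lemma card_min_normals_prod:
  assumes P: "gprod A V" and V: "min_normal V" and A: "finite A"
    and X: "X \<lhd> G" "finite X" and iso: "\<And>K. K \<in> min_normals (A <#> V) \<Longrightarrow> giso K X"
  shows "card (min_normals (A <#> V)) = 1 + card (min_normals A) * card (ghom X X)"
proof -
  note Pd = gprodD [OF P]
  note Vn = min_normalD [OF V]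
  have inj: "inj_on (\<lambda>(K, \<theta>). graph K \<theta>) (SIGMA K:min_normals A. ghom K V)"
    using graph_inject [OF P] by (auto simp: inj_on_def min_normals_def)
  have notin: "V \<notin> (\<lambda>(K, \<theta>). graph K \<theta>) ` (SIGMA K:min_normals A. ghom K V)"
  proof
    assume "V \<in> (\<lambda>(K, \<theta>). graph K \<theta>) ` (SIGMA K:min_normals A. ghom K V)"
    then obtain K \<theta> where "min_normal K" "K \<subseteq> A" "\<theta> \<in> ghom K V" "V = graph K \<theta>" by (auto simp: min_normals_def)
    then have "V \<inter> V = {\<one>}" using min_normal_graph(3) [OF P] by metis
    then show False using Vn(3) by simp
  qed
  have fin: "finite (min_normals A)" by (rule finite_min_normals [OF A])
  have Kf: "finite K" "K \<lhd> G" if "K \<in> min_normals A" for K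
    using that min_normalD by (auto simp: min_normals_def)
  have cardg: "card (ghom K V) = card (ghom X X)" if K: "K \<in> min_normals A" for K
  proof -
    have "K \<in> min_normals (A <#> V)" "V \<in> min_normals (A <#> V)"
      using K V normal_set_mult [OF Pd(1,2)] by (auto simp: min_normals_def)
    then have i: "giso K X" "giso V X" by (auto intro: iso)
    have "giso X K" "giso X V" using i Kf [OF K] Vn(1) X by (auto intro: giso_sym)
    then show ?thesis
      using i Kf [OF K] Vn X by (intro antisym card_ghom_le) auto
  qed
  have "card (SIGMA K:min_normals A. ghom K V) = (\<Sum>K\<in>min_normals A. card (ghom K V))"
    using fin Kf Vn by (intro card_SigmaI) (auto intro: finite_ghom)
  also have "\<dots> = card (min_normals A) * card (ghom X X)" by (simp add: cardg)
  finally have c: "card (SIGMA K:min_normals A. ghom K V) = card (min_normals A) * card (ghom X X)" .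
  have "finite (SIGMA K:min_normals A. ghom K V)"
    by (intro finite_SigmaI fin finite_ghom Kf(1) Vn(2))
  then show ?thesis
    unfolding min_normals_prod [OF P V] using notin by (simp add: card_image [OF inj] c)
qed

end

section \<open>Minimal blocked families\<close>

context group
begin

text \<open>The consequence of P(k) that the structure theory uses. It speaks of subgroups instead
  of elements, so it applies to families obtained by shrinking or projecting.\<close>

definition unblocked_upto :: "nat \<Rightarrow> bool" where
  "unblocked_upto k \<longleftrightarrow> (\<forall>\<N>. finite \<N> \<and> card \<N> \<le> k \<and>
    (\<forall>N\<in>\<N>. N \<lhd> G \<and> finite N \<and> N \<noteq> {\<one>}) \<longrightarrow> \<not> blocked \<N>)"

lemma unblocked_uptoD:
  "\<lbrakk>unblocked_upto k; finite \<N>; card \<N> \<le> k; \<And>N. N \<in> \<N> \<Longrightarrow> N \<lhd> G \<and> finite N \<and> N \<noteq> {\<one>}\<rbrakk> \<Longrightarrow> \<not> blocked \<N>"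
  unfolding unblocked_upto_def by blast

lemma property_P_unblocked:
  assumes P: "property_P G k" shows "unblocked_upto k"
  unfolding unblocked_upto_def
proof (intro allI impI)
  fix \<N> assume N: "finite \<N> \<and> card \<N> \<le> k \<and> (\<forall>N\<in>\<N>. N \<lhd> G \<and> finite N \<and> N \<noteq> {\<one>})"
  then have "\<exists>x. x \<in> N \<and> x \<noteq> \<one>" if "N \<in> \<N>" for N using that normal_one by blast
  then obtain c where c: "\<And>N. N \<in> \<N> \<Longrightarrow> c N \<in> N \<and> c N \<noteq> \<one>" by metis
  have "c ` \<N> \<subseteq> carrier G" using c N normal_subset by blast
  moreover have "card (c ` \<N>) \<le> k" using N card_image_le [of \<N> c] by simp
  ultimately have "irreducibly_faithful G (c ` \<N>)" using P N by (simp add: property_P_def)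
  then obtain H :: "('a \<Rightarrow> complex) cinner_space" and \<pi> where
    I: "irreducible_unitary_representation G H \<pi>" and f: "\<And>x. x \<in> c ` \<N> \<Longrightarrow> x \<noteq> \<one> \<Longrightarrow> \<pi> x \<noteq> \<one>\<^bsub>unitary_group H\<^esub>"
    unfolding irreducibly_faithful_def by blast
  interpret I: irreducible_unitary_representation G H \<pi> by fact
  show "\<not> blocked \<N>"
  proof (rule I.not_blocked_if_nontrivial)
    fix M assume M: "M \<in> \<N>"
    have "c M \<notin> I.rep_kernel"
      using f [of "c M"] c [OF M] M N normal_subset [of M] I.kernel_iff [of "c M"] by blast
    then show "M \<lhd> G \<and> finite M \<and> \<not> M \<subseteq> I.rep_kernel" using M N c by blast
  qed (use N in blast)
qed

lemma unfaithful_blocked: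
  assumes cnt: "countable (carrier G)" and F: "finite F" "F \<subseteq> carrier G" and nf: "\<not> irreducibly_faithful G F"
  obtains D where "D \<subseteq> F" "\<one> \<notin> D" "\<And>d. d \<in> D \<Longrightarrow> finite (normal_closure {d})"
    "blocked ((\<lambda>d. normal_closure {d}) ` D)"
proof (rule that)
  define D where "D = {x \<in> F. x \<noteq> \<one> \<and> finite (normal_closure {x})}"
  have "{normal_closure {x} | x. x \<in> F \<and> x \<noteq> \<one> \<and> finite (normal_closure {x})} = (\<lambda>d. normal_closure {d}) ` D"
    by (auto simp: D_def)
  then show "blocked ((\<lambda>d. normal_closure {d}) ` D)"
    using irreducibly_faithful_if_not_blocked [OF cnt F] nf by auto
  show "finite (normal_closure {d})" if "d \<in> D" for d using that by (simp add: D_def)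
  show "D \<subseteq> F" "\<one> \<notin> D" by (auto simp: D_def)
qed

lemma normal_closure_elem:
  assumes "x \<in> carrier G"
  shows "normal_closure {x} \<lhd> G" "x \<in> normal_closure {x}"
  using normal_closure_normal [of "{x}"] normal_closure_superset [of "{x}"] assms by auto

text \<open>Distinct members centralise each other. By \<open>blocked_insert_subset\<close> each
  member lies in the join of the others, so it centralises itself too.\<close>

lemma abelian_if_blocked:
  assumes fin: "finite \<K>" and mn: "\<And>K. K \<in> \<K> \<Longrightarrow> min_normal K"
    and bl: "blocked \<K>" and nb: "\<And>K. K \<in> \<K> \<Longrightarrow> \<not> blocked (\<K> - {K})"
    and x: "x \<in> join \<K>" and y: "y \<in> join \<K>"
  shows "x \<otimes> y = y \<otimes> x"
proof -
  have n: "K \<lhd> G" if "K \<in> \<K>" for K by (rule min_normalD(1) [OF mn [OF that]])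
  have M: "join \<K> \<lhd> G" using n by (rule join_normal)
  have com: "K' \<subseteq> centralizer K" if K: "K \<in> \<K>" "K' \<in> \<K>" "K' \<noteq> K" for K K'
  proof
    fix a assume a: "a \<in> K'"
    have "a \<otimes> b = b \<otimes> a" if "b \<in> K" for b
      using normal_commute [OF n [OF K(2)] n [OF K(1)] min_normal_distinct [OF mn [OF K(2)] mn [OF K(1)] K(3)] a that] .
    then show "a \<in> centralizer K" using a normal_subset [OF n [OF K(2)]] by (auto simp: centralizer_def)
  qed
  have cent: "join \<K> \<subseteq> centralizer K" if K: "K \<in> \<K>" for K
  proof (rule join_least [OF centralizer_normal [OF n [OF K]]])
    fix K' assume K': "K' \<in> \<K>"
    have "K \<subseteq> join (\<K> - {K})"
    proof (rule blocked_insert_subset [OF nb [OF K]])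
      show "blocked (insert K (\<K> - {K}))" using bl K by (simp add: insert_absorb)
      show "join (\<K> - {K}) \<lhd> G" using n by (intro join_normal) auto
      show "K'' \<lhd> G \<and> K'' \<subseteq> join (\<K> - {K})" if "K'' \<in> \<K> - {K}" for K''
        using n [of K''] join_upper [OF that] that by simp
    qed (use n [OF K] min_normalD(2) [OF mn [OF K]] in auto)
    also have "\<dots> \<subseteq> centralizer K"
      using com K by (intro join_least centralizer_normal n) auto
    finally show "K' \<subseteq> centralizer K" using com [OF K K'] by (cases "K' = K") auto
  qed
  have "join \<K> \<subseteq> centralizer (join \<K>)"
  proof (rule join_least [OF centralizer_normal [OF M]])
    fix K assume K: "K \<in> \<K>"
    show "K \<subseteq> centralizer (join \<K>)"
    proof
      fix a assume a: "a \<in> K"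
      have "a \<otimes> b = b \<otimes> a" if "b \<in> join \<K>" for b
        using cent [OF K] that a by (auto simp: centralizer_def)
      then show "a \<in> centralizer (join \<K>)" using a normal_subset [OF n [OF K]] by (auto simp: centralizer_def)
    qed
  qed
  then show ?thesis using x y by (auto simp: centralizer_def)
qed

text \<open>Separate the members isomorphic to \<open>K\<close> from the rest. By
  \<open>giso_of_join\<close> the two joins share no minimal normal subgroup, so they meet
  trivially, and \<open>not_blocked_union\<close> would combine the two unblocked halves.\<close>

lemma blocked_isotypic:
  assumes fin: "finite \<K>" and mn: "\<And>K. K \<in> \<K> \<Longrightarrow> min_normal K"
    and bl: "blocked \<K>" and nb: "\<And>\<L>. \<L> \<subset> \<K> \<Longrightarrow> \<not> blocked \<L>"
    and K: "K \<in> \<K>" and L: "L \<in> \<K>"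
  shows "giso K L"
proof (rule ccontr)
  assume nKL: "\<not> giso K L"
  have n: "K \<lhd> G" if "K \<in> \<K>" for K by (rule min_normalD(1) [OF mn [OF that]])
  define E where "E = {K' \<in> \<K>. giso K K'}"
  have E: "E \<subset> \<K>" "\<K> - E \<subset> \<K>" using nKL L K giso_refl [OF n [OF K]] by (auto simp: E_def)
  have "join E \<inter> join (\<K> - E) = {\<one>}"
  proof (rule ccontr)
    have "join E \<lhd> G" "join (\<K> - E) \<lhd> G" using n by (auto intro!: join_normal simp: E_def)
    then have I: "join E \<inter> join (\<K> - E) \<lhd> G" by (rule normal_Int)
    have "finite (join E)" using fin n min_normalD(2) [OF mn] by (intro finite_join) (auto simp: E_def)
    then have "finite (join E \<inter> join (\<K> - E))" by simp
    moreover assume "join E \<inter> join (\<K> - E) \<noteq> {\<one>}"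
    ultimately obtain B where B: "min_normal B" "B \<subseteq> join E" "B \<subseteq> join (\<K> - E)"
      using exists_min_normal [OF I] by blast
    obtain A1 where A1: "A1 \<in> E" "giso B A1" using giso_of_join [of E B] fin mn B by (auto simp: E_def)
    obtain A2 where A2: "A2 \<in> \<K> - E" "giso B A2" using giso_of_join [of "\<K> - E" B] fin mn B by auto
    have "giso K A1" using A1 by (simp add: E_def)
    moreover have "A1 \<in> \<K>" using A1(1) by (simp add: E_def)
    then have "giso A1 B" by (rule giso_sym [OF min_normalD(1) [OF B(1)] n A1(2)])
    ultimately have "giso K B" by (rule giso_trans [OF n [OF K]])
    then have "giso K A2" by (rule giso_trans [OF n [OF K] _ A2(2)])
    then show False using A2 by (simp add: E_def)
  qed
  then have "\<not> blocked (E \<union> (\<K> - E))"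
  proof (rule not_blocked_union [rotated 5])
    show "\<not> blocked E" "\<not> blocked (\<K> - E)" using nb E by blast+
    have EK: "K' \<in> \<K>" if "K' \<in> E" for K' using that by (simp add: E_def)
    show "join E \<lhd> G" by (intro join_normal n EK)
    show "join (\<K> - E) \<lhd> G" by (intro join_normal n) blast
    have "finite E" using fin by (simp add: E_def)
    then show "finite (join E)" using n EK min_normalD(2) [OF mn] by (intro finite_join) auto
    show "N \<subseteq> join E" if "N \<in> E" for N by (rule join_upper [OF that])
    show "N \<lhd> G \<and> N \<subseteq> join (\<K> - E)" if "N \<in> \<K> - E" for N
      using n [of N] join_upper [OF that] that by simp
  qed
  moreover have "E \<union> (\<K> - E) = \<K>" by (auto simp: E_def)
  ultimately show False using bl by simp
qed

text \<open>\<open>M\<close> is the join of minimal normal subgroups chosen inside the closures, and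
  \<open>\<rho>\<close> is reduction modulo a normal subgroup \<open>Q\<close> avoiding
  \<open>D\<close>, realised on a complement \<open>C\<close>. Maximality of \<open>Q\<close> makes
  \<open>D\<close> reach every point of \<open>C\<close>, so there are at most \<open>card D\<close>
  points; they are blocked, so there are at least \<open>Suc k\<close>.\<close>

theorem blocked_structure:
  assumes P: "unblocked_upto k" and D: "finite D" "D \<subseteq> carrier G" "\<one> \<notin> D" "card D \<le> Suc k"
    and finD: "\<And>d. d \<in> D \<Longrightarrow> finite (normal_closure {d})"
    and bl: "blocked ((\<lambda>d. normal_closure {d}) ` D)"
  obtains M C \<rho> where
    "M \<lhd> G" "D \<subseteq> M" "C \<lhd> G" "finite C" "\<And>x y. \<lbrakk>x \<in> C; y \<in> C\<rbrakk> \<Longrightarrow> x \<otimes> y = y \<otimes> x"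
    "C \<subseteq> join (min_normals C)" "blocked (min_normals C)" "card (min_normals C) = Suc k"
    "\<And>K L. \<lbrakk>K \<in> min_normals C; L \<in> min_normals C\<rbrakk> \<Longrightarrow> giso K L"
    "\<And>x. x \<in> M \<Longrightarrow> \<rho> x \<in> C" "\<And>x y. \<lbrakk>x \<in> M; y \<in> M\<rbrakk> \<Longrightarrow> \<rho> (x \<otimes> y) = \<rho> x \<otimes> \<rho> y"
    "\<And>K. K \<in> min_normals C \<Longrightarrow> \<exists>d\<in>D. \<rho> d \<in> K \<and> \<rho> d \<noteq> \<one>"
proof -
  define nc where "nc = (\<lambda>d. normal_closure {d})"
  have nc: "nc d \<lhd> G" "d \<in> nc d" "finite (nc d)" "nc d \<noteq> {\<one>}" "d \<noteq> \<one>" "d \<in> carrier G" if "d \<in> D" for d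
  proof -
    show 1: "d \<in> carrier G" "d \<noteq> \<one>" using D that by auto
    then show "nc d \<lhd> G" "d \<in> nc d" "finite (nc d)" "nc d \<noteq> {\<one>}"
      using normal_closure_elem [OF 1(1)] finD [OF that] by (auto simp: nc_def)
  qed
  have "\<exists>K. min_normal K \<and> K \<subseteq> nc d" if "d \<in> D" for d
    using exists_min_normal nc [OF that] by blast
  then obtain \<kappa> where \<kappa>: "\<And>d. d \<in> D \<Longrightarrow> min_normal (\<kappa> d)" "\<And>d. d \<in> D \<Longrightarrow> \<kappa> d \<subseteq> nc d" by metis
  have card_lower: "Suc k \<le> card \<N>"
    if "finite \<N>" "blocked \<N>" "\<And>N. N \<in> \<N> \<Longrightarrow> N \<lhd> G \<and> finite N \<and> N \<noteq> {\<one>}" for \<N>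
    using unblocked_uptoD [OF P that(1) _ that(3)] that(2) by (meson not_less_eq_eq)
  have bl\<kappa>: "blocked (\<kappa> ` D)"
    by (rule blocked_refine [OF bl])
      (use nc \<kappa> min_normalD(1,2) in \<open>fastforce simp: nc_def\<close>)
  have \<kappa>n: "\<kappa> d \<lhd> G" "finite (\<kappa> d)" "\<kappa> d \<noteq> {\<one>}" if "d \<in> D" for d
    using min_normalD(1-3) [OF \<kappa>(1) [OF that]] by auto
  have card\<kappa>: "card (\<kappa> ` D) = Suc k" "card D = Suc k"
  proof -
    have "Suc k \<le> card (\<kappa> ` D)" using D \<kappa>n by (intro card_lower bl\<kappa>) auto
    moreover have "card (\<kappa> ` D) \<le> card D" by (rule card_image_le [OF D(1)])
    ultimately show "card (\<kappa> ` D) = Suc k" "card D = Suc k" using D(4) by auto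
  qed
  have inj\<kappa>: "inj_on \<kappa> D" using D(1) card\<kappa> by (simp add: eq_card_imp_inj_on)
  define M where "M = join (\<kappa> ` D)"
  have M: "M \<lhd> G" unfolding M_def using \<kappa>n by (auto intro: join_normal)
  have Mfin: "finite M" unfolding M_def using D \<kappa>n by (intro finite_join) auto
  have nbpsub: "\<not> blocked \<L>" if "\<L> \<subset> \<N>" "card \<N> = Suc k" "finite \<N>" "\<And>N. N \<in> \<N> \<Longrightarrow> min_normal N" for \<L> \<N>
  proof (rule unblocked_uptoD [OF P])
    show "finite \<L>" using that by (auto intro: finite_subset)
    show "card \<L> \<le> k" using psubset_card_mono [OF that(3,1)] that(2) by simp
    show "N \<lhd> G \<and> finite N \<and> N \<noteq> {\<one>}" if "N \<in> \<L>" for N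
    proof -
      have "min_normal N" using that \<open>\<L> \<subset> \<N>\<close> \<open>\<And>N. N \<in> \<N> \<Longrightarrow> min_normal N\<close> by blast
      then show ?thesis using min_normalD(1-3) [of N] by simp
    qed
  qed
  have nb\<kappa>: "\<not> blocked \<L>" if "\<L> \<subset> \<kappa> ` D" for \<L>
    by (rule nbpsub [OF that card\<kappa>(1)]) (use D(1) \<kappa>(1) in auto)
  \<comment> \<open>Minimality leaves no slack: exchanging one chosen subgroup for the full closure
    keeps the family blocked, while the others alone are unblocked and lie in \<open>M\<close>. So
    the closure lies in \<open>M\<close>.\<close>
  have ncM: "nc d \<subseteq> M" if d: "d \<in> D" for d
  proof (rule blocked_insert_subset [of "\<kappa> ` (D - {d})"])
    have "\<kappa> d \<notin> \<kappa> ` (D - {d})" using inj\<kappa> d by (auto simp: inj_on_def)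
    then have "\<kappa> ` (D - {d}) \<subset> \<kappa> ` D" using d by blast
    then show "\<not> blocked (\<kappa> ` (D - {d}))"
      by (rule nb\<kappa>)
    show "blocked (insert (nc d) (\<kappa> ` (D - {d})))"
    proof (rule blocked_refine [OF bl])
      fix N assume "N \<in> (\<lambda>d. normal_closure {d}) ` D"
      then obtain e where e: "e \<in> D" "N = nc e" by (auto simp: nc_def)
      show "N \<lhd> G \<and> (\<exists>K\<in>insert (nc d) (\<kappa> ` (D - {d})). K \<lhd> G \<and> finite K \<and> K \<subseteq> N)"
        using e nc [OF e(1)] nc [OF d] \<kappa>n [OF e(1)] \<kappa>(2) [OF e(1)] by (cases "e = d") auto
    qed
    show "K \<lhd> G \<and> K \<subseteq> M" if "K \<in> \<kappa> ` (D - {d})" for K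
      using that \<kappa>n join_upper [of K "\<kappa> ` D"] by (auto simp: M_def)
  qed (use nc [OF d] M in auto)
  have DM: "D \<subseteq> M" using ncM nc(2) by blast
  have comm: "x \<otimes> y = y \<otimes> x" if xy: "x \<in> M" "y \<in> M" for x y
  proof (rule abelian_if_blocked [of "\<kappa> ` D"])
    show "\<not> blocked (\<kappa> ` D - {K})" if "K \<in> \<kappa> ` D" for K
      using that by (intro nb\<kappa>) blast
  qed (use D \<kappa> bl\<kappa> xy in \<open>auto simp: M_def\<close>)
  \<comment> \<open>The largest \<open>Q\<close> is wanted that keeps all elements of
    \<open>D\<close> nontrivial modulo \<open>Q\<close>.\<close>
  define R where "R = (\<lambda>Q. Q \<lhd> G \<and> Q \<subseteq> M \<and> Q \<inter> D = {})"
  have "R {\<one>}" using one_is_normal normal_one [OF M] D(3) by (auto simp: R_def)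
  moreover have "\<forall>Q. R Q \<longrightarrow> card Q < Suc (card M)"
    using Mfin by (auto simp: R_def less_Suc_eq_le intro: card_mono)
  ultimately have "\<exists>Q. R Q \<and> (\<forall>Q'. R Q' \<longrightarrow> card Q' \<le> card Q)" by (rule ex_has_greatest_nat)
  then obtain Q where RQ: "R Q" and max: "\<And>Q'. R Q' \<Longrightarrow> card Q' \<le> card Q" by blast
  have Q: "Q \<lhd> G" "Q \<subseteq> M" "Q \<inter> D = {}" using RQ by (auto simp: R_def)
  have Qfin: "finite Q" using Q(2) Mfin by (rule finite_subset)
  have mn\<kappa>: "\<And>N. N \<in> \<kappa> ` D \<Longrightarrow> min_normal N" using \<kappa>(1) by auto
  obtain C where C: "C \<lhd> G" "C \<subseteq> M" "C \<inter> Q = {\<one>}" "M \<subseteq> C <#> Q"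
    using complement_exists [OF mn\<kappa> M_def Mfin Q(1)] by blast
  have Cfin: "finite C" using C(2) Mfin by (rule finite_subset)
  have CQ: "gprod C Q" using C Q by (simp add: gprod_def)
  define \<rho> where "\<rho> = lpart C Q"
  have \<rho>: "\<rho> x \<in> C" if "x \<in> M" for x using lpart_closed(1) [OF CQ] C(4) that by (auto simp: \<rho>_def)
  have \<rho>m: "\<rho> (x \<otimes> y) = \<rho> x \<otimes> \<rho> y" if "x \<in> M" "y \<in> M" for x y
    using lpart_mult(1) [OF CQ] C(4) that by (auto simp: \<rho>_def)
  have mnC: "min_normal K" "K \<subseteq> C" if "K \<in> min_normals C" for K using that by (auto simp: min_normals_def)
  have mnCn: "K \<lhd> G" "finite K" "K \<noteq> {\<one>}" if "K \<in> min_normals C" for K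
    using min_normalD(1-3) [OF mnC(1) [OF that]] by auto
  have finK: "finite (min_normals C)" by (rule finite_min_normals [OF Cfin])
  have blC: "blocked (min_normals C)"
  proof (rule ccontr)
    assume nb: "\<not> blocked (min_normals C)"
    have "\<not> blocked (nc ` D)"
    proof (rule not_blocked_quotient [OF nb Q(1) Qfin C(1,3)])
      show "K \<lhd> G \<and> finite K \<and> K \<subseteq> C" if "K \<in> min_normals C" for K using mnC mnCn that by blast
      fix N assume "N \<in> nc ` D"
      then obtain d where d: "d \<in> D" "N = nc d" by blast
      note nd = nc [OF d(1)]
      note NQ = normal_set_mult [OF nd(1) Q(1)]
      \<comment> \<open>The component \<open>c\<close> of \<open>d\<close> in \<open>C\<close> is
        nontrivial because \<open>d\<close> is not in \<open>Q\<close>. So the closure of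
        \<open>d\<close> contains a point of \<open>C\<close> modulo \<open>Q\<close>, as
        \<open>not_blocked_quotient\<close> requires.\<close>
      obtain c q where cq: "c \<in> C" "q \<in> Q" "d = c \<otimes> q" using gprodE [OF CQ] C(4) DM d(1) by blast
      note CQG = gprodD(4,5) [OF CQ]
      have "d \<otimes> inv q = c" using cq CQG by (simp add: word_simps)
      moreover have "d \<otimes> inv q \<in> nc d <#> Q"
        using nd(2) normal_inv [OF Q(1) cq(2)] by (auto simp: set_mult_def)
      ultimately have c: "c \<in> (nc d <#> Q) \<inter> C" using cq by simp
      have "c \<noteq> \<one>" using cq Q(3) d CQG by auto
      then have "(nc d <#> Q) \<inter> C \<noteq> {\<one>}" using c by blast
      moreover have "finite ((nc d <#> Q) \<inter> C)" using Cfin by simp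
      ultimately obtain K where "min_normal K" "K \<subseteq> (nc d <#> Q) \<inter> C"
        using exists_min_normal [OF normal_Int [OF NQ(1) C(1)]] by blast
      then show "N \<lhd> G \<and> (\<exists>K\<in>min_normals C. K \<subseteq> N <#> Q)"
        using nd(1) d(2) by (auto simp: min_normals_def)
    qed
    then show False using bl by (simp add: nc_def)
  qed
  \<comment> \<open>\<open>K <#> Q\<close> is strictly larger than \<open>Q\<close>, so by
    maximality it contains some \<open>d\<close>, whose component in \<open>C\<close> then lies in
    \<open>K\<close>.\<close>
  have hit: "\<exists>d\<in>D. \<rho> d \<in> K \<and> \<rho> d \<noteq> \<one>" if K: "K \<in> min_normals C" for K
  proof -
    note KQ = normal_set_mult [OF mnCn(1) [OF K] Q(1)]
    have sub: "K <#> Q \<subseteq> M" using mnC(2) [OF K] C(2) Q(2) M by (intro set_mult_least) auto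
    have "\<not> K \<subseteq> Q"
      using mnC(2) [OF K] C(3) mnCn [OF K] normal_one by blast
    then have "K <#> Q \<noteq> Q" using KQ(2) by blast
    then have "Q \<subset> K <#> Q" using KQ(3) by blast
    then have "card Q < card (K <#> Q)"
      using finite_subset [OF sub Mfin] by (intro psubset_card_mono)
    then have "\<not> R (K <#> Q)" using max by (meson not_le)
    then obtain d where d: "d \<in> D" "d \<in> K <#> Q" using KQ(1) sub by (auto simp: R_def)
    obtain x q where xq: "x \<in> K" "q \<in> Q" "d = x \<otimes> q" using d(2) by (auto simp: set_mult_def)
    have "\<rho> d = x" using lpart_eq(1) [OF CQ, of x q] xq mnC(2) [OF K] by (auto simp: \<rho>_def)
    moreover have "x \<noteq> \<one>" using xq Q(3) d gprodD(5) [OF CQ] by auto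
    ultimately show ?thesis using d xq by blast
  qed
  have cardC: "card (min_normals C) = Suc k"
  proof (rule antisym)
    show "Suc k \<le> card (min_normals C)" using finK blC mnCn by (intro card_lower) auto
    obtain s where s: "\<And>K. K \<in> min_normals C \<Longrightarrow> s K \<in> D \<and> \<rho> (s K) \<in> K \<and> \<rho> (s K) \<noteq> \<one>"
      using hit by metis
    have "inj_on s (min_normals C)"
    proof (rule inj_onI)
      fix K L assume KL: "K \<in> min_normals C" "L \<in> min_normals C" "s K = s L"
      have "\<rho> (s K) \<in> K \<inter> L" "\<rho> (s K) \<noteq> \<one>" using s [OF KL(1)] s [OF KL(2)] KL(3) by auto
      then show "K = L" using min_normal_distinct [OF mnC(1) [OF KL(1)] mnC(1) [OF KL(2)]] by blast
    qed
    moreover have "s ` min_normals C \<subseteq> D" using s by blast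
    ultimately have "card (min_normals C) \<le> card D" using D(1) by (intro card_inj_on_le)
    then show "card (min_normals C) \<le> Suc k" using card\<kappa> by simp
  qed
  have iso: "giso K L" if "K \<in> min_normals C" "L \<in> min_normals C" for K L
  proof (rule blocked_isotypic [OF finK mnC(1) blC _ that])
    show "\<not> blocked \<L>" if "\<L> \<subset> min_normals C" for \<L>
      by (rule nbpsub [OF that cardC finK mnC(1)])
  qed
  \<comment> \<open>A complement of the join in \<open>M\<close> meets \<open>C\<close> trivially,
    since otherwise it would contain a point of \<open>C\<close>. Splitting an element of
    \<open>C\<close> along that complement leaves only the part in the join.\<close>
  have Cjoin: "C \<subseteq> join (min_normals C)"
  proof -
    let ?B = "join (min_normals C)"
    have B: "?B \<lhd> G" "?B \<subseteq> C"
      by (rule join_normal, rule mnCn(1), assumption) (rule join_least [OF C(1) mnC(2)])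
    obtain B' where B': "B' \<lhd> G" "B' \<subseteq> M" "B' \<inter> ?B = {\<one>}" "M \<subseteq> B' <#> ?B"
      using complement_exists [OF mn\<kappa> M_def Mfin B(1)] by blast
    have "B' \<inter> C = {\<one>}"
    proof (rule ccontr)
      assume "B' \<inter> C \<noteq> {\<one>}"
      then obtain K where K: "min_normal K" "K \<subseteq> B' \<inter> C"
        using exists_min_normal [OF normal_Int [OF B'(1) C(1)]] Cfin by blast
      then have "K \<subseteq> ?B" by (intro join_upper) (auto simp: min_normals_def)
      then have "K \<subseteq> {\<one>}" using K B'(3) by blast
      then show False using min_normal_nontrivial [OF K(1)] by blast
    qed
    show ?thesis
    proof
      fix x assume x: "x \<in> C"
      then obtain b b' where b: "b' \<in> B'" "b \<in> ?B" "x = b' \<otimes> b" using C(2) B'(4) by (auto simp: set_mult_def)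
      have G: "b \<in> carrier G" "b' \<in> carrier G" using b normal_subset [OF B(1)] normal_subset [OF B'(1)] by auto
      have "b' = x \<otimes> inv b" using b G by (simp add: word_simps)
      also have "\<dots> \<in> C" using x b B by (intro normal_mult [OF C(1)] normal_inv [OF C(1)]) auto
      finally have "b' = \<one>" using b \<open>B' \<inter> C = {\<one>}\<close> by blast
      then show "x \<in> ?B" using b G by simp
    qed
  qed
  have commC: "x \<otimes> y = y \<otimes> x" if "x \<in> C" "y \<in> C" for x y
    by (rule comm) (use C(2) that in blast)+
  show ?thesis
    by (rule that [OF M DM C(1) Cfin commC Cjoin blC cardC iso \<rho> \<rho>m hit])
qed

end

section \<open>Directions determined by few points of a plane\<close>

text \<open>Schur's lemma provides a division ring, so a slope acts from the left: the line of slope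
  \<open>s\<close> consists of the pairs \<open>(a, s \<otimes> a)\<close>.\<close>

locale div_ring = ring R for R (structure) +
  assumes one_not_zero: "\<one> \<noteq> \<zero>" and units: "\<lbrakk>a \<in> carrier R; a \<noteq> \<zero>\<rbrakk> \<Longrightarrow> a \<in> Units R"
begin

text \<open>Two points of the plane determine the slope \<open>s\<close>, or the vertical direction if their first coordinates agree.\<close>

definition covers :: "('a \<times> 'a) set \<Rightarrow> 'a \<Rightarrow> bool" where
  "covers U s \<longleftrightarrow> (\<exists>a b a' b'. (a, b) \<in> U \<and> (a', b') \<in> U \<and> a \<noteq> a' \<and> b \<ominus> b' = s \<otimes> (a \<ominus> a'))"

definition all_directions :: "('a \<times> 'a) set \<Rightarrow> bool" where
  "all_directions U \<longleftrightarrow> finite U \<and> U \<subseteq> carrier R \<times> carrier R \<and>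
    (\<exists>a b b'. (a, b) \<in> U \<and> (a, b') \<in> U \<and> b \<noteq> b') \<and> (\<forall>s\<in>carrier R. covers U s)"

lemma minus_eq_zero: "\<lbrakk>a \<in> carrier R; b \<in> carrier R\<rbrakk> \<Longrightarrow> a \<ominus> b = \<zero> \<longleftrightarrow> a = b"
proof -
  assume ab: "a \<in> carrier R" "b \<in> carrier R"
  then have "a = (a \<ominus> b) \<oplus> b" "b \<ominus> b = \<zero>" by algebra+
  then show ?thesis using ab by auto
qed

lemma division:
  assumes "a \<in> carrier R" "b \<in> carrier R" "a \<noteq> \<zero>"
  shows "\<exists>s\<in>carrier R. b = s \<otimes> a"
proof
  have u: "a \<in> Units R" using assms units by auto
  show "b \<otimes> inv a \<in> carrier R" using assms u by simp
  show "b = b \<otimes> inv a \<otimes> a" using assms u by (simp add: m_assoc)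
qed

lemma no_zero_divisors: "\<lbrakk>a \<in> carrier R; b \<in> carrier R; a \<otimes> b = \<zero>\<rbrakk> \<Longrightarrow> a = \<zero> \<or> b = \<zero>"
proof (rule disjCI)
  assume ab: "a \<in> carrier R" "b \<in> carrier R" "a \<otimes> b = \<zero>" and "b \<noteq> \<zero>"
  then have u: "b \<in> Units R" using units by auto
  have "a = a \<otimes> b \<otimes> inv b" using ab(1,2) u by (simp add: m_assoc)
  then show "a = \<zero>" using ab u by simp
qed

lemma right_cancel:
  assumes "a \<in> carrier R" "b \<in> carrier R" "c \<in> carrier R" "c \<noteq> \<zero>" "a \<otimes> c = b \<otimes> c"
  shows "a = b"
proof -
  have "(a \<ominus> b) \<otimes> c = \<zero>" using assms by (simp add: minus_eq l_distr l_minus r_neg)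
  then show ?thesis using no_zero_divisors [of "a \<ominus> b" c] assms minus_eq_zero [of a b] by simp
qed

lemma sub_self_eq: "\<lbrakk>x \<in> carrier R; y \<in> carrier R; x \<ominus> y = x\<rbrakk> \<Longrightarrow> y = \<zero>"
proof -
  assume xy: "x \<in> carrier R" "y \<in> carrier R" and eq: "x \<ominus> y = x"
  have "y = x \<ominus> (x \<ominus> y)" using xy by algebra
  then show ?thesis unfolding eq using xy minus_eq_zero [of x x] by simp
qed

lemma mult_minus_one:
  "\<lbrakk>x \<in> carrier R; y \<in> carrier R\<rbrakk> \<Longrightarrow> x \<otimes> (y \<ominus> \<one>) = x \<otimes> y \<ominus> x"
  by (simp add: minus_eq r_distr r_minus)

lemma neg_one_mult: "x \<in> carrier R \<Longrightarrow> (\<ominus> \<one>) \<otimes> x = \<ominus> x"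
  by (simp add: l_minus)

lemma coversI:
  "\<lbrakk>(a, b) \<in> U; (a', b') \<in> U; a \<noteq> a'; b \<ominus> b' = s \<otimes> (a \<ominus> a')\<rbrakk> \<Longrightarrow> covers U s"
  unfolding covers_def by blast

lemma covers_mono: "\<lbrakk>covers U s; U \<subseteq> V\<rbrakk> \<Longrightarrow> covers V s"
  unfolding covers_def by blast

text \<open>The first three points determine the slopes 0 and -1 and the vertical direction. Joined
  to them, the fourth point offers up to three further slopes: b/a, b/(a - 1) and (b - 1)/a.\<close>

definition quad :: "'a \<Rightarrow> 'a \<Rightarrow> ('a \<times> 'a) set" where
  "quad a b = {(\<zero>, \<zero>), (\<one>, \<zero>), (\<zero>, \<one>), (a, b)}"

lemma quad_facts:
  assumes "a \<in> carrier R" "b \<in> carrier R"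
  shows "finite (quad a b)" "quad a b \<subseteq> carrier R \<times> carrier R" "card (quad a b) \<le> 4"
    "\<exists>a' c c'. (a', c) \<in> quad a b \<and> (a', c') \<in> quad a b \<and> c \<noteq> c'"
    "covers (quad a b) \<zero>" "covers (quad a b) (\<ominus> \<one>)"
proof -
  show "finite (quad a b)" "quad a b \<subseteq> carrier R \<times> carrier R"
    using assms by (auto simp: quad_def)
  show "card (quad a b) \<le> 4" unfolding quad_def by (intro card_insert_le_m1) auto
  show "\<exists>a' c c'. (a', c) \<in> quad a b \<and> (a', c') \<in> quad a b \<and> c \<noteq> c'"
    using one_not_zero by (intro exI [of _ \<zero>] exI [of _ \<one>]) (auto simp: quad_def)
  show "covers (quad a b) \<zero>"
    by (rule coversI [of \<one> \<zero> _ \<zero> \<zero>]) (use one_not_zero in \<open>auto simp: quad_def minus_eq\<close>)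
  show "covers (quad a b) (\<ominus> \<one>)"
    by (rule coversI [of \<one> \<zero> _ \<zero> \<one>]) (use one_not_zero in \<open>auto simp: quad_def minus_eq l_minus\<close>)
qed

lemma quad_covers:
  assumes ab: "a \<in> carrier R" "b \<in> carrier R" and s: "s \<in> carrier R"
  shows "\<lbrakk>b = s \<otimes> a; a \<noteq> \<zero>\<rbrakk> \<Longrightarrow> covers (quad a b) s"
    and "\<lbrakk>b = s \<otimes> (a \<ominus> \<one>); a \<noteq> \<one>\<rbrakk> \<Longrightarrow> covers (quad a b) s"
    and "\<lbrakk>b \<ominus> \<one> = s \<otimes> a; a \<noteq> \<zero>\<rbrakk> \<Longrightarrow> covers (quad a b) s"
proof -
  show "covers (quad a b) s" if "b = s \<otimes> a" "a \<noteq> \<zero>"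
    by (rule coversI [of a b _ \<zero> \<zero>]) (use that ab s in \<open>auto simp: quad_def minus_eq\<close>)
  show "covers (quad a b) s" if "b = s \<otimes> (a \<ominus> \<one>)" "a \<noteq> \<one>"
    by (rule coversI [of a b _ \<one> \<zero>]) (use that ab s in \<open>auto simp: quad_def minus_eq\<close>)
  show "covers (quad a b) s" if "b \<ominus> \<one> = s \<otimes> a" "a \<noteq> \<zero>"
    by (rule coversI [of a b _ \<zero> \<one>]) (use that ab s in \<open>auto simp: quad_def minus_eq\<close>)
qed

text \<open>With \<open>b = 1\<close> the fourth point is level with (0, 1). The slopes 0, -1, 1/a
  and 1/(a - 1) are distinct once \<open>a\<close> is none of 0, 1, -1, and these three exclusions
  leave an element out of four.\<close>

lemma all_directions_card4:
  assumes card: "card (carrier R) = 4"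
  obtains U where "all_directions U" "card U \<le> 4"
proof -
  have fin: "finite (carrier R)" using card by (metis card.infinite zero_neq_numeral)
  have "card {\<zero>, \<one>, \<ominus> \<one>} \<le> 3" by (intro card_insert_le_m1) auto
  then have "\<not> carrier R \<subseteq> {\<zero>, \<one>, \<ominus> \<one>}" using card card_mono [of "{\<zero>, \<one>, \<ominus> \<one>}" "carrier R"] by auto
  then obtain a where a: "a \<in> carrier R" "a \<noteq> \<zero>" "a \<noteq> \<one>" "a \<noteq> \<ominus> \<one>" by blast
  have a1: "a \<ominus> \<one> \<in> carrier R" "a \<ominus> \<one> \<noteq> \<zero>" using a minus_eq_zero by auto
  obtain s where s: "s \<in> carrier R" "\<one> = s \<otimes> a" using division a by blast
  obtain t where t: "t \<in> carrier R" "\<one> = t \<otimes> (a \<ominus> \<one>)" using division a1 by blast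
  have "s \<noteq> \<zero>" "t \<noteq> \<zero>" using s t a a1 one_not_zero by auto
  moreover have "s \<noteq> \<ominus> \<one>"
  proof
    assume eq: "s = \<ominus> \<one>"
    have "\<one> = \<ominus> a" using s(2) unfolding eq neg_one_mult [OF a(1)] .
    then show False using a by (metis minus_minus one_closed)
  qed
  moreover have "t \<noteq> \<ominus> \<one>"
  proof
    assume eq: "t = \<ominus> \<one>"
    have "\<one> = \<ominus> (a \<ominus> \<one>)" using t(2) unfolding eq neg_one_mult [OF a1(1)] .
    also have "\<dots> = \<one> \<ominus> a" using a by algebra
    finally have "a = \<zero>" using sub_self_eq [of \<one> a] a by simp
    then show False using a by simp
  qed
  moreover have "s \<noteq> t"
  proof
    assume "s = t"
    then have "s \<otimes> a = s \<otimes> (a \<ominus> \<one>)" using s(2) t(2) by simp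
    also have "\<dots> = s \<otimes> a \<ominus> s" using s(1) a(1) by (rule mult_minus_one)
    finally have "s = \<zero>" using sub_self_eq [of "s \<otimes> a" s] s(1) a(1) by simp
    then show False using \<open>s \<noteq> \<zero>\<close> by simp
  qed
  moreover have "\<zero> \<noteq> \<ominus> \<one>" using one_not_zero by (metis minus_minus minus_zero one_closed)
  ultimately have "card {\<zero>, \<ominus> \<one>, s, t} = 4" by auto
  moreover have "{\<zero>, \<ominus> \<one>, s, t} \<subseteq> carrier R" using s(1) t(1) by auto
  ultimately have eq: "carrier R = {\<zero>, \<ominus> \<one>, s, t}" using card fin by (metis card_subset_eq)
  have "covers (quad a \<one>) s" "covers (quad a \<one>) t"
    using quad_covers(1) [OF a(1) one_closed s a(2)] quad_covers(2) [OF a(1) one_closed t a(3)] by auto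
  then have "all_directions (quad a \<one>)"
    unfolding all_directions_def using quad_facts [OF a(1) one_closed] eq by auto
  then show ?thesis using that quad_facts(3) [OF a(1) one_closed] by blast
qed

text \<open>For \<open>a\<close> different from 0 and 1 a generic \<open>b\<close> yields five
  distinct slopes. The values 0 and 1 of \<open>b\<close> would create a slope 0, the values
  \<open>- a\<close> and \<open>1 - a\<close> a slope -1; four exclusions leave an element out of
  five.\<close>

lemma quad_many_directions:
  assumes card: "card (carrier R) \<ge> 5" and fin: "finite (carrier R)"
  obtains a b where "a \<in> carrier R" "b \<in> carrier R"
    "card {s \<in> carrier R. \<not> covers (quad a b) s} \<le> card (carrier R) - 5"
proof -
  have "card {\<zero>, \<one>} \<le> 2" by (intro card_insert_le_m1) auto
  then have "\<not> carrier R \<subseteq> {\<zero>, \<one>}" using card card_mono [of "{\<zero>, \<one>}" "carrier R"] by auto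
  then obtain a where a: "a \<in> carrier R" "a \<noteq> \<zero>" "a \<noteq> \<one>" by blast
  have "card {\<zero>, \<one>, \<ominus> a, \<one> \<ominus> a} \<le> 4" by (intro card_insert_le_m1) auto
  then have "\<not> carrier R \<subseteq> {\<zero>, \<one>, \<ominus> a, \<one> \<ominus> a}" using card card_mono [of "{\<zero>, \<one>, \<ominus> a, \<one> \<ominus> a}" "carrier R"] by auto
  then obtain b where b: "b \<in> carrier R" "b \<noteq> \<zero>" "b \<noteq> \<one>" "b \<noteq> \<ominus> a" "b \<noteq> \<one> \<ominus> a" by blast
  have a1: "a \<ominus> \<one> \<in> carrier R" "a \<ominus> \<one> \<noteq> \<zero>" using a minus_eq_zero by auto
  have b1: "b \<ominus> \<one> \<in> carrier R" "b \<ominus> \<one> \<noteq> \<zero>" using b minus_eq_zero by auto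
  obtain s where s: "s \<in> carrier R" "b = s \<otimes> a" using division a b by blast
  obtain t where t: "t \<in> carrier R" "b = t \<otimes> (a \<ominus> \<one>)" using division a1 b by blast
  obtain u where u: "u \<in> carrier R" "b \<ominus> \<one> = u \<otimes> a" using division a b1 by blast
  have z: "s \<noteq> \<zero>" "t \<noteq> \<zero>" "u \<noteq> \<zero>" using s t u a a1 b b1 by auto
  moreover have "s \<noteq> \<ominus> \<one>"
  proof
    assume eq: "s = \<ominus> \<one>"
    have "b = \<ominus> a" using s(2) unfolding eq neg_one_mult [OF a(1)] .
    then show False using b by simp
  qed
  moreover have "t \<noteq> \<ominus> \<one>"
  proof
    assume eq: "t = \<ominus> \<one>"
    have "b = \<ominus> (a \<ominus> \<one>)" using t(2) unfolding eq neg_one_mult [OF a1(1)] .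
    also have "\<dots> = \<one> \<ominus> a" using a by algebra
    finally show False using b by simp
  qed
  moreover have "u \<noteq> \<ominus> \<one>"
  proof
    assume eq: "u = \<ominus> \<one>"
    have "b \<ominus> \<one> = \<ominus> a" using u(2) unfolding eq neg_one_mult [OF a(1)] .
    then have "(b \<ominus> \<one>) \<oplus> \<one> = \<ominus> a \<oplus> \<one>" by simp
    moreover have "(b \<ominus> \<one>) \<oplus> \<one> = b" "\<ominus> a \<oplus> \<one> = \<one> \<ominus> a" using a(1) b(1) by algebra+
    ultimately have "b = \<one> \<ominus> a" by simp
    then show False using b by simp
  qed
  moreover have "s \<noteq> t"
  proof
    assume "s = t"
    then have "s \<otimes> a = s \<otimes> (a \<ominus> \<one>)" using s(2) t(2) by simp
    also have "\<dots> = s \<otimes> a \<ominus> s" using s(1) a(1) by (rule mult_minus_one)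
    finally have "s = \<zero>" using sub_self_eq [of "s \<otimes> a" s] s(1) a(1) by simp
    then show False using z by simp
  qed
  moreover have "s \<noteq> u"
  proof
    assume "s = u"
    then have "b \<ominus> \<one> = b" using s(2) u(2) by simp
    then have "\<one> = \<zero>" using sub_self_eq [of b \<one>] b(1) by simp
    then show False using one_not_zero by simp
  qed
  moreover have "t \<noteq> u"
  proof
    assume "t = u"
    then have "t \<otimes> (a \<ominus> \<one>) \<ominus> \<one> = t \<otimes> a" using t(2) u(2) by simp
    moreover have "t \<otimes> (a \<ominus> \<one>) \<ominus> \<one> = t \<otimes> a \<ominus> (t \<oplus> \<one>)"
      unfolding mult_minus_one [OF t(1) a(1)] using t(1) a(1) by algebra
    ultimately have "t \<oplus> \<one> = \<zero>" using sub_self_eq [of "t \<otimes> a" "t \<oplus> \<one>"] t(1) a(1) by simp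
    then have "t = \<ominus> \<one>" using t(1) minus_equality [of t \<one>] by simp
    then show False using \<open>t \<noteq> \<ominus> \<one>\<close> by simp
  qed
  moreover have "\<zero> \<noteq> \<ominus> \<one>" using one_not_zero by (metis minus_minus minus_zero one_closed)
  ultimately have 5: "card {\<zero>, \<ominus> \<one>, s, t, u} = 5" by auto
  have sub: "{\<zero>, \<ominus> \<one>, s, t, u} \<subseteq> carrier R" using s(1) t(1) u(1) by auto
  have "covers (quad a b) s" "covers (quad a b) t" "covers (quad a b) u"
    using quad_covers(1) [OF a(1) b(1) s a(2)] quad_covers(2) [OF a(1) b(1) t a(3)]
      quad_covers(3) [OF a(1) b(1) u a(2)] by auto
  then have "{s \<in> carrier R. \<not> covers (quad a b) s} \<subseteq> carrier R - {\<zero>, \<ominus> \<one>, s, t, u}"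
    using quad_facts [OF a(1) b(1)] by auto
  then have "card {s \<in> carrier R. \<not> covers (quad a b) s} \<le> card (carrier R - {\<zero>, \<ominus> \<one>, s, t, u})"
    using fin by (intro card_mono) auto
  also have "\<dots> = card (carrier R) - 5" using sub 5 fin by (subst card_Diff_subset) auto
  finally show ?thesis using that a b by blast
qed

lemma all_directions_card5:
  assumes card: "card (carrier R) = 5"
  obtains U where "all_directions U" "card U \<le> 4"
proof -
  have fin: "finite (carrier R)" using card by (metis card.infinite zero_neq_numeral)
  obtain a b where ab: "a \<in> carrier R" "b \<in> carrier R"
    "card {s \<in> carrier R. \<not> covers (quad a b) s} \<le> card (carrier R) - 5"
    using quad_many_directions [OF _ fin] card by auto
  then have "card {s \<in> carrier R. \<not> covers (quad a b) s} = 0" using card by simp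
  then have "\<forall>s\<in>carrier R. covers (quad a b) s" using fin by auto
  then have "all_directions (quad a b)"
    unfolding all_directions_def using quad_facts [OF ab(1,2)] by blast
  then show ?thesis using that quad_facts(3) [OF ab(1,2)] by blast
qed

text \<open>At most two slopes are missing after four points. A fifth point placed where the line of
  slope \<open>s\<close> through the origin meets the line of slope \<open>t\<close> through (1, 0)
  supplies both.\<close>

lemma all_directions_card6_7:
  assumes card: "card (carrier R) = 6 \<or> card (carrier R) = 7"
  obtains U where "all_directions U" "card U \<le> 5"
proof -
  have fin: "finite (carrier R)" using card by (metis card.infinite zero_neq_numeral)
  obtain a b where ab: "a \<in> carrier R" "b \<in> carrier R"
    and c5: "card {s \<in> carrier R. \<not> covers (quad a b) s} \<le> card (carrier R) - 5"
  proof -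
    have "card (carrier R) \<ge> 5" using card by auto
    then show ?thesis using quad_many_directions [OF _ fin] that by blast
  qed
  note qf = quad_facts [OF ab]
  define M where "M = {s \<in> carrier R. \<not> covers (quad a b) s}"
  have Mfin: "finite M" using fin by (simp add: M_def)
  have M2: "card M \<le> 2" using c5 card by (auto simp: M_def)
  have "\<exists>c d. c \<in> carrier R \<and> d \<in> carrier R \<and> (\<forall>s\<in>M. covers (insert (c, d) (quad a b)) s)"
  proof -
    consider "M = {}" | s where "M = {s}" | s t where "M = {s, t}" "s \<noteq> t"
    proof -
      have "card M = 0 \<or> card M = 1 \<or> card M = 2" using M2 by linarith
      then show ?thesis using that Mfin by (auto simp: card_1_singleton_iff card_2_iff)
    qed
    then show ?thesis
    proof cases
      case 1
      then show ?thesis by auto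
    next
      case 2
      then have s: "s \<in> carrier R" by (auto simp: M_def)
      have "covers (insert (\<one>, s) (quad a b)) s"
        by (rule coversI [of \<one> s _ \<zero> \<zero>]) (use s one_not_zero in \<open>auto simp: quad_def minus_eq\<close>)
      then show ?thesis using 2 s by blast
    next
      case 3
      then have st: "s \<in> carrier R" "t \<in> carrier R" "\<not> covers (quad a b) s" "\<not> covers (quad a b) t"
        by (auto simp: M_def)
      then have nz: "s \<noteq> \<zero>" "t \<noteq> \<zero>" using qf by auto
      have d: "t \<ominus> s \<in> Units R" using st 3 minus_eq_zero [of t s] by (intro units) auto
      \<comment> \<open>The first coordinate of the intersection: \<open>s c = t (c - 1)\<close> is
        equivalent to \<open>(t - s) c = t\<close>.\<close>
      define c where "c = inv (t \<ominus> s) \<otimes> t"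
      have c: "c \<in> carrier R" using d st by (simp add: c_def)
      have tc: "(t \<ominus> s) \<otimes> c = t" using d st by (simp add: c_def m_assoc [symmetric])
      have sc: "s \<otimes> c = t \<otimes> (c \<ominus> \<one>)"
      proof -
        have "s \<otimes> c = t \<otimes> c \<ominus> (t \<ominus> s) \<otimes> c" using st(1,2) c by algebra
        also have "\<dots> = t \<otimes> (c \<ominus> \<one>)" unfolding tc mult_minus_one [OF st(2) c] ..
        finally show ?thesis .
      qed
      have "c \<noteq> \<zero>" using tc nz st by auto
      moreover have "c \<noteq> \<one>"
      proof
        assume "c = \<one>"
        then have "t \<ominus> s = t" using tc st by simp
        then have "s = \<zero>" using sub_self_eq [of t s] st(1,2) by simp
        then show False using nz by simp
      qed
      moreover have "covers (insert (c, s \<otimes> c) (quad a b)) s"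
        by (rule coversI [of c "s \<otimes> c" _ \<zero> \<zero>]) (use c st \<open>c \<noteq> \<zero>\<close> in \<open>auto simp: quad_def minus_eq\<close>)
      moreover have "covers (insert (c, s \<otimes> c) (quad a b)) t"
        by (rule coversI [of c "s \<otimes> c" _ \<one> \<zero>]) (use c st sc \<open>c \<noteq> \<one>\<close> in \<open>auto simp: quad_def minus_eq\<close>)
      ultimately show ?thesis using c st 3 by (intro exI [of _ c] exI [of _ "s \<otimes> c"]) auto
    qed
  qed
  then obtain c d where cd: "c \<in> carrier R" "d \<in> carrier R" "\<And>s. s \<in> M \<Longrightarrow> covers (insert (c, d) (quad a b)) s"
    by blast
  let ?U = "insert (c, d) (quad a b)"
  have "covers ?U s" if "s \<in> carrier R" for s
    using cd(3) [of s] covers_mono [of "quad a b" s ?U] that by (auto simp: M_def)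
  then have "all_directions ?U" unfolding all_directions_def using qf cd by blast
  moreover have "card ?U \<le> 5" using qf card_insert_le_m1 [of 5 "quad a b"] by simp
  ultimately show ?thesis by (rule that)
qed

lemma card_Units: "finite (carrier R) \<Longrightarrow> card (Units R) = card (carrier R) - 1"
proof -
  assume fin: "finite (carrier R)"
  have "\<zero> \<notin> Units R"
    using one_not_zero by (metis Units_l_inv Units_inv_closed r_null)
  then have "Units R = carrier R - {\<zero>}" using units Units_closed by auto
  then show ?thesis using fin by simp
qed

lemma unit_pow_card:
  assumes fin: "finite (carrier R)" and a: "a \<in> carrier R" "a \<noteq> \<zero>"
  shows "a [^] (card (carrier R) - 1) = \<one>"
proof -
  interpret U: group "units_of R" by (rule units_group)
  have u: "a \<in> Units R" by (rule units [OF a])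
  have "a [^]\<^bsub>units_of R\<^esub> Coset.order (units_of R) = \<one>\<^bsub>units_of R\<^esub>"
    using u by (intro U.pow_order_eq_1) (simp add: units_of_carrier)
  then show ?thesis
    using u card_Units [OF fin] by (simp add: Coset.order_def units_of_carrier units_of_pow units_of_one)
qed

lemma char_divides:
  assumes "finite (carrier R)" shows "[card (carrier R)] \<cdot> \<one> = \<zero>"
proof -
  have "\<one> [^]\<^bsub>add_monoid R\<^esub> Coset.order (add_monoid R) = \<one>\<^bsub>add_monoid R\<^esub>"
    by (rule group.pow_order_eq_1 [OF a_group]) simp
  then show ?thesis by (simp add: add_pow_def Coset.order_def)
qed

text \<open>Nine directions have to come out of ten pairs. With a generator \<open>w\<close>
  satisfying \<open>1 + w = w^3\<close>, the points (0, 0), (1, 0), (0, 1), (1, w), (w^4, w^3) give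
  0, all powers of \<open>w\<close>, and the vertical direction, which is the only one taken
  twice.\<close>

lemma all_directions_card8:
  assumes card: "card (carrier R) = 8"
  obtains U where "all_directions U" "card U \<le> 5"
proof -
  have fin: "finite (carrier R)" using card by (metis card.infinite zero_neq_numeral)
  have two: "\<one> \<oplus> \<one> = \<zero>"
  proof -
    let ?t = "\<one> \<oplus> \<one>"
    have "[(8::nat)] \<cdot> \<one> = \<zero>" using char_divides [OF fin] card by simp
    moreover have "[(8::nat)] \<cdot> \<one> = ?t \<otimes> (?t \<otimes> ?t)"
      by (simp add: numeral_eq_Suc l_distr r_distr a_ac)
    ultimately show ?thesis using no_zero_divisors [of ?t "?t \<otimes> ?t"] no_zero_divisors [of ?t ?t] by auto
  qed
  have dbl: "x \<oplus> x = \<zero>" if "x \<in> carrier R" for x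
    using l_distr [of \<one> \<one> x] two that by simp
  then have neg: "\<ominus> x = x" if "x \<in> carrier R" for x using that by (metis minus_equality)
  have sub: "x \<ominus> y = x \<oplus> y" if "x \<in> carrier R" "y \<in> carrier R" for x y using that neg by (simp add: minus_eq)
  have dbl2: "x \<oplus> (x \<oplus> y) = y" if "x \<in> carrier R" "y \<in> carrier R" for x y
    using that dbl by (simp flip: a_assoc)
  have pow7: "w [^] (7::nat) = \<one>" if "w \<in> carrier R" "w \<noteq> \<zero>" for w
    using unit_pow_card [OF fin that] card by simp
  \<comment> \<open>The group of units has prime order 7, so every element other than 0 and 1
    generates it.\<close>
  have gen: "\<exists>i<7. x = w [^] (i::nat)"
    if w: "w \<in> carrier R" "w \<noteq> \<zero>" "w \<noteq> \<one>" and x: "x \<in> carrier R" "x \<noteq> \<zero>" for w x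
  proof -
    interpret U: group "units_of R" by (rule units_group)
    have wU: "w \<in> carrier (units_of R)" using units w by (simp add: units_of_carrier)
    have cU: "card (carrier (units_of R)) = 7" using card_Units [OF fin] card by (simp add: units_of_carrier)
    then have fU: "finite (carrier (units_of R))" by (metis card.infinite zero_neq_numeral)
    have "U.ord w dvd 7" using U.ord_dvd_group_order [OF wU] cU by (simp add: Coset.order_def)
    moreover have "d = 1 \<or> d = 7" if d: "d dvd 7" for d :: nat
    proof -
      have "d \<le> 7" using d by (rule dvd_imp_le) simp
      then have "d \<in> {0, 1, 2, 3, 4, 5, 6, 7}" by auto
      then show ?thesis using d by auto
    qed
    moreover have "U.ord w \<noteq> 1" using U.ord_eq_1 [OF wU] w by (simp add: units_of_one)
    ultimately have ord: "U.ord w = 7" by blast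
    have "inj_on (\<lambda>i. w [^]\<^bsub>units_of R\<^esub> (i::nat)) {0..6}" using U.ord_inj [OF wU] ord by simp
    then have "card ((\<lambda>i. w [^]\<^bsub>units_of R\<^esub> (i::nat)) ` {0..6}) = 7" by (simp add: card_image)
    moreover have "(\<lambda>i. w [^]\<^bsub>units_of R\<^esub> (i::nat)) ` {0..6} \<subseteq> carrier (units_of R)"
      using wU by auto
    ultimately have "carrier (units_of R) = (\<lambda>i. w [^]\<^bsub>units_of R\<^esub> (i::nat)) ` {0..6}"
      using cU fU by (metis card_subset_eq)
    moreover have "x \<in> carrier (units_of R)" using units x by (simp add: units_of_carrier)
    ultimately obtain i where "i \<le> 6" "x = w [^]\<^bsub>units_of R\<^esub> (i::nat)" by auto
    then show ?thesis using units w by (intro exI [of _ i]) (simp add: units_of_pow)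
  qed
  \<comment> \<open>Write \<open>1 + v\<close> as the power \<open>v^i\<close>. The exponents 0 and
    1 force \<open>v = 0\<close> and \<open>1 = 0\<close>; 2, 4 and 6 give \<open>v^2 = 1\<close> or
    \<open>v^3 = 1\<close>. There remain \<open>i = 3\<close>, where \<open>v\<close> will do, and
    \<open>i = 5\<close>, where its inverse \<open>v^6\<close> satisfies the wanted equation: the
    two irreducible cubics are reciprocal.\<close>
  have "\<exists>w\<in>carrier R. w \<noteq> \<zero> \<and> w \<noteq> \<one> \<and> \<one> \<oplus> w = w [^] (3::nat)"
  proof -
    have "card {\<zero>, \<one>} \<le> 2" by (intro card_insert_le_m1) auto
    then have "\<not> carrier R \<subseteq> {\<zero>, \<one>}" using card card_mono [of "{\<zero>, \<one>}" "carrier R"] by auto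
    then obtain v where v: "v \<in> carrier R" "v \<noteq> \<zero>" "v \<noteq> \<one>" by blast
    have "\<one> \<oplus> v \<noteq> \<zero>" using v sub [of \<one> v] minus_eq_zero [of \<one> v] by auto
    then obtain i where i: "i < 7" "\<one> \<oplus> v = v [^] (i::nat)" using gen [OF v, of "\<one> \<oplus> v"] v by auto
    define p where "p = (\<lambda>n::nat. v [^] n)"
    have p: "p n \<in> carrier R" "p m \<otimes> p n = p (m + n)" "p 0 = \<one>" "p 1 = v" "p (n + 7) = p n" for m n
      using v pow7 [OF v(1,2)] by (simp_all add: p_def nat_pow_mult flip: nat_pow_mult)
    have pv: "\<one> \<oplus> p 1 = p i" using i by (simp add: p_def v)
    have step: "p n \<oplus> p (n + 1) = p (n + i)" for n
    proof -
      have "p n \<otimes> (\<one> \<oplus> p 1) = p n \<otimes> p i" using pv by simp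
      then show ?thesis using p by (simp add: r_distr)
    qed
    \<comment> \<open>\<open>j\<close> is invertible modulo 7, so \<open>v^j = 1\<close> would give
      \<open>v = 1\<close>.\<close>
    have inj: "p j \<noteq> \<one>" if "0 < j" "j < 7" for j
    proof
      assume j: "p j = \<one>"
      have "p (j * k) = \<one>" for k
      proof (induction k)
        case (Suc k)
        have "p (j * Suc k) = p (j * k) \<otimes> p j" by (simp only: p(2) mult_Suc_right add.commute)
        then show ?case using Suc j by simp
      qed (simp add: p(3))
      note mult = this
      have per: "p (n + 7 * m) = p n" for n m
      proof (induction m)
        case (Suc m)
        have "p (n + 7 * Suc m) = p ((n + 7 * m) + 7)" by (simp add: algebra_simps)
        then show ?case using Suc p(5) by simp
      qed simp
      have "\<exists>k m. j * k = 1 + 7 * m"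
      proof -
        have "j \<in> {1, 2, 3, 4, 5, 6}" using that by auto
        then show ?thesis
          by (elim insertE emptyE; hypsubst; presburger)
      qed
      then obtain k m where "j * k = 1 + 7 * m" by blast
      then have "p 1 = \<one>" using mult [of k] per [of 1 m] by simp
      then show False using p(4) v by simp
    qed
    have sq: "\<one> \<oplus> p 2 = p (i + i)"
    proof -
      have "(\<one> \<oplus> p 1) \<otimes> (\<one> \<oplus> p 1) = \<one> \<oplus> p 1 \<oplus> (p 1 \<oplus> p (1 + 1))"
        using p(1,2) by (simp add: l_distr r_distr)
      also have "\<dots> = \<one> \<oplus> p 2" using p(1) dbl2 [of "p 1" "p 2"] by (simp add: a_assoc numeral_2_eq_2)
      finally show ?thesis using pv p(2) by simp
    qed
    have "i \<in> {0, 1, 2, 3, 4, 5, 6}" using i(1) by auto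
    moreover have "i \<noteq> 0"
    proof
      assume "i = 0"
      then have "\<one> \<oplus> (\<one> \<oplus> v) = \<zero>" using pv p(3,4) dbl [of \<one>] by simp
      then show False using dbl2 [of \<one> v] v by simp
    qed
    moreover have "i \<noteq> 1"
    proof
      assume "i = 1"
      then have "v \<oplus> (v \<oplus> \<one>) = \<zero>" using pv p(4) v dbl [of v] by (simp add: a_comm)
      then show False using dbl2 [of v \<one>] v one_not_zero by simp
    qed
    moreover have "i \<noteq> 2"
    proof
      assume "i = 2"
      then have "p 3 = p 1 \<oplus> (p 1 \<oplus> \<one>)" using step [of 1] pv p(1) by (simp add: a_comm numeral_eq_Suc)
      then show False using dbl2 [of "p 1" \<one>] p(1) inj [of 3] by simp
    qed
    moreover have "i \<noteq> 4"
    proof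
      assume "i = 4"
      then have "\<one> \<oplus> p 2 = p 1" "\<one> \<oplus> p 1 = p 4" using sq pv p(5) [of 1] by simp_all
      then have "p 4 = p 2" using dbl2 [of \<one> "p 2"] p(1) by simp
      then have "p 4 \<otimes> p 5 = p 2 \<otimes> p 5" by simp
      then have "p 2 = \<one>" using p(2,3) p(5) [of 2] p(5) [of 0] by simp
      then show False using inj [of 2] by simp
    qed
    moreover have "i \<noteq> 6"
    proof
      assume i6: "i = 6"
      then have "p 1 \<oplus> p 2 = \<one>" using step [of 1] p(3) p(5) [of 0] by (simp add: numeral_2_eq_2)
      then have "p 2 = p 1 \<oplus> \<one>" using dbl2 [of "p 1" "p 2"] p(1) by simp
      then have "p 2 = p 6" using pv i6 p(1) by (simp add: a_comm)
      then have "p 2 \<otimes> p 1 = p 6 \<otimes> p 1" by simp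
      then have "p 3 = \<one>" using p(2,3) p(5) [of 0] by simp
      then show False using inj [of 3] by simp
    qed
    ultimately consider "i = 3" | "i = 5" by auto
    then show ?thesis
    proof cases
      case 1
      then show ?thesis using v i(2) by blast
    next
      case 2
      have "p 6 \<oplus> \<one> = p 4" using step [of 6] 2 p(3) p(5) [of 0] p(5) [of 4] by simp
      then have "\<one> \<oplus> p 6 = p 4" using p(1) by (simp add: a_comm)
      also have "p 4 = (p 6) [^] (3::nat)"
        using p(2,1) p(5) [of 4] p(5) [of 11] by (simp add: numeral_eq_Suc)
      finally have "\<one> \<oplus> p 6 = (p 6) [^] (3::nat)" .
      moreover have "p 6 \<noteq> \<zero>"
      proof
        assume "p 6 = \<zero>"
        then have "p 6 \<otimes> p 1 = \<zero>" using p(1) by simp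
        then show False using p(2,3) p(5) [of 0] one_not_zero by simp
      qed
      ultimately show ?thesis using p(1) inj [of 6] by (intro bexI [of _ "p 6"]) auto
    qed
  qed
  then obtain w where w: "w \<in> carrier R" "w \<noteq> \<zero>" "w \<noteq> \<one>" "\<one> \<oplus> w = w [^] (3::nat)" by blast
  define p where "p = (\<lambda>n::nat. w [^] n)"
  have pc [simp]: "p n \<in> carrier R" for n using w by (simp add: p_def)
  have pm [simp]: "p m \<otimes> p n = p (m + n)" for m n using w by (simp add: p_def nat_pow_mult)
  have p0: "p 0 = \<one>" and p1: "p 1 = w" using w by (simp_all add: p_def)
  have p7: "p (n + 7) = p n" for n using pow7 [OF w(1,2)] w(1) by (simp add: p_def nat_pow_mult [symmetric])
  have step: "p (n + 3) = p n \<oplus> p (n + 1)" for n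
  proof -
    have "p 3 = \<one> \<oplus> p 1" unfolding p1 w(4) by (simp add: p_def)
    then have "p (n + 3) = p n \<otimes> (\<one> \<oplus> p 1)" by (metis pm)
    also have "\<dots> = p n \<oplus> p (n + 1)" using pc [of n] pc [of 1] by (simp add: r_distr del: One_nat_def)
    finally show ?thesis .
  qed
  have nz: "p n \<noteq> \<zero>" for n
  proof
    assume "p n = \<zero>"
    have "p (n + k) = \<zero>" for k using pm [of n k] \<open>p n = \<zero>\<close> by (metis l_null pc)
    moreover have "p (n + 6 * n) = \<one>"
    proof -
      have "p (7 * n) = \<one>"
      proof (induction n)
        case (Suc n)
        have "p (7 * Suc n) = p (7 * n + 7)" by (simp add: add.commute)
        then show ?case using Suc p7 by simp
      qed (simp add: p0)
      then show ?thesis by simp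
    qed
    ultimately show False using one_not_zero by metis
  qed
  have e3: "p 3 = \<one> \<oplus> p 1" using step [of 0] by (simp add: p0)
  have e4: "p 4 = p 1 \<oplus> p 2" using step [of 1] by (simp add: numeral_2_eq_2)
  have e5: "p 5 = p 2 \<oplus> p 3" using step [of 2] by simp
  let ?U = "insert (p 4, p 3) (quad \<one> (p 1))"
  have qf: "finite (quad \<one> (p 1))" "quad \<one> (p 1) \<subseteq> carrier R \<times> carrier R" "card (quad \<one> (p 1)) \<le> 4"
    using quad_facts [of \<one> "p 1"] by auto
  have c0: "covers ?U \<zero>" "covers ?U \<one>"
    using quad_facts(5,6) [of \<one> "p 1"] neg [of \<one>] by (auto intro: covers_mono)
  have e5': "p 4 \<ominus> \<one> = p 5" using sub by (simp add: e5 e4 e3 a_ac)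
  have p4: "p 4 \<noteq> \<one>" using e5' nz [of 5] by (auto simp: minus_eq r_neg)
  have e31: "p 3 \<oplus> \<one> = p 1" "p 3 \<oplus> p 1 = \<one>"
    using dbl2 [of \<one> "p 1"] dbl2 [of "p 1" \<one>] by (simp_all add: e3 a_ac)
  have "covers ?U (p 0)" using c0 by (simp add: p0)
  moreover have "covers ?U (p 1)"
    by (rule coversI [of \<one> "p 1" _ \<zero> \<zero>]) (use one_not_zero in \<open>auto simp: quad_def minus_eq\<close>)
  moreover have "covers ?U (p 2)"
    by (rule coversI [of "p 4" "p 3" _ \<one> "p 1"])
      (use p4 e5' e31 p0 p7 [of 0] in \<open>auto simp: quad_def sub\<close>)
  moreover have "covers ?U (p 3)"
    by (rule coversI [of \<one> "p 1" _ \<zero> \<one>]) (use one_not_zero e3 in \<open>auto simp: quad_def sub a_comm\<close>)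
  moreover have "covers ?U (p 4)"
    by (rule coversI [of "p 4" "p 3" _ \<zero> \<one>]) (use nz e31 p7 [of 1] in \<open>auto simp: quad_def sub\<close>)
  moreover have "covers ?U (p 5)"
    by (rule coversI [of "p 4" "p 3" _ \<one> \<zero>]) (use p4 e5' p7 [of 3] in \<open>auto simp: quad_def sub\<close>)
  moreover have "covers ?U (p 6)"
    by (rule coversI [of "p 4" "p 3" _ \<zero> \<zero>]) (use nz p7 [of 3] in \<open>auto simp: quad_def sub\<close>)
  moreover have "n \<in> {0, 1, 2, 3, 4, 5, 6}" if "n < 7" for n :: nat using that by auto
  ultimately have c: "covers ?U (p n)" if "n < 7" for n using that by blast
  have "covers ?U s" if s: "s \<in> carrier R" for s
  proof (cases "s = \<zero>")
    case False
    then obtain i where "i < 7" "s = p i" using gen [OF w(1-3) s] by (auto simp: p_def)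
    then show ?thesis using c by blast
  qed (use c0 in simp)
  then have "all_directions ?U"
    unfolding all_directions_def using qf quad_facts(4) [of \<one> "p 1"] by (auto 4 4)
  moreover have "card ?U \<le> 5" using qf card_insert_le_m1 [of 5 "quad \<one> (p 1)"] by simp
  ultimately show ?thesis by (rule that)
qed

end

text \<open>The field with three elements \<open>0\<close>, \<open>1\<close>, \<open>-1\<close>, and its quadratic extension by a square root \<open>i\<close>
  of \<open>-1\<close>, where the pair \<open>(a, b)\<close> stands for \<open>a + b i\<close>.\<close>

datatype t3 = Z3 | O3 | T3

fun add3 :: "t3 \<Rightarrow> t3 \<Rightarrow> t3" where
  "add3 Z3 y = y"
| "add3 x Z3 = x"
| "add3 O3 O3 = T3"
| "add3 O3 T3 = Z3"
| "add3 T3 O3 = Z3"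
| "add3 T3 T3 = O3"

fun neg3 :: "t3 \<Rightarrow> t3" where
  "neg3 Z3 = Z3"
| "neg3 O3 = T3"
| "neg3 T3 = O3"

fun mul3 :: "t3 \<Rightarrow> t3 \<Rightarrow> t3" where
  "mul3 Z3 y = Z3"
| "mul3 O3 y = y"
| "mul3 T3 y = neg3 y"

fun add9 :: "t3 \<times> t3 \<Rightarrow> t3 \<times> t3 \<Rightarrow> t3 \<times> t3" where
  "add9 (a, b) (c, d) = (add3 a c, add3 b d)"

fun neg9 :: "t3 \<times> t3 \<Rightarrow> t3 \<times> t3" where
  "neg9 (a, b) = (neg3 a, neg3 b)"

fun mul9 :: "t3 \<times> t3 \<Rightarrow> t3 \<times> t3 \<Rightarrow> t3 \<times> t3" where
  "mul9 (a, b) (c, d) = (add3 (mul3 a c) (neg3 (mul3 b d)), add3 (mul3 a d) (mul3 b c))"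

definition sub9 :: "t3 \<times> t3 \<Rightarrow> t3 \<times> t3 \<Rightarrow> t3 \<times> t3" where
  "sub9 x y = add9 x (neg9 y)"

type_synonym pt9 = "(t3 \<times> t3) \<times> (t3 \<times> t3)"

text \<open>Slopes are compared by cross-multiplication, which includes the vertical direction; a
  difference of coincident points counts as parallel to everything.\<close>

fun par9 :: "pt9 \<times> pt9 \<Rightarrow> pt9 \<times> pt9 \<Rightarrow> bool" where
  "par9 (((a, b)), ((a', b'))) (((c, d)), ((c', d'))) \<longleftrightarrow>
     mul9 (sub9 a a') (sub9 d d') = mul9 (sub9 c c') (sub9 b b')"

section \<open>The finite check that five points repeat a direction\<close>

primrec pairs :: "'x list \<Rightarrow> ('x \<times> 'x) list" where
  "pairs [] = []"
| "pairs (x # xs) = map (Pair x) xs @ pairs xs"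

definition some_parallel :: "pt9 list \<Rightarrow> bool" where
  "some_parallel ps \<longleftrightarrow> list_ex (\<lambda>(s, t). par9 s t) (pairs (pairs ps))"

definition all9 :: "(t3 \<times> t3) list" where
  "all9 = List.product [Z3, O3, T3] [Z3, O3, T3]"

text \<open>The points (0, 0), (1, 0), (0, -1). The minus sign matches
  \<open>no_five_points\<close>, where the frame is chosen so that the difference of the second and
  the third point has slope 1.\<close>

definition base9 :: "pt9 list" where
  "base9 = [((Z3, Z3), (Z3, Z3)), ((O3, Z3), (Z3, Z3)), ((Z3, Z3), (T3, Z3))]"

text \<open>Candidates for a fourth point that do not already repeat a direction. Filtering first
  leaves far fewer pairs of candidates to evaluate than all pairs of points of the plane.\<close>

definition quads9 :: "pt9 list" where
  "quads9 = filter (\<lambda>p. \<not> some_parallel (p # base9)) (List.product all9 all9)"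

lemma quads9_check: "list_all (\<lambda>p. list_all (\<lambda>r. some_parallel (p # r # base9)) quads9) quads9"
  by code_simp

lemma some_parallel_mono:
  "some_parallel [p, a, b, c] \<Longrightarrow> some_parallel [p, r, a, b, c]"
  "some_parallel [r, a, b, c] \<Longrightarrow> some_parallel [p, r, a, b, c]"
  by (auto simp: some_parallel_def simp del: par9.simps)

lemma some_parallel_five: "some_parallel (p # r # base9)"
proof -
  have t3: "x \<in> set [Z3, O3, T3]" for x by (cases x) auto
  then have "x \<in> set all9" for x :: "t3 \<times> t3"
    unfolding all9_def set_product by (cases x) blast
  then have all: "p \<in> set (List.product all9 all9)" for p :: pt9 by (cases p) simp
  consider "p \<in> set quads9" "r \<in> set quads9" | "some_parallel (p # base9)" | "some_parallel (r # base9)"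
    using all [of p] all [of r] unfolding quads9_def set_filter by blast
  then show ?thesis
  proof cases
    case 1
    then show ?thesis using quads9_check by (simp add: list_all_iff)
  qed (use some_parallel_mono in \<open>auto simp: base9_def\<close>)
qed

lemma pairs_map: "pairs (map f xs) = map (map_prod f f) (pairs xs)"
  by (induction xs) auto

lemma pairs_mem: "(a, b) \<in> set (pairs xs) \<Longrightarrow> a \<in> set xs \<and> b \<in> set xs"
  by (induction xs) auto

section \<open>Division rings with nine elements\<close>

context div_ring
begin

primrec incl3 :: "t3 \<Rightarrow> 'a" where
  "incl3 Z3 = \<zero>"
| "incl3 O3 = \<one>"
| "incl3 T3 = \<ominus> \<one>"

definition incl9 :: "'a \<Rightarrow> t3 \<times> t3 \<Rightarrow> 'a" where
  "incl9 i z = incl3 (fst z) \<oplus> incl3 (snd z) \<otimes> i"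

lemma incl3_closed [simp]: "incl3 x \<in> carrier R"
  by (cases x) auto

lemma incl3_neg: "incl3 (neg3 x) = \<ominus> incl3 x"
  by (cases x) auto

lemma incl3_mul: "incl3 (mul3 x y) = incl3 x \<otimes> incl3 y"
  by (cases x; cases y) (auto simp: l_minus r_minus)

lemma incl3_central: "r \<in> carrier R \<Longrightarrow> r \<otimes> incl3 x = incl3 x \<otimes> r"
  by (cases x) (auto simp: l_minus r_minus)

lemma three_zero:
  assumes card: "card (carrier R) = 9" shows "\<one> \<oplus> \<one> \<oplus> \<one> = \<zero>"
proof -
  have fin: "finite (carrier R)" using card by (metis card.infinite zero_neq_numeral)
  let ?t = "\<one> \<oplus> \<one> \<oplus> \<one>"
  have "[(9::nat)] \<cdot> \<one> = \<zero>" using char_divides [OF fin] card by simp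
  moreover have "[(9::nat)] \<cdot> \<one> = ?t \<otimes> ?t"
    by (simp add: numeral_eq_Suc l_distr r_distr a_ac)
  ultimately show ?thesis using no_zero_divisors [of ?t ?t] by auto
qed

lemma incl3_add:
  assumes three: "\<one> \<oplus> \<one> \<oplus> \<one> = \<zero>"
  shows "incl3 (add3 x y) = incl3 x \<oplus> incl3 y"
proof -
  have 1: "\<ominus> \<one> = \<one> \<oplus> \<one>" using three by (intro minus_equality) auto
  have 2: "\<ominus> \<one> \<oplus> \<ominus> \<one> = \<one>" using 1 three by (simp add: a_assoc [symmetric])
  have 3: "\<one> \<oplus> (\<one> \<oplus> \<one>) = \<zero>" using three by (simp add: a_assoc)
  show ?thesis using 1 2 three 3 by (cases x; cases y) (auto simp: r_neg l_neg)
qed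

lemma incl9_closed: "i \<in> carrier R \<Longrightarrow> incl9 i z \<in> carrier R"
  by (simp add: incl9_def)

text \<open>A coincidence between two combinations would express \<open>i\<close> by an element of
  the prime field; so the nine combinations are distinct and exhaust the ring.\<close>

lemma surj_incl9:
  assumes card: "card (carrier R) = 9" and i: "i \<in> carrier R" "i \<notin> range incl3" and x: "x \<in> carrier R"
  shows "\<exists>z. x = incl9 i z"
proof -
  note add = incl3_add [OF three_zero [OF card]]
  have inj: "inj (incl9 i)"
  proof (rule injI)
    fix z w assume eq: "incl9 i z = incl9 i w"
    obtain a b where z: "z = (a, b)" by (cases z)
    obtain c d where w: "w = (c, d)" by (cases w)
    have e: "incl3 a \<oplus> incl3 b \<otimes> i = incl3 c \<oplus> incl3 d \<otimes> i" using eq by (simp add: incl9_def z w)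
    have "incl3 (add3 b (neg3 d)) \<otimes> i = (incl3 b \<oplus> \<ominus> incl3 d) \<otimes> i" by (simp add: add incl3_neg)
    also have "\<dots> = (incl3 a \<oplus> incl3 b \<otimes> i) \<ominus> (incl3 a \<oplus> incl3 d \<otimes> i)"
      using i(1) incl3_closed [of a] incl3_closed [of b] incl3_closed [of d] by algebra
    also have "\<dots> = incl3 c \<oplus> \<ominus> incl3 a"
      unfolding e using i(1) incl3_closed [of a] incl3_closed [of c] incl3_closed [of d] by algebra
    also have "\<dots> = incl3 (add3 c (neg3 a))" by (simp add: add incl3_neg)
    finally have f: "incl3 (add3 b (neg3 d)) \<otimes> i = incl3 (add3 c (neg3 a))" .
    have "add3 b (neg3 d) = Z3"
    proof (cases "add3 b (neg3 d)")
      case O3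
      then have "i = incl3 (add3 c (neg3 a))" using f i by simp
      then show ?thesis using i by blast
    next
      case T3
      then have "\<ominus> i = incl3 (add3 c (neg3 a))" using f i by (simp add: l_minus)
      then have "i = incl3 (neg3 (add3 c (neg3 a)))" using i by (simp only: incl3_neg) (metis minus_minus)
      then show ?thesis using i by blast
    qed
    then have b: "b = d" by (cases b; cases d) auto
    have "incl3 (add3 c (neg3 a)) = \<zero>" using f \<open>add3 b (neg3 d) = Z3\<close> i by simp
    moreover have "\<ominus> \<one> \<noteq> \<zero>" using one_not_zero by (metis minus_minus minus_zero one_closed)
    ultimately have "add3 c (neg3 a) = Z3" using one_not_zero by (cases "add3 c (neg3 a)") auto
    then have "a = c" by (cases a; cases c) auto
    then show "z = w" using b by (simp add: z w)
  qed
  have fin: "finite (carrier R)" using card by (metis card.infinite zero_neq_numeral)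
  have U: "(UNIV :: t3 set) = {Z3, O3, T3}" using t3.exhaust by blast
  have "card (UNIV :: (t3 \<times> t3) set) = 9"
    unfolding UNIV_Times_UNIV [symmetric] U card_cartesian_product by simp
  then have "card (range (incl9 i)) = 9" using card_image [OF inj] by simp
  moreover have "range (incl9 i) \<subseteq> carrier R" using i by (auto simp: incl9_closed)
  ultimately have "range (incl9 i) = carrier R" using card fin by (metis card_subset_eq)
  then show ?thesis using x by blast
qed

text \<open>For \<open>a\<close> outside the prime field, \<open>a^2 = p + q a\<close>. In
  characteristic 3 the square of \<open>b = a + q\<close> is \<open>p + q^2\<close>, an element of
  the prime field; the values 0 and 1 would put \<open>b\<close> into the prime field, so the square
  is -1.\<close>

lemma exists_sqrt_minus_one:
  assumes card: "card (carrier R) = 9"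
  shows "\<exists>i\<in>carrier R. i \<notin> range incl3 \<and> i \<otimes> i = \<ominus> \<one>"
proof -
  note three = three_zero [OF card]
  note add = incl3_add [OF three]
  have rng: "range incl3 = {\<zero>, \<one>, \<ominus> \<one>}"
  proof -
    have U: "(UNIV :: t3 set) = {Z3, O3, T3}" using t3.exhaust by blast
    show ?thesis by (simp add: U)
  qed
  have "card (range incl3) \<le> 3" unfolding rng by (intro card_insert_le_m1) auto
  then have "\<not> carrier R \<subseteq> range incl3" using card card_mono [of "range incl3" "carrier R"] rng by auto
  then obtain a where a: "a \<in> carrier R" "a \<notin> range incl3" by blast
  obtain p q where pq: "a \<otimes> a = incl3 p \<oplus> incl3 q \<otimes> a"
    using surj_incl9 [OF card a, of "a \<otimes> a"] a by (auto simp: incl9_def)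
  define b where "b = a \<oplus> incl3 q"
  have b: "b \<in> carrier R" using a by (simp add: b_def)
  have bn: "b \<notin> range incl3"
  proof
    assume "b \<in> range incl3"
    then obtain r where "b = incl3 r" by blast
    then have "a \<oplus> incl3 q = incl3 r" by (simp add: b_def)
    moreover have "a = (a \<oplus> incl3 q) \<ominus> incl3 q" using a(1) incl3_closed [of q] by algebra
    ultimately have "a = incl3 (add3 r (neg3 q))" by (simp add: add incl3_neg minus_eq)
    then show False using a by blast
  qed
  have bb: "b \<otimes> b = incl3 (add3 p (mul3 q q))"
  proof -
    let ?x = "incl3 q \<otimes> a"
    have x: "?x \<in> carrier R" using a by simp
    have xxx: "?x \<oplus> ?x \<oplus> ?x = \<zero>"
    proof -
      have "?x \<oplus> ?x \<oplus> ?x = (\<one> \<oplus> \<one> \<oplus> \<one>) \<otimes> ?x" using x by (simp add: l_distr)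
      then show ?thesis using three x by simp
    qed
    have "b \<otimes> b = a \<otimes> a \<oplus> a \<otimes> incl3 q \<oplus> (incl3 q \<otimes> a \<oplus> incl3 q \<otimes> incl3 q)"
      using a by (simp add: b_def l_distr r_distr a_ac)
    also have "\<dots> = incl3 p \<oplus> ?x \<oplus> ?x \<oplus> (?x \<oplus> incl3 q \<otimes> incl3 q)"
      unfolding pq incl3_central [OF a(1)] ..
    also have "\<dots> = (?x \<oplus> ?x \<oplus> ?x) \<oplus> (incl3 p \<oplus> incl3 q \<otimes> incl3 q)"
      using x by (simp add: a_ac)
    finally show ?thesis unfolding xxx by (simp add: add incl3_mul)
  qed
  have nb: "b \<noteq> \<zero>" "b \<noteq> \<one>" "b \<noteq> \<ominus> \<one>" using bn by (auto simp: rng)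
  have "add3 p (mul3 q q) = T3"
  proof (cases "add3 p (mul3 q q)")
    case Z3
    then show ?thesis using bb no_zero_divisors [OF b b] nb by simp
  next
    case O3
    have "(b \<ominus> \<one>) \<otimes> (b \<oplus> \<one>) = b \<otimes> b \<ominus> \<one>"
      using b by (simp add: minus_eq l_distr r_distr l_minus a_ac r_neg2)
    then have "(b \<ominus> \<one>) \<otimes> (b \<oplus> \<one>) = \<zero>" using bb O3 by (simp add: minus_eq r_neg)
    then have "b \<ominus> \<one> = \<zero> \<or> b \<oplus> \<one> = \<zero>" using b by (intro no_zero_divisors) auto
    then have False using nb b minus_eq_zero [of b \<one>] minus_equality [of b \<one>] by auto
    then show ?thesis ..
  qed auto
  then show ?thesis using b bn bb by auto
qed

text \<open>The ring is identified with the explicit model, which transfers the finite check and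
  also commutativity. The index list follows the order of \<open>some_parallel_five\<close>: the two
  free points, then the base.\<close>

lemma five_points_parallel:
  assumes card: "card (carrier R) = 9"
    and base: "x 0 = \<zero>" "y 0 = \<zero>" "x 1 = \<one>" "y 1 = \<zero>" "x 2 = \<zero>" "y 2 = \<ominus> \<one>"
    and cl: "x 3 \<in> carrier R" "y 3 \<in> carrier R" "x 4 \<in> carrier R" "y 4 \<in> carrier R"
  shows "\<exists>((i, j), (k, l))\<in>set (pairs (pairs [3, 4, 0, 1, 2 :: nat])).
      (x i \<ominus> x j) \<otimes> (y k \<ominus> y l) = (x k \<ominus> x l) \<otimes> (y i \<ominus> y j)"
    and "\<And>r s. \<lbrakk>r \<in> carrier R; s \<in> carrier R\<rbrakk> \<Longrightarrow> r \<otimes> s = s \<otimes> r"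
proof -
  note three = three_zero [OF card]
  note add = incl3_add [OF three]
  obtain i where i: "i \<in> carrier R" "i \<notin> range incl3" "i \<otimes> i = \<ominus> \<one>"
    using exists_sqrt_minus_one [OF card] by blast
  let ?e = "incl9 i"
  note sur = surj_incl9 [OF card i(1,2)]
  have e_add: "?e (add9 z w) = ?e z \<oplus> ?e w" for z w
    using i by (cases z; cases w) (simp add: incl9_def add l_distr a_ac)
  have e_neg: "?e (neg9 z) = \<ominus> ?e z" for z
    using i by (cases z) (simp add: incl9_def incl3_neg minus_add l_minus)
  have e_sub: "?e (sub9 z w) = ?e z \<ominus> ?e w" for z w
    by (simp add: sub9_def e_add e_neg minus_eq)
  have e_mul: "?e (mul9 z w) = ?e z \<otimes> ?e w" for z w
  proof -
    obtain a b where z: "z = (a, b)" by (cases z)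
    obtain c d where w: "w = (c, d)" by (cases w)
    let ?a = "incl3 a" and ?b = "incl3 b" and ?c = "incl3 c" and ?d = "incl3 d"
    have 1: "?b \<otimes> i \<otimes> ?c = ?b \<otimes> ?c \<otimes> i" using i incl3_central [OF i(1), of c] by (simp add: m_assoc)
    have 2: "?b \<otimes> i \<otimes> (?d \<otimes> i) = \<ominus> (?b \<otimes> ?d)"
    proof -
      have "?b \<otimes> i \<otimes> (?d \<otimes> i) = ?b \<otimes> (i \<otimes> ?d) \<otimes> i" using i by (simp add: m_assoc)
      also have "\<dots> = ?b \<otimes> ?d \<otimes> (i \<otimes> i)" using i unfolding incl3_central [OF i(1)] by (simp add: m_assoc)
      finally show ?thesis using i by (simp add: r_minus)
    qed
    have "?e z \<otimes> ?e w = (?a \<oplus> ?b \<otimes> i) \<otimes> (?c \<oplus> ?d \<otimes> i)" by (simp add: incl9_def z w)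
    also have "\<dots> = ?a \<otimes> ?c \<oplus> ?a \<otimes> ?d \<otimes> i \<oplus> (?b \<otimes> i \<otimes> ?c \<oplus> ?b \<otimes> i \<otimes> (?d \<otimes> i))"
      using i by (simp add: l_distr r_distr m_assoc a_ac)
    also have "\<dots> = (?a \<otimes> ?c \<oplus> \<ominus> (?b \<otimes> ?d)) \<oplus> (?a \<otimes> ?d \<oplus> ?b \<otimes> ?c) \<otimes> i"
      unfolding 1 2 using i by (simp add: l_distr a_ac)
    also have "\<dots> = ?e (mul9 z w)"
      by (simp add: incl9_def z w add incl3_mul incl3_neg)
    finally show ?thesis by simp
  qed
  have comm3: "mul3 a b = mul3 b a" for a b by (cases a; cases b) auto
  have comma3: "add3 a b = add3 b a" for a b by (cases a; cases b) auto
  have comm9: "mul9 z w = mul9 w z" for z w by (cases z; cases w) (simp add: comm3 comma3)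
  show "r \<otimes> s = s \<otimes> r" if "r \<in> carrier R" "s \<in> carrier R" for r s
    using sur [OF that(1)] sur [OF that(2)] e_mul comm9 by metis
  obtain p3 q3 p4 q4 where c: "x 3 = ?e p3" "y 3 = ?e q3" "x 4 = ?e p4" "y 4 = ?e q4"
    using sur cl by metis
  define P where "P = (\<lambda>n::nat. if n = 3 then (p3, q3) else if n = 4 then (p4, q4)
     else if n = 0 then ((Z3, Z3), (Z3, Z3)) else if n = 1 then ((O3, Z3), (Z3, Z3)) else ((Z3, Z3), (T3, Z3)))"
  have P: "map P [3, 4, 0, 1, 2] = (p3, q3) # (p4, q4) # base9" by (simp add: P_def base9_def)
  have xy: "x n = ?e (fst (P n)) \<and> y n = ?e (snd (P n))" if "n \<in> {0, 1, 2, 3, 4}" for n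
    using that i base c by (auto simp: P_def incl9_def)
  define L where "L = [3, 4, 0, 1, 2 :: nat]"
  have "some_parallel (map P L)" unfolding L_def P by (rule some_parallel_five)
  then have "\<exists>z\<in>set (pairs (pairs L)). case map_prod (map_prod P P) (map_prod P P) z of (s, t) \<Rightarrow> par9 s t"
    by (simp only: some_parallel_def pairs_map list_ex_iff set_map bex_simps)
  then obtain a b d f where ab: "((a, b), (d, f)) \<in> set (pairs (pairs L))" and par: "par9 (P a, P b) (P d, P f)"
    by auto
  have "a \<in> set L" "b \<in> set L" "d \<in> set L" "f \<in> set L"
    using pairs_mem [OF ab] pairs_mem [of _ _ L] by blast+
  then have abdf: "a \<in> {0, 1, 2, 3, 4}" "b \<in> {0, 1, 2, 3, 4}" "d \<in> {0, 1, 2, 3, 4}" "f \<in> {0, 1, 2, 3, 4}"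
    by (auto simp: L_def)
  have "mul9 (sub9 (fst (P a)) (fst (P b))) (sub9 (snd (P d)) (snd (P f)))
     = mul9 (sub9 (fst (P d)) (fst (P f))) (sub9 (snd (P a)) (snd (P b)))"
    using par by (cases "P a"; cases "P b"; cases "P d"; cases "P f") simp
  from arg_cong [OF this, of ?e]
  have "(x a \<ominus> x b) \<otimes> (y d \<ominus> y f) = (x d \<ominus> x f) \<otimes> (y a \<ominus> y b)"
    unfolding e_mul e_sub using xy abdf by simp
  then have "\<exists>((i, j), (k, l))\<in>set (pairs (pairs L)).
      (x i \<ominus> x j) \<otimes> (y k \<ominus> y l) = (x k \<ominus> x l) \<otimes> (y i \<ominus> y j)"
    by (intro bexI [OF _ ab]) simp
  then show "\<exists>((i, j), (k, l))\<in>set (pairs (pairs [3, 4, 0, 1, 2 :: nat])).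
      (x i \<ominus> x j) \<otimes> (y k \<ominus> y l) = (x k \<ominus> x l) \<otimes> (y i \<ominus> y j)"
    unfolding L_def .
qed

end

section \<open>The endomorphism ring of a minimal normal subgroup\<close>

context group
begin

definition endring :: "'a set \<Rightarrow> ('a \<Rightarrow> 'a) ring" where
  "endring X = \<lparr>carrier = ghom X X, mult = (\<lambda>a b. \<lambda>x\<in>X. a (b x)), one = (\<lambda>x\<in>X. x),
    zero = (\<lambda>x\<in>X. \<one>), add = (\<lambda>a b. \<lambda>x\<in>X. a x \<otimes> b x)\<rparr>"

lemma endring_simps [simp]:
  "carrier (endring X) = ghom X X" "mult (endring X) a b = (\<lambda>x\<in>X. a (b x))"
  "one (endring X) = (\<lambda>x\<in>X. x)" "zero (endring X) = (\<lambda>x\<in>X. \<one>)"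
  "add (endring X) a b = (\<lambda>x\<in>X. a x \<otimes> b x)"
  by (simp_all add: endring_def)

lemma ghom_trivial: "\<lbrakk>X \<lhd> G; Y \<lhd> G\<rbrakk> \<Longrightarrow> (\<lambda>x\<in>X. \<one>) \<in> ghom X Y"
  using normal_one by (intro ghomI) auto

lemma ghom_add:
  assumes X: "X \<lhd> G" and Y: "Y \<lhd> G" and comm: "\<And>x y. \<lbrakk>x \<in> Y; y \<in> Y\<rbrakk> \<Longrightarrow> x \<otimes> y = y \<otimes> x"
    and a: "a \<in> ghom X Y" and b: "b \<in> ghom X Y"
  shows "(\<lambda>x\<in>X. a x \<otimes> b x) \<in> ghom X Y"
proof (rule ghomI [OF _ _ _ X])
  have YG: "y \<in> carrier G" if "y \<in> Y" for y using that normal_subset [OF Y] by auto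
  have XG: "y \<in> carrier G" if "y \<in> X" for y using that normal_subset [OF X] by auto
  note cl = ghom_closed [OF a] ghom_closed [OF b]
  show "a x \<otimes> b x \<in> Y" if "x \<in> X" for x using that cl by (intro normal_mult [OF Y])
  show "a (x \<otimes> y) \<otimes> b (x \<otimes> y) = a x \<otimes> b x \<otimes> (a y \<otimes> b y)" if xy: "x \<in> X" "y \<in> X" for x y
  proof -
    have "a x \<otimes> b x \<otimes> (a y \<otimes> b y) = a x \<otimes> (b x \<otimes> a y) \<otimes> b y" using xy cl YG by (simp add: m_assoc)
    also have "b x \<otimes> a y = a y \<otimes> b x" using xy cl by (intro comm)
    finally show ?thesis using xy cl YG by (simp add: ghom_mult [OF a] ghom_mult [OF b] m_assoc)
  qed
  show "a (g \<otimes> x \<otimes> inv g) \<otimes> b (g \<otimes> x \<otimes> inv g) = g \<otimes> (a x \<otimes> b x) \<otimes> inv g" if g: "g \<in> carrier G" "x \<in> X" for g x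
    unfolding ghom_conj [OF a g] ghom_conj [OF b g] using g cl YG by (simp add: word_simps)
qed

lemma ghom_uminus:
  assumes X: "X \<lhd> G" and Y: "Y \<lhd> G" and comm: "\<And>x y. \<lbrakk>x \<in> Y; y \<in> Y\<rbrakk> \<Longrightarrow> x \<otimes> y = y \<otimes> x"
    and a: "a \<in> ghom X Y"
  shows "(\<lambda>x\<in>X. inv (a x)) \<in> ghom X Y"
proof (rule ghomI [OF _ _ _ X])
  have YG: "y \<in> carrier G" if "y \<in> Y" for y using that normal_subset [OF Y] by auto
  note cl = ghom_closed [OF a]
  show "inv (a x) \<in> Y" if "x \<in> X" for x using that cl by (intro normal_inv [OF Y])
  show "inv (a (x \<otimes> y)) = inv (a x) \<otimes> inv (a y)" if xy: "x \<in> X" "y \<in> X" for x y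
    unfolding ghom_mult [OF a xy] comm [OF cl [OF xy(1)] cl [OF xy(2)]] using xy cl YG by (simp add: inv_mult_group)
  show "inv (a (g \<otimes> x \<otimes> inv g)) = g \<otimes> inv (a x) \<otimes> inv g" if g: "g \<in> carrier G" "x \<in> X" for g x
    unfolding ghom_conj [OF a g] using g cl YG by (simp add: word_simps)
qed

context
  fixes X assumes X: "min_normal X" and comm: "\<And>x y. \<lbrakk>x \<in> X; y \<in> X\<rbrakk> \<Longrightarrow> x \<otimes> y = y \<otimes> x"
begin

lemma XG: "x \<in> X \<Longrightarrow> x \<in> carrier G"
  using normal_subset [OF min_normalD(1) [OF X]] by auto

lemma ring_endring: "ring (endring X)"
proof (rule ringI)
  note Xn = min_normalD(1) [OF X]
  have cl: "a x \<in> X" "a x \<in> carrier G" if "a \<in> ghom X X" "x \<in> X" for a x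
    using ghom_closed [OF that] XG by auto
  have ext: "a = (\<lambda>x\<in>X. a x)" if "a \<in> ghom X X" for a
    using ghom_ext [OF that] by (simp add: extensional_restrict)
  show "abelian_group (endring X)"
  proof (rule abelian_groupI)
    fix a assume a: "a \<in> carrier (endring X)"
    show "\<exists>b\<in>carrier (endring X). b \<oplus>\<^bsub>endring X\<^esub> a = \<zero>\<^bsub>endring X\<^esub>"
      using a ghom_uminus [OF Xn Xn comm, of a] cl(2) [of a]
      by (intro bexI [of _ "\<lambda>x\<in>X. inv (a x)"]) auto
    show "\<zero>\<^bsub>endring X\<^esub> \<oplus>\<^bsub>endring X\<^esub> a = a"
      using a cl(2) [of a] ext [of a] by (auto simp: fun_eq_iff) (metis restrict_apply)
    fix b assume b: "b \<in> carrier (endring X)"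
    show "a \<oplus>\<^bsub>endring X\<^esub> b \<in> carrier (endring X)"
      using a b ghom_add [OF Xn Xn comm] by simp
    show "a \<oplus>\<^bsub>endring X\<^esub> b = b \<oplus>\<^bsub>endring X\<^esub> a"
      using a b cl(1) by (auto simp: fun_eq_iff intro: comm)
    fix c assume c: "c \<in> carrier (endring X)"
    show "a \<oplus>\<^bsub>endring X\<^esub> b \<oplus>\<^bsub>endring X\<^esub> c = a \<oplus>\<^bsub>endring X\<^esub> (b \<oplus>\<^bsub>endring X\<^esub> c)"
      using a b c cl(2) by (auto simp: fun_eq_iff m_assoc)
  qed (use ghom_trivial [OF Xn Xn] in simp)
  show "monoid (endring X)"
  proof (rule monoidI)
    show "\<one>\<^bsub>endring X\<^esub> \<in> carrier (endring X)" using ghomI [of X "\<lambda>x. x" X] Xn by simp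
    fix a assume a: "a \<in> carrier (endring X)"
    show "\<one>\<^bsub>endring X\<^esub> \<otimes>\<^bsub>endring X\<^esub> a = a" "a \<otimes>\<^bsub>endring X\<^esub> \<one>\<^bsub>endring X\<^esub> = a"
      using a cl(1) [of a] ext [of a] by (auto simp: fun_eq_iff) (metis restrict_apply)+
    fix b assume b: "b \<in> carrier (endring X)"
    show "a \<otimes>\<^bsub>endring X\<^esub> b \<in> carrier (endring X)" using a b ghom_compose [OF Xn, of b X a X] by simp
    fix c assume c: "c \<in> carrier (endring X)"
    show "a \<otimes>\<^bsub>endring X\<^esub> b \<otimes>\<^bsub>endring X\<^esub> c = a \<otimes>\<^bsub>endring X\<^esub> (b \<otimes>\<^bsub>endring X\<^esub> c)"
      using a b c cl(1) by (auto simp: fun_eq_iff)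
  qed
  fix a b c assume "a \<in> carrier (endring X)" "b \<in> carrier (endring X)" "c \<in> carrier (endring X)"
  then have abc: "a \<in> ghom X X" "b \<in> ghom X X" "c \<in> ghom X X" by auto
  show "(a \<oplus>\<^bsub>endring X\<^esub> b) \<otimes>\<^bsub>endring X\<^esub> c = a \<otimes>\<^bsub>endring X\<^esub> c \<oplus>\<^bsub>endring X\<^esub> b \<otimes>\<^bsub>endring X\<^esub> c"
    using abc cl(1) by (auto simp: fun_eq_iff)
  show "c \<otimes>\<^bsub>endring X\<^esub> (a \<oplus>\<^bsub>endring X\<^esub> b) = c \<otimes>\<^bsub>endring X\<^esub> a \<oplus>\<^bsub>endring X\<^esub> c \<otimes>\<^bsub>endring X\<^esub> b"
    using abc cl(1) by (auto simp: fun_eq_iff ghom_mult [OF abc(3)])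
qed

lemma ghom_nonzero_bij:
  assumes a: "a \<in> ghom X X" "a \<noteq> (\<lambda>x\<in>X. \<one>)" shows "bij_betw a X X"
proof -
  have "\<exists>x\<in>X. a x \<noteq> \<one>"
  proof (rule ccontr)
    assume "\<not> (\<exists>x\<in>X. a x \<noteq> \<one>)"
    then have "a = (\<lambda>x\<in>X. \<one>)"
      using ghom_ext [OF a(1)] by (intro extensionalityI [of _ X]) auto
    then show False using a by simp
  qed
  then show ?thesis using ghom_min_normal_bij [OF X X a(1)] by blast
qed

lemma div_ring_endring: "div_ring (endring X)"
proof -
  interpret E: ring "endring X" by (rule ring_endring)
  note Xn = min_normalD(1) [OF X]
  show ?thesis
  proof unfold_locales
    obtain x where "x \<in> X" "x \<noteq> \<one>" by (rule min_normal_nontrivial [OF X])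
    then show "\<one>\<^bsub>endring X\<^esub> \<noteq> \<zero>\<^bsub>endring X\<^esub>" by (auto simp: fun_eq_iff)
    fix a assume "a \<in> carrier (endring X)" "a \<noteq> \<zero>\<^bsub>endring X\<^esub>"
    then have a: "a \<in> ghom X X" and bij: "bij_betw a X X" using ghom_nonzero_bij by auto
    define b where "b = restrict (inv_into X a) X"
    have b: "b \<in> ghom X X" unfolding b_def by (rule ghom_inv_into [OF Xn Xn a bij])
    have "a (b x) = x" "b (a x) = x" if "x \<in> X" for x
      using bij that by (auto simp: b_def bij_betw_def f_inv_into_f)
    then show "a \<in> Units (endring X)"
      using a b unfolding Units_def by (auto intro!: bexI [of _ b])
  qed
qed

lemma endring_minus:
  assumes a: "a \<in> ghom X X" and x: "x \<in> X"
  shows "(\<ominus>\<^bsub>endring X\<^esub> a) x = inv (a x)"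
proof -
  interpret E: ring "endring X" by (rule ring_endring)
  note Xn = min_normalD(1) [OF X]
  have "(\<lambda>x\<in>X. inv (a x)) \<oplus>\<^bsub>endring X\<^esub> a = \<zero>\<^bsub>endring X\<^esub>"
    using a ghom_closed [OF a] XG by (auto simp: fun_eq_iff)
  then have "\<ominus>\<^bsub>endring X\<^esub> a = (\<lambda>x\<in>X. inv (a x))"
    using a ghom_uminus [OF Xn Xn comm a] by (intro E.minus_equality) auto
  then show ?thesis using x by simp
qed

lemma endring_diff:
  assumes a: "a \<in> ghom X X" and b: "b \<in> ghom X X" and x: "x \<in> X"
  shows "(a \<ominus>\<^bsub>endring X\<^esub> b) x = a x \<otimes> inv (b x)"
proof -
  interpret E: ring "endring X" by (rule ring_endring)
  show ?thesis using endring_minus [OF b x] x by (simp add: E.minus_eq)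
qed

end

text \<open>Coordinates on the product of two isomorphic minimal normal subgroups: the pair \<open>(a, b)\<close> of
  endomorphisms of \<open>X\<close> stands for \<open>a x\<^sub>0 \<otimes> \<phi> (b x\<^sub>0)\<close>, and the minimal normal subgroups are the lines
  through the origin.\<close>

context
  fixes X Y \<phi> x0 and pt :: "('a \<Rightarrow> 'a) \<Rightarrow> ('a \<Rightarrow> 'a) \<Rightarrow> 'a" and slope_line :: "('a \<Rightarrow> 'a) \<Rightarrow> 'a set"
  assumes X: "min_normal X" and Y: "min_normal Y" and XY: "X \<noteq> Y"
    and comm: "\<And>x y. \<lbrakk>x \<in> X <#> Y; y \<in> X <#> Y\<rbrakk> \<Longrightarrow> x \<otimes> y = y \<otimes> x"
    and \<phi>: "\<phi> \<in> ghom X Y" "bij_betw \<phi> X Y" and x0: "x0 \<in> X" "x0 \<noteq> \<one>"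
  defines "pt \<equiv> \<lambda>a b. a x0 \<otimes> \<phi> (b x0)"
    and "slope_line \<equiv> \<lambda>s. graph X (\<lambda>x\<in>X. \<phi> (s x))"
begin

lemma frame_gprod: "gprod X Y"
  using min_normal_distinct [OF X Y XY] min_normalD(1) [OF X] min_normalD(1) [OF Y] by (simp add: gprod_def)

lemma frame_comm: "\<lbrakk>x \<in> X; y \<in> X\<rbrakk> \<Longrightarrow> x \<otimes> y = y \<otimes> x"
  using comm normal_set_mult(2) [OF min_normalD(1) [OF X] min_normalD(1) [OF Y]] by blast

interpretation E: div_ring "endring X"
  by (rule div_ring_endring [OF X frame_comm])

lemma pt_parts:
  assumes "a \<in> ghom X X" "b \<in> ghom X X"
  shows "pt a b \<in> X <#> Y" "lpart X Y (pt a b) = a x0" "rpart X Y (pt a b) = \<phi> (b x0)"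
proof -
  have cl: "a x0 \<in> X" "\<phi> (b x0) \<in> Y" using assms x0 ghom_closed \<phi>(1) by blast+
  then show "pt a b \<in> X <#> Y" "lpart X Y (pt a b) = a x0" "rpart X Y (pt a b) = \<phi> (b x0)"
    using lpart_eq [OF frame_gprod cl] by (auto simp: pt_def set_mult_def)
qed

lemma pt_diff:
  assumes ab: "a \<in> ghom X X" "b \<in> ghom X X" "a' \<in> ghom X X" "b' \<in> ghom X X"
  shows "pt a b \<otimes> inv (pt a' b') = pt (a \<ominus>\<^bsub>endring X\<^esub> a') (b \<ominus>\<^bsub>endring X\<^esub> b')"
proof -
  note Pd = gprodD [OF frame_gprod]
  have cl: "a x0 \<in> X" "a' x0 \<in> X" "b x0 \<in> X" "b' x0 \<in> X" using ab x0 ghom_closed by blast+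
  note cl' = cl [THEN ghom_closed [OF \<phi>(1)]]
  note clG = cl [THEN Pd(4)] cl' [THEN Pd(5)]
  have i: "inv (b' x0) \<in> X" "inv (a' x0) \<in> X" using cl by (auto intro: normal_inv [OF Pd(1)])
  have "\<phi> (b x0 \<otimes> inv (b' x0)) = \<phi> (b x0) \<otimes> inv (\<phi> (b' x0))"
    using ghom_mult [OF \<phi>(1) cl(3) i(1)] ghom_inv [OF \<phi>(1) Pd(1,2) cl(4)] by simp
  then have "pt (a \<ominus>\<^bsub>endring X\<^esub> a') (b \<ominus>\<^bsub>endring X\<^esub> b')
     = a x0 \<otimes> (inv (a' x0) \<otimes> (\<phi> (b x0) \<otimes> inv (\<phi> (b' x0))))"
    using ab x0 clG by (simp add: pt_def endring_diff [OF X frame_comm] m_assoc)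
  also have "inv (a' x0) \<otimes> (\<phi> (b x0) \<otimes> inv (\<phi> (b' x0))) = \<phi> (b x0) \<otimes> inv (\<phi> (b' x0)) \<otimes> inv (a' x0)"
    using cl' i by (intro Pd(6) [symmetric] normal_mult [OF Pd(2)] normal_inv [OF Pd(2)])
  also have "a x0 \<otimes> (\<phi> (b x0) \<otimes> inv (\<phi> (b' x0)) \<otimes> inv (a' x0)) = pt a b \<otimes> inv (pt a' b')"
    using clG by (simp add: pt_def word_simps)
  finally show ?thesis ..
qed

text \<open>A nonzero endomorphism is injective, so evaluation at \<open>x0\<close> is faithful and
  coordinates with respect to \<open>x0\<close> are unique.\<close>

lemma endo_zero_iff:
  assumes "a \<in> ghom X X" shows "a x0 = \<one> \<longleftrightarrow> a = (\<lambda>x\<in>X. \<one>)"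
proof
  assume a1: "a x0 = \<one>"
  show "a = (\<lambda>x\<in>X. \<one>)"
  proof (rule ccontr)
    assume "a \<noteq> (\<lambda>x\<in>X. \<one>)"
    then have "inj_on a X" using ghom_nonzero_bij [OF X frame_comm assms] by (simp add: bij_betw_def)
    moreover have "a \<one> = \<one>" using ghom_one [OF assms] min_normalD(1) [OF X] by simp
    ultimately show False using a1 x0 normal_one [OF min_normalD(1) [OF X]] by (metis inj_onD)
  qed
qed (use x0 in simp)

lemma pt_eq_one:
  assumes ab: "a \<in> ghom X X" "b \<in> ghom X X" and 1: "pt a b = \<one>"
  shows "a = \<zero>\<^bsub>endring X\<^esub> \<and> b = \<zero>\<^bsub>endring X\<^esub>"
proof -
  note Pd = gprodD [OF frame_gprod]
  have "lpart X Y \<one> = \<one>" "rpart X Y \<one> = \<one>"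
    using lpart_eq [OF frame_gprod normal_one [OF Pd(1)] normal_one [OF Pd(2)]] by simp_all
  then have "a x0 = \<one>" and p: "\<phi> (b x0) = \<one>" using pt_parts(2,3) [OF ab] 1 by simp_all
  moreover have "b x0 = \<one>"
    using p \<phi>(2) ghom_one [OF \<phi>(1) Pd(1,2)] ghom_closed [OF ab(2) x0(1)] normal_one [OF Pd(1)]
    by (auto simp: bij_betw_def inj_on_def)
  ultimately show ?thesis using endo_zero_iff ab by simp
qed

lemma pt_in_Y: "b \<in> ghom X X \<Longrightarrow> pt \<zero>\<^bsub>endring X\<^esub> b \<in> Y"
  using x0 ghom_closed [OF \<phi>(1)] ghom_closed [of b X X] gprodD(5) [OF frame_gprod] by (simp add: pt_def)

lemma pt_in_slope_line:
  assumes "a \<in> ghom X X" "s \<in> ghom X X"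
  shows "pt a (s \<otimes>\<^bsub>endring X\<^esub> a) \<in> slope_line s"
  using ghom_closed [OF assms(1) x0(1)] x0 by (auto simp: slope_line_def graph_def pt_def)

lemma slope_line_min_normal:
  assumes s: "s \<in> ghom X X" shows "slope_line s \<in> min_normals (X <#> Y)"
  using min_normal_graph(1,2) [OF frame_gprod X subset_refl ghom_compose [OF min_normalD(1) [OF X] s \<phi>(1)]]
  by (simp add: min_normals_def slope_line_def)

lemma frame_min_normals:
  assumes K: "K \<in> min_normals (X <#> Y)" "K \<noteq> Y"
  obtains s where "s \<in> ghom X X" "K = slope_line s"
proof -
  note Xn = min_normalD(1) [OF X] and Yn = min_normalD(1) [OF Y]
  obtain L \<theta> where L: "min_normal L" "L \<subseteq> X" "\<theta> \<in> ghom L Y" "K = graph L \<theta>"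
    using K unfolding min_normals_prod [OF frame_gprod Y] by (auto simp: min_normals_def)
  have "L = X" using min_normalD(4) [OF X min_normalD(1) [OF L(1)] L(2)] min_normalD(3) [OF L(1)] by blast
  then have t: "\<theta> \<in> ghom X Y" "K = graph X \<theta>" using L by auto
  define s where "s = (\<lambda>x\<in>X. restrict (inv_into X \<phi>) Y (\<theta> x))"
  have s: "s \<in> ghom X X" unfolding s_def by (rule ghom_compose [OF Xn t(1) ghom_inv_into [OF Xn Yn \<phi>]])
  have "\<phi> (s x) = \<theta> x" if "x \<in> X" for x
    using \<phi>(2) that ghom_closed [OF t(1) that] by (simp add: s_def bij_betw_def f_inv_into_f)
  then have "(\<lambda>x\<in>X. \<phi> (s x)) = \<theta>"
    using ghom_ext [OF t(1)] by (intro extensionalityI [of _ X]) auto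
  then show ?thesis using that s t by (simp add: slope_line_def)
qed

text \<open>\<open>X\<close> may be larger than the set of images of \<open>x0\<close>, so not every
  element has coordinates. An intersection of two lines has: an element on the line of slope
  \<open>s\<close> through the origin and on the line of slope \<open>t\<close> through
  \<open>x0\<close> has first coordinate \<open>a\<close> with
  \<open>(s - t) a = - t\<close>.\<close>

lemma pt_exists:
  assumes s: "s \<in> ghom X X" and t: "t \<in> ghom X X" and st: "s \<noteq> t"
    and c: "c \<in> slope_line s" and c': "c \<otimes> inv x0 \<in> slope_line t"
  shows "\<exists>a\<in>ghom X X. \<exists>b\<in>ghom X X. c = pt a b"
proof -
  note Pd = gprodD [OF frame_gprod]
  obtain x where x: "x \<in> X" "c = x \<otimes> \<phi> (s x)" using c by (auto simp: slope_line_def graph_def)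
  obtain z where z: "z \<in> X" "c \<otimes> inv x0 = z \<otimes> \<phi> (t z)" using c' by (auto simp: slope_line_def graph_def)
  have cl: "s x \<in> X" "t z \<in> X" "\<phi> (s x) \<in> Y" "\<phi> (t z) \<in> Y" "t x \<in> X" "t x0 \<in> X" "inv x0 \<in> X"
    using x z x0 ghom_closed [OF s] ghom_closed [OF t] ghom_closed [OF \<phi>(1)] normal_inv [OF Pd(1)] by auto
  have "c \<otimes> inv x0 = x \<otimes> (\<phi> (s x) \<otimes> inv x0)" using x cl Pd(4,5) by (simp add: m_assoc)
  also have "\<phi> (s x) \<otimes> inv x0 = inv x0 \<otimes> \<phi> (s x)" using cl by (intro Pd(6))
  finally have e: "c \<otimes> inv x0 = (x \<otimes> inv x0) \<otimes> \<phi> (s x)" using x(1) cl Pd(4,5) by (simp add: m_assoc)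
  have xi: "x \<otimes> inv x0 \<in> X" using x(1) cl by (intro normal_mult [OF Pd(1)])
  have "z = x \<otimes> inv x0" "\<phi> (t z) = \<phi> (s x)"
    using lpart_eq [OF frame_gprod xi cl(3)] lpart_eq [OF frame_gprod z(1) cl(4)] e z(2) by simp_all
  then have "t (x \<otimes> inv x0) = s x" using \<phi>(2) cl(1,2) by (metis bij_betw_def inj_onD)
  then have sx: "s x = t x \<otimes> inv (t x0)"
    using ghom_mult [OF t x(1) cl(7)] ghom_inv [OF t Pd(1) Pd(1) x0(1)] by simp
  let ?d = "s \<ominus>\<^bsub>endring X\<^esub> t"
  have d: "?d \<in> carrier (endring X)" using s t by (intro E.minus_closed) simp_all
  have "?d \<noteq> \<zero>\<^bsub>endring X\<^esub>" using E.minus_eq_zero [of s t] s t st by simp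
  then have u: "?d \<in> Units (endring X)" using d by (rule E.units [rotated])
  define a where "a = inv\<^bsub>endring X\<^esub> ?d \<otimes>\<^bsub>endring X\<^esub> (\<ominus>\<^bsub>endring X\<^esub> t)"
  have mt: "\<ominus>\<^bsub>endring X\<^esub> t \<in> carrier (endring X)" using t by (intro E.a_inv_closed) simp
  have ai: "inv\<^bsub>endring X\<^esub> ?d \<in> carrier (endring X)" using u by (rule E.Units_inv_closed)
  have a: "a \<in> carrier (endring X)" unfolding a_def by (rule E.m_closed [OF ai mt])
  have "?d \<otimes>\<^bsub>endring X\<^esub> a = \<ominus>\<^bsub>endring X\<^esub> t"
    unfolding a_def E.m_assoc [OF d ai mt, symmetric] E.Units_r_inv [OF u] by (rule E.l_one [OF mt])
  from fun_cong [OF this, of x0] have "?d (a x0) = inv (t x0)"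
    using x0 endring_minus [OF X frame_comm t x0(1)] by simp
  moreover have "?d x = inv (t x0)"
  proof -
    have "?d x = s x \<otimes> inv (t x)" by (rule endring_diff [OF X frame_comm s t x(1)])
    also have "\<dots> = inv (t x0) \<otimes> t x \<otimes> inv (t x)"
      unfolding sx using cl by (simp add: frame_comm [of "t x" "inv (t x0)"] normal_inv [OF Pd(1)])
    finally show ?thesis using cl Pd(4) by (simp add: m_assoc)
  qed
  moreover have "inj_on ?d X" using ghom_nonzero_bij [OF X frame_comm, of ?d] d \<open>?d \<noteq> \<zero>\<^bsub>endring X\<^esub>\<close>
    by (simp add: bij_betw_def)
  moreover have "a x0 \<in> X" using a x0 ghom_closed [of a X X] by simp
  ultimately have "x = a x0" using x(1) by (metis inj_onD)
  then have "c = pt a (s \<otimes>\<^bsub>endring X\<^esub> a)" using x(2) x0 by (simp add: pt_def)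
  moreover have "s \<otimes>\<^bsub>endring X\<^esub> a \<in> carrier (endring X)" using s a by (intro E.m_closed) simp_all
  ultimately show ?thesis using a by auto
qed

lemma directions_hit:
  assumes U: "div_ring.all_directions (endring X) U" and K: "K \<in> min_normals (X <#> Y)"
  shows "\<exists>u\<in>(\<lambda>(a, b). pt a b) ` U. \<exists>v\<in>(\<lambda>(a, b). pt a b) ` U. u \<noteq> v \<and> u \<otimes> inv v \<in> K"
proof -
  have Uc: "a \<in> ghom X X" "b \<in> ghom X X" if "(a, b) \<in> U" for a b
    using that U by (auto simp: E.all_directions_def)
  have ne: "pt a b \<noteq> pt a' b'" if "(a, b) \<in> U" "(a', b') \<in> U" "a \<noteq> a' \<or> b \<noteq> b'" for a b a' b'
  proof
    assume eq: "pt a b = pt a' b'"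
    have "pt a' b' \<in> carrier G" using pt_parts(1) [OF Uc [OF that(2)]] normal_subset
        normal_set_mult(1) [OF min_normalD(1) [OF X] min_normalD(1) [OF Y]] by blast
    then have "pt (a \<ominus>\<^bsub>endring X\<^esub> a') (b \<ominus>\<^bsub>endring X\<^esub> b') = \<one>"
      using pt_diff [OF Uc [OF that(1)] Uc [OF that(2)]] eq by simp
    moreover have "a \<ominus>\<^bsub>endring X\<^esub> a' \<in> ghom X X" "b \<ominus>\<^bsub>endring X\<^esub> b' \<in> ghom X X"
      using E.minus_closed [of a a'] E.minus_closed [of b b'] Uc that(1,2) by auto
    ultimately have "a \<ominus>\<^bsub>endring X\<^esub> a' = \<zero>\<^bsub>endring X\<^esub>" "b \<ominus>\<^bsub>endring X\<^esub> b' = \<zero>\<^bsub>endring X\<^esub>"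
      using pt_eq_one by blast+
    then show False using E.minus_eq_zero [of a a'] E.minus_eq_zero [of b b'] Uc that by auto
  qed
  show ?thesis
  proof (cases "K = Y")
    case True
    obtain a b b' where ab: "(a, b) \<in> U" "(a, b') \<in> U" "b \<noteq> b'" using U by (auto simp: E.all_directions_def)
    note abc = Uc [OF ab(1)] Uc [OF ab(2)]
    have "pt a b \<otimes> inv (pt a b') = pt \<zero>\<^bsub>endring X\<^esub> (b \<ominus>\<^bsub>endring X\<^esub> b')"
      using pt_diff [OF abc] E.minus_eq_zero [of a a] abc by simp
    also have "\<dots> \<in> Y" using pt_in_Y [of "b \<ominus>\<^bsub>endring X\<^esub> b'"] E.minus_closed [of b b'] abc by simp
    finally show ?thesis using ne [OF ab(1,2)] ab True by (intro bexI [of _ "pt a b"] bexI [of _ "pt a b'"]) auto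
  next
    case False
    then obtain s where s: "s \<in> ghom X X" "K = slope_line s" using frame_min_normals [OF K] by blast
    then have "div_ring.covers (endring X) U s" using U by (simp add: E.all_directions_def)
    then obtain a b a' b' where ab: "(a, b) \<in> U" "(a', b') \<in> U" "a \<noteq> a'"
      "b \<ominus>\<^bsub>endring X\<^esub> b' = s \<otimes>\<^bsub>endring X\<^esub> (a \<ominus>\<^bsub>endring X\<^esub> a')"
      unfolding E.covers_def by blast
    note abc = Uc [OF ab(1)] Uc [OF ab(2)]
    have "pt a b \<otimes> inv (pt a' b') = pt (a \<ominus>\<^bsub>endring X\<^esub> a') (s \<otimes>\<^bsub>endring X\<^esub> (a \<ominus>\<^bsub>endring X\<^esub> a'))"
      using pt_diff [OF abc] ab(4) by simp
    also have "\<dots> \<in> K" unfolding s(2) using E.minus_closed [of a a'] abc s by (intro pt_in_slope_line) auto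
    finally show ?thesis using ne [OF ab(1,2)] ab by (intro bexI [of _ "pt a b"] bexI [of _ "pt a' b'"]) auto
  qed
qed

end

section \<open>Sets whose quotients reach all points of an isotypic subgroup\<close>

definition hits_all :: "'a set \<Rightarrow> 'a set set \<Rightarrow> bool" where
  "hits_all U \<K> \<longleftrightarrow> finite U \<and> (\<forall>K\<in>\<K>. \<exists>u\<in>U. \<exists>v\<in>U. u \<noteq> v \<and> u \<otimes> inv v \<in> K)"

definition isotypic :: "'a set \<Rightarrow> bool" where
  "isotypic C \<longleftrightarrow> C \<lhd> G \<and> finite C \<and> (\<forall>x\<in>C. \<forall>y\<in>C. x \<otimes> y = y \<otimes> x) \<and>
    C \<subseteq> join (min_normals C) \<and> (\<forall>K\<in>min_normals C. \<forall>L\<in>min_normals C. giso K L)"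

lemma isotypicD:
  assumes "isotypic C"
  shows "C \<lhd> G" "finite C" "\<And>x y. \<lbrakk>x \<in> C; y \<in> C\<rbrakk> \<Longrightarrow> x \<otimes> y = y \<otimes> x"
    "C \<subseteq> join (min_normals C)" "\<And>K L. \<lbrakk>K \<in> min_normals C; L \<in> min_normals C\<rbrakk> \<Longrightarrow> giso K L"
  using assms by (auto simp: isotypic_def)

lemma min_normalsD: "K \<in> min_normals C \<Longrightarrow> min_normal K" "K \<in> min_normals C \<Longrightarrow> K \<subseteq> C"
  by (auto simp: min_normals_def)

lemma min_normals_mono: "A \<subseteq> B \<Longrightarrow> min_normals A \<subseteq> min_normals B"
  by (auto simp: min_normals_def)

lemma min_normals_self: "min_normal X \<Longrightarrow> min_normals X = {X}"
proof -
  assume X: "min_normal X"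
  have "K = X" if "min_normal K" "K \<subseteq> X" for K
    using min_normalD(4) [OF X min_normalD(1) [OF that(1)] that(2)] min_normalD(3) [OF that(1)] by blast
  then show ?thesis using X by (auto simp: min_normals_def)
qed

lemma isotypic_extend:
  assumes C: "isotypic C" and A: "A \<lhd> G" "A \<subseteq> C" "A \<noteq> C"
  obtains V where "V \<in> min_normals C" "gprod A V" "A <#> V \<subseteq> C"
proof -
  note Cd = isotypicD [OF C]
  have "\<exists>V\<in>min_normals C. \<not> V \<subseteq> A"
  proof (rule ccontr)
    assume "\<not> (\<exists>V\<in>min_normals C. \<not> V \<subseteq> A)"
    then have "join (min_normals C) \<subseteq> A" by (intro join_least [OF A(1)]) blast
    then show False using Cd(4) A by blast
  qed
  then obtain V where V: "V \<in> min_normals C" "\<not> V \<subseteq> A" by blast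
  note Vd = min_normalsD [OF V(1)]
  have "gprod A V"
    using min_normal_Int [OF Vd(1) A(1) V(2)] A(1) min_normalD(1) [OF Vd(1)] by (auto simp: gprod_def)
  moreover have "A <#> V \<subseteq> C" by (rule set_mult_least [OF A(2) Vd(2) Cd(1)])
  ultimately show ?thesis using that V by blast
qed

lemma isotypic_card_extend:
  assumes C: "isotypic C" and X: "X \<in> min_normals C"
    and V: "V \<in> min_normals C" "gprod A V" "A <#> V \<subseteq> C" and A: "finite A"
  shows "card (min_normals (A <#> V)) = 1 + card (min_normals A) * card (ghom X X)"
proof (rule card_min_normals_prod [OF V(2) min_normalsD(1) [OF V(1)] A])
  note Xd = min_normalD [OF min_normalsD(1) [OF X]]
  show "X \<lhd> G" "finite X" using Xd by auto
  show "giso K X" if "K \<in> min_normals (A <#> V)" for K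
    using that min_normals_mono [OF V(3)] X isotypicD(5) [OF C] by blast
qed

text \<open>Three dimensions give \<open>1 + q + q^2\<close> points, which is at least 13 for
  \<open>q >= 3\<close> and equal to 7 for \<open>q = 2\<close>; four dimensions over two elements
  give 15. Ten points thus leave only planes and the three-dimensional space with
  \<open>q = 2\<close>.\<close>

lemma isotypic_dimension:
  assumes C: "isotypic C" and X: "X \<in> min_normals C" and Y: "Y \<in> min_normals C" and XY: "X \<noteq> Y"
    and card: "card (min_normals C) \<le> 10"
  obtains "C = X <#> Y" "card (min_normals C) = 1 + card (ghom X X)"
  | V where "V \<in> min_normals C" "gprod (X <#> Y) V" "C = (X <#> Y) <#> V" "card (ghom X X) = 2"
      "card (min_normals C) = 7"
proof -
  note Cd = isotypicD [OF C]
  note Xm = min_normalsD [OF X] and Ym = min_normalsD [OF Y]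
  note Xd = min_normalD [OF Xm(1)] and Yd = min_normalD [OF Ym(1)]
  have XYp: "gprod X Y" using min_normal_distinct [OF Xm(1) Ym(1) XY] Xd(1) Yd(1) by (simp add: gprod_def)
  define q where "q = card (ghom X X)"
  let ?A = "X <#> Y"
  have A: "?A \<lhd> G" "finite ?A" "?A \<subseteq> C"
    using normal_set_mult(1) [OF Xd(1) Yd(1)] finite_set_mult [OF Xd(2) Yd(2)] set_mult_least [OF Xm(2) Ym(2) Cd(1)]
    by auto
  have cA: "card (min_normals ?A) = 1 + q"
    using isotypic_card_extend [OF C X Y XYp A(3) Xd(2)] min_normals_self [OF Xm(1)] by (simp add: q_def)
  have q2: "2 \<le> q"
  proof -
    have "(\<lambda>x\<in>X. x) \<in> ghom X X" "(\<lambda>x\<in>X. \<one>) \<in> ghom X X"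
      using ghomI [of X "\<lambda>x. x" X] ghom_trivial Xd(1) by auto
    moreover have "(\<lambda>x\<in>X. x) \<noteq> (\<lambda>x\<in>X. \<one>)"
      using min_normal_nontrivial [OF Xm(1)] by (auto simp: fun_eq_iff)
    ultimately have "card {(\<lambda>x\<in>X. x), (\<lambda>x\<in>X. \<one>)} = 2" "{(\<lambda>x\<in>X. x), (\<lambda>x\<in>X. \<one>)} \<subseteq> ghom X X" by auto
    then show ?thesis unfolding q_def using finite_ghom [OF Xd(2) Xd(2)] by (metis card_mono)
  qed
  show ?thesis
  proof (cases "?A = C")
    case True
    then show ?thesis using that(1) cA by (simp add: q_def)
  next
    case False
    then obtain V where V: "V \<in> min_normals C" "gprod ?A V" "?A <#> V \<subseteq> C" by (rule isotypic_extend [OF C A(1,3)])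
    note Vd = min_normalD [OF min_normalsD(1) [OF V(1)]]
    let ?B = "?A <#> V"
    have B: "?B \<lhd> G" "finite ?B"
      using normal_set_mult(1) [OF A(1) Vd(1)] finite_set_mult [OF A(2) Vd(2)] by auto
    have cB: "card (min_normals ?B) = 1 + (1 + q) * q"
      using isotypic_card_extend [OF C X V A(2)] cA by (simp add: q_def)
    have le: "card (min_normals D) \<le> 10" if "D \<subseteq> C" for D
      using card_mono [OF finite_min_normals [OF Cd(2)] min_normals_mono [OF that]] card by linarith
    have "q < 3"
    proof (rule ccontr)
      assume "\<not> q < 3"
      then have "4 * 3 \<le> (1 + q) * q" by (intro mult_mono) auto
      then show False using le [OF V(3)] cB by simp
    qed
    then have q: "q = 2" using q2 by simp
    have "?B = C"
    proof (rule ccontr)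
      assume "?B \<noteq> C"
      then obtain W where W: "W \<in> min_normals C" "gprod ?B W" "?B <#> W \<subseteq> C"
        by (rule isotypic_extend [OF C B(1) V(3)])
      show False using isotypic_card_extend [OF C X W B(2)] cB q le [OF W(3)] by (simp add: q_def)
    qed
    then show ?thesis using cB q by (intro that(2) [OF V(1,2)]) (simp_all add: q_def)
  qed
qed

lemma isotypic_two:
  assumes C: "isotypic C" and bl: "blocked (min_normals C)"
  obtains X Y where "X \<in> min_normals C" "Y \<in> min_normals C" "X \<noteq> Y"
proof -
  have "min_normals C \<noteq> {}" using bl not_blocked_empty by auto
  then obtain X where X: "X \<in> min_normals C" by blast
  have "min_normals C \<noteq> {X}"
    using bl not_blocked_singleton [of X] min_normalD(1-3) [OF min_normalsD(1) [OF X]] by auto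
  then show ?thesis using that X by blast
qed

text \<open>The three elements \<open>1\<close>, \<open>x\<close> and the inverse of
  \<open>\<phi> x\<close> have quotients in \<open>X\<close>, in \<open>Y\<close> and in the graph
  of \<open>\<phi>\<close>, so the first three points cost three elements. Every other point costs
  one more element, compared with \<open>1\<close>; this is exactly what Q(n) needs for
  P(n).\<close>

lemma isotypic_hits:
  assumes C: "isotypic C" and bl: "blocked (min_normals C)"
  obtains U where "U \<subseteq> C" "hits_all U (min_normals C)" "card U \<le> card (min_normals C)" "3 \<le> card (min_normals C)"
proof -
  note Cd = isotypicD [OF C]
  obtain X Y where X: "X \<in> min_normals C" and Y: "Y \<in> min_normals C" and XY: "X \<noteq> Y"
    by (rule isotypic_two [OF C bl])
  note Xm = min_normalsD [OF X] and Ym = min_normalsD [OF Y]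
  note Xd = min_normalD [OF Xm(1)] and Yd = min_normalD [OF Ym(1)]
  have P: "gprod X Y" using min_normal_distinct [OF Xm(1) Ym(1) XY] Xd(1) Yd(1) by (simp add: gprod_def)
  obtain \<phi> where \<phi>: "\<phi> \<in> ghom X Y" "bij_betw \<phi> X Y" using Cd(5) [OF X Y] by (auto simp: giso_def)
  define Z where "Z = graph X \<phi>"
  note gr = min_normal_graph [OF P Xm(1) subset_refl \<phi>(1)]
  have Z: "Z \<in> min_normals C"
    using gr(1,2) set_mult_least [OF Xm(2) Ym(2) Cd(1)] by (auto simp: min_normals_def Z_def)
  have ZY: "Z \<noteq> Y" using gr(3) Yd(3) by (auto simp: Z_def)
  obtain x where x: "x \<in> X" "x \<noteq> \<one>" by (rule min_normal_nontrivial [OF Xm(1)])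
  have G: "x \<in> carrier G" "\<phi> x \<in> carrier G" "\<phi> x \<in> Y"
    using x ghom_closed [OF \<phi>(1)] normal_subset Xd(1) Yd(1) by blast+
  have px: "\<phi> x \<noteq> \<one>"
    using \<phi>(2) x ghom_one [OF \<phi>(1) Xd(1) Yd(1)] normal_one [OF Xd(1)] by (metis bij_betw_def inj_onD)
  have xZ: "x \<otimes> \<phi> x \<in> Z" using x by (auto simp: Z_def graph_def)
  have XYi: "X \<inter> Y = {\<one>}" by (rule gprodD(3) [OF P])
  have ZX: "Z \<noteq> X"
  proof
    assume "Z = X"
    then have "inv x \<otimes> (x \<otimes> \<phi> x) \<in> X"
      using xZ by (intro normal_mult [OF Xd(1) normal_inv [OF Xd(1) x(1)]]) simp
    then have "\<phi> x \<in> X" using G by (simp add: word_simps)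
    then show False using G(3) XYi px by blast
  qed
  have fin: "finite (min_normals C)" by (rule finite_min_normals [OF Cd(2)])
  have "\<exists>z. z \<in> K \<and> z \<noteq> \<one>" if "K \<in> min_normals C" for K
    using min_normal_nontrivial [OF min_normalsD(1) [OF that]] by blast
  then obtain z where z: "\<And>K. K \<in> min_normals C \<Longrightarrow> z K \<in> K \<and> z K \<noteq> \<one>" by metis
  let ?R = "min_normals C - {X, Y, Z}"
  define U where "U = {\<one>, x, inv (\<phi> x)} \<union> z ` ?R"
  have c3: "card {X, Y, Z} = 3" using XY ZX ZY by simp
  have sub: "{X, Y, Z} \<subseteq> min_normals C" using X Y Z by auto
  have ge3: "3 \<le> card (min_normals C)" using card_mono [OF fin sub] c3 by simp
  have zC: "z K \<in> C" if "K \<in> ?R" for K using z [of K] min_normalsD(2) [of K C] that by auto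
  have "U \<subseteq> C"
    using normal_one [OF Cd(1)] x Xm(2) normal_inv [OF Yd(1) G(3)] Ym(2) zC by (auto simp: U_def)
  moreover have "card U \<le> card (min_normals C)"
  proof -
    have "card U \<le> card {\<one>, x, inv (\<phi> x)} + card (z ` ?R)" unfolding U_def by (rule card_Un_le)
    also have "card {\<one>, x, inv (\<phi> x)} \<le> 3" by (intro card_insert_le_m1) auto
    also have "card (z ` ?R) \<le> card ?R" using fin by (intro card_image_le) simp
    also have "card ?R = card (min_normals C) - 3" using sub c3 fin by (subst card_Diff_subset) auto
    finally show ?thesis using ge3 by simp
  qed
  moreover have "hits_all U (min_normals C)"
    unfolding hits_all_def
  proof (intro conjI ballI)
    show "finite U" using fin by (simp add: U_def)
    fix K assume K: "K \<in> min_normals C"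
    have U1: "\<one> \<in> U" "x \<in> U" "inv (\<phi> x) \<in> U" by (auto simp: U_def)
    consider "K = X" | "K = Y" | "K = Z" | "K \<in> ?R" using K by blast
    then show "\<exists>u\<in>U. \<exists>v\<in>U. u \<noteq> v \<and> u \<otimes> inv v \<in> K"
    proof cases
      case 1
      then show ?thesis using x G by (intro bexI [OF _ U1(2)] bexI [OF _ U1(1)]) auto
    next
      case 2
      moreover have "\<one> \<noteq> inv (\<phi> x)" using px inv_eq_1_iff [OF G(2)] by auto
      ultimately show ?thesis using G by (intro bexI [OF _ U1(1)] bexI [OF _ U1(3)]) auto
    next
      case 3
      have "x \<noteq> inv (\<phi> x)"
      proof
        assume "x = inv (\<phi> x)"
        then have "x \<in> Y" using normal_inv [OF Yd(1) G(3)] by simp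
        then show False using x XYi by blast
      qed
      then show ?thesis using 3 xZ G by (intro bexI [OF _ U1(2)] bexI [OF _ U1(3)]) auto
    next
      case 4
      then have "z K \<in> U" by (simp add: U_def)
      moreover have "z K \<in> carrier G" using zC [OF 4] normal_subset [OF Cd(1)] by blast
      ultimately show ?thesis using z [OF K] by (intro bexI [of _ "z K"] bexI [OF _ U1(1)]) auto
    qed
  qed
  ultimately show ?thesis using that ge3 by blast
qed

text \<open>The seven points are marked by \<open>x\<close>, \<open>y\<close>, \<open>w\<close>,
  \<open>x y\<close>, \<open>x w\<close>, \<open>y w\<close> and \<open>x y w\<close>. All of these
  are quotients of two of the five elements 1, \<open>x\<close>, \<open>y\<close>, \<open>w\<close>,
  \<open>x y w\<close>.\<close>

lemma fano_hits:
  assumes C: "isotypic C" and X: "X \<in> min_normals C" and Y: "Y \<in> min_normals C" and XY: "X \<noteq> Y"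
    and V: "V \<in> min_normals C" "gprod (X <#> Y) V" and CV: "C = (X <#> Y) <#> V" and q: "card (ghom X X) = 2"
  obtains U where "U \<subseteq> C" "hits_all U (min_normals C)" "card U \<le> 5"
proof -
  note Cd = isotypicD [OF C]
  note Xm = min_normalsD [OF X] and Ym = min_normalsD [OF Y] and Vm = min_normalsD [OF V(1)]
  note Xd = min_normalD [OF Xm(1)] and Yd = min_normalD [OF Ym(1)] and Vd = min_normalD [OF Vm(1)]
  have P: "gprod X Y" using min_normal_distinct [OF Xm(1) Ym(1) XY] Xd(1) Yd(1) by (simp add: gprod_def)
  obtain f where f: "f \<in> ghom X Y" "bij_betw f X Y" using Cd(5) [OF X Y] by (auto simp: giso_def)
  obtain h where h: "h \<in> ghom X V" "bij_betw h X V" using Cd(5) [OF X V(1)] by (auto simp: giso_def)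
  obtain x where x: "x \<in> X" "x \<noteq> \<one>" by (rule min_normal_nontrivial [OF Xm(1)])
  \<comment> \<open>There are only two homomorphisms from \<open>X\<close> to any point, the trivial
    one and the fixed isomorphism. This replaces working with coefficients 0 and 1.\<close>
  have two: "\<theta> x = \<one> \<or> \<theta> x = k x"
    if k: "k \<in> ghom X L" "bij_betw k X L" and L: "L \<in> min_normals C" and t: "\<theta> \<in> ghom X L" for k L \<theta>
  proof -
    note Ld = min_normalD [OF min_normalsD(1) [OF L]]
    have "card (ghom X L) \<le> card (ghom X X)"
      using Cd(5) [OF L X] Cd(5) [OF X X] Xd Ld by (intro card_ghom_le) auto
    then have c: "card (ghom X L) \<le> 2" using q by simp
    have tr: "(\<lambda>x\<in>X. \<one>) \<in> ghom X L" by (rule ghom_trivial [OF Xd(1) Ld(1)])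
    have "k x \<noteq> \<one>"
      using k(2) x ghom_one [OF k(1) Xd(1) Ld(1)] normal_one [OF Xd(1)] by (metis bij_betw_def inj_onD)
    then have "(\<lambda>x\<in>X. \<one>) \<noteq> k" using x by auto
    then have "card {(\<lambda>x\<in>X. \<one>), k} = 2" by simp
    moreover have "{(\<lambda>x\<in>X. \<one>), k} \<subseteq> ghom X L" using tr k by auto
    ultimately have "{(\<lambda>x\<in>X. \<one>), k} = ghom X L"
      using c finite_ghom [OF Xd(2) Ld(2)] by (metis card_seteq)
    then have "\<theta> = (\<lambda>x\<in>X. \<one>) \<or> \<theta> = k" using t by blast
    then show ?thesis using x by auto
  qed
  define y where "y = f x"
  define w where "w = h x"
  have cl: "x \<in> C" "y \<in> C" "w \<in> C"
    using x ghom_closed [OF f(1)] ghom_closed [OF h(1)] Xm Ym Vm by (auto simp: y_def w_def)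
  have CG: "a \<in> carrier G" if "a \<in> C" for a using that normal_subset [OF Cd(1)] by blast
  note clG = cl [THEN CG]
  have ne: "x \<noteq> \<one>" "y \<noteq> \<one>" "w \<noteq> \<one>"
    using x f(2) h(2) ghom_one [OF f(1) Xd(1) Yd(1)] ghom_one [OF h(1) Xd(1) Vd(1)] normal_one [OF Xd(1)]
    unfolding y_def w_def by (metis bij_betw_def inj_onD)+
  \<comment> \<open>A point other than \<open>V\<close> is a graph over a point \<open>L\<close> of
    \<open>X <#> Y\<close>, and \<open>L\<close> is \<open>Y\<close> or a graph over
    \<open>X\<close>. By \<open>two\<close> the homomorphisms involved take only the values 1,
    \<open>y\<close> and 1, \<open>w\<close>.\<close>
  have key: "\<exists>e\<in>{x, y, x \<otimes> y}. e \<in> K \<or> e \<otimes> w \<in> K" if K: "K \<in> min_normals C" "K \<noteq> V" for K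
  proof -
    obtain L \<theta> where L: "L \<in> min_normals (X <#> Y)" "\<theta> \<in> ghom L V" "K = graph L \<theta>"
      using K unfolding CV min_normals_prod [OF V(2) Vm(1)] by blast
    have "\<exists>\<iota>\<in>ghom X L. \<iota> x \<in> {x, y, x \<otimes> y}"
    proof (cases "L = Y")
      case True
      then show ?thesis using f by (auto simp: y_def)
    next
      case False
      then obtain L' \<phi> where L': "min_normal L'" "L' \<subseteq> X" "\<phi> \<in> ghom L' Y" "L = graph L' \<phi>"
        using L(1) unfolding min_normals_prod [OF P Ym(1)] by (auto simp: min_normals_def)
      have "L' = X" using Xd(4) [OF min_normalD(1) [OF L'(1)] L'(2)] min_normalD(3) [OF L'(1)] by blast
      then have \<phi>: "\<phi> \<in> ghom X Y" "L = graph X \<phi>" using L' by auto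
      have "(\<lambda>x\<in>X. x \<otimes> \<phi> x) \<in> ghom X L"
      proof (rule ghomI [OF _ _ _ Xd(1)])
        note Pd = gprodD [OF P]
        note pc = ghom_closed [OF \<phi>(1)]
        show "a \<otimes> \<phi> a \<in> L" if "a \<in> X" for a using that by (auto simp: \<phi>(2) graph_def)
        show "a \<otimes> b \<otimes> \<phi> (a \<otimes> b) = a \<otimes> \<phi> a \<otimes> (b \<otimes> \<phi> b)" if ab: "a \<in> X" "b \<in> X" for a b
        proof -
          have "a \<otimes> \<phi> a \<otimes> (b \<otimes> \<phi> b) = a \<otimes> (\<phi> a \<otimes> b) \<otimes> \<phi> b" using ab pc Pd(4,5) by (simp add: m_assoc)
          also have "\<phi> a \<otimes> b = b \<otimes> \<phi> a" using ab pc by (intro Pd(6))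
          finally show ?thesis using ab pc Pd(4,5) by (simp add: ghom_mult [OF \<phi>(1)] m_assoc)
        qed
        show "g \<otimes> a \<otimes> inv g \<otimes> \<phi> (g \<otimes> a \<otimes> inv g) = g \<otimes> (a \<otimes> \<phi> a) \<otimes> inv g"
          if ga: "g \<in> carrier G" "a \<in> X" for g a
          unfolding ghom_conj [OF \<phi>(1) ga] using ga pc Pd(4,5) by (simp add: word_simps)
      qed
      moreover have "\<phi> x = \<one> \<or> \<phi> x = y" using two [OF f Y \<phi>(1)] by (simp add: y_def)
      ultimately show ?thesis using x clG by (intro bexI [of _ "\<lambda>x\<in>X. x \<otimes> \<phi> x"]) auto
    qed
    then obtain \<iota> where \<iota>: "\<iota> \<in> ghom X L" "\<iota> x \<in> {x, y, x \<otimes> y}" by blast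
    have "(\<lambda>x\<in>X. \<theta> (\<iota> x)) \<in> ghom X V" by (rule ghom_compose [OF Xd(1) \<iota>(1) L(2)])
    then have "\<theta> (\<iota> x) = \<one> \<or> \<theta> (\<iota> x) = w" using two [OF h V(1)] x by (force simp: w_def)
    moreover have "\<iota> x \<otimes> \<theta> (\<iota> x) \<in> K" using ghom_closed [OF \<iota>(1) x(1)] by (auto simp: L(3) graph_def)
    moreover have "\<iota> x \<in> carrier G" using \<iota>(2) clG by auto
    ultimately have "\<iota> x \<in> K \<or> \<iota> x \<otimes> w \<in> K" by auto
    then show ?thesis using \<iota>(2) by blast
  qed
  define U where "U = {\<one>, x, y, w, x \<otimes> y \<otimes> w}"
  have xyw: "x \<otimes> y \<otimes> w \<in> carrier G" using clG by simp
  have c: "x \<otimes> y = y \<otimes> x" "x \<otimes> w = w \<otimes> x" "y \<otimes> w = w \<otimes> y" using Cd(3) cl by blast+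
  have "U \<subseteq> C" using cl normal_one [OF Cd(1)] normal_mult [OF Cd(1)] by (auto simp: U_def)
  moreover have "card U \<le> 5" unfolding U_def by (intro card_insert_le_m1) auto
  moreover have "hits_all U (min_normals C)"
    unfolding hits_all_def
  proof (intro conjI ballI)
    show "finite U" by (simp add: U_def)
    have U: "\<one> \<in> U" "x \<in> U" "y \<in> U" "w \<in> U" "x \<otimes> y \<otimes> w \<in> U" by (auto simp: U_def)
    fix K assume K: "K \<in> min_normals C"
    have "\<exists>u\<in>U. \<exists>v\<in>U. u \<otimes> inv v \<in> K \<and> u \<otimes> inv v \<noteq> \<one>"
    proof (cases "K = V")
      case True
      then show ?thesis using ne(3) clG ghom_closed [OF h(1) x(1)]
        by (intro bexI [OF _ U(4)] bexI [OF _ U(1)]) (simp add: w_def)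
    next
      case False
      have nxy: "x \<otimes> y \<noteq> \<one>"
      proof
        assume "x \<otimes> y = \<one>"
        then have "x = inv y" using clG inv_equality [of x y] by simp
        then have "x \<in> X \<inter> Y" using x normal_inv [OF Yd(1) ghom_closed [OF f(1) x(1)]] by (simp add: y_def)
        then show False using gprodD(3) [OF P] ne by blast
      qed
      have nA: "e \<otimes> w \<noteq> \<one>" if e: "e \<in> X <#> Y" for e
      proof
        assume ew: "e \<otimes> w = \<one>"
        have wV: "w \<in> V" using ghom_closed [OF h(1) x(1)] by (simp add: w_def)
        have eG: "e \<in> carrier G" using e gprodD(4) [OF V(2)] by blast
        have "e = inv w" using inv_equality [OF ew clG(3) eG] by simp
        then have "e \<in> V" using normal_inv [OF Vd(1) wV] by simp
        then have "e = \<one>" using e gprodD(3) [OF V(2)] by blast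
        then show False using ew clG ne by simp
      qed
      have eA: "x \<in> X <#> Y" "y \<in> X <#> Y" "x \<otimes> y \<in> X <#> Y"
      proof -
        show "x \<in> X <#> Y" using normal_set_mult(2) [OF Xd(1) Yd(1)] x(1) by (rule subsetD)
        moreover show "y \<in> X <#> Y"
          unfolding y_def using normal_set_mult(3) [OF Xd(1) Yd(1)] ghom_closed [OF f(1) x(1)] by (rule subsetD)
        ultimately show "x \<otimes> y \<in> X <#> Y" by (rule normal_mult [OF gprodD(1) [OF V(2)]])
      qed
      have d: "x \<otimes> y \<otimes> w \<otimes> inv w = x \<otimes> y" "x \<otimes> y \<otimes> w \<otimes> inv y = x \<otimes> w" "x \<otimes> y \<otimes> w \<otimes> inv x = y \<otimes> w"
      proof -
        show "x \<otimes> y \<otimes> w \<otimes> inv w = x \<otimes> y" using clG by (simp add: word_simps)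
        have "x \<otimes> y \<otimes> w \<otimes> inv y = x \<otimes> (y \<otimes> w) \<otimes> inv y" using clG by (simp add: m_assoc)
        then show "x \<otimes> y \<otimes> w \<otimes> inv y = x \<otimes> w" unfolding c(3) using clG by (simp add: word_simps)
        have "x \<otimes> y \<otimes> w \<otimes> inv x = (y \<otimes> (x \<otimes> w)) \<otimes> inv x" using clG c(1) by (simp add: m_assoc [symmetric])
        then show "x \<otimes> y \<otimes> w \<otimes> inv x = y \<otimes> w" unfolding c(2) using clG by (simp add: word_simps)
      qed
      obtain e where e: "e \<in> {x, y, x \<otimes> y}" "e \<in> K \<or> e \<otimes> w \<in> K" using key [OF K False] by blast
      have "\<exists>u\<in>U. \<exists>v\<in>U. u \<otimes> inv v = e" "\<exists>u\<in>U. \<exists>v\<in>U. u \<otimes> inv v = e \<otimes> w"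
      proof -
        have 1: "\<exists>u\<in>U. \<exists>v\<in>U. u \<otimes> inv v = x" using clG by (intro bexI [OF _ U(2)] bexI [OF _ U(1)]) simp
        have 2: "\<exists>u\<in>U. \<exists>v\<in>U. u \<otimes> inv v = y" using clG by (intro bexI [OF _ U(3)] bexI [OF _ U(1)]) simp
        have 3: "\<exists>u\<in>U. \<exists>v\<in>U. u \<otimes> inv v = x \<otimes> y \<otimes> w" using xyw by (intro bexI [OF _ U(5)] bexI [OF _ U(1)]) simp
        show "\<exists>u\<in>U. \<exists>v\<in>U. u \<otimes> inv v = e" using e(1) 1 2 d(1) U by blast
        show "\<exists>u\<in>U. \<exists>v\<in>U. u \<otimes> inv v = e \<otimes> w" using e(1) 3 d(2,3) U by blast
      qed
      moreover have "e \<noteq> \<one>" "e \<otimes> w \<noteq> \<one>" using e(1) ne nxy nA eA by auto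
      ultimately show ?thesis using e(2) by metis
    qed
    then obtain u v where uv: "u \<in> U" "v \<in> U" "u \<otimes> inv v \<in> K" "u \<otimes> inv v \<noteq> \<one>" by blast
    have "v \<in> carrier G" using uv(2) clG by (auto simp: U_def)
    then have "u \<noteq> v" using uv(4) by auto
    then show "\<exists>u\<in>U. \<exists>v\<in>U. u \<noteq> v \<and> u \<otimes> inv v \<in> K" using uv by blast
  qed
  ultimately show ?thesis using that by blast
qed

text \<open>A plane with 5 to 9 points has an endomorphism ring of 4 to 8 elements, for which the
  point sets of the preceding part are available; up to four points the general
  \<open>isotypic_hits\<close> suffices.\<close>

lemma isotypic_few_hits:
  assumes C: "isotypic C" and bl: "blocked (min_normals C)" and card: "card (min_normals C) \<le> 9"
  obtains U where "U \<subseteq> C" "hits_all U (min_normals C)" "card U \<le> 5" "card (min_normals C) \<le> 6 \<longrightarrow> card U \<le> 4"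
proof -
  note Cd = isotypicD [OF C]
  obtain X Y where X: "X \<in> min_normals C" and Y: "Y \<in> min_normals C" and XY: "X \<noteq> Y"
    by (rule isotypic_two [OF C bl])
  note Xm = min_normalsD [OF X] and Ym = min_normalsD [OF Y]
  have "card (min_normals C) \<le> 10" using card by simp
  from C X Y XY this show ?thesis
  proof (cases rule: isotypic_dimension)
    case (2 V)
    obtain U where "U \<subseteq> C" "hits_all U (min_normals C)" "card U \<le> 5"
      by (rule fano_hits [OF C X Y XY 2(1-4)])
    then show ?thesis using that 2(5) by simp
  next
    case 1
    show ?thesis
    proof (cases "card (min_normals C) \<le> 4")
      case True
      obtain U where U: "U \<subseteq> C" "hits_all U (min_normals C)" "card U \<le> card (min_normals C)"
        by (rule isotypic_hits [OF C bl])
      then show ?thesis using True by (intro that [OF U(1,2)]) simp_all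
    next
      case False
      have comm: "x \<otimes> y = y \<otimes> x" if "x \<in> X <#> Y" "y \<in> X <#> Y" for x y using Cd(3) that 1(1) by simp
      obtain \<phi> where \<phi>: "\<phi> \<in> ghom X Y" "bij_betw \<phi> X Y" using Cd(5) [OF X Y] by (auto simp: giso_def)
      obtain x0 where x0: "x0 \<in> X" "x0 \<noteq> \<one>" by (rule min_normal_nontrivial [OF Xm(1)])
      have commX: "x \<otimes> y = y \<otimes> x" if "x \<in> X" "y \<in> X" for x y using Cd(3) Xm(2) that by blast
      interpret E: div_ring "endring X" by (rule div_ring_endring [OF Xm(1) commX])
      have q: "card (carrier (endring X)) = card (min_normals C) - 1" using 1(2) by simp
      have "\<exists>U. E.all_directions U \<and> card U \<le> 5 \<and> (card (min_normals C) \<le> 6 \<longrightarrow> card U \<le> 4)"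
      proof -
        consider "card (min_normals C) = 5" | "card (min_normals C) = 6" | "card (min_normals C) \<in> {7, 8}" | "card (min_normals C) = 9"
          using False card by fastforce
        then show ?thesis
        proof cases
          case 1
          then have "card (carrier (endring X)) = 4" using q by simp
          then obtain U where "E.all_directions U" "card U \<le> 4" by (rule E.all_directions_card4)
          then show ?thesis by (intro exI [of _ U]) simp
        next
          case 2
          then have "card (carrier (endring X)) = 5" using q by simp
          then obtain U where "E.all_directions U" "card U \<le> 4" by (rule E.all_directions_card5)
          then show ?thesis by (intro exI [of _ U]) simp
        next
          case 3
          then have "card (carrier (endring X)) = 6 \<or> card (carrier (endring X)) = 7" using q by auto
          then obtain U where "E.all_directions U" "card U \<le> 5" by (rule E.all_directions_card6_7)
          then show ?thesis using 3 by (intro exI [of _ U]) auto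
        next
          case 4
          then have "card (carrier (endring X)) = 8" using q by simp
          then obtain U where "E.all_directions U" "card U \<le> 5" by (rule E.all_directions_card8)
          then show ?thesis using 4 by (intro exI [of _ U]) auto
        qed
      qed
      then obtain U where U: "E.all_directions U" "card U \<le> 5" "card (min_normals C) \<le> 6 \<longrightarrow> card U \<le> 4" by blast
      define W where "W = (\<lambda>(a, b). a x0 \<otimes> \<phi> (b x0)) ` U"
      have Ufin: "finite U" "U \<subseteq> ghom X X \<times> ghom X X" using U(1) by (auto simp: E.all_directions_def)
      have "card W \<le> card U" unfolding W_def by (rule card_image_le [OF Ufin(1)])
      moreover have "W \<subseteq> C"
        using Ufin(2) pt_parts(1) [OF Xm(1) Ym(1) XY comm \<phi> x0] 1(1) by (auto simp: W_def)
      moreover have "hits_all W (min_normals C)"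
        unfolding hits_all_def
      proof (intro conjI ballI)
        show "finite W" using Ufin by (simp add: W_def)
        fix K assume "K \<in> min_normals C"
        then show "\<exists>u\<in>W. \<exists>v\<in>W. u \<noteq> v \<and> u \<otimes> inv v \<in> K"
          using directions_hit [OF Xm(1) Ym(1) XY comm \<phi> x0 U(1), of K] 1(1) by (simp add: W_def)
      qed
      ultimately show ?thesis using that U(2,3) by (meson le_trans)
    qed
  qed
qed

end

section \<open>Comparing the properties P and Q\<close>

lemma length_pairs: "length (pairs xs) = length xs choose 2"
  by (induction xs) (simp_all add: numeral_2_eq_2)

lemma pairs_total: "\<lbrakk>x \<in> set xs; y \<in> set xs; x \<noteq> y\<rbrakk> \<Longrightarrow> (x, y) \<in> set (pairs xs) \<or> (y, x) \<in> set (pairs xs)"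
  by (induction xs) auto

lemma property_P_mono: "\<lbrakk>property_P G n; m \<le> n\<rbrakk> \<Longrightarrow> property_P G m"
  by (auto simp: property_P_def)

context group
begin

lemma not_property_Q:
  assumes bl: "blocked \<K>" and \<K>: "finite \<K>" "\<And>K. K \<in> \<K> \<Longrightarrow> K \<lhd> G \<and> finite K"
    and U: "U \<subseteq> carrier G" "hits_all U \<K>" "card U \<le> n"
  shows "\<not> property_Q G n"
proof
  assume "property_Q G n"
  then have "irreducibly_injective G U" using U by (simp add: property_Q_def hits_all_def)
  then obtain H :: "('a \<Rightarrow> complex) cinner_space" and \<pi> where
    I: "irreducible_unitary_representation G H \<pi>" and inj: "inj_on \<pi> U"
    unfolding irreducibly_injective_def by blast
  interpret I: irreducible_unitary_representation G H \<pi> by fact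
  have "\<not> blocked \<K>"
  proof (rule I.not_blocked_if_nontrivial [OF \<K>(1)])
    fix K assume K: "K \<in> \<K>"
    then obtain u v where uv: "u \<in> U" "v \<in> U" "u \<noteq> v" "u \<otimes> inv v \<in> K" using U(2) by (auto simp: hits_all_def)
    have "u \<otimes> inv v \<notin> I.rep_kernel"
      using I.rep_eq_iff_kernel [of u v] uv U(1) inj by (auto simp: inj_on_def)
    then show "K \<lhd> G \<and> finite K \<and> \<not> K \<subseteq> I.rep_kernel" using \<K>(2) [OF K] uv by blast
  qed
  then show False using bl by simp
qed

text \<open>Two elements have the same image exactly if their quotient is in the kernel. One order
  of each pair is enough, which is where the binomial coefficient comes from.\<close>

lemma not_faithful_differences:
  assumes F: "set xs \<subseteq> carrier G" and ni: "\<not> irreducibly_injective G (set xs)"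
  shows "\<not> irreducibly_faithful G ((\<lambda>(x, y). x \<otimes> inv y) ` set (pairs xs) - {\<one>})"
proof
  assume "irreducibly_faithful G ((\<lambda>(x, y). x \<otimes> inv y) ` set (pairs xs) - {\<one>})"
  then obtain H :: "('a \<Rightarrow> complex) cinner_space" and \<pi> where
    I: "irreducible_unitary_representation G H \<pi>" and
    f: "\<And>d. \<lbrakk>d \<in> (\<lambda>(x, y). x \<otimes> inv y) ` set (pairs xs); d \<noteq> \<one>\<rbrakk> \<Longrightarrow> \<pi> d \<noteq> \<one>\<^bsub>unitary_group H\<^esub>"
    unfolding irreducibly_faithful_def by blast
  interpret I: irreducible_unitary_representation G H \<pi> by fact
  have sep: "\<pi> x \<noteq> \<pi> y" if "(x, y) \<in> set (pairs xs)" "x \<noteq> y" for x y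
  proof
    assume eq: "\<pi> x = \<pi> y"
    have xy: "x \<in> carrier G" "y \<in> carrier G" using pairs_mem [OF that(1)] F by auto
    have "x \<otimes> inv y \<noteq> \<one>"
      using xy that(2) inv_equality [of x "inv y"] by auto
    then have "\<pi> (x \<otimes> inv y) \<noteq> \<one>\<^bsub>unitary_group H\<^esub>" using that(1) by (intro f) (auto intro: rev_image_eqI)
    then show False using eq I.rep_eq_iff_kernel [OF xy] I.kernel_iff [of "x \<otimes> inv y"] xy by simp
  qed
  have "inj_on \<pi> (set xs)"
  proof (rule inj_onI)
    fix x y assume xy: "x \<in> set xs" "y \<in> set xs" "\<pi> x = \<pi> y"
    show "x = y" using pairs_total [OF xy(1,2)] sep [of x y] sep [of y x] xy(3) by auto
  qed
  then show False using ni I unfolding irreducibly_injective_def by blast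
qed

lemma card_differences: "card ((\<lambda>(x, y). x \<otimes> inv y) ` set (pairs xs) - {\<one>}) \<le> length xs choose 2"
proof -
  have "card ((\<lambda>(x, y). x \<otimes> inv y) ` set (pairs xs) - {\<one>}) \<le> card ((\<lambda>(x, y). x \<otimes> inv y) ` set (pairs xs))"
    by (rule card_mono) auto
  also have "\<dots> \<le> card (set (pairs xs))" by (rule card_image_le) simp
  also have "\<dots> \<le> length xs choose 2" using card_length [of "pairs xs"] by (simp add: length_pairs)
  finally show ?thesis .
qed

lemma differences_closed:
  "set xs \<subseteq> carrier G \<Longrightarrow> (\<lambda>(x, y). x \<otimes> inv y) ` set (pairs xs) - {\<one>} \<subseteq> carrier G"
  using pairs_mem by fastforce

lemma property_P_imp_Q:
  assumes P: "property_P G (n choose 2)" shows "property_Q G n"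
  unfolding property_Q_def
proof (intro allI impI)
  fix F assume F: "F \<subseteq> carrier G \<and> finite F \<and> card F \<le> n"
  then obtain xs where xs: "set xs = F" "distinct xs" using finite_distinct_list by blast
  let ?D = "(\<lambda>(x, y). x \<otimes> inv y) ` set (pairs xs) - {\<one>}"
  have "length xs \<le> n" using F xs distinct_card by metis
  then have "length xs choose 2 \<le> n choose 2" by (rule binomial_right_mono)
  then have "card ?D \<le> n choose 2" using card_differences [of xs] by linarith
  then have "irreducibly_faithful G ?D"
    using P differences_closed [of xs] F xs by (simp add: property_P_def)
  then show "irreducibly_injective G F" using not_faithful_differences [of xs] F xs by auto
qed

lemma not_faithful_structure:
  assumes cnt: "countable (carrier G)" and P: "property_P G k" and F: "finite F" "F \<subseteq> carrier G"
    "card F \<le> Suc k" "\<not> irreducibly_faithful G F"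
  obtains D M C \<rho> where "D \<subseteq> F" "M \<lhd> G" "D \<subseteq> M" "isotypic C" "blocked (min_normals C)"
    "card (min_normals C) = Suc k" "\<And>x. x \<in> M \<Longrightarrow> \<rho> x \<in> C"
    "\<And>x y. \<lbrakk>x \<in> M; y \<in> M\<rbrakk> \<Longrightarrow> \<rho> (x \<otimes> y) = \<rho> x \<otimes> \<rho> y"
    "\<And>K. K \<in> min_normals C \<Longrightarrow> \<exists>d\<in>D. \<rho> d \<in> K \<and> \<rho> d \<noteq> \<one>"
proof -
  obtain D where D: "D \<subseteq> F" "\<one> \<notin> D" "\<And>d. d \<in> D \<Longrightarrow> finite (normal_closure {d})"
    "blocked ((\<lambda>d. normal_closure {d}) ` D)"
    by (rule unfaithful_blocked [OF cnt F(1,2,4)]) blast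
  have Dk: "finite D" "D \<subseteq> carrier G" "card D \<le> Suc k"
    using D(1) F finite_subset card_mono [of F D] by auto
  obtain M C \<rho> where st: "M \<lhd> G" "D \<subseteq> M" "C \<lhd> G" "finite C"
    "\<And>x y. \<lbrakk>x \<in> C; y \<in> C\<rbrakk> \<Longrightarrow> x \<otimes> y = y \<otimes> x"
    "C \<subseteq> join (min_normals C)" "blocked (min_normals C)" "card (min_normals C) = Suc k"
    "\<And>K L. \<lbrakk>K \<in> min_normals C; L \<in> min_normals C\<rbrakk> \<Longrightarrow> giso K L"
    "\<And>x. x \<in> M \<Longrightarrow> \<rho> x \<in> C" "\<And>x y. \<lbrakk>x \<in> M; y \<in> M\<rbrakk> \<Longrightarrow> \<rho> (x \<otimes> y) = \<rho> x \<otimes> \<rho> y"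
    "\<And>K. K \<in> min_normals C \<Longrightarrow> \<exists>d\<in>D. \<rho> d \<in> K \<and> \<rho> d \<noteq> \<one>"
    by (rule blocked_structure [OF property_P_unblocked [OF P] Dk(1,2) D(2) Dk(3) D(3,4)]) auto
  have "isotypic C" unfolding isotypic_def using st(3-6,9) by blast
  then show ?thesis by (rule that [OF D(1) st(1,2) _ st(7,8,10,11,12)])
qed

text \<open>At the least failing \<open>m\<close> the property holds for \<open>m - 1\<close>, so
  the family extracted from a failing set has exactly \<open>m\<close> members.\<close>

lemma not_property_P_structure:
  assumes cnt: "countable (carrier G)" and nP: "\<not> property_P G n"
  obtains C where "isotypic C" "blocked (min_normals C)" "card (min_normals C) \<le> n"
proof -
  define m where "m = (LEAST m. \<not> property_P G m)"
  have m: "\<not> property_P G m" unfolding m_def using nP by (rule LeastI)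
  have below: "property_P G k" if "k < m" for k using not_less_Least that unfolding m_def by blast
  have mn: "m \<le> n" unfolding m_def using nP by (rule Least_le)
  obtain F where F: "F \<subseteq> carrier G" "finite F" "card F \<le> m" "\<not> irreducibly_faithful G F"
    using m by (auto simp: property_P_def)
  have "m \<noteq> 0"
  proof
    assume "m = 0"
    then have "F = {}" using F by simp
    then have "irreducibly_faithful G F"
      using irreducibly_faithful_if_not_blocked [OF cnt, of F] not_blocked_empty by simp
    then show False using F by simp
  qed
  then obtain k where k: "m = Suc k" by (cases m) auto
  then have P: "property_P G k" using below by simp
  have cF: "card F \<le> Suc k" using F(3) k by simp
  obtain D M C \<rho> where "isotypic C" "blocked (min_normals C)" "card (min_normals C) = Suc k"
    by (rule not_faithful_structure [OF cnt P F(2,1) cF F(4)]) blast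
  then show ?thesis using that mn k by simp
qed

lemma isotypic_not_Q:
  assumes C: "isotypic C" and bl: "blocked (min_normals C)" and U: "U \<subseteq> C" "hits_all U (min_normals C)" "card U \<le> n"
  shows "\<not> property_Q G n"
proof (rule not_property_Q [OF bl _ _ _ U(2,3)])
  note Cd = isotypicD [OF C]
  show "finite (min_normals C)" by (rule finite_min_normals [OF Cd(2)])
  show "K \<lhd> G \<and> finite K" if "K \<in> min_normals C" for K
    using min_normalD(1,2) [OF min_normalsD(1) [OF that]] by simp
  show "U \<subseteq> carrier G" using U(1) normal_subset [OF Cd(1)] by blast
qed

text \<open>A blocked set of points contains two points and the graph of an isomorphism between
  them, so at least three.\<close>

lemma property_P_two: assumes cnt: "countable (carrier G)" shows "property_P G 2"
proof (rule ccontr)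
  assume "\<not> property_P G 2"
  then obtain C where C: "isotypic C" "blocked (min_normals C)" "card (min_normals C) \<le> 2"
    by (rule not_property_P_structure [OF cnt])
  obtain U where "3 \<le> card (min_normals C)" by (rule isotypic_hits [OF C(1,2)])
  then show False using C(3) by simp
qed

lemma property_Q_imp_P:
  assumes cnt: "countable (carrier G)" and Q: "property_Q G n" shows "property_P G n"
proof (rule ccontr)
  assume "\<not> property_P G n"
  then obtain C where C: "isotypic C" "blocked (min_normals C)" "card (min_normals C) \<le> n"
    by (rule not_property_P_structure [OF cnt])
  obtain U where U: "U \<subseteq> C" "hits_all U (min_normals C)" "card U \<le> card (min_normals C)"
    by (rule isotypic_hits [OF C(1,2)])
  have "card U \<le> n" using U(3) C(3) by simp
  then show False using isotypic_not_Q [OF C(1,2) U(1,2)] Q by blast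
qed

lemma property_Q4_imp_P6:
  assumes cnt: "countable (carrier G)" and Q: "property_Q G 4" shows "property_P G 6"
proof (rule ccontr)
  assume "\<not> property_P G 6"
  then obtain C where C: "isotypic C" "blocked (min_normals C)" "card (min_normals C) \<le> 6"
    by (rule not_property_P_structure [OF cnt])
  have "card (min_normals C) \<le> 9" using C(3) by simp
  then obtain U where U: "U \<subseteq> C" "hits_all U (min_normals C)" "card (min_normals C) \<le> 6 \<longrightarrow> card U \<le> 4"
    by (rule isotypic_few_hits [OF C(1,2)])
  then show False using isotypic_not_Q [OF C(1,2) U(1,2), of 4] C(3) Q by blast
qed

lemma property_Q5_imp_P9:
  assumes cnt: "countable (carrier G)" and Q: "property_Q G 5" shows "property_P G 9"
proof (rule ccontr)
  assume "\<not> property_P G 9"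
  then obtain C where C: "isotypic C" "blocked (min_normals C)" "card (min_normals C) \<le> 9"
    by (rule not_property_P_structure [OF cnt])
  obtain U where U: "U \<subseteq> C" "hits_all U (min_normals C)" "card U \<le> 5"
    by (rule isotypic_few_hits [OF C])
  then show False using isotypic_not_Q [OF C(1,2) U] Q by blast
qed

text \<open>The list of indices is not increasing, hence the normalisation of a pair by
  \<open>min\<close> and \<open>max\<close>.\<close>

lemma pairs_pairs_five:
  assumes "((i, j), (k, l)) \<in> set (pairs (pairs [3, 4, 0, 1, 2 :: nat]))"
  shows "i < 5 \<and> j < 5 \<and> k < 5 \<and> l < 5 \<and> i \<noteq> j \<and> k \<noteq> l \<and> (min i j, max i j) \<noteq> (min k l, max k l)"
proof -
  have "list_all (\<lambda>((i, j), (k, l)). i < 5 \<and> j < 5 \<and> k < 5 \<and> l < 5 \<and> i \<noteq> j \<and> k \<noteq> l \<and>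
    (min i j, max i j) \<noteq> (min k l, max k l)) (pairs (pairs [3, 4, 0, 1, 2 :: nat]))"
    by code_simp
  then show ?thesis using assms unfolding list_all_iff by fast
qed

text \<open>In the only configuration that could obstruct the implication, five points of the affine plane over
  the field with nine elements would determine ten distinct directions.\<close>

lemma no_five_points:
  fixes c :: "nat \<Rightarrow> 'a" and s :: "'a set \<Rightarrow> nat \<times> nat"
  assumes C: "isotypic C" and bl: "blocked (min_normals C)" and card: "card (min_normals C) = 10"
    and c: "\<And>i. i < 5 \<Longrightarrow> c i \<in> C" "c 0 = \<one>"
    and ex: "\<And>i j. \<lbrakk>i < 5; j < 5; i \<noteq> j\<rbrakk> \<Longrightarrow> c i \<otimes> inv (c j) \<noteq> \<one> \<and> (\<exists>K\<in>min_normals C. c i \<otimes> inv (c j) \<in> K)"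
    and s: "\<And>i j K. \<lbrakk>i < 5; j < 5; i \<noteq> j; K \<in> min_normals C; c i \<otimes> inv (c j) \<in> K\<rbrakk> \<Longrightarrow> s K = (min i j, max i j)"
  shows False
proof -
  note Cd = isotypicD [OF C]
  have CG: "x \<in> carrier G" if "x \<in> C" for x using that normal_subset [OF Cd(1)] by blast
  have cG: "c i \<in> carrier G" if "i < 5" for i using CG c that by blast
  have c0: "c i \<otimes> inv (c 0) = c i" if "i < 5" for i using cG [OF that] c(2) by simp
  obtain X where X: "X \<in> min_normals C" "c 1 \<in> X" using ex [of 1 0] c0 [of 1] by auto
  obtain Y where Y: "Y \<in> min_normals C" "c 2 \<in> Y" using ex [of 2 0] c0 [of 2] by auto
  obtain L where L: "L \<in> min_normals C" "c 1 \<otimes> inv (c 2) \<in> L" using ex [of 1 2] by auto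
  \<comment> \<open>\<open>s\<close> labels a point by the pair of indices whose quotient it
    contains. Different labels are how points are shown to be different below.\<close>
  have sX: "s X = (0, 1)" using s [of 1 0 X] X c0 [of 1] by simp
  have sY: "s Y = (0, 2)" using s [of 2 0 Y] Y c0 [of 2] by simp
  have sL: "s L = (1, 2)" using s [of 1 2 L] L by simp
  have XY: "X \<noteq> Y" using sX sY by auto
  have LY: "L \<noteq> Y" using sL sY by auto
  have c1: "c 1 \<noteq> \<one>" using ex [of 1 0] c0 [of 1] by simp
  have c2: "c 2 \<noteq> \<one>" using ex [of 2 0] c0 [of 2] by simp
  note Xm = min_normalsD [OF X(1)] and Ym = min_normalsD [OF Y(1)]
  note Xd = min_normalD [OF Xm(1)] and Yd = min_normalD [OF Ym(1)]
  have P: "gprod X Y" using min_normal_distinct [OF Xm(1) Ym(1) XY] Xd(1) Yd(1) by (simp add: gprod_def)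
  have "card (min_normals C) \<le> 10" using card by simp
  with C X(1) Y(1) XY have CXY: "C = X <#> Y \<and> card (ghom X X) = 9"
    by (rule isotypic_dimension) (use card in auto)
  have comm: "x \<otimes> y = y \<otimes> x" if "x \<in> X <#> Y" "y \<in> X <#> Y" for x y using Cd(3) that CXY by simp
  have commX: "x \<otimes> y = y \<otimes> x" if "x \<in> X" "y \<in> X" for x y using Cd(3) Xm(2) that by blast
  \<comment> \<open>Any isomorphism from \<open>X\<close> to \<open>Y\<close> gives a frame with
    \<open>c 1\<close> at (1, 0). The one whose graph is \<open>L\<close> sends \<open>c 1\<close>
    to the inverse of \<open>c 2\<close>, so that \<open>c 2\<close> gets the coordinates (0,
    -1).\<close>
  obtain L' \<phi> where L': "min_normal L'" "L' \<subseteq> X" "\<phi> \<in> ghom L' Y" "L = graph L' \<phi>"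
    using L(1) LY unfolding conjunct1 [OF CXY] min_normals_prod [OF P Ym(1)] by (auto simp: min_normals_def)
  have "L' = X" using Xd(4) [OF min_normalD(1) [OF L'(1)] L'(2)] min_normalD(3) [OF L'(1)] by blast
  then have \<phi>: "\<phi> \<in> ghom X Y" and Lg: "L = graph X \<phi>" using L' by auto
  have i2: "inv (c 2) \<in> Y" by (rule normal_inv [OF Yd(1) Y(2)])
  have \<phi>c: "\<phi> (c 1) = inv (c 2)"
    using min_normal_graph(4) [OF P Xm(1) subset_refl \<phi>, of "c 1 \<otimes> inv (c 2)"] L(2)
      lpart_eq [OF P X(2) i2] by (simp add: Lg)
  have "\<phi> (c 1) \<noteq> \<one>" unfolding \<phi>c using c2 inv_eq_1_iff [OF cG] by simp
  then have bij: "bij_betw \<phi> X Y" using ghom_min_normal_bij [OF Xm(1) Ym(1) \<phi> X(2)] by simp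
  note fr = Xm(1) Ym(1) XY comm \<phi> bij X(2) c1
  interpret E: div_ring "endring X" by (rule div_ring_endring [OF Xm(1) commX])
  have card9: "card (carrier (endring X)) = 9" using CXY by simp
  define pt where "pt = (\<lambda>a b. a (c 1) \<otimes> \<phi> (b (c 1)))"
  define slope_line where "slope_line = (\<lambda>s. graph X (\<lambda>x\<in>X. \<phi> (s x)))"
  have pt_exists': "\<exists>a\<in>ghom X X. \<exists>b\<in>ghom X X. d = pt a b"
    if "a \<in> ghom X X" "b \<in> ghom X X" "a \<noteq> b" "d \<in> slope_line a" "d \<otimes> inv (c 1) \<in> slope_line b" for a b d
    unfolding pt_def by (rule pt_exists [OF fr that [unfolded slope_line_def]])
  have pt_diff': "pt a b \<otimes> inv (pt a' b') = pt (a \<ominus>\<^bsub>endring X\<^esub> a') (b \<ominus>\<^bsub>endring X\<^esub> b')"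
    if "a \<in> ghom X X" "b \<in> ghom X X" "a' \<in> ghom X X" "b' \<in> ghom X X" for a b a' b'
    unfolding pt_def by (rule pt_diff [OF fr that])
  have pt_in_Y': "pt \<zero>\<^bsub>endring X\<^esub> b \<in> Y" if "b \<in> ghom X X" for b
    unfolding pt_def by (rule pt_in_Y [OF fr that])
  have pt_in_slope_line': "pt a (t \<otimes>\<^bsub>endring X\<^esub> a) \<in> slope_line t" if "a \<in> ghom X X" "t \<in> ghom X X" for a t
    unfolding pt_def slope_line_def by (rule pt_in_slope_line [OF fr that])
  have slope_line_min_normal': "slope_line t \<in> min_normals C" if "t \<in> ghom X X" for t
    unfolding slope_line_def conjunct1 [OF CXY] by (rule slope_line_min_normal [OF fr that])
  have frame_min_normals': "\<exists>a\<in>ghom X X. K = slope_line a" if "K \<in> min_normals C" "K \<noteq> Y" for K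
    unfolding slope_line_def
    by (rule frame_min_normals [OF fr that [unfolded conjunct1 [OF CXY]]]; (assumption | erule bexI [rotated]))
  \<comment> \<open>The element \<open>c m\<close> lies on the line of its quotient by
    \<open>c 0\<close> and on a line through \<open>c 1\<close>; the labels show that the two slopes
    exist and differ, so \<open>pt_exists\<close> gives coordinates.\<close>
  have coord: "\<exists>a b. a \<in> ghom X X \<and> b \<in> ghom X X \<and> c m = pt a b" if m: "m = 3 \<or> m = 4" for m
  proof -
    have m5: "m < 5" "m \<noteq> 0" "m \<noteq> 1" "m \<noteq> 2" using m by auto
    obtain K where K: "K \<in> min_normals C" "c m \<in> K" using ex [of m 0] c0 [of m] m5 by auto
    obtain K' where K': "K' \<in> min_normals C" "c m \<otimes> inv (c 1) \<in> K'" using ex [of m 1] m5 by auto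
    have sK: "s K = (0, m)" using s [of m 0 K] K c0 [of m] m5 by simp
    have sK': "s K' = (1, m)" using s [of m 1 K'] K' m5 m by auto
    have ne: "K \<noteq> Y" "K' \<noteq> Y" "K \<noteq> K'" using sK sK' sY m5 by auto
    obtain a where a: "a \<in> ghom X X" "K = slope_line a" using frame_min_normals' [OF K(1) ne(1)] by blast
    obtain b where b: "b \<in> ghom X X" "K' = slope_line b" using frame_min_normals' [OF K'(1) ne(2)] by blast
    have "a \<noteq> b" using a b ne by auto
    then show ?thesis using pt_exists' [OF a(1) b(1)] K(2) K'(2) a(2) b(2) by blast
  qed
  obtain a3 b3 where p3: "a3 \<in> ghom X X" "b3 \<in> ghom X X" "c 3 = pt a3 b3" using coord [of 3] by auto
  obtain a4 b4 where p4: "a4 \<in> ghom X X" "b4 \<in> ghom X X" "c 4 = pt a4 b4" using coord [of 4] by auto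
  define x where "x = (\<lambda>n::nat. if n = 3 then a3 else if n = 4 then a4 else if n = 1 then \<one>\<^bsub>endring X\<^esub> else \<zero>\<^bsub>endring X\<^esub>)"
  define y where "y = (\<lambda>n::nat. if n = 3 then b3 else if n = 4 then b4 else if n = 2 then \<ominus>\<^bsub>endring X\<^esub> \<one>\<^bsub>endring X\<^esub> else \<zero>\<^bsub>endring X\<^esub>)"
  have zc: "\<zero>\<^bsub>endring X\<^esub> \<in> ghom X X" "\<one>\<^bsub>endring X\<^esub> \<in> ghom X X" "\<ominus>\<^bsub>endring X\<^esub> \<one>\<^bsub>endring X\<^esub> \<in> ghom X X"
    using E.zero_closed E.one_closed E.a_inv_closed [OF E.one_closed] unfolding endring_simps(1) by blast+
  have xy: "x n \<in> ghom X X" "y n \<in> ghom X X" for n using p3 p4 zc by (auto simp only: x_def y_def split: if_splits)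
  have cp: "c n = pt (x n) (y n)" if "n < 5" for n
  proof -
    have f1: "\<phi> \<one> = \<one>" by (rule ghom_one [OF \<phi> Xd(1) Yd(1)])
    have "pt \<zero>\<^bsub>endring X\<^esub> \<zero>\<^bsub>endring X\<^esub> = \<one>" using X(2) f1 by (simp add: pt_def)
    moreover have "pt \<one>\<^bsub>endring X\<^esub> \<zero>\<^bsub>endring X\<^esub> = c 1" using X(2) f1 cG [of 1] by (simp add: pt_def)
    moreover have "pt \<zero>\<^bsub>endring X\<^esub> (\<ominus>\<^bsub>endring X\<^esub> \<one>\<^bsub>endring X\<^esub>) = c 2"
    proof -
      have "(\<ominus>\<^bsub>endring X\<^esub> \<one>\<^bsub>endring X\<^esub>) (c 1) = inv (c 1)"
        using endring_minus [OF Xm(1) commX zc(2) X(2)] X(2) by simp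
      moreover have "\<phi> (inv (c 1)) = c 2"
        using ghom_inv [OF \<phi> Xd(1) Yd(1) X(2)] \<phi>c cG [of 2] by simp
      ultimately show ?thesis using X(2) cG [of 2] by (simp add: pt_def)
    qed
    moreover have "n \<in> {0, 1, 2, 3, 4}" using that by auto
    ultimately show ?thesis using p3 p4 c(2) by (auto simp: x_def y_def simp del: endring_simps)
  qed
  have "\<exists>((i, j), (k, l))\<in>set (pairs (pairs [3, 4, 0, 1, 2 :: nat])).
      (x i \<ominus>\<^bsub>endring X\<^esub> x j) \<otimes>\<^bsub>endring X\<^esub> (y k \<ominus>\<^bsub>endring X\<^esub> y l)
        = (x k \<ominus>\<^bsub>endring X\<^esub> x l) \<otimes>\<^bsub>endring X\<^esub> (y i \<ominus>\<^bsub>endring X\<^esub> y j)"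
    by (rule E.five_points_parallel(1) [OF card9])
      (use p3 p4 in \<open>simp_all add: x_def y_def del: endring_simps(2-)\<close>)
  then obtain i j k l where ijkl: "((i, j), (k, l)) \<in> set (pairs (pairs [3, 4, 0, 1, 2 :: nat]))"
    and par: "(x i \<ominus>\<^bsub>endring X\<^esub> x j) \<otimes>\<^bsub>endring X\<^esub> (y k \<ominus>\<^bsub>endring X\<^esub> y l)
        = (x k \<ominus>\<^bsub>endring X\<^esub> x l) \<otimes>\<^bsub>endring X\<^esub> (y i \<ominus>\<^bsub>endring X\<^esub> y j)"
    by blast
  note idx = pairs_pairs_five [OF ijkl]
  have mult_comm: "r \<otimes>\<^bsub>endring X\<^esub> t = t \<otimes>\<^bsub>endring X\<^esub> r"
    if "r \<in> carrier (endring X)" "t \<in> carrier (endring X)" for r t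
    by (rule E.five_points_parallel(2) [OF card9, of x y])
      (use p3 p4 that in \<open>simp_all add: x_def y_def del: endring_simps(2-)\<close>)
  define da where "da = x i \<ominus>\<^bsub>endring X\<^esub> x j"
  define db where "db = y i \<ominus>\<^bsub>endring X\<^esub> y j"
  define dc where "dc = x k \<ominus>\<^bsub>endring X\<^esub> x l"
  define dd where "dd = y k \<ominus>\<^bsub>endring X\<^esub> y l"
  have dcl: "da \<in> carrier (endring X)" "db \<in> carrier (endring X)" "dc \<in> carrier (endring X)" "dd \<in> carrier (endring X)"
    unfolding da_def db_def dc_def dd_def by (intro E.minus_closed; use xy in simp)+
  have e1: "c i \<otimes> inv (c j) = pt da db" and e2: "c k \<otimes> inv (c l) = pt dc dd"
    using idx by (simp_all add: cp pt_diff' xy da_def db_def dc_def dd_def)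
  have par': "da \<otimes>\<^bsub>endring X\<^esub> dd = dc \<otimes>\<^bsub>endring X\<^esub> db"
    using par by (simp only: da_def db_def dc_def dd_def)
  \<comment> \<open>Equal cross products place both quotients in one point: in \<open>Y\<close> if
    \<open>da\<close> is zero, and otherwise on the line of slope \<open>t\<close> with
    \<open>db = t da\<close>, where commutativity is used to move the slope to the left. This point
    would carry two different labels.\<close>
  have "\<exists>K\<in>min_normals C. pt da db \<in> K \<and> pt dc dd \<in> K"
  proof (cases "da = \<zero>\<^bsub>endring X\<^esub>")
    case True
    have "db \<noteq> \<zero>\<^bsub>endring X\<^esub>"
    proof
      assume "db = \<zero>\<^bsub>endring X\<^esub>"
      then have "pt da db = \<one>" using True cp [of 0] c(2) by (simp add: x_def y_def del: endring_simps)
      then show False using ex [of i j] idx e1 c(2) by simp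
    qed
    moreover have "dc \<otimes>\<^bsub>endring X\<^esub> db = \<zero>\<^bsub>endring X\<^esub>"
      unfolding par' [symmetric] True by (rule E.l_null [OF dcl(4)])
    ultimately have "dc = \<zero>\<^bsub>endring X\<^esub>" using E.no_zero_divisors [OF dcl(3,2)] by blast
    then show ?thesis using True pt_in_Y' dcl(2,4) Y(1) by auto
  next
    case False
    obtain t where t: "t \<in> carrier (endring X)" "db = t \<otimes>\<^bsub>endring X\<^esub> da"
      using E.division [OF dcl(1,2) False] by blast
    have "dd \<otimes>\<^bsub>endring X\<^esub> da = da \<otimes>\<^bsub>endring X\<^esub> dd" using dcl by (intro mult_comm)
    also have "\<dots> = dc \<otimes>\<^bsub>endring X\<^esub> (t \<otimes>\<^bsub>endring X\<^esub> da)" using par' t(2) by simp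
    also have "\<dots> = (dc \<otimes>\<^bsub>endring X\<^esub> t) \<otimes>\<^bsub>endring X\<^esub> da" by (rule E.m_assoc [OF dcl(3) t(1) dcl(1), symmetric])
    also have "dc \<otimes>\<^bsub>endring X\<^esub> t = t \<otimes>\<^bsub>endring X\<^esub> dc" using dcl t by (intro mult_comm)
    finally have "dd = t \<otimes>\<^bsub>endring X\<^esub> dc"
      using E.right_cancel [OF dcl(4) E.m_closed [OF t(1) dcl(3)] dcl(1) False] by blast
    moreover have "da \<in> ghom X X" "dc \<in> ghom X X" "t \<in> ghom X X" using dcl t by simp_all
    ultimately show ?thesis
      using pt_in_slope_line' [of da t] pt_in_slope_line' [of dc t] slope_line_min_normal' [of t] t(2)
      by metis
  qed
  then obtain K where "K \<in> min_normals C" "c i \<otimes> inv (c j) \<in> K" "c k \<otimes> inv (c l) \<in> K" using e1 e2 by auto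
  then have "s K = (min i j, max i j)" "s K = (min k l, max k l)" using s idx by blast+
  then show False using idx by simp
qed

text \<open>P(9) handles all families of at most nine quotients, so a failure yields exactly ten
  points, each containing the image of one of at most ten quotients. Counting makes points and pairs
  correspond bijectively, and \<open>\<rho>\<close> carries the five elements to a configuration
  excluded by \<open>no_five_points\<close>.\<close>

lemma property_P9_imp_Q5:
  assumes cnt: "countable (carrier G)" and P: "property_P G 9" shows "property_Q G 5"
  unfolding property_Q_def
proof (intro allI impI, rule ccontr)
  fix F assume F: "F \<subseteq> carrier G \<and> finite F \<and> card F \<le> 5" and ni: "\<not> irreducibly_injective G F"
  then obtain xs where xs: "set xs = F" "distinct xs" using finite_distinct_list by blast
  define D0 where "D0 = (\<lambda>(x, y). x \<otimes> inv y) ` set (pairs xs) - {\<one>}"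
  have nf: "\<not> irreducibly_faithful G D0"
    using not_faithful_differences [of xs] F ni xs by (simp add: D0_def)
  have len: "length xs \<le> 5" using F xs distinct_card by metis
  have c0: "card D0 \<le> length xs choose 2" unfolding D0_def by (rule card_differences)
  have "length xs choose 2 \<le> 5 choose 2" using len by (rule binomial_right_mono)
  also have "5 choose 2 = (10::nat)" by (simp add: choose_two)
  finally have cD0: "card D0 \<le> Suc 9" using c0 by simp
  have D0: "finite D0" "D0 \<subseteq> carrier G" using differences_closed [of xs] F xs by (simp_all add: D0_def)
  obtain D M C \<rho> where D: "D \<subseteq> D0" and M: "M \<lhd> G" "D \<subseteq> M" and C: "isotypic C" "blocked (min_normals C)"
    and card: "card (min_normals C) = Suc 9" and \<rho>: "\<And>x. x \<in> M \<Longrightarrow> \<rho> x \<in> C"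
      "\<And>x y. \<lbrakk>x \<in> M; y \<in> M\<rbrakk> \<Longrightarrow> \<rho> (x \<otimes> y) = \<rho> x \<otimes> \<rho> y"
    and ex: "\<And>K. K \<in> min_normals C \<Longrightarrow> \<exists>d\<in>D. \<rho> d \<in> K \<and> \<rho> d \<noteq> \<one>"
    by (rule not_faithful_structure [OF cnt P D0 cD0 nf]) blast
  note Cd = isotypicD [OF C(1)]
  have unique: "K = K'" if "K \<in> min_normals C" "K' \<in> min_normals C" "z \<in> K" "z \<in> K'" "z \<noteq> \<one>" for K K' z
    using min_normal_distinct [of K K'] that min_normalsD(1) by blast
  define n where "n = length xs"
  define I where "I = set (pairs [0..<n])"
  define \<delta> where "\<delta> = (\<lambda>(i, j). xs ! i \<otimes> inv (xs ! j))"
  have "pairs xs = map (map_prod ((!) xs) ((!) xs)) (pairs [0..<n])"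
    unfolding n_def pairs_map [symmetric] map_nth ..
  then have D0_eq: "D0 = \<delta> ` I - {\<one>}"
    by (simp add: D0_def I_def \<delta>_def image_image case_prod_beta)
  have "\<exists>p\<in>I. \<delta> p \<in> D \<and> \<rho> (\<delta> p) \<in> K \<and> \<rho> (\<delta> p) \<noteq> \<one>" if "K \<in> min_normals C" for K
    using ex [OF that] D unfolding D0_eq by blast
  then obtain s where s: "\<And>K. K \<in> min_normals C \<Longrightarrow>
      s K \<in> I \<and> \<delta> (s K) \<in> D \<and> \<rho> (\<delta> (s K)) \<in> K \<and> \<rho> (\<delta> (s K)) \<noteq> \<one>" by metis
  have inj: "inj_on s (min_normals C)"
    by (rule inj_onI) (metis s unique)
  have cI: "card I \<le> n choose 2" unfolding I_def using card_length [of "pairs [0..<n]"] by (simp add: length_pairs)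
  have sI: "s ` min_normals C \<subseteq> I" using s by blast
  have "card (s ` min_normals C) = 10" using card_image [OF inj] card by simp
  moreover have "finite I" by (simp add: I_def)
  ultimately have le: "10 \<le> card I" using card_mono [OF _ sI] by simp
  have n5: "n = 5"
  proof (rule ccontr)
    assume "n \<noteq> 5"
    then have "n choose 2 \<le> 4 choose 2" using len by (intro binomial_right_mono) (simp add: n_def)
    then show False using le cI by (simp add: choose_two)
  qed
  then have "card I \<le> 10" using cI by (simp add: choose_two)
  \<comment> \<open>Ten points inject into at most ten pairs. So every pair belongs to a point,
    every quotient has a nontrivial image, and different pairs lead to different points.\<close>
  then have onto: "s ` min_normals C = I"
    using sI \<open>card (s ` min_normals C) = 10\<close> \<open>finite I\<close> by (intro card_seteq) auto
  have I: "(i, j) \<in> I" if "i < j" "j < 5" for i j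
  proof -
    have "i \<in> {0, 1, 2, 3}" "j \<in> {1, 2, 3, 4}" using that by auto
    moreover have "[0..<5] = [0, 1, 2, 3, 4 :: nat]" by (simp add: upt_rec)
    ultimately show ?thesis using that unfolding I_def n5 by auto
  qed
  have sec: "\<delta> p \<in> M \<and> \<rho> (\<delta> p) \<noteq> \<one> \<and> (\<exists>K\<in>min_normals C. \<rho> (\<delta> p) \<in> K)" if "p \<in> I" for p
    using that s M(2) unfolding onto [symmetric] by blast
  have s_eq: "s K = p" if "p \<in> I" "K \<in> min_normals C" "\<rho> (\<delta> p) \<in> K" for p K
    using that s unique unfolding onto [symmetric] by (metis imageE)
  have x: "xs ! i \<in> carrier G" if "i < 5" for i using that n5 xs F nth_mem [of i xs] by (auto simp: n_def)
  have \<rho>1: "\<rho> \<one> = \<one>"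
  proof -
    have o: "\<one> \<in> M" by (rule normal_one [OF M(1)])
    have "\<rho> \<one> \<in> carrier G" using \<rho>(1) [OF o] normal_subset [OF Cd(1)] by blast
    then show ?thesis using \<rho>(2) [OF o o] by (simp add: r_cancel_one')
  qed
  have \<rho>inv: "\<rho> (inv z) = inv (\<rho> z)" if "z \<in> M" for z
  proof -
    have zM: "inv z \<in> M" by (rule normal_inv [OF M(1) that])
    have zG: "z \<in> carrier G" "\<rho> z \<in> carrier G" "\<rho> (inv z) \<in> carrier G"
      using that zM \<rho>(1) normal_subset [OF M(1)] normal_subset [OF Cd(1)] by blast+
    then have "\<rho> (inv z) \<otimes> \<rho> z = \<one>" using \<rho>(2) [OF zM that] \<rho>1 by simp
    then show ?thesis using zG inv_equality by simp
  qed
  \<comment> \<open>Only quotients are known to lie in \<open>M\<close>, where \<open>\<rho>\<close>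
    is multiplicative, so the elements are divided by the first one before \<open>\<rho>\<close> is
    applied.\<close>
  define c where "c = (\<lambda>i. \<rho> (xs ! i \<otimes> inv (xs ! 0)))"
  have mem0: "xs ! i \<otimes> inv (xs ! 0) \<in> M" if "i < 5" for i
  proof (cases "i = 0")
    case True
    then show ?thesis using x [of 0] normal_one [OF M(1)] by simp
  next
    case False
    then have "\<delta> (0, i) \<in> M" using sec [OF I] that by simp
    then have "inv (\<delta> (0, i)) \<in> M" by (rule normal_inv [OF M(1)])
    then show ?thesis using x that by (simp add: \<delta>_def inv_mult_group)
  qed
  have diff: "c i \<otimes> inv (c j) = \<rho> (\<delta> (i, j))" if "i < 5" "j < 5" for i j
  proof -
    have "c i \<otimes> inv (c j) = \<rho> ((xs ! i \<otimes> inv (xs ! 0)) \<otimes> inv (xs ! j \<otimes> inv (xs ! 0)))"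
      using that mem0 normal_inv [OF M(1)] by (simp add: c_def \<rho>inv \<rho>(2))
    also have "(xs ! i \<otimes> inv (xs ! 0)) \<otimes> inv (xs ! j \<otimes> inv (xs ! 0)) = \<delta> (i, j)"
      using x [OF that(1)] x [OF that(2)] x [of 0] by (simp add: \<delta>_def word_simps)
    finally show ?thesis .
  qed
  have swap: "\<rho> (\<delta> (i, j)) = inv (\<rho> (\<delta> (j, i)))" if "i < 5" "j < i" for i j
  proof -
    have "\<delta> (i, j) = inv (\<delta> (j, i))" using x that by (simp add: \<delta>_def inv_mult_group)
    then show ?thesis using \<rho>inv sec [OF I] that by simp
  qed
  show False
  proof (rule no_five_points [OF C])
    show "card (min_normals C) = 10" using card by simp
    show "c i \<in> C" if "i < 5" for i unfolding c_def by (rule \<rho>(1) [OF mem0 [OF that]])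
    show "c 0 = \<one>" using x [of 0] \<rho>1 by (simp add: c_def)
    fix i j :: nat assume ij: "i < 5" "j < 5" "i \<noteq> j"
    have eq: "c i \<otimes> inv (c j) = \<rho> (\<delta> (min i j, max i j)) \<or> c i \<otimes> inv (c j) = inv (\<rho> (\<delta> (min i j, max i j)))"
      using diff ij swap by (cases "i < j") (auto simp: min_def max_def)
    have mm: "(min i j, max i j) \<in> I" using I [of "min i j" "max i j"] ij by auto
    note S = sec [OF mm]
    have G: "\<rho> (\<delta> (min i j, max i j)) \<in> carrier G" using S \<rho>(1) normal_subset [OF Cd(1)] by blast
    have inK: "c i \<otimes> inv (c j) \<in> K \<longleftrightarrow> \<rho> (\<delta> (min i j, max i j)) \<in> K" if "K \<in> min_normals C" for K
      using eq normal_inv [OF min_normalD(1) [OF min_normalsD(1) [OF that]]] inv_inv [OF G] by metis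
    show "c i \<otimes> inv (c j) \<noteq> \<one> \<and> (\<exists>K\<in>min_normals C. c i \<otimes> inv (c j) \<in> K)"
      using eq S inK inv_eq_1_iff [OF G] by auto
    show "s K = (min i j, max i j)" if "K \<in> min_normals C" "c i \<otimes> inv (c j) \<in> K" for K
      using s_eq [OF mm that(1)] inK that by blast
  qed
qed

end

theorem proposition1p15:
  fixes G :: "('a, 'b) monoid_scheme" and n :: nat
  assumes "group G" and "countable (carrier G)" and "n > 0"
  shows "((property_P G (n choose 2) \<longrightarrow> property_Q G n) \<and> property_Q G 2) \<and>
    (property_Q G n \<longrightarrow> property_P G n) \<and>
    (property_Q G 3 \<longleftrightarrow> property_P G 3) \<and>
    (property_Q G 4 \<longleftrightarrow> property_P G 6) \<and>
    (property_Q G 5 \<longleftrightarrow> property_P G 9)"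
proof -
  interpret group G by fact
  note cnt = assms(2)
  \<comment> \<open>Two elements have a single quotient, so Q(2) follows from P(1), a case of
    \<open>property_P_two\<close>.\<close>
  have "2 choose 2 = (1 :: nat)" "3 choose 2 = (3 :: nat)" "4 choose 2 = (6 :: nat)" by (simp_all add: choose_two)
  then have "property_Q G 2" "property_P G 3 \<Longrightarrow> property_Q G 3" "property_P G 6 \<Longrightarrow> property_Q G 4"
    using property_P_imp_Q [of 2] property_P_imp_Q [of 3] property_P_imp_Q [of 4]
      property_P_mono [OF property_P_two [OF cnt], of 1] by simp_all
  then show ?thesis
    using property_P_imp_Q [of n] property_Q_imp_P [OF cnt] property_Q4_imp_P6 [OF cnt]
      property_Q5_imp_P9 [OF cnt] property_P9_imp_Q5 [OF cnt] by blast
qed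

end
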